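(* Let $(\mathcal{B},\mathcal{L},\theta,\mathcal{I}_\alpha)$ be a generalized Boolean dynamical system, let $\mathbb{F}$ be the free group generated by $\mathcal{L}$, and let $C_0(\partial E)\rtimes_{\hat\varphi}\mathbb{F}$ be the partial crossed product associated with the partial action $\varphi$ of $\mathbb{F}$ on the boundary path space $\partial E$. Let $C^*(\{1_{\mathcal{N}(\emptyset,A)}\delta_\emptyset,1_{\mathcal{N}(\alpha,B)}\delta_\alpha\})$ denote the $C^*$-subalgebra of $C_0(\partial E)\rtimes_{\hat\varphi}\mathbb{F}$ generated by $\{1_{\mathcal{N}(\emptyset,A)}\delta_\emptyset,\ 1_{\mathcal{N}(\alpha,B)}\delta_\alpha: A\in\mathcal{B},\ \alpha\in\mathcal{L},\ B\in\mathcal{I}_\alpha\}$. Then $$C_0(\partial E)\rtimes_{\hat\varphi}\mathbb{F}=C^*(\{1_{\mathcal{N}(\emptyset,A)}\delta_\emptyset,1_{\mathcal{N}(\alpha,B)}\delta_\alpha\}).$$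
   Context: Boolean algebras. A Boolean algebra is a set $\mathcal{B}$ with an element $\emptyset$ and operations $\cap,\cup,\setminus$ such that $(\mathcal{B},\cap,\cup)$ is a distributive lattice, $A\cap\emptyset=\emptyset$, $(A\cap B)\cup(A\setminus B)=A$ and $(A\cap B)\cap(A\setminus B)=\emptyset$ (no unit is required). $A\subseteq B$ means $A\cap B=A$. An ideal is a non-empty subset closed under $\cup$ and under intersection with arbitrary elements of $\mathcal{B}$; it is itself a Boolean algebra. A filter is a non-empty subset not containing $\emptyset$, upward closed and closed under $\cap$; an ultrafilter is a maximal filter. An action on $\mathcal{B}$ is a map $\mathcal{B}\to\mathcal{B}$ preserving $\cap,\cup,\setminus$ and $\emptyset$. Generalized Boolean dynamical system. A quadruple $(\mathcal{B},\mathcal{L},\theta,\mathcal{I}_\alpha)$ with $\mathcal{B}$ a Boolean algebra, $\mathcal{L}$ a set, $\{\theta_\alpha\}_{\alpha\in\mathcal{L}}$ actions on $\mathcal{B}$, and $\{\mathcal{I}_\alpha\}_{\alpha\in\mathcal{L}}$ ideals of $\mathcal{B}$ with $\mathcal{R}_\alpha:=\{A\in\mathcal{B}:A\subseteq\theta_\alpha(B)\text{ for some }B\in\mathcal{B}\}\subseteq\mathcal{I}_\alpha$. $\mathcal{L}^*$ is the set of finite words in $\mathcal{L}$, including the empty word $\emptyset$; $|\alpha|$ is length. For $\alpha=\alpha_1\cdots\alpha_n$, $n\ge1$: $\theta_\alpha=\theta_{\alpha_n}\circ\cdots\circ\theta_{\alpha_1}$, $\theta_\emptyset=\mathrm{id}$,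 $\mathcal{I}_\alpha=\{A\in\mathcal{B}:A\subseteq\theta_{\alpha_2\cdots\alpha_n}(B)\text{ for some }B\in\mathcal{I}_{\alpha_1}\}$, $\mathcal{I}_\emptyset=\mathcal{B}$. $\mathcal{W}^*=\{\alpha\in\mathcal{L}^*:\mathcal{I}_\alpha\ne\{\emptyset\}\}$ and $\mathcal{W}^{\ge1}$ is the set of words of length $\ge1$ in $\mathcal{W}^*$. $X_\alpha$ is the set of ultrafilters in $\mathcal{I}_\alpha$ with the topology generated by the sets $\{\mathcal{F}\in X_\alpha:A\in\mathcal{F}\}$, $A\in\mathcal{I}_\alpha$. Boundary path space. $E^0=X_\emptyset$; $F^0=X_\emptyset\cup\{\emptyset\}$, where $\emptyset$ is an isolated point if $\mathcal{B}$ is unital and the point at infinity of the one-point compactification of $X_\emptyset$ otherwise. $E^1=\{e^\alpha_\eta:\alpha\in\mathcal{L},\eta\in X_\alpha\}$ with the topology of the disjoint union of the $X_\alpha$. For $\alpha\in\mathcal{L}$ put $f_{\emptyset[\alpha]}(\eta)=\{A\in\mathcal{B}:\theta_\alpha(A)\in\eta\}$ (an ultrafilter of $\mathcal{B}$ or $\emptyset$). Define $d:E^1\to E^0$, $d(e^\alpha_\eta)=\{B\in\mathcal{B}:A\subseteq B\text{ for some }A\in\eta\}$ and $r:E^1\to F^0$, $r(e^\alpha_\eta)=f_{\emptyset[\alpha]}(\eta)$. For $n\ge 2$, $E^n$ is the subspace of $\prod_{i=1}^nE^1$ of $(e_1,\dots,e_n)$ with $d(e_i)=r(e_{i+1})$;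 $E^*=\bigsqcup_{n\ge0}E^n$; $E^\infty$ is the set of infinite sequences in $E^1$ with $d(e_i)=r(e_{i+1})$ for all $i$. For a path, $r$ is $r$ of its first edge, $d$ of a finite path is $d$ of its last edge; $r(v)=d(v)=v$ for $v\in E^0$. Put $F^0_{sce}=F^0\setminus\overline{r(E^1)}$, $F^0_{fin}=\{v\in F^0: v\text{ has a neighborhood }V\text{ with }r^{-1}(V)\text{ compact}\}$, $F^0_{rg}=F^0_{fin}\setminus\overline{F^0_{sce}}$, $E^0_{sg}=E^0\setminus F^0_{rg}$. Then $\partial E=E^\infty\sqcup\{\mu\in E^*:d(\mu)\in E^0_{sg}\}$. For $S\subseteq E^*$ let $\mathcal{Z}(S)$ be the set of $\mu\in\partial E$ with $r(\mu)\in S$ or $\mu_1\cdots\mu_i\in S$ for some $1\le i\le|\mu|$; the topology of $\partial E$ is generated by the sets $\mathcal{Z}(U)\cap\mathcal{Z}(K)^c$, $U\subseteq E^*$ open, $K\subseteq E^*$ compact. It is locally compact Hausdorff. Cylinder sets. For $\alpha\in\mathcal{W}^{\ge1}$ and $A\in\mathcal{I}_\alpha$, $\mathcal{N}(\alpha,A)=\{(e^{\beta_n}_{\eta_n})\in\partial E:\beta_1\cdots\beta_{|\alpha|}=\alpha,\ A\in\eta_{|\alpha|}\}$; for $A\in\mathcal{B}$, $\mathcal{N}(\emptyset,A)=\{\mu\in\partial E:A\in r(\mu)\}$. (For a letter $\alpha\notin\mathcal{W}^*$, the only $B\in\mathcal{I}_\alpha$ is $\emptyset$ and $\mathcal{N}(\alpha,\emptyset)=\emptyset$.)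 These are compact-open sets; $1_Y$ denotes a characteristic function. The partial action. Words are regarded as elements of $\mathbb{F}$, with $\emptyset$ the identity. $U_\emptyset=\partial E$. For $\alpha,\beta\in\mathcal{W}^{\ge1}$ with $\alpha\beta^{-1}$ in reduced form, $U_{\alpha\beta^{-1}}$ is the set of $(e^{\gamma_k}_{\eta_k})_{k=1}^N\in\partial E$ with $\gamma_1\cdots\gamma_{|\alpha|}=\alpha$ and $\eta_{|\alpha|}\cap\mathcal{I}_\beta\ne\emptyset$. For $\alpha\in\mathcal{W}^{\ge1}$, $U_\alpha=\{(e^{\gamma_k}_{\eta_k})_{k=1}^N\in\partial E:\gamma_1\cdots\gamma_{|\alpha|}=\alpha\}$. For $\beta\in\mathcal{W}^{\ge1}$, $U_{\beta^{-1}}=\{\mu\in\partial E:r(\mu)\cap\mathcal{I}_\beta\ne\emptyset\}$. For all other $t\in\mathbb{F}$, $U_t=\emptyset$. The homeomorphisms $\varphi_t:U_{t^{-1}}\to U_t$ are: $\varphi_\emptyset=\mathrm{id}$; for $\beta\in\mathcal{W}^{\ge1}$, $\varphi_{\beta^{-1}}$ removes the first $|\beta|$ edges (if $|\mu|=|\beta|$ the result is $d(\mu)\in E^0$); for $\alpha=\alpha_1\cdots\alpha_n\in\mathcal{W}^{\ge1}$ and $\beta\in\mathcal{W}^*$ with $\alpha\beta^{-1}$ reduced and $U_{\beta\alpha^{-1}}\neq\emptyset$, $\varphi_{\alpha\beta^{-1}}(\mu)$ is obtained by removing the first $|\beta|$ edges of $\mu$ and adding at the beginning $e^{\alpha_1}_{\eta_1}\cdots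 e^{\alpha_n}_{\eta_n}$, where $\eta_n=\zeta\cap\mathcal{I}_{\alpha_n}$ with $\zeta=d(\mu_{|\beta|})$ if $\beta\ne\emptyset$ and $\zeta=r(\mu)$ if $\beta=\emptyset$, and $\eta_i=f_{\emptyset[\alpha_{i+1}]}(\eta_{i+1})\cap\mathcal{I}_{\alpha_i}$ for $i=n-1,\dots,1$; all other $\varphi_t$ are empty maps. This is a partial action of $\mathbb{F}$ on $\partial E$. Partial crossed product. $D_t=C_0(U_t)$, viewed as an ideal of $C_0(\partial E)$ by extension by zero; $\hat\varphi_t:D_{t^{-1}}\to D_t$, $\hat\varphi_t(f)=f\circ\varphi_{t^{-1}}$. $C_0(\partial E)\rtimes_{\hat\varphi}\mathbb{F}$ is the completion in the universal (maximal) $C^*$-norm of the $*$-algebra of finite formal sums $\sum_t f_t\delta_t$, $f_t\in D_t$, with $(a\delta_s)(b\delta_t)=\hat\varphi_s(\hat\varphi_{s^{-1}}(a)b)\delta_{st}$ and $(a\delta_s)^*=\hat\varphi_{s^{-1}}(a^* )\delta_{s^{-1}}$. *)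

theory Defs
  imports "HOL-Analysis.Analysis" "HOL-Algebra.Group"
begin

section \<open>Boolean algebras without unit\<close>

class generalized_boolean_algebra = distrib_lattice + order_bot + minus +
  assumes sup_inf_diff: "sup (inf A B) (A - B) = A"
    and inf_inf_diff: "inf (inf A B) (A - B) = bot"

context boolean_algebra
begin

subclass generalized_boolean_algebra
proof
  fix A B
  show "sup (inf A B) (A - B) = A"
    by (simp add: diff_eq flip: inf_sup_distrib1)
  show "inf (inf A B) (A - B) = bot"
    by (simp add: diff_eq inf.assoc inf.left_commute)
qed

end

definition ba_unital :: "'b::generalized_boolean_algebra itself \<Rightarrow> bool" where
  "ba_unital _ \<longleftrightarrow> (\<exists>u::'b. \<forall>A. A \<le> u)"

definition ba_ideal :: "'b::generalized_boolean_algebra set \<Rightarrow> bool" where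
  "ba_ideal J \<longleftrightarrow> J \<noteq> {} \<and> (\<forall>A\<in>J. \<forall>B\<in>J. sup A B \<in> J) \<and> (\<forall>A\<in>J. \<forall>B. inf A B \<in> J)"

definition ba_filter :: "'b::generalized_boolean_algebra set \<Rightarrow> 'b set \<Rightarrow> bool" where
  "ba_filter J F \<longleftrightarrow> F \<subseteq> J \<and> F \<noteq> {} \<and> bot \<notin> F \<and>
     (\<forall>A\<in>F. \<forall>B\<in>J. A \<le> B \<longrightarrow> B \<in> F) \<and> (\<forall>A\<in>F. \<forall>B\<in>F. inf A B \<in> F)"

definition ba_ultrafilters :: "'b::generalized_boolean_algebra set \<Rightarrow> 'b set set" where
  "ba_ultrafilters J = {F. ba_filter J F \<and> (\<forall>G. ba_filter J G \<and> F \<subseteq> G \<longrightarrow> G = F)}"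

definition ultrafilter_topology :: "'b::generalized_boolean_algebra set \<Rightarrow> 'b set topology" where
  "ultrafilter_topology J = topology_generated_by {{F \<in> ba_ultrafilters J. A \<in> F} | A. A \<in> J}"

definition ba_action :: "('b::generalized_boolean_algebra \<Rightarrow> 'b) \<Rightarrow> bool" where
  "ba_action h \<longleftrightarrow> (\<forall>A B. h (inf A B) = inf (h A) (h B) \<and> h (sup A B) = sup (h A) (h B) \<and>
     h (A - B) = h A - h B) \<and> h bot = bot"


section \<open>Free groups as groups of reduced words\<close>

datatype 'l signed_letter = Gen 'l | GenInv 'l

fun flip_letter :: "'l signed_letter \<Rightarrow> 'l signed_letter" where
  "flip_letter (Gen a) = GenInv a"
| "flip_letter (GenInv a) = Gen a"

fun letter_base :: "'l signed_letter \<Rightarrow> 'l" where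
  "letter_base (Gen a) = a"
| "letter_base (GenInv a) = a"

definition fg_reduced :: "'l signed_letter list \<Rightarrow> bool" where
  "fg_reduced t \<longleftrightarrow> successively (\<lambda>x y. y \<noteq> flip_letter x) t"

fun reduced_Cons :: "'l signed_letter \<Rightarrow> 'l signed_letter list \<Rightarrow> 'l signed_letter list" where
  "reduced_Cons x [] = [x]"
| "reduced_Cons x (y # t) = (if y = flip_letter x then t else x # y # t)"

definition free_group :: "'l set \<Rightarrow> 'l signed_letter list monoid" where
  "free_group L = \<lparr>carrier = {t. fg_reduced t \<and> letter_base ` set t \<subseteq> L},
     mult = (\<lambda>s t. foldr reduced_Cons s t), one = []\<rparr>"

definition word_elt :: "'l list \<Rightarrow> 'l signed_letter list" where
  "word_elt \<alpha> = map Gen \<alpha>"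

definition word_elt_inv :: "'l list \<Rightarrow> 'l signed_letter list" where
  "word_elt_inv \<beta> = map GenInv (rev \<beta>)"

lemma flip_flip [simp]: "flip_letter (flip_letter x) = x"
  by (cases x) auto

lemma letter_base_flip [simp]: "letter_base (flip_letter x) = letter_base x"
  by (cases x) auto

lemma fg_reduced_Nil [simp]: "fg_reduced []"
  by (simp add: fg_reduced_def)

lemma fg_reduced_ConsD: "fg_reduced (x # t) \<Longrightarrow> fg_reduced t"
  by (cases t) (auto simp: fg_reduced_def)

lemma fg_reduced_reduced_Cons: "fg_reduced t \<Longrightarrow> fg_reduced (reduced_Cons x t)"
  by (cases t) (auto simp: fg_reduced_def dest: fg_reduced_ConsD[unfolded fg_reduced_def])

lemma reduced_Cons_flip:
  "fg_reduced t \<Longrightarrow> reduced_Cons x (reduced_Cons (flip_letter x) t) = t"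
proof (cases t)
  case (Cons y u)
  assume "fg_reduced t"
  then show ?thesis using Cons by (cases u) (auto simp: fg_reduced_def)
qed auto

lemma reduced_Cons_of_reduced: "fg_reduced (x # t) \<Longrightarrow> reduced_Cons x t = x # t"
  by (cases t) (auto simp: fg_reduced_def)

lemma fg_reduced_foldr: "fg_reduced t \<Longrightarrow> fg_reduced (foldr reduced_Cons s t)"
  by (induction s) (auto intro: fg_reduced_reduced_Cons)

lemma foldr_reduced_Cons_reduced_Cons:
  assumes "fg_reduced t"
  shows "foldr reduced_Cons (reduced_Cons x s) t = reduced_Cons x (foldr reduced_Cons s t)"
proof (cases s)
  case (Cons y u)
  then show ?thesis
    using reduced_Cons_flip[OF fg_reduced_foldr[OF assms, of u], of x] by auto
qed auto

lemma foldr_reduced_Cons_assoc: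
  assumes "fg_reduced t"
  shows "foldr reduced_Cons (foldr reduced_Cons r s) t = foldr reduced_Cons r (foldr reduced_Cons s t)"
  by (induction r) (auto simp: foldr_reduced_Cons_reduced_Cons assms)

lemma foldr_reduced_Cons_Nil: "fg_reduced t \<Longrightarrow> foldr reduced_Cons t [] = t"
proof (induction t)
  case (Cons x t)
  then show ?case
    using fg_reduced_ConsD[OF Cons.prems] reduced_Cons_of_reduced[OF Cons.prems] by simp
qed auto

lemma set_reduced_Cons: "set (reduced_Cons x t) \<subseteq> insert x (set t)"
  by (cases t) auto

lemma set_foldr_reduced_Cons: "set (foldr reduced_Cons s t) \<subseteq> set s \<union> set t"
proof (induction s)
  case (Cons x s)
  then show ?case using set_reduced_Cons[of x "foldr reduced_Cons s t"] by auto
qed auto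

lemma foldr_reduced_Cons_inverse:
  "fg_reduced t \<Longrightarrow> foldr reduced_Cons (rev (map flip_letter s)) (foldr reduced_Cons s t) = t"
proof (induction s)
  case (Cons x s)
  then show ?case
    using reduced_Cons_flip[OF fg_reduced_foldr[of t s], of "flip_letter x"] by simp
qed auto

lemma fg_reduced_inverse: "fg_reduced s \<Longrightarrow> fg_reduced (rev (map flip_letter s))"
  unfolding fg_reduced_def successively_rev successively_map
  by (erule successively_mono) (metis flip_flip)

theorem group_free_group: "group (free_group L)"
proof (rule groupI)
  fix s t assume "s \<in> carrier (free_group L)" "t \<in> carrier (free_group L)"
  then show "s \<otimes>\<^bsub>free_group L\<^esub> t \<in> carrier (free_group L)"
    using set_foldr_reduced_Cons[of s t] by (fastforce simp: free_group_def fg_reduced_foldr)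
next
  fix s assume s: "s \<in> carrier (free_group L)"
  let ?u = "rev (map flip_letter s)"
  have "?u \<in> carrier (free_group L)"
    using s by (auto simp: free_group_def fg_reduced_inverse)
  moreover have "?u \<otimes>\<^bsub>free_group L\<^esub> s = \<one>\<^bsub>free_group L\<^esub>"
    using s foldr_reduced_Cons_inverse[of "[]" s]
    by (simp add: free_group_def foldr_reduced_Cons_Nil)
  ultimately show "\<exists>u\<in>carrier (free_group L). u \<otimes>\<^bsub>free_group L\<^esub> s = \<one>\<^bsub>free_group L\<^esub>"
    by blast
qed (auto simp: free_group_def foldr_reduced_Cons_assoc)

lemma inv_free_group:
  assumes "s \<in> carrier (free_group L)"
  shows "inv\<^bsub>free_group L\<^esub> s = rev (map flip_letter s)"
proof -
  have "rev (map flip_letter s) \<in> carrier (free_group L)"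
    using assms by (auto simp: free_group_def fg_reduced_inverse)
  moreover have "rev (map flip_letter s) \<otimes>\<^bsub>free_group L\<^esub> s = \<one>\<^bsub>free_group L\<^esub>"
    using assms foldr_reduced_Cons_inverse[of "[]" s]
    by (simp add: free_group_def foldr_reduced_Cons_Nil)
  ultimately show ?thesis
    using group.inv_equality[OF group_free_group] assms by blast
qed


section \<open>Complex *-algebras, C*-seminorms, completions, C*-subalgebras\<close>

record 'a star_algebra = "'a partial_object" +
  sa_zero :: 'a
  sa_add :: "'a \<Rightarrow> 'a \<Rightarrow> 'a"
  sa_scale :: "complex \<Rightarrow> 'a \<Rightarrow> 'a"
  sa_mult :: "'a \<Rightarrow> 'a \<Rightarrow> 'a"
  sa_star :: "'a \<Rightarrow> 'a"

record 'a normed_star_algebra = "'a star_algebra" +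
  sa_norm :: "'a \<Rightarrow> real"

definition sa_diff :: "('a, 'm) star_algebra_scheme \<Rightarrow> 'a \<Rightarrow> 'a \<Rightarrow> 'a" where
  "sa_diff A x y = sa_add A x (sa_scale A (-1) y)"

definition cstar_seminorm :: "('a, 'm) star_algebra_scheme \<Rightarrow> ('a \<Rightarrow> real) \<Rightarrow> bool" where
  "cstar_seminorm A p \<longleftrightarrow>
     (\<forall>x\<in>carrier A. 0 \<le> p x \<and> p (sa_star A x) = p x \<and> p (sa_mult A (sa_star A x) x) = (p x)\<^sup>2 \<and>
        (\<forall>c. p (sa_scale A c x) = norm c * p x)) \<and>
     (\<forall>x\<in>carrier A. \<forall>y\<in>carrier A.
        p (sa_add A x y) \<le> p x + p y \<and> p (sa_mult A x y) \<le> p x * p y)"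

text \<open>The largest C*-seminorm. It is a finite supremum for the algebraic partial crossed products
  below: a C*-seminorm \<open>p\<close> satisfies \<open>p (f \<delta>\<^sub>t) \<le> \<parallel>f\<parallel>\<close>, because its restriction to the C*-algebra
  \<open>C\<^sub>0(X)\<close> is dominated by the supremum norm and \<open>(f \<delta>\<^sub>t) (f \<delta>\<^sub>t)* = f f* \<delta>\<^sub>1\<close>.\<close>

definition universal_norm :: "('a, 'm) star_algebra_scheme \<Rightarrow> 'a \<Rightarrow> real" where
  "universal_norm A x = Sup {p x | p. cstar_seminorm A p}"

text \<open>Completion with respect to \<open>p\<close>: Cauchy sequences modulo null sequences.\<close>

definition cauchy_seqs :: "('a, 'm) star_algebra_scheme \<Rightarrow> ('a \<Rightarrow> real) \<Rightarrow> (nat \<Rightarrow> 'a) set" where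
  "cauchy_seqs A p = {x. (\<forall>n. x n \<in> carrier A) \<and>
     (\<forall>e>0. \<exists>N. \<forall>m\<ge>N. \<forall>n\<ge>N. p (sa_diff A (x m) (x n)) < e)}"

definition null_rel ::
    "('a, 'm) star_algebra_scheme \<Rightarrow> ('a \<Rightarrow> real) \<Rightarrow> ((nat \<Rightarrow> 'a) \<times> (nat \<Rightarrow> 'a)) set" where
  "null_rel A p = {(x, y). x \<in> cauchy_seqs A p \<and> y \<in> cauchy_seqs A p \<and>
     (\<lambda>n. p (sa_diff A (x n) (y n))) \<longlonglongrightarrow> 0}"

definition sa_embed :: "('a, 'm) star_algebra_scheme \<Rightarrow> ('a \<Rightarrow> real) \<Rightarrow> 'a \<Rightarrow> (nat \<Rightarrow> 'a) set" where
  "sa_embed A p a = null_rel A p `` {\<lambda>_. a}"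

definition sa_completion ::
    "('a, 'm) star_algebra_scheme \<Rightarrow> ('a \<Rightarrow> real) \<Rightarrow> (nat \<Rightarrow> 'a) set normed_star_algebra" where
  "sa_completion A p = \<lparr>
     carrier = cauchy_seqs A p // null_rel A p,
     sa_zero = sa_embed A p (sa_zero A),
     sa_add = (\<lambda>X Y. \<Union>x\<in>X. \<Union>y\<in>Y. null_rel A p `` {\<lambda>n. sa_add A (x n) (y n)}),
     sa_scale = (\<lambda>c X. \<Union>x\<in>X. null_rel A p `` {\<lambda>n. sa_scale A c (x n)}),
     sa_mult = (\<lambda>X Y. \<Union>x\<in>X. \<Union>y\<in>Y. null_rel A p `` {\<lambda>n. sa_mult A (x n) (y n)}),
     sa_star = (\<lambda>X. \<Union>x\<in>X. null_rel A p `` {\<lambda>n. sa_star A (x n)}),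
     sa_norm = (\<lambda>X. lim (\<lambda>n. p ((SOME x. x \<in> X) n)))\<rparr>"

definition cstar_subalgebra :: "('a, 'm) normed_star_algebra_scheme \<Rightarrow> 'a set \<Rightarrow> bool" where
  "cstar_subalgebra A S \<longleftrightarrow> S \<subseteq> carrier A \<and> sa_zero A \<in> S \<and>
     (\<forall>x\<in>S. sa_star A x \<in> S \<and> (\<forall>c. sa_scale A c x \<in> S)) \<and>
     (\<forall>x\<in>S. \<forall>y\<in>S. sa_add A x y \<in> S \<and> sa_mult A x y \<in> S) \<and>
     (\<forall>x\<in>carrier A. (\<forall>e>0. \<exists>y\<in>S. sa_norm A (sa_diff A x y) < e) \<longrightarrow> x \<in> S)"

definition cstar_generated :: "('a, 'm) normed_star_algebra_scheme \<Rightarrow> 'a set \<Rightarrow> 'a set" where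
  "cstar_generated A T = \<Inter>{S. cstar_subalgebra A S \<and> T \<subseteq> S}"


section \<open>Partial crossed products of commutative C*-algebras\<close>

text \<open>\<open>C\<^sub>0(V)\<close> for an open \<open>V \<subseteq> X\<close>, as functions extended by zero.\<close>

definition C0 :: "'x topology \<Rightarrow> 'x set \<Rightarrow> ('x \<Rightarrow> complex) set" where
  "C0 X V = {f. (\<forall>x. x \<notin> V \<longrightarrow> f x = 0) \<and> continuous_map (subtopology X V) euclidean f \<and>
     (\<forall>e>0. compactin (subtopology X V) {x \<in> V. e \<le> norm (f x)})}"

definition transport ::
    "('g, 'm) monoid_scheme \<Rightarrow> ('g \<Rightarrow> 'x set) \<Rightarrow> ('g \<Rightarrow> 'x \<Rightarrow> 'x) \<Rightarrow> 'g \<Rightarrow> ('x \<Rightarrow> complex) \<Rightarrow> 'x \<Rightarrow> complex" where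
  "transport G U \<phi> t f = (\<lambda>x. if x \<in> U t then f (\<phi> (inv\<^bsub>G\<^esub> t) x) else 0)"

definition fdelta :: "'g \<Rightarrow> ('x \<Rightarrow> complex) \<Rightarrow> 'g \<Rightarrow> 'x \<Rightarrow> complex" where
  "fdelta t f = (\<lambda>s. if s = t then f else (\<lambda>_. 0))"

text \<open>The formal sum \<open>\<Sum>\<^sub>t f\<^sub>t \<delta>\<^sub>t\<close> is the finitely supported function \<open>t \<mapsto> f\<^sub>t\<close>; \<open>\<phi> t\<close> is only
  relevant on \<open>U (inv t)\<close>.\<close>

definition algebraic_crossed_product ::
    "('g, 'm) monoid_scheme \<Rightarrow> 'x topology \<Rightarrow> ('g \<Rightarrow> 'x set) \<Rightarrow> ('g \<Rightarrow> 'x \<Rightarrow> 'x) \<Rightarrow>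
     ('g \<Rightarrow> 'x \<Rightarrow> complex) star_algebra" where
  "algebraic_crossed_product G X U \<phi> = \<lparr>
     carrier = {a. finite {t. a t \<noteq> (\<lambda>_. 0)} \<and> (\<forall>t\<in>carrier G. a t \<in> C0 X (U t)) \<and>
        (\<forall>t. t \<notin> carrier G \<longrightarrow> a t = (\<lambda>_. 0))},
     sa_zero = (\<lambda>_ _. 0),
     sa_add = (\<lambda>a b t x. a t x + b t x),
     sa_scale = (\<lambda>c a t x. c * a t x),
     sa_mult = (\<lambda>a b t x. \<Sum>(r, s) \<in> {(r, s). a r \<noteq> (\<lambda>_. 0) \<and> b s \<noteq> (\<lambda>_. 0) \<and> r \<otimes>\<^bsub>G\<^esub> s = t}.
        transport G U \<phi> r (\<lambda>y. transport G U \<phi> (inv\<^bsub>G\<^esub> r) (a r) y * b s y) x),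
     sa_star = (\<lambda>a t. if t \<in> carrier G then transport G U \<phi> t (\<lambda>y. cnj (a (inv\<^bsub>G\<^esub> t) y))
        else (\<lambda>_. 0))\<rparr>"

definition crossed_product ::
    "('g, 'm) monoid_scheme \<Rightarrow> 'x topology \<Rightarrow> ('g \<Rightarrow> 'x set) \<Rightarrow> ('g \<Rightarrow> 'x \<Rightarrow> 'x) \<Rightarrow>
     (nat \<Rightarrow> 'g \<Rightarrow> 'x \<Rightarrow> complex) set normed_star_algebra" where
  "crossed_product G X U \<phi> = sa_completion (algebraic_crossed_product G X U \<phi>)
     (universal_norm (algebraic_crossed_product G X U \<phi>))"

text \<open>The image of \<open>f \<delta>\<^sub>t\<close> in the crossed product.\<close>

definition cp_delta ::
    "('g, 'm) monoid_scheme \<Rightarrow> 'x topology \<Rightarrow> ('g \<Rightarrow> 'x set) \<Rightarrow> ('g \<Rightarrow> 'x \<Rightarrow> 'x) \<Rightarrow>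
     'g \<Rightarrow> ('x \<Rightarrow> complex) \<Rightarrow> (nat \<Rightarrow> 'g \<Rightarrow> 'x \<Rightarrow> complex) set" where
  "cp_delta G X U \<phi> t f = sa_embed (algebraic_crossed_product G X U \<phi>)
     (universal_norm (algebraic_crossed_product G X U \<phi>)) (fdelta t f)"


section \<open>Paths\<close>

text \<open>The edge \<open>e\<^sup>\<alpha>\<^sub>\<eta>\<close> is the pair \<open>(\<alpha>, \<eta>)\<close>. A path is a vertex, a finite sequence of edges
  (non-empty lists only; see \<open>finite_paths\<close> below), or an infinite sequence of edges, which is
  indexed from 0.\<close>

type_synonym ('l, 'b) edge = "'l \<times> 'b set"

datatype ('l, 'b) path = Vertex "'b set" | FinPath "('l, 'b) edge list" | InfPath "nat \<Rightarrow> ('l, 'b) edge"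

fun path_length :: "('l, 'b) path \<Rightarrow> enat" where
  "path_length (Vertex v) = 0"
| "path_length (FinPath es) = enat (length es)"
| "path_length (InfPath e) = \<infinity>"

fun path_take :: "nat \<Rightarrow> ('l, 'b) path \<Rightarrow> ('l, 'b) edge list" where
  "path_take n (Vertex v) = []"
| "path_take n (FinPath es) = take n es"
| "path_take n (InfPath e) = map e [0..<n]"

text \<open>The labels of the first \<open>length \<alpha>\<close> edges are \<open>\<alpha>\<close>; in particular there are that many edges.\<close>

definition path_starts :: "('l, 'b) path \<Rightarrow> 'l list \<Rightarrow> bool" where
  "path_starts \<mu> \<alpha> \<longleftrightarrow> map fst (path_take (length \<alpha>) \<mu>) = \<alpha>"

fun path_prepend :: "('l, 'b) edge list \<Rightarrow> ('l, 'b) path \<Rightarrow> ('l, 'b) path" where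
  "path_prepend es (Vertex v) = FinPath es"
| "path_prepend es (FinPath fs) = FinPath (es @ fs)"
| "path_prepend es (InfPath e) = InfPath (\<lambda>i. if i < length es then es ! i else e (i - length es))"


section \<open>Generalized Boolean dynamical systems and their boundary path spaces\<close>

locale gen_boolean_dyn_system =
  fixes L :: "'l set"
    and \<theta> :: "'l \<Rightarrow> 'b::generalized_boolean_algebra \<Rightarrow> 'b"
    and \<I> :: "'l \<Rightarrow> 'b set"
  assumes action: "\<alpha> \<in> L \<Longrightarrow> ba_action (\<theta> \<alpha>)"
    and ideal: "\<alpha> \<in> L \<Longrightarrow> ba_ideal (\<I> \<alpha>)"
    and range_subset: "\<alpha> \<in> L \<Longrightarrow> {A. \<exists>B. A \<le> \<theta> \<alpha> B} \<subseteq> \<I> \<alpha>"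
begin

definition word_action :: "'l list \<Rightarrow> 'b \<Rightarrow> 'b" where
  "word_action \<alpha> = fold \<theta> \<alpha>"

fun word_ideal :: "'l list \<Rightarrow> 'b set" where
  "word_ideal [] = UNIV"
| "word_ideal (a # \<alpha>) = {A. \<exists>B\<in>\<I> a. A \<le> word_action \<alpha> B}"

definition words :: "'l list set" where
  "words = {\<alpha> \<in> lists L. word_ideal \<alpha> \<noteq> {bot}}"

definition words1 :: "'l list set" where
  "words1 = {\<alpha> \<in> words. \<alpha> \<noteq> []}"

subsection \<open>The topological correspondence\<close>

definition E0_topology :: "'b set topology" where
  "E0_topology = ultrafilter_topology UNIV"

definition E0 :: "'b set set" where
  "E0 = ba_ultrafilters UNIV"

definition F0 :: "'b set set" where
  "F0 = insert {} E0"

definition F0_topology :: "'b set topology" where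
  "F0_topology =
     (if ba_unital TYPE('b) then topology_generated_by (insert {{}} {V. openin E0_topology V})
      else pullback_topology F0 (\<lambda>v. if v = {} then None else Some v)
             (Alexandroff_compactification E0_topology))"

definition E1 :: "('l, 'b) edge set" where
  "E1 = (SIGMA \<alpha>:L. ba_ultrafilters (\<I> \<alpha>))"

definition E1_topology :: "('l, 'b) edge topology" where
  "E1_topology = sum_topology (\<lambda>\<alpha>. ultrafilter_topology (\<I> \<alpha>)) L"

definition edge_d :: "('l, 'b) edge \<Rightarrow> 'b set" where
  "edge_d e = {B. \<exists>A\<in>snd e. A \<le> B}"

definition letter_map :: "'l \<Rightarrow> 'b set \<Rightarrow> 'b set" where
  "letter_map \<alpha> \<eta> = {A. \<theta> \<alpha> A \<in> \<eta>}"

definition edge_r :: "('l, 'b) edge \<Rightarrow> 'b set" where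
  "edge_r e = letter_map (fst e) (snd e)"

subsection \<open>Finite and infinite paths\<close>

definition En :: "nat \<Rightarrow> ('l, 'b) edge list set" where
  "En n = {es. length es = n \<and> set es \<subseteq> E1 \<and>
     (\<forall>i. Suc i < n \<longrightarrow> edge_d (es ! i) = edge_r (es ! Suc i))}"

definition En_topology :: "nat \<Rightarrow> ('l, 'b) edge list topology" where
  "En_topology n = pullback_topology (En n) (\<lambda>es. restrict (nth es) {..<n})
     (product_topology (\<lambda>_. E1_topology) {..<n})"

definition finite_paths :: "('l, 'b) path set" where
  "finite_paths = Vertex ` E0 \<union> (\<Union>n\<in>{1..}. FinPath ` En n)"

definition infinite_paths :: "('l, 'b) path set" where
  "infinite_paths = {InfPath e | e. \<forall>i. e i \<in> E1 \<and> edge_d (e i) = edge_r (e (Suc i))}"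

text \<open>Disjoint union topology of \<open>E\<^sup>0, E\<^sup>1, E\<^sup>2, \<dots>\<close>.\<close>

definition finite_paths_topology :: "('l, 'b) path topology" where
  "finite_paths_topology = topology (\<lambda>V. V \<subseteq> finite_paths \<and> openin E0_topology {v. Vertex v \<in> V} \<and>
     (\<forall>n\<ge>1. openin (En_topology n) {es. length es = n \<and> FinPath es \<in> V}))"

lemma openin_finite_paths_topology:
  "openin finite_paths_topology V \<longleftrightarrow> V \<subseteq> finite_paths \<and> openin E0_topology {v. Vertex v \<in> V} \<and>
     (\<forall>n\<ge>1. openin (En_topology n) {es. length es = n \<and> FinPath es \<in> V})"
proof -
  let ?P = "\<lambda>V. V \<subseteq> finite_paths \<and> openin E0_topology {v. Vertex v \<in> V} \<and>
     (\<forall>n\<ge>1. openin (En_topology n) {es. length es = n \<and> FinPath es \<in> V})"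
  have "istopology ?P"
    unfolding istopology_def
  proof (intro conjI allI impI)
    fix S T assume S: "?P S" and T: "?P T"
    have eq: "{v. Vertex v \<in> S \<inter> T} = {v. Vertex v \<in> S} \<inter> {v. Vertex v \<in> T}"
      "{es. length es = n \<and> FinPath es \<in> S \<inter> T} =
         {es. length es = n \<and> FinPath es \<in> S} \<inter> {es. length es = n \<and> FinPath es \<in> T}" for n
      by auto
    show "S \<inter> T \<subseteq> finite_paths" using S by blast
    show "openin E0_topology {v. Vertex v \<in> S \<inter> T}" using S T unfolding eq by blast
    show "openin (En_topology n) {es. length es = n \<and> FinPath es \<in> S \<inter> T}" if "1 \<le> n" for n
      using S T that unfolding eq by blast
  next
    fix K assume K: "\<forall>S\<in>K. ?P S"
    have eq: "{v. Vertex v \<in> \<Union>K} = (\<Union>S\<in>K. {v. Vertex v \<in> S})"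
      "{es. length es = n \<and> FinPath es \<in> \<Union>K} = (\<Union>S\<in>K. {es. length es = n \<and> FinPath es \<in> S})" for n
      by auto
    show "\<Union>K \<subseteq> finite_paths" using K by blast
    show "openin E0_topology {v. Vertex v \<in> \<Union>K}" using K unfolding eq by blast
    show "openin (En_topology n) {es. length es = n \<and> FinPath es \<in> \<Union>K}" if "1 \<le> n" for n
      using K that unfolding eq by blast
  qed
  then show ?thesis
    unfolding finite_paths_topology_def by (simp add: topology_inverse')
qed

fun path_r :: "('l, 'b) path \<Rightarrow> 'b set" where
  "path_r (Vertex v) = v"
| "path_r (FinPath es) = edge_r (hd es)"
| "path_r (InfPath e) = edge_r (e 0)"

text \<open>Only used on finite paths.\<close>

fun path_d :: "('l, 'b) path \<Rightarrow> 'b set" where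
  "path_d (Vertex v) = v"
| "path_d (FinPath es) = edge_d (last es)"
| "path_d (InfPath e) = undefined"

text \<open>Removal of the first \<open>n\<close> edges of a path of length at least \<open>n\<close>.\<close>

fun path_drop :: "nat \<Rightarrow> ('l, 'b) path \<Rightarrow> ('l, 'b) path" where
  "path_drop n (Vertex v) = Vertex v"
| "path_drop n (FinPath es) =
     (if n < length es then FinPath (drop n es) else Vertex (edge_d (last es)))"
| "path_drop n (InfPath e) = InfPath (\<lambda>i. e (n + i))"

subsection \<open>The boundary path space\<close>

definition F0_sce :: "'b set set" where
  "F0_sce = F0 - F0_topology closure_of (edge_r ` E1)"

definition F0_fin :: "'b set set" where
  "F0_fin = {v \<in> F0. \<exists>V W. openin F0_topology W \<and> v \<in> W \<and> W \<subseteq> V \<and> V \<subseteq> F0 \<and>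
     compactin E1_topology {e \<in> E1. edge_r e \<in> V}}"

definition F0_rg :: "'b set set" where
  "F0_rg = F0_fin - F0_topology closure_of F0_sce"

definition E0_sg :: "'b set set" where
  "E0_sg = E0 - F0_rg"

definition boundary :: "('l, 'b) path set" where
  "boundary = infinite_paths \<union> {\<mu> \<in> finite_paths. path_d \<mu> \<in> E0_sg}"

definition Z :: "('l, 'b) path set \<Rightarrow> ('l, 'b) path set" where
  "Z S = {\<mu> \<in> boundary. Vertex (path_r \<mu>) \<in> S \<or>
     (\<exists>i\<ge>1. enat i \<le> path_length \<mu> \<and> FinPath (path_take i \<mu>) \<in> S)}"

definition boundary_topology :: "('l, 'b) path topology" where
  "boundary_topology = topology_generated_by
     {Z V - Z K | V K. openin finite_paths_topology V \<and> compactin finite_paths_topology K}"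

definition cylinder :: "'l list \<Rightarrow> 'b \<Rightarrow> ('l, 'b) path set" where
  "cylinder \<alpha> A =
     (if \<alpha> = [] then {\<mu> \<in> boundary. A \<in> path_r \<mu>}
      else {\<mu> \<in> boundary. path_starts \<mu> \<alpha> \<and> A \<in> snd (last (path_take (length \<alpha>) \<mu>))})"

subsection \<open>The partial action of the free group\<close>

definition pa_domain :: "'l signed_letter list \<Rightarrow> ('l, 'b) path set" where
  "pa_domain t = {\<mu> \<in> boundary.
     t = [] \<or>
     (\<exists>\<alpha>\<in>words1. \<exists>\<beta>\<in>words1. t = word_elt \<alpha> @ word_elt_inv \<beta> \<and> fg_reduced t \<and>
        path_starts \<mu> \<alpha> \<and> snd (last (path_take (length \<alpha>) \<mu>)) \<inter> word_ideal \<beta> \<noteq> {}) \<or>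
     (\<exists>\<alpha>\<in>words1. t = word_elt \<alpha> \<and> path_starts \<mu> \<alpha>) \<or>
     (\<exists>\<beta>\<in>words1. t = word_elt_inv \<beta> \<and> path_r \<mu> \<inter> word_ideal \<beta> \<noteq> {})}"

text \<open>The edges \<open>e\<^sup>\<alpha>\<^sup>1\<^sub>\<eta>\<^sub>1 \<dots> e\<^sup>\<alpha>\<^sup>n\<^sub>\<eta>\<^sub>n\<close> with \<open>\<eta>\<^sub>n = \<zeta> \<inter> \<I> \<alpha>\<^sub>n\<close> and \<open>\<eta>\<^sub>i = letter_map \<alpha>\<^sub>i\<^sub>+\<^sub>1 \<eta>\<^sub>i\<^sub>+\<^sub>1 \<inter> \<I> \<alpha>\<^sub>i\<close>.\<close>

fun lift_edges :: "'l list \<Rightarrow> 'b set \<Rightarrow> ('l, 'b) edge list" where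
  "lift_edges [] \<zeta> = []"
| "lift_edges [a] \<zeta> = [(a, \<zeta> \<inter> \<I> a)]"
| "lift_edges (a # b # \<alpha>) \<zeta> =
     (let es = lift_edges (b # \<alpha>) \<zeta> in (a, letter_map b (snd (hd es)) \<inter> \<I> a) # es)"

text \<open>For \<open>t = \<alpha> \<beta>\<^sup>-\<^sup>1\<close> in reduced form, \<open>\<alpha>\<close> and \<open>\<beta>\<close> are read off from the positive and the negative
  letters of \<open>t\<close>. For \<open>t\<close> not of this form \<open>pa_domain (inv t)\<close> is empty.\<close>

definition pa_map :: "'l signed_letter list \<Rightarrow> ('l, 'b) path \<Rightarrow> ('l, 'b) path" where
  "pa_map t \<mu> =
     (let \<alpha> = [a. Gen a \<leftarrow> t]; \<beta> = rev [b. GenInv b \<leftarrow> t];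
          \<zeta> = (if \<beta> = [] then path_r \<mu> else edge_d (last (path_take (length \<beta>) \<mu>)));
          \<nu> = (if \<beta> = [] then \<mu> else path_drop (length \<beta>) \<mu>)
      in if \<alpha> = [] then \<nu> else path_prepend (lift_edges \<alpha> \<zeta>) \<nu>)"

subsection \<open>The partial crossed product\<close>

definition bdry_crossed_product ::
    "(nat \<Rightarrow> 'l signed_letter list \<Rightarrow> ('l, 'b) path \<Rightarrow> complex) set normed_star_algebra" where
  "bdry_crossed_product = crossed_product (free_group L) boundary_topology pa_domain pa_map"

definition cyl_delta ::
    "'l list \<Rightarrow> 'b \<Rightarrow> (nat \<Rightarrow> 'l signed_letter list \<Rightarrow> ('l, 'b) path \<Rightarrow> complex) set" where
  "cyl_delta \<alpha> A = cp_delta (free_group L) boundary_topology pa_domain pa_map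
     (word_elt \<alpha>) (indicator (cylinder \<alpha> A))"

end

end

theory Submission
  imports Defs
begin

text \<open>Let \<open>S\<close> be a closed *-subalgebra containing the generators, and consider the pairs of \<open>t\<close> and a
  compact open subset \<open>K\<close> of the domain indexed by \<open>t\<close> for which the element with coefficient
  \<open>1\<^sub>K\<close> at \<open>t\<close> lies in \<open>S\<close>. Products and adjoints in \<open>S\<close> translate these sets by the partial action.
  Starting from the cylinders, one reaches at the identity of the group a family of sets that separates
  the points of the boundary path space, and at every \<open>t\<close> a cover of the corresponding domain. By
  compactness they form bases of the domains, so every element with a single coefficient \<open>f\<close> is a limit of
  elements of \<open>S\<close>; here one uses that every C*-seminorm of such an element is at most the supremum
  norm of \<open>f\<close>, which also makes the universal norm finite.

  The topology of the boundary path space turns out to be generated by the cylinders. These are compact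
  because a pointwise limit of the membership patterns of boundary paths is again such a pattern: the
  limit path can be read off edge by edge, and it cannot stop at a regular vertex.\<close>

section \<open>Functions vanishing at infinity\<close>

text \<open>The topology of the boundary path space is given by sets \<open>Z V - Z K\<close> with
  arbitrary compact \<open>K\<close> in a disjoint union of path spaces, a description that shows
  neither the Hausdorff property nor the compactness of cylinders. A boundary path is therefore
  coded by ultrafilters of the whole algebra, one for each word (\<open>tail_filter\<close>). In
  this code removing or adding an edge shifts the word, and the cylinder topology is pointwise
  convergence. Two features shape the details. A path may have empty range, namely when no set is
  sent by \<theta> into the ultrafilter of its first edge. It then lies in no cylinder over the
  empty word, so the generators at the identity do not cover the space; the missing sets come from
  products a a* of generators a at letters. Moreover the set A of a cylinder has to lie in the ideal
  of its word before the complement may serve as an open set, which is why sets are cut down again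
  and again by \<open>inf\<close> with images of members of the ideals. The partial action is
  examined one letter at a time along reduced words, and its product law then follows
  formally.\<close>

lemma continuous_map_mult:
  fixes f g :: "'a \<Rightarrow> 'b::real_normed_algebra"
  shows "continuous_map X euclidean f \<Longrightarrow> continuous_map X euclidean g \<Longrightarrow>
    continuous_map X euclidean (\<lambda>x. f x * g x)"
  by (simp add: continuous_map_atin tendsto_mult)

lemma continuous_map_compose_continuous_on:
  assumes f: "continuous_map X euclidean f" and h: "continuous_on UNIV h"
  shows "continuous_map X euclidean (\<lambda>x. h (f x))"
  using continuous_map_compose[OF f, of euclidean h] h by (simp add: o_def)

text \<open>Openness of \<open>V\<close> handles the values away from 0. Near 0 one uses that the
  set where \<open>f\<close> has norm at least \<open>e\<close> is compact, hence closed in the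
  Hausdorff space \<open>X\<close>; so the extension by zero is continuous across the boundary of
  \<open>V\<close>.\<close>

lemma C0_iff:
  assumes X: "Hausdorff_space X" and V: "openin X V"
  shows "f \<in> C0 X V \<longleftrightarrow> (\<forall>x. x \<notin> V \<longrightarrow> f x = 0) \<and> continuous_map X euclidean f \<and>
     (\<forall>e>0. compactin X {x \<in> V. e \<le> norm (f x)})" (is "_ \<longleftrightarrow> ?R")
proof
  have VX: "V \<subseteq> topspace X" using V by (rule openin_subset)
  assume f: "f \<in> C0 X V"
  then have 0: "\<And>x. x \<notin> V \<Longrightarrow> f x = 0" and c: "continuous_map (subtopology X V) euclidean f"
    and k: "\<And>e. e > 0 \<Longrightarrow> compactin X {x \<in> V. e \<le> norm (f x)}"
    by (auto simp: C0_def compactin_subtopology)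
  have "continuous_map X euclidean f"
    unfolding continuous_map_def
  proof (intro conjI allI impI)
    fix W :: "complex set" assume W: "openin euclidean W"
    have "openin (subtopology X V) {x \<in> topspace (subtopology X V). f x \<in> W}"
      using c W by (simp add: continuous_map_def)
    moreover have "{x \<in> topspace (subtopology X V). f x \<in> W} = {x \<in> V. f x \<in> W}" using VX by auto
    ultimately have o: "openin X {x \<in> V. f x \<in> W}" using V by (simp add: openin_open_subtopology)
    show "openin X {x \<in> topspace X. f x \<in> W}"
    proof (cases "0 \<in> W")
      case False
      then have "{x \<in> topspace X. f x \<in> W} = {x \<in> V. f x \<in> W}" using 0 VX by fastforce
      then show ?thesis using o by simp
    next
      case True
      then obtain e where e: "e > 0" "ball 0 e \<subseteq> W" using W by (meson open_contains_ball open_openin)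
      \<comment> \<open>Where the norm of \<open>f\<close> is below \<open>e\<close> the value lies
        in the ball inside \<open>W\<close>; this covers all points off \<open>V\<close> as
        well.\<close>
      have "{x \<in> topspace X. f x \<in> W} = {x \<in> V. f x \<in> W} \<union> (topspace X - {x \<in> V. e \<le> norm (f x)})"
        (is "?l = ?r")
      proof (rule Set.set_eqI)
        fix x
        have "f x \<in> W" if "norm (f x) < e" using e that by auto
        then show "x \<in> ?l \<longleftrightarrow> x \<in> ?r" using 0[of x] True VX by (cases "x \<in> V") auto
      qed
      then show ?thesis using o compactin_imp_closedin[OF X k[OF e(1)]] by auto
    qed
  qed auto
  then show ?R using 0 k by auto
next
  assume ?R
  then show "f \<in> C0 X V"
    by (auto simp: C0_def compactin_subtopology continuous_map_from_subtopology)
qed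

lemma C0_zero: "(\<lambda>_. 0) \<in> C0 X V"
proof -
  have "{x \<in> V. e \<le> norm (0::complex)} = {}" if "e > 0" for e using that by auto
  then show ?thesis by (simp add: C0_def)
qed

context
  fixes X :: "'x topology" and V :: "'x set"
  assumes X: "Hausdorff_space X" and V: "openin X V"
begin

text \<open>The level set of \<open>g\<close> at \<open>e\<close> is closed in \<open>X\<close> and
  contained in the compact level set of \<open>f\<close> at \<open>e / M\<close>. The equation
  assumed for \<open>g\<close> expresses that \<open>g\<close> vanishes off
  \<open>V\<close>.\<close>

lemma C0_dominated:
  assumes f: "f \<in> C0 X V" and g: "continuous_map X euclidean g" "g = (\<lambda>x. if x \<in> V then g x else 0)"
    and M: "M > 0" "\<And>x. x \<in> V \<Longrightarrow> norm (g x) \<le> M * norm (f x)"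
  shows "g \<in> C0 X V"
  unfolding C0_iff[OF X V]
proof (intro conjI allI impI)
  have VX: "V \<subseteq> topspace X" using V by (rule openin_subset)
  show "g x = 0" if "x \<notin> V" for x using that g(2) by metis
  show "continuous_map X euclidean g" by fact
  fix e :: real assume e: "e > 0"
  have n: "continuous_map X euclidean (\<lambda>x. norm (g x))"
    by (rule continuous_map_norm[OF g(1)])
  have "closedin X {x \<in> topspace X. norm (g x) \<in> {e..}}"
    by (rule closedin_continuous_map_preimage[OF n]) auto
  moreover have "compactin X {x \<in> V. e / M \<le> norm (f x)}"
    using f e M by (auto simp: C0_iff[OF X V])
  ultimately have "compactin X ({x \<in> topspace X. norm (g x) \<in> {e..}} \<inter> {x \<in> V. e / M \<le> norm (f x)})"
    by (rule closed_Int_compactin)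
  moreover have "{x \<in> topspace X. norm (g x) \<in> {e..}} \<inter> {x \<in> V. e / M \<le> norm (f x)} = {x \<in> V. e \<le> norm (g x)}"
  proof -
    have "e / M \<le> norm (f x)" if "x \<in> V" "e \<le> norm (g x)" for x
      using M(1) M(2)[OF that(1)] that(2) by (simp add: field_simps)
    then show ?thesis using VX by auto
  qed
  ultimately show "compactin X {x \<in> V. e \<le> norm (g x)}" by simp
qed

text \<open>On the compact level set at 1 the norm is bounded by continuity, and elsewhere 1 is a
  bound.\<close>

lemma C0_bounded:
  assumes f: "f \<in> C0 X V"
  obtains M where "M > 0" "\<And>x. norm (f x) \<le> M"
proof -
  have c: "continuous_map X euclidean (\<lambda>x. norm (f x))"
    using f by (auto simp: C0_iff[OF X V] intro: continuous_map_norm)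
  have "compactin X {x \<in> V. 1 \<le> norm (f x)}"
    using f by (auto simp: C0_iff[OF X V])
  then have "compactin euclidean ((\<lambda>x. norm (f x)) ` {x \<in> V. 1 \<le> norm (f x)})"
    using c by (rule image_compactin)
  then have "bounded ((\<lambda>x. norm (f x)) ` {x \<in> V. 1 \<le> norm (f x)})"
    by (simp add: compact_imp_bounded)
  then obtain M where M: "\<And>x. x \<in> V \<Longrightarrow> 1 \<le> norm (f x) \<Longrightarrow> norm (f x) \<le> M"
    by (auto simp: bounded_iff)
  have "norm (f x) \<le> max M 1" for x
  proof (cases "x \<in> V \<and> 1 \<le> norm (f x)")
    case False
    then have "norm (f x) \<le> 1" using f by (cases "x \<in> V") (auto simp: C0_iff[OF X V])
    then show ?thesis by simp
  qed (use M in \<open>simp add: le_max_iff_disj\<close>)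
  then show ?thesis by (intro that[of "max M 1"]) auto
qed

lemma C0_mult_bounded:
  assumes f: "f \<in> C0 X V" and g: "continuous_map X euclidean g" and M: "\<And>x. norm (g x) \<le> M"
  shows "(\<lambda>x. f x * g x) \<in> C0 X V"
proof (rule C0_dominated[OF f])
  have 0: "f x = 0" if "x \<notin> V" for x using f that by (auto simp: C0_iff[OF X V])
  show "continuous_map X euclidean (\<lambda>x. f x * g x)"
    using f g by (auto simp: C0_iff[OF X V] intro: continuous_map_mult)
  show "(\<lambda>x. f x * g x) = (\<lambda>x. if x \<in> V then f x * g x else 0)" using 0 by auto
  \<comment> \<open>\<open>max M 1\<close> is positive, as \<open>C0_dominated\<close> demands,
    whatever the sign of \<open>M\<close>.\<close>
  show "norm (f x * g x) \<le> max M 1 * norm (f x)" for x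
    using mult_right_mono[OF M[of x] norm_ge_zero[of "f x"]]
      mult_right_mono[of M "max M 1" "norm (f x)"]
    by (simp add: norm_mult mult.commute)
qed simp

lemma C0_scale: "f \<in> C0 X V \<Longrightarrow> (\<lambda>x. c * f x) \<in> C0 X V"
  using C0_mult_bounded[of f "\<lambda>_. c" "norm c"] by (simp add: mult.commute)

lemma C0_cnj:
  assumes f: "f \<in> C0 X V" shows "(\<lambda>x. cnj (f x)) \<in> C0 X V"
proof (rule C0_dominated[OF f, of _ 1])
  have "f x = 0" if "x \<notin> V" for x using f that by (simp add: C0_iff[OF X V])
  then show "(\<lambda>x. cnj (f x)) = (\<lambda>x. if x \<in> V then cnj (f x) else 0)"
    by (metis complex_cnj_zero)
  have "continuous_map X euclidean f" using f by (simp add: C0_iff[OF X V])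
  then show "continuous_map X euclidean (\<lambda>x. cnj (f x))"
    by (rule continuous_map_compose_continuous_on) (intro continuous_intros)
qed simp_all

text \<open>Where the sum has norm at least \<open>e\<close>, one of the summands has norm at least
  \<open>e / 2\<close>.\<close>

lemma C0_add:
  assumes f: "f \<in> C0 X V" and g: "g \<in> C0 X V"
  shows "(\<lambda>x. f x + g x) \<in> C0 X V"
  unfolding C0_iff[OF X V]
proof (intro conjI allI impI)
  have VX: "V \<subseteq> topspace X" using V by (rule openin_subset)
  show "f x + g x = 0" if "x \<notin> V" for x using f g that by (auto simp: C0_iff[OF X V])
  show c: "continuous_map X euclidean (\<lambda>x. f x + g x)"
    using f g by (auto simp: C0_iff[OF X V] intro: continuous_map_add)
  fix e :: real assume e: "e > 0"
  have "closedin X {x \<in> topspace X. norm (f x + g x) \<in> {e..}}"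
    by (rule closedin_continuous_map_preimage[OF continuous_map_norm[OF c]]) auto
  moreover have "compactin X ({x \<in> V. e / 2 \<le> norm (f x)} \<union> {x \<in> V. e / 2 \<le> norm (g x)})"
    using f g half_gt_zero[OF e] unfolding C0_iff[OF X V] by (blast intro: compactin_Un)
  ultimately have "compactin X ({x \<in> topspace X. norm (f x + g x) \<in> {e..}} \<inter>
      ({x \<in> V. e / 2 \<le> norm (f x)} \<union> {x \<in> V. e / 2 \<le> norm (g x)}))"
    by (rule closed_Int_compactin)
  moreover have "{x \<in> topspace X. norm (f x + g x) \<in> {e..}} \<inter>
      ({x \<in> V. e / 2 \<le> norm (f x)} \<union> {x \<in> V. e / 2 \<le> norm (g x)}) = {x \<in> V. e \<le> norm (f x + g x)}"
  proof -
    have "e / 2 \<le> norm (f x) \<or> e / 2 \<le> norm (g x)" if "e \<le> norm (f x + g x)" for x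
      using that norm_triangle_ineq[of "f x" "g x"] by linarith
    then show ?thesis using VX by auto
  qed
  ultimately show "compactin X {x \<in> V. e \<le> norm (f x + g x)}" by simp
qed

lemma C0_sum: "(\<And>i. i \<in> I \<Longrightarrow> f i \<in> C0 X V) \<Longrightarrow> (\<lambda>x. \<Sum>i\<in>I. f i x) \<in> C0 X V"
proof (induction I rule: infinite_finite_induct)
  case (insert i I)
  then show ?case using C0_add[of "f i" "\<lambda>x. \<Sum>i\<in>I. f i x"] by simp
qed (simp_all add: C0_zero)

text \<open>For positive \<open>e\<close> the level sets see only the points where \<open>f\<close>
  is nonzero, so the surrounding open set may be exchanged. This moves a product of coefficients
  from \<open>U s\<close> to the domain of the product of the group elements.\<close>

lemma C0_subset:
  assumes f: "f \<in> C0 X V" and W: "openin X W" and 0: "\<And>x. x \<notin> W \<Longrightarrow> f x = 0"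
  shows "f \<in> C0 X W"
proof -
  have z: "f x = 0" if "x \<notin> V" for x using that f by (simp add: C0_iff[OF X V])
  have "{x \<in> V. e \<le> norm (f x)} = {x \<in> W. e \<le> norm (f x)}" if "e > 0" for e
    using that 0 z by fastforce
  then show ?thesis using f 0 by (simp add: C0_iff[OF X V] C0_iff[OF X W])
qed

end

text \<open>\<open>K\<close> is both the set where its indicator is nonzero, hence open, and the
  level set at 1, hence compact. Conversely a compact open set is clopen in a Hausdorff space, so
  its indicator is continuous.\<close>

lemma indicator_in_C0_iff:
  assumes X: "Hausdorff_space X" and V: "openin X V" and K: "K \<subseteq> V"
  shows "(indicator K :: _ \<Rightarrow> complex) \<in> C0 X V \<longleftrightarrow> openin X K \<and> compactin X K"
proof
  have VX: "V \<subseteq> topspace X" using V by (rule openin_subset)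
  assume f: "(indicator K :: _ \<Rightarrow> complex) \<in> C0 X V"
  have "{x \<in> topspace X. (indicator K x :: complex) \<in> - {0}} = K"
    using K VX by (auto simp: indicator_def)
  moreover have "openin X {x \<in> topspace X. (indicator K x :: complex) \<in> - {0}}"
    by (rule openin_continuous_map_preimage[of X euclidean]) (use f in \<open>auto simp: C0_iff[OF X V]\<close>)
  moreover have "{x \<in> V. 1 \<le> norm (indicator K x :: complex)} = K" using K by (auto simp: indicator_def)
  moreover have "compactin X {x \<in> V. 1 \<le> norm (indicator K x :: complex)}"
    using f unfolding C0_iff[OF X V] by (metis zero_less_one)
  ultimately show "openin X K \<and> compactin X K" by simp
next
  assume k: "openin X K \<and> compactin X K"
  have "closedin X K" using compactin_imp_closedin[OF X] k by blast
  have KX: "K \<subseteq> topspace X" using k openin_subset by blast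
  have "continuous_map X euclidean (indicator K :: _ \<Rightarrow> complex)"
    unfolding continuous_map_def
  proof (intro conjI allI impI)
    fix W :: "complex set"
    have "{x \<in> topspace X. (indicator K x :: complex) \<in> W} =
       (if 1 \<in> W then K else {}) \<union> (if 0 \<in> W then topspace X - K else {})"
      using KX by (auto simp: indicator_def split: if_splits)
    then show "openin X {x \<in> topspace X. (indicator K x :: complex) \<in> W}"
      using k \<open>closedin X K\<close> by auto
  qed auto
  moreover have "compactin X {x \<in> V. e \<le> norm (indicator K x :: complex)}" if "e > 0" for e
  proof -
    have "{x \<in> V. e \<le> norm (indicator K x :: complex)} = (if e \<le> 1 then K else {})"
      using that K by (auto simp: indicator_def split: if_splits)
    then show ?thesis using k by simp
  qed
  ultimately show "(indicator K :: _ \<Rightarrow> complex) \<in> C0 X V"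
    using K unfolding C0_iff[OF X V] by (simp add: indicator_def subset_iff) metis
qed

section \<open>Partial crossed products\<close>

text \<open>The maps are indexed as \<open>\<phi> (inv t)\<close> on \<open>U t\<close> because
  functions are pulled back in this direction. \<open>domain_mult\<close> is the half of the partial
  action law that places a product of coefficients at \<open>s\<close> and \<open>t\<close> in
  \<open>C0 X (U (s \<otimes> t))\<close>.\<close>

locale partial_dynamical_system = group G for G :: "('g, 'm) monoid_scheme" (structure) +
  fixes X :: "'x topology" and U :: "'g \<Rightarrow> 'x set" and \<phi> :: "'g \<Rightarrow> 'x \<Rightarrow> 'x"
  assumes Hausdorff: "Hausdorff_space X"
    and open_domain: "t \<in> carrier G \<Longrightarrow> openin X (U t)"
    and domain_one: "U \<one> = topspace X"
    and map_one: "x \<in> topspace X \<Longrightarrow> \<phi> \<one> x = x"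
    and continuous: "t \<in> carrier G \<Longrightarrow> continuous_map (subtopology X (U t)) X (\<phi> (inv t))"
    and maps: "\<lbrakk>t \<in> carrier G; x \<in> U t\<rbrakk> \<Longrightarrow> \<phi> (inv t) x \<in> U (inv t)"
    and inverse: "\<lbrakk>t \<in> carrier G; x \<in> U t\<rbrakk> \<Longrightarrow> \<phi> t (\<phi> (inv t) x) = x"
    and domain_mult: "\<lbrakk>s \<in> carrier G; t \<in> carrier G; x \<in> U s; \<phi> (inv s) x \<in> U t\<rbrakk> \<Longrightarrow> x \<in> U (s \<otimes> t)"
begin

abbreviation alg where "alg \<equiv> algebraic_crossed_product G X U \<phi>"

lemma domain_subset: "t \<in> carrier G \<Longrightarrow> U t \<subseteq> topspace X"
  using open_domain openin_subset by blast

lemmas C0_iff' = C0_iff[OF Hausdorff open_domain]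

lemma C0_outside: "f \<in> C0 X (U t) \<Longrightarrow> x \<notin> U t \<Longrightarrow> f x = 0"
  by (auto simp: C0_def)

lemma alg_add [simp]: "sa_add alg a b = (\<lambda>t x. a t x + b t x)"
  and alg_scale [simp]: "sa_scale alg c a = (\<lambda>t x. c * a t x)"
  and alg_zero [simp]: "sa_zero alg = (\<lambda>_ _. 0)"
  and alg_diff [simp]: "sa_diff alg a b = (\<lambda>t x. a t x - b t x)"
  by (simp_all add: algebraic_crossed_product_def sa_diff_def)

lemma alg_carrier_iff: "a \<in> carrier alg \<longleftrightarrow> finite {t. a t \<noteq> (\<lambda>_. 0)} \<and>
    (\<forall>t\<in>carrier G. a t \<in> C0 X (U t)) \<and> (\<forall>t. t \<notin> carrier G \<longrightarrow> a t = (\<lambda>_. 0))"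
  by (simp add: algebraic_crossed_product_def)

lemma alg_support: "a \<in> carrier alg \<Longrightarrow> {t. a t \<noteq> (\<lambda>_. 0)} \<subseteq> carrier G"
  by (auto simp: alg_carrier_iff)

lemma alg_C0: "a \<in> carrier alg \<Longrightarrow> t \<in> carrier G \<Longrightarrow> a t \<in> C0 X (U t)"
  by (simp add: alg_carrier_iff)

lemma alg_star: "t \<in> carrier G \<Longrightarrow>
    sa_star alg a t x = (if x \<in> U t then cnj (a (inv t) (\<phi> (inv t) x)) else 0)"
  "t \<notin> carrier G \<Longrightarrow> sa_star alg a t = (\<lambda>_. 0)"
  by (simp_all add: algebraic_crossed_product_def transport_def)

lemma alg_mult_def: "sa_mult alg a b t x = (\<Sum>(r, s)\<in>{(r, s). a r \<noteq> (\<lambda>_. 0) \<and> b s \<noteq> (\<lambda>_. 0) \<and> r \<otimes> s = t}.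
    transport G U \<phi> r (\<lambda>y. transport G U \<phi> (inv r) (a r) y * b s y) x)"
  by (simp add: algebraic_crossed_product_def)

lemma alg_mult_outside:
  assumes a: "a \<in> carrier alg" and b: "b \<in> carrier alg" and t: "t \<notin> carrier G"
  shows "sa_mult alg a b t = (\<lambda>_. 0)"
proof -
  have "{(r, s). a r \<noteq> (\<lambda>_. 0) \<and> b s \<noteq> (\<lambda>_. 0) \<and> r \<otimes> s = t} = {}"
    using alg_support[OF a] alg_support[OF b] t by blast
  then show ?thesis by (intro ext) (simp only: alg_mult_def sum.empty)
qed

text \<open>In a pair with product \<open>t\<close> the second member is determined by the first, so
  the sum over pairs becomes a sum over one index. The index set \<open>R\<close> may exceed the
  support of \<open>a\<close>; this lets several products be summed over a common set.\<close>

lemma alg_mult: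
  assumes a: "a \<in> carrier alg" and b: "b \<in> carrier alg" and t: "t \<in> carrier G"
    and R: "finite R" "{r. a r \<noteq> (\<lambda>_. 0)} \<subseteq> R" "R \<subseteq> carrier G"
  shows "sa_mult alg a b t x = (\<Sum>r\<in>R. a r x * b (inv r \<otimes> t) (\<phi> (inv r) x))"
proof -
  let ?P = "{(r, s). a r \<noteq> (\<lambda>_. 0) \<and> b s \<noteq> (\<lambda>_. 0) \<and> r \<otimes> s = t}"
  have P: "r \<in> carrier G \<and> s \<in> carrier G \<and> s = inv r \<otimes> t" if "(r, s) \<in> ?P" for r s
  proof -
    have "r \<in> carrier G" "s \<in> carrier G" "r \<otimes> s = t"
      using that alg_support[OF a] alg_support[OF b] by auto
    then show ?thesis using inv_solve_left[of s r t] t by simp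
  qed
  \<comment> \<open>On \<open>U r\<close> the transport to \<open>inv r\<close> and back cancels on
    the coefficient \<open>a r\<close>; off \<open>U r\<close> this coefficient vanishes.\<close>
  have tr: "transport G U \<phi> r (\<lambda>y. transport G U \<phi> (inv r) (a r) y * b s y) x =
      a r x * b (inv r \<otimes> t) (\<phi> (inv r) x)" if rs: "(r, s) \<in> ?P" for r s
  proof -
    have r: "r \<in> carrier G" and s: "s = inv r \<otimes> t" using P[OF rs] by auto
    show ?thesis
    proof (cases "x \<in> U r")
      case True
      then show ?thesis using maps[OF r True] inverse[OF r True] r s by (simp add: transport_def)
    next
      case False
      then show ?thesis using C0_outside[OF alg_C0[OF a r] False] by (simp add: transport_def)
    qed
  qed
  have "sa_mult alg a b t x = (\<Sum>(r, s)\<in>?P. a r x * b (inv r \<otimes> t) (\<phi> (inv r) x))"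
    unfolding alg_mult_def using tr by (auto intro!: sum.cong)
  also have "\<dots> = (\<Sum>r\<in>fst ` ?P. a r x * b (inv r \<otimes> t) (\<phi> (inv r) x))"
  proof -
    have "inj_on fst ?P" using P by (auto simp: inj_on_def)
    then show ?thesis by (subst sum.reindex) (simp_all add: case_prod_unfold o_def)
  qed
  also have "\<dots> = (\<Sum>r\<in>R. a r x * b (inv r \<otimes> t) (\<phi> (inv r) x))"
  proof (rule sum.mono_neutral_left[OF R(1)])
    show "fst ` ?P \<subseteq> R" using R by auto
    show "\<forall>r\<in>R - fst ` ?P. a r x * b (inv r \<otimes> t) (\<phi> (inv r) x) = 0"
    proof
      fix r assume r: "r \<in> R - fst ` ?P"
      then have "r \<in> carrier G" using R by auto
      then have "r \<otimes> (inv r \<otimes> t) = t" using t by (simp flip: m_assoc)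
      then have "a r = (\<lambda>_. 0) \<or> b (inv r \<otimes> t) = (\<lambda>_. 0)" using r by force
      then show "a r x * b (inv r \<otimes> t) (\<phi> (inv r) x) = 0" by auto
    qed
  qed
  finally show ?thesis .
qed

lemma continuous_pullback:
  assumes t: "t \<in> carrier G" and g: "continuous_map X euclidean g"
  shows "continuous_map (subtopology X (U t)) euclidean (\<lambda>x. g (\<phi> (inv t) x))"
  using continuous_map_compose[OF continuous[OF t] g] by (simp add: o_def)

text \<open>A level set of the pulled back function is the image of a level set of \<open>f\<close>
  under the inverse homeomorphism, hence compact.\<close>

lemma C0_transport:
  assumes t: "t \<in> carrier G" and f: "f \<in> C0 X (U (inv t))"
  shows "(\<lambda>x. if x \<in> U t then f (\<phi> (inv t) x) else 0) \<in> C0 X (U t)"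
  unfolding C0_def mem_Collect_eq
proof (intro conjI allI impI)
  have t': "inv t \<in> carrier G" using t by simp
  have f': "continuous_map X euclidean f" using f by (simp add: C0_iff'[OF t'])
  show "continuous_map (subtopology X (U t)) euclidean (\<lambda>x. if x \<in> U t then f (\<phi> (inv t) x) else 0)"
    by (rule continuous_map_eq[OF continuous_pullback[OF t f']]) auto
  fix e :: real assume "e > 0"
  let ?C = "{x \<in> U (inv t). e \<le> norm (f x)}"
  have "compactin (subtopology X (U (inv t))) ?C"
    using f \<open>e > 0\<close> by (simp add: C0_iff'[OF t'] compactin_subtopology)
  then have "compactin X (\<phi> (inv (inv t)) ` ?C)"
    using continuous[OF t'] by (rule image_compactin)
  moreover have "\<phi> (inv (inv t)) ` ?C = {x \<in> U t. e \<le> norm (f (\<phi> (inv t) x))}"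
  proof -
    have "x \<in> \<phi> t ` ?C" if "x \<in> U t" "e \<le> norm (f (\<phi> (inv t) x))" for x
      using that maps[OF t] inverse[OF t] by (intro image_eqI[of _ _ "\<phi> (inv t) x"]) auto
    moreover have "\<phi> t y \<in> U t \<and> e \<le> norm (f (\<phi> (inv t) (\<phi> t y)))" if "y \<in> ?C" for y
      using that maps[OF t', of y] inverse[OF t', of y] t by simp
    ultimately show ?thesis using t by auto
  qed
  moreover have "{x \<in> U t. e \<le> norm (if x \<in> U t then f (\<phi> (inv t) x) else 0)} =
      {x \<in> U t. e \<le> norm (f (\<phi> (inv t) x))}" by auto
  ultimately show "compactin (subtopology X (U t)) {x \<in> U t. e \<le> norm (if x \<in> U t then f (\<phi> (inv t) x) else 0)}"
    by (simp add: compactin_subtopology)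
qed simp

text \<open>Boundedness of \<open>g\<close> puts the product in \<open>C0 X (U s)\<close>. Off
  \<open>U (s \<otimes> t)\<close> it vanishes, because by \<open>domain_mult\<close> the point at
  which \<open>g\<close> is evaluated then lies outside \<open>U t\<close>; so
  \<open>C0_subset\<close> applies.\<close>

lemma C0_mult_pullback:
  assumes s: "s \<in> carrier G" and t: "t \<in> carrier G" and f: "f \<in> C0 X (U s)" and g: "g \<in> C0 X (U t)"
  shows "(\<lambda>x. f x * g (\<phi> (inv s) x)) \<in> C0 X (U (s \<otimes> t))"
proof -
  have f0: "f x = 0" if "x \<notin> U s" for x using C0_outside[OF f that] .
  have g': "continuous_map X euclidean g" using g by (simp add: C0_iff'[OF t])
  obtain M where M: "M > 0" "\<And>x. norm (g x) \<le> M" 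
    using C0_bounded[OF Hausdorff open_domain[OF t] g] by metis
  have "(\<lambda>x. f x * g (\<phi> (inv s) x)) \<in> C0 X (U s)"
    unfolding C0_def mem_Collect_eq
  proof (intro conjI allI impI)
    have f': "continuous_map (subtopology X (U s)) euclidean f" using f by (simp add: C0_def)
    show c: "continuous_map (subtopology X (U s)) euclidean (\<lambda>x. f x * g (\<phi> (inv s) x))"
      by (rule continuous_map_mult[OF f' continuous_pullback[OF s g']])
    show "f x * g (\<phi> (inv s) x) = 0" if "x \<notin> U s" for x using f0[OF that] by simp
    fix e :: real assume e: "e > 0"
    have "closedin (subtopology X (U s))
        {x \<in> topspace (subtopology X (U s)). norm (f x * g (\<phi> (inv s) x)) \<in> {e..}}"
      by (rule closedin_continuous_map_preimage[OF continuous_map_norm[OF c]]) auto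
    moreover have "compactin (subtopology X (U s)) {x \<in> U s. e / M \<le> norm (f x)}"
      using f divide_pos_pos[OF e M(1)] by (simp add: C0_def)
    ultimately have "compactin (subtopology X (U s))
        ({x \<in> topspace (subtopology X (U s)). norm (f x * g (\<phi> (inv s) x)) \<in> {e..}} \<inter>
          {x \<in> U s. e / M \<le> norm (f x)})"
      by (rule closed_Int_compactin)
    moreover have "{x \<in> topspace (subtopology X (U s)). norm (f x * g (\<phi> (inv s) x)) \<in> {e..}} \<inter>
          {x \<in> U s. e / M \<le> norm (f x)} = {x \<in> U s. e \<le> norm (f x * g (\<phi> (inv s) x))}"
    proof -
      have "e / M \<le> norm (f x)" if "e \<le> norm (f x * g (\<phi> (inv s) x))" for x
        using that mult_left_mono[OF M(2)[of "\<phi> (inv s) x"] norm_ge_zero[of "f x"]] M(1)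
        by (simp add: norm_mult field_simps)
      then show ?thesis using domain_subset[OF s] by auto
    qed
    ultimately show "compactin (subtopology X (U s)) {x \<in> U s. e \<le> norm (f x * g (\<phi> (inv s) x))}"
      by simp
  qed
  then show ?thesis
  proof (rule C0_subset[OF Hausdorff open_domain[OF s]])
    show "openin X (U (s \<otimes> t))" using open_domain s t by simp
    show "f x * g (\<phi> (inv s) x) = 0" if "x \<notin> U (s \<otimes> t)" for x
    proof (cases "x \<in> U s")
      case True
      then have "\<phi> (inv s) x \<notin> U t" using that domain_mult[OF s t True] by metis
      then show ?thesis using C0_outside[OF g] by simp
    qed (simp add: f0)
  qed
qed

lemma alg_zero_closed: "(\<lambda>_ _. 0) \<in> carrier alg"
  by (simp add: alg_carrier_iff C0_zero)

lemma alg_carrierI: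
  assumes "finite S" "\<And>t. t \<notin> S \<Longrightarrow> a t = (\<lambda>_. 0)"
    "\<And>t. t \<in> carrier G \<Longrightarrow> a t \<in> C0 X (U t)" "\<And>t. t \<notin> carrier G \<Longrightarrow> a t = (\<lambda>_. 0)"
  shows "a \<in> carrier alg"
proof -
  have "{t. a t \<noteq> (\<lambda>_. 0)} \<subseteq> S" using assms(2) by blast
  then have "finite {t. a t \<noteq> (\<lambda>_. 0)}" using assms(1) finite_subset by blast
  then show ?thesis using assms(3,4) by (simp add: alg_carrier_iff)
qed

lemma alg_finite_support: "a \<in> carrier alg \<Longrightarrow> finite {t. a t \<noteq> (\<lambda>_. 0)}"
  by (simp add: alg_carrier_iff)

lemma alg_outside: "a \<in> carrier alg \<Longrightarrow> t \<notin> carrier G \<Longrightarrow> a t = (\<lambda>_. 0)"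
  by (simp add: alg_carrier_iff)

lemma alg_add_closed:
  assumes a: "a \<in> carrier alg" and b: "b \<in> carrier alg"
  shows "(\<lambda>t x. a t x + b t x) \<in> carrier alg"
proof (rule alg_carrierI)
  show "finite ({t. a t \<noteq> (\<lambda>_. 0)} \<union> {t. b t \<noteq> (\<lambda>_. 0)})"
    using alg_finite_support[OF a] alg_finite_support[OF b] by simp
  show "(\<lambda>x. a t x + b t x) \<in> C0 X (U t)" if t: "t \<in> carrier G" for t
    by (rule C0_add[OF Hausdorff open_domain[OF t] alg_C0[OF a t] alg_C0[OF b t]])
  show "(\<lambda>x. a t x + b t x) = (\<lambda>_. 0)" if t: "t \<notin> carrier G" for t
    using alg_outside[OF a t] alg_outside[OF b t] by simp
qed auto

lemma alg_scale_closed: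
  assumes a: "a \<in> carrier alg" shows "(\<lambda>t x. c * a t x) \<in> carrier alg"
proof (rule alg_carrierI[OF alg_finite_support[OF a]])
  show "(\<lambda>x. c * a t x) \<in> C0 X (U t)" if t: "t \<in> carrier G" for t
    by (rule C0_scale[OF Hausdorff open_domain[OF t] alg_C0[OF a t]])
  show "(\<lambda>x. c * a t x) = (\<lambda>_. 0)" if t: "t \<notin> carrier G" for t
    using alg_outside[OF a t] by simp
qed auto

lemma alg_star_closed:
  assumes a: "a \<in> carrier alg" shows "sa_star alg a \<in> carrier alg"
proof (rule alg_carrierI)
  show "finite ((\<lambda>t. inv t) ` {t. a t \<noteq> (\<lambda>_. 0)})" using alg_finite_support[OF a] by simp
  show "sa_star alg a t = (\<lambda>_. 0)" if "t \<notin> carrier G" for t by (rule alg_star(2)[OF that])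
  show "sa_star alg a t = (\<lambda>_. 0)" if t': "t \<notin> (\<lambda>t. inv t) ` {t. a t \<noteq> (\<lambda>_. 0)}" for t
  proof (cases "t \<in> carrier G")
    case t: True
    have "a (inv t) = (\<lambda>_. 0)"
    proof (rule ccontr)
      assume "a (inv t) \<noteq> (\<lambda>_. 0)"
      then have "inv (inv t) \<in> (\<lambda>t. inv t) ` {t. a t \<noteq> (\<lambda>_. 0)}" by blast
      then show False using t t' by simp
    qed
    then show ?thesis by (intro ext) (simp add: alg_star(1)[OF t])
  qed (rule alg_star(2))
  show "sa_star alg a t \<in> C0 X (U t)" if t: "t \<in> carrier G" for t
  proof -
    have "(\<lambda>x. cnj (a (inv t) x)) \<in> C0 X (U (inv t))"
      using a t by (intro C0_cnj[OF Hausdorff open_domain] alg_C0) auto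
    from C0_transport[OF t this]
    have "(\<lambda>x. if x \<in> U t then cnj (a (inv t) (\<phi> (inv t) x)) else 0) \<in> C0 X (U t)" .
    also have "(\<lambda>x. if x \<in> U t then cnj (a (inv t) (\<phi> (inv t) x)) else 0) = sa_star alg a t"
      by (rule ext) (rule alg_star(1)[OF t, symmetric])
    finally show ?thesis .
  qed
qed

lemma alg_mult_closed:
  assumes a: "a \<in> carrier alg" and b: "b \<in> carrier alg" shows "sa_mult alg a b \<in> carrier alg"
proof (rule alg_carrierI)
  let ?R = "{r. a r \<noteq> (\<lambda>_. 0)}" and ?S = "{r. b r \<noteq> (\<lambda>_. 0)}"
  note R = alg_finite_support[OF a] alg_support[OF a]
  note m = alg_mult[OF a b _ R(1) subset_refl R(2)]
  show "finite ((\<lambda>(r, s). r \<otimes> s) ` (?R \<times> ?S))"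
    using R(1) alg_finite_support[OF b] by blast
  have r_mult: "r \<otimes> (inv r \<otimes> t) = t" if "r \<in> ?R" "t \<in> carrier G" for r t
    using that R(2) by (simp add: subset_iff flip: m_assoc)
  show "sa_mult alg a b t = (\<lambda>_. 0)" if t': "t \<notin> (\<lambda>(r, s). r \<otimes> s) ` (?R \<times> ?S)" for t
  proof (cases "t \<in> carrier G")
    case t: True
    have "b (inv r \<otimes> t) = (\<lambda>_. 0)" if r: "r \<in> ?R" for r
    proof (rule ccontr)
      assume "b (inv r \<otimes> t) \<noteq> (\<lambda>_. 0)"
      then have "(r, inv r \<otimes> t) \<in> ?R \<times> ?S" using r by simp
      from imageI[OF this, of "\<lambda>(r, s). r \<otimes> s"] show False using t' r_mult[OF r t] by simp
    qed
    then show ?thesis by (intro ext) (simp add: m[OF t])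
  qed (rule alg_mult_outside[OF a b])
  show "sa_mult alg a b t \<in> C0 X (U t)" if t: "t \<in> carrier G" for t
  proof -
    have "(\<lambda>x. a r x * b (inv r \<otimes> t) (\<phi> (inv r) x)) \<in> C0 X (U t)" if r: "r \<in> ?R" for r
    proof -
      have r': "r \<in> carrier G" using r R by auto
      then have s: "inv r \<otimes> t \<in> carrier G" using t by simp
      show ?thesis
        using C0_mult_pullback[OF r' s alg_C0[OF a r'] alg_C0[OF b s]] r_mult[OF r t] by simp
    qed
    then have "(\<lambda>x. \<Sum>r\<in>?R. a r x * b (inv r \<otimes> t) (\<phi> (inv r) x)) \<in> C0 X (U t)"
      by (rule C0_sum[OF Hausdorff open_domain[OF t]])
    also have "(\<lambda>x. \<Sum>r\<in>?R. a r x * b (inv r \<otimes> t) (\<phi> (inv r) x)) = sa_mult alg a b t"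
      by (rule ext) (rule m[OF t, symmetric])
    finally show ?thesis .
  qed
qed (rule alg_mult_outside[OF a b])

end

section \<open>Completion of a C*-seminormed algebra\<close>

text \<open>The algebraic laws are stated through \<open>sa_diff\<close> because they serve to bound
  the distance of two sums, multiples, products or adjoints by the distances of the arguments. Such
  bounds are what makes the operations descend to Cauchy sequences modulo null sequences.\<close>

locale cstar_seminormed =
  fixes A :: "('a, 'm) star_algebra_scheme" and p :: "'a \<Rightarrow> real"
  assumes zero_closed: "sa_zero A \<in> carrier A"
    and add_closed: "\<lbrakk>x \<in> carrier A; y \<in> carrier A\<rbrakk> \<Longrightarrow> sa_add A x y \<in> carrier A"
    and scale_closed: "x \<in> carrier A \<Longrightarrow> sa_scale A c x \<in> carrier A"
    and mult_closed: "\<lbrakk>x \<in> carrier A; y \<in> carrier A\<rbrakk> \<Longrightarrow> sa_mult A x y \<in> carrier A"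
    and star_closed: "x \<in> carrier A \<Longrightarrow> sa_star A x \<in> carrier A"
    and diff_self: "x \<in> carrier A \<Longrightarrow> sa_diff A x x = sa_scale A 0 x"
    and diff_swap: "\<lbrakk>x \<in> carrier A; y \<in> carrier A\<rbrakk> \<Longrightarrow> sa_diff A y x = sa_scale A (-1) (sa_diff A x y)"
    and diff_trans: "\<lbrakk>x \<in> carrier A; y \<in> carrier A; z \<in> carrier A\<rbrakk> \<Longrightarrow>
      sa_diff A x z = sa_add A (sa_diff A x y) (sa_diff A y z)"
    and diff_cancel: "\<lbrakk>x \<in> carrier A; y \<in> carrier A\<rbrakk> \<Longrightarrow> x = sa_add A (sa_diff A x y) y"
    and diff_add: "\<lbrakk>x \<in> carrier A; y \<in> carrier A; x' \<in> carrier A; y' \<in> carrier A\<rbrakk> \<Longrightarrow>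
      sa_diff A (sa_add A x y) (sa_add A x' y') = sa_add A (sa_diff A x x') (sa_diff A y y')"
    and diff_scale: "\<lbrakk>x \<in> carrier A; x' \<in> carrier A\<rbrakk> \<Longrightarrow>
      sa_diff A (sa_scale A c x) (sa_scale A c x') = sa_scale A c (sa_diff A x x')"
    and diff_mult: "\<lbrakk>x \<in> carrier A; y \<in> carrier A; x' \<in> carrier A; y' \<in> carrier A\<rbrakk> \<Longrightarrow>
      sa_diff A (sa_mult A x y) (sa_mult A x' y') =
        sa_add A (sa_mult A (sa_diff A x x') y) (sa_mult A x' (sa_diff A y y'))"
    and diff_star: "\<lbrakk>x \<in> carrier A; x' \<in> carrier A\<rbrakk> \<Longrightarrow>
      sa_diff A (sa_star A x) (sa_star A x') = sa_star A (sa_diff A x x')"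
    and seminorm: "cstar_seminorm A p"
begin

lemma p_nonneg: "x \<in> carrier A \<Longrightarrow> 0 \<le> p x"
  and p_star: "x \<in> carrier A \<Longrightarrow> p (sa_star A x) = p x"
  and p_scale: "x \<in> carrier A \<Longrightarrow> p (sa_scale A c x) = norm c * p x"
  and p_add: "\<lbrakk>x \<in> carrier A; y \<in> carrier A\<rbrakk> \<Longrightarrow> p (sa_add A x y) \<le> p x + p y"
  and p_mult: "\<lbrakk>x \<in> carrier A; y \<in> carrier A\<rbrakk> \<Longrightarrow> p (sa_mult A x y) \<le> p x * p y"
  using seminorm unfolding cstar_seminorm_def by blast+

lemma diff_closed: "\<lbrakk>x \<in> carrier A; y \<in> carrier A\<rbrakk> \<Longrightarrow> sa_diff A x y \<in> carrier A"
  by (simp add: sa_diff_def add_closed scale_closed)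

abbreviation pd where "pd x y \<equiv> p (sa_diff A x y)"

lemma pd_nonneg: "\<lbrakk>x \<in> carrier A; y \<in> carrier A\<rbrakk> \<Longrightarrow> 0 \<le> pd x y"
  by (simp add: p_nonneg diff_closed)

lemma pd_self: "x \<in> carrier A \<Longrightarrow> pd x x = 0"
  by (simp add: diff_self p_scale)

lemma pd_commute: "\<lbrakk>x \<in> carrier A; y \<in> carrier A\<rbrakk> \<Longrightarrow> pd y x = pd x y"
  using diff_swap[of x y] p_scale[OF diff_closed[of x y], of "-1"] by simp

lemma pd_triangle: "\<lbrakk>x \<in> carrier A; y \<in> carrier A; z \<in> carrier A\<rbrakk> \<Longrightarrow> pd x z \<le> pd x y + pd y z"
  using diff_trans[of x y z] p_add[OF diff_closed diff_closed, of x y y z] by simp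

lemma p_le_pd: "\<lbrakk>x \<in> carrier A; y \<in> carrier A\<rbrakk> \<Longrightarrow> p x \<le> pd x y + p y"
  using diff_cancel[of x y] p_add[OF diff_closed[of x y], of y] by simp

lemma pd_add: "\<lbrakk>x \<in> carrier A; y \<in> carrier A; x' \<in> carrier A; y' \<in> carrier A\<rbrakk> \<Longrightarrow>
    pd (sa_add A x y) (sa_add A x' y') \<le> pd x x' + pd y y'"
  by (simp add: diff_add p_add diff_closed)

lemma pd_scale: "\<lbrakk>x \<in> carrier A; x' \<in> carrier A\<rbrakk> \<Longrightarrow>
    pd (sa_scale A c x) (sa_scale A c x') = norm c * pd x x'"
  by (simp add: diff_scale p_scale diff_closed)

lemma pd_star: "\<lbrakk>x \<in> carrier A; x' \<in> carrier A\<rbrakk> \<Longrightarrow>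
    pd (sa_star A x) (sa_star A x') = pd x x'"
  by (simp add: diff_star p_star diff_closed)

text \<open>Since xy - x'y' = (x - x')y + x'(y - y'), only \<open>y\<close> and \<open>x'\<close>
  have to be bounded by \<open>M\<close>.\<close>

lemma pd_mult:
  assumes c: "x \<in> carrier A" "y \<in> carrier A" "x' \<in> carrier A" "y' \<in> carrier A"
    and M: "p x' \<le> M" "p y \<le> M"
  shows "pd (sa_mult A x y) (sa_mult A x' y') \<le> M * (pd x x' + pd y y')"
proof -
  have "pd (sa_mult A x y) (sa_mult A x' y') \<le>
      p (sa_mult A (sa_diff A x x') y) + p (sa_mult A x' (sa_diff A y y'))"
    using c by (simp add: diff_mult p_add mult_closed diff_closed)
  also have "\<dots> \<le> pd x x' * p y + p x' * pd y y'"
    using c by (intro add_mono p_mult diff_closed)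
  also have "\<dots> \<le> pd x x' * M + M * pd y y'"
    using c M by (intro add_mono mult_left_mono mult_right_mono pd_nonneg)
  finally show ?thesis by (simp add: algebra_simps)
qed

section \<open>Cauchy sequences and the operations on their classes\<close>

abbreviation C where "C \<equiv> cauchy_seqs A p"
abbreviation R where "R \<equiv> null_rel A p"

lemma C_carrier: "x \<in> C \<Longrightarrow> x n \<in> carrier A"
  by (simp add: cauchy_seqs_def)

lemma C_cauchy: "x \<in> C \<Longrightarrow> e > 0 \<Longrightarrow> \<exists>N. \<forall>m\<ge>N. \<forall>n\<ge>N. pd (x m) (x n) < e"
  by (simp add: cauchy_seqs_def)

lemma C_const: "a \<in> carrier A \<Longrightarrow> (\<lambda>_. a) \<in> C"
  by (simp add: cauchy_seqs_def pd_self)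

lemma C_bounded:
  assumes x: "x \<in> C"
  obtains M where "M > 0" "\<And>n. p (x n) \<le> M"
proof -
  obtain N where N: "\<And>m n. m \<ge> N \<Longrightarrow> n \<ge> N \<Longrightarrow> pd (x m) (x n) < 1"
    using C_cauchy[OF x, of 1] by auto
  \<comment> \<open>Beyond \<open>N\<close> the distance to \<open>x N\<close> is below 1, which the
    added 1 absorbs.\<close>
  define M where "M = Max ((\<lambda>n. p (x n)) ` {..N}) + 1"
  have M: "p (x n) \<le> M - 1" if "n \<le> N" for n
    using that unfolding M_def by (auto intro: Max_ge)
  have "p (x n) \<le> M" for n
  proof (cases "n \<le> N")
    case False
    then show ?thesis using N[of n N] p_le_pd[of "x n" "x N"] M[of N] C_carrier[OF x] by force
  qed (use M in force)
  moreover have "M > 0" using M[of N] p_nonneg[OF C_carrier[OF x], of N] by auto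
  ultimately show ?thesis using that by blast
qed

text \<open>One estimate serves all operations, here for the Cauchy property and in
  \<open>R_dominated\<close> for null differences. Unary operations are treated with two equal
  arguments.\<close>

lemma C_dominated:
  assumes x: "x \<in> C" and y: "y \<in> C" and z: "\<And>n. z n \<in> carrier A"
    and M: "M > 0" "\<And>m n. pd (z m) (z n) \<le> M * (pd (x m) (x n) + pd (y m) (y n))"
  shows "z \<in> C"
  unfolding cauchy_seqs_def mem_Collect_eq
proof (intro conjI allI impI z)
  fix e :: real assume e: "e > 0"
  then have e': "e / (2 * M) > 0" using M(1) by simp
  obtain N1 where N1: "\<And>m n. m \<ge> N1 \<Longrightarrow> n \<ge> N1 \<Longrightarrow> pd (x m) (x n) < e / (2 * M)"
    using C_cauchy[OF x e'] by auto
  obtain N2 where N2: "\<And>m n. m \<ge> N2 \<Longrightarrow> n \<ge> N2 \<Longrightarrow> pd (y m) (y n) < e / (2 * M)"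
    using C_cauchy[OF y e'] by auto
  have "pd (z m) (z n) < e" if "m \<ge> max N1 N2" "n \<ge> max N1 N2" for m n
  proof -
    have "pd (x m) (x n) + pd (y m) (y n) < e / M"
      using N1[of m n] N2[of m n] that by (simp add: field_simps)
    then have "M * (pd (x m) (x n) + pd (y m) (y n)) < e"
      using M(1) by (simp add: pos_less_divide_eq mult.commute)
    then show ?thesis using M(2)[of m n] by simp
  qed
  then show "\<exists>N. \<forall>m\<ge>N. \<forall>n\<ge>N. pd (z m) (z n) < e" by blast
qed

lemma R_dominated:
  assumes x: "(x, x') \<in> R" and y: "(y, y') \<in> R" and z: "z \<in> C" "z' \<in> C"
    and M: "\<And>n. pd (z n) (z' n) \<le> M * (pd (x n) (x' n) + pd (y n) (y' n))"
  shows "(z, z') \<in> R"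
proof -
  have "(\<lambda>n. M * (pd (x n) (x' n) + pd (y n) (y' n))) \<longlonglongrightarrow> M * (0 + 0)"
    using x y unfolding null_rel_def by (intro tendsto_intros) auto
  then have "(\<lambda>n. M * (pd (x n) (x' n) + pd (y n) (y' n))) \<longlonglongrightarrow> 0" by simp
  then have "(\<lambda>n. pd (z n) (z' n)) \<longlonglongrightarrow> 0"
    by (rule tendsto_sandwich[OF _ _ tendsto_const, rotated 2])
      (use M pd_nonneg[OF C_carrier[OF z(1)] C_carrier[OF z(2)]] in \<open>simp_all add: always_eventually\<close>)
  then show ?thesis using z by (simp add: null_rel_def)
qed

lemma R_refl: "x \<in> C \<Longrightarrow> (x, x) \<in> R"
  by (simp add: null_rel_def pd_self C_carrier)

lemma R_C: "(x, y) \<in> R \<Longrightarrow> x \<in> C" "(x, y) \<in> R \<Longrightarrow> y \<in> C"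
  by (simp_all add: null_rel_def)

lemma equiv_R: "equiv C R"
proof (rule equivI)
  show "R \<subseteq> C \<times> C" by (auto simp: null_rel_def)
  show "refl_on C R" by (auto simp: refl_on_def R_refl dest: R_C)
  show "sym R"
  proof (rule symI)
    fix x y assume r: "(x, y) \<in> R"
    have "pd (x n) (y n) = pd (y n) (x n)" for n
      by (intro pd_commute C_carrier R_C[OF r])
    then show "(y, x) \<in> R" using r by (simp add: null_rel_def)
  qed
  show "trans R"
  proof (rule transI)
    fix x y z assume r: "(x, y) \<in> R" "(y, z) \<in> R"
    show "(x, z) \<in> R"
      by (rule R_dominated[OF r R_C(1)[OF r(1)] R_C(2)[OF r(2)], of 1])
        (simp add: pd_triangle C_carrier R_C(1)[OF r(1)] R_C[OF r(2)])
  qed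
qed

lemma C_add: "\<lbrakk>x \<in> C; y \<in> C\<rbrakk> \<Longrightarrow> (\<lambda>n. sa_add A (x n) (y n)) \<in> C"
  by (rule C_dominated[of x y _ 1]) (simp_all add: add_closed C_carrier pd_add)

lemma C_scale: "x \<in> C \<Longrightarrow> (\<lambda>n. sa_scale A c (x n)) \<in> C"
  \<comment> \<open>The added 1 keeps the constant positive when \<open>c\<close> is 0.\<close>
  by (rule C_dominated[of x x _ "norm c + 1"])
    (simp_all add: scale_closed C_carrier pd_scale mult_mono pd_nonneg add_pos_nonneg add.commute)

lemma C_star: "x \<in> C \<Longrightarrow> (\<lambda>n. sa_star A (x n)) \<in> C"
  by (rule C_dominated[of x x _ 1]) (simp_all add: star_closed C_carrier pd_star pd_nonneg)

lemma C_mult: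
  assumes x: "x \<in> C" and y: "y \<in> C" shows "(\<lambda>n. sa_mult A (x n) (y n)) \<in> C"
proof -
  obtain M where M: "M > 0" "\<And>n. p (x n) \<le> M" using C_bounded[OF x] by metis
  obtain M' where M': "M' > 0" "\<And>n. p (y n) \<le> M'" using C_bounded[OF y] by metis
  show ?thesis
    by (rule C_dominated[OF x y, of _ "max M M'"])
      (simp_all add: mult_closed C_carrier[OF x] C_carrier[OF y] pd_mult M M' le_max_iff_disj less_max_iff_disj)
qed

lemma congruent_scale: "congruent R (\<lambda>x. R `` {\<lambda>n. sa_scale A c (x n)})"
proof (rule congruentI)
  fix x x' assume r: "(x, x') \<in> R"
  note c = R_C[OF r]
  have "((\<lambda>n. sa_scale A c (x n)), (\<lambda>n. sa_scale A c (x' n))) \<in> R"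
    by (rule R_dominated[OF r r C_scale[OF c(1)] C_scale[OF c(2)], where M = "norm c"])
      (simp add: pd_scale C_carrier c pd_nonneg mult_left_mono)
  then show "R `` {\<lambda>n. sa_scale A c (x n)} = R `` {\<lambda>n. sa_scale A c (x' n)}"
    by (rule equiv_class_eq[OF equiv_R])
qed

lemma congruent_star: "congruent R (\<lambda>x. R `` {\<lambda>n. sa_star A (x n)})"
proof (rule congruentI)
  fix x x' assume r: "(x, x') \<in> R"
  note c = R_C[OF r]
  have "((\<lambda>n. sa_star A (x n)), (\<lambda>n. sa_star A (x' n))) \<in> R"
    by (rule R_dominated[OF r r C_star[OF c(1)] C_star[OF c(2)], of 1])
      (simp add: pd_star C_carrier c pd_nonneg)
  then show "R `` {\<lambda>n. sa_star A (x n)} = R `` {\<lambda>n. sa_star A (x' n)}"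
    by (rule equiv_class_eq[OF equiv_R])
qed

lemma congruent_add: "congruent2 R R (\<lambda>x y. R `` {\<lambda>n. sa_add A (x n) (y n)})"
proof (rule congruent2I')
  fix x x' y y' assume r: "(x, x') \<in> R" "(y, y') \<in> R"
  note c = R_C[OF r(1)] R_C[OF r(2)]
  have "((\<lambda>n. sa_add A (x n) (y n)), (\<lambda>n. sa_add A (x' n) (y' n))) \<in> R"
    by (rule R_dominated[OF r C_add[OF c(1,3)] C_add[OF c(2,4)], of 1])
      (simp add: pd_add C_carrier c)
  then show "R `` {\<lambda>n. sa_add A (x n) (y n)} = R `` {\<lambda>n. sa_add A (x' n) (y' n)}"
    by (rule equiv_class_eq[OF equiv_R])
qed

lemma congruent_mult: "congruent2 R R (\<lambda>x y. R `` {\<lambda>n. sa_mult A (x n) (y n)})"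
proof (rule congruent2I')
  fix x x' y y' assume r: "(x, x') \<in> R" "(y, y') \<in> R"
  note c = R_C[OF r(1)] R_C[OF r(2)]
  obtain M where M: "M > 0" "\<And>n. p (x' n) \<le> M" using C_bounded[OF c(2)] by metis
  obtain M' where M': "M' > 0" "\<And>n. p (y n) \<le> M'" using C_bounded[OF c(3)] by metis
  have "((\<lambda>n. sa_mult A (x n) (y n)), (\<lambda>n. sa_mult A (x' n) (y' n))) \<in> R"
    by (rule R_dominated[OF r C_mult[OF c(1,3)] C_mult[OF c(2,4)], of "max M M'"])
      (simp add: pd_mult C_carrier c M M' le_max_iff_disj)
  then show "R `` {\<lambda>n. sa_mult A (x n) (y n)} = R `` {\<lambda>n. sa_mult A (x' n) (y' n)}"
    by (rule equiv_class_eq[OF equiv_R])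
qed

abbreviation cp where "cp \<equiv> sa_completion A p"

lemma cp_carrier: "carrier cp = C // R"
  by (simp add: sa_completion_def)

lemma cp_add: "\<lbrakk>x \<in> C; y \<in> C\<rbrakk> \<Longrightarrow> sa_add cp (R `` {x}) (R `` {y}) = R `` {\<lambda>n. sa_add A (x n) (y n)}"
  by (simp add: sa_completion_def UN_equiv_class2[OF equiv_R equiv_R congruent_add])

lemma cp_mult: "\<lbrakk>x \<in> C; y \<in> C\<rbrakk> \<Longrightarrow> sa_mult cp (R `` {x}) (R `` {y}) = R `` {\<lambda>n. sa_mult A (x n) (y n)}"
  by (simp add: sa_completion_def UN_equiv_class2[OF equiv_R equiv_R congruent_mult])

lemma cp_scale: "x \<in> C \<Longrightarrow> sa_scale cp c (R `` {x}) = R `` {\<lambda>n. sa_scale A c (x n)}"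
  by (simp add: sa_completion_def UN_equiv_class[OF equiv_R congruent_scale])

lemma cp_star: "x \<in> C \<Longrightarrow> sa_star cp (R `` {x}) = R `` {\<lambda>n. sa_star A (x n)}"
  by (simp add: sa_completion_def UN_equiv_class[OF equiv_R congruent_star])

lemma cp_diff: "\<lbrakk>x \<in> C; y \<in> C\<rbrakk> \<Longrightarrow> sa_diff cp (R `` {x}) (R `` {y}) = R `` {\<lambda>n. sa_diff A (x n) (y n)}"
  by (simp add: sa_diff_def cp_scale cp_add C_scale)

lemma C_diff: "\<lbrakk>x \<in> C; y \<in> C\<rbrakk> \<Longrightarrow> (\<lambda>n. sa_diff A (x n) (y n)) \<in> C"
  by (simp add: sa_diff_def C_scale C_add)

text \<open>The norm is the limit along a representative \<open>y\<close> picked by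
  \<open>SOME\<close>, not along \<open>x\<close>. The limit exists because \<open>p\<close> changes
  along \<open>y\<close> by at most the distance, and the two representatives differ by a null
  sequence.\<close>

lemma cp_norm_le:
  assumes x: "x \<in> C" and N: "\<And>n. n \<ge> N \<Longrightarrow> p (x n) \<le> e"
  shows "sa_norm cp (R `` {x}) \<le> e"
proof -
  define y where "y = (SOME y. y \<in> R `` {x})"
  have "y \<in> R `` {x}" unfolding y_def by (rule someI[of _ x]) (simp add: R_refl[OF x])
  then have r: "(x, y) \<in> R" by simp
  then have y: "y \<in> C" by (rule R_C)
  have le: "\<bar>p (y m) - p (y n)\<bar> \<le> pd (y m) (y n)" for m n
    using p_le_pd[of "y m" "y n"] p_le_pd[of "y n" "y m"] pd_commute[of "y m" "y n"] C_carrier[OF y]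
    by fastforce
  have "Cauchy (\<lambda>n. p (y n))"
    unfolding Cauchy_def dist_real_def using C_cauchy[OF y] le by (meson order_le_less_trans)
  then have lim: "(\<lambda>n. p (y n)) \<longlonglongrightarrow> lim (\<lambda>n. p (y n))"
    by (simp add: Cauchy_convergent_iff convergent_LIMSEQ_iff)
  have "(\<lambda>n. e + pd (x n) (y n)) \<longlonglongrightarrow> e + 0"
    using r unfolding null_rel_def by (intro tendsto_intros) auto
  moreover have "p (y n) \<le> e + pd (x n) (y n)" if "n \<ge> N" for n
    using N[OF that] p_le_pd[of "y n" "x n"] pd_commute[of "x n" "y n"] C_carrier[OF x] C_carrier[OF y]
    by fastforce
  ultimately have "lim (\<lambda>n. p (y n)) \<le> e + 0"
    by (intro LIMSEQ_le[OF lim]) auto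
  then show ?thesis by (simp add: sa_completion_def y_def)
qed

section \<open>The canonical map into the completion\<close>

abbreviation emb where "emb \<equiv> sa_embed A p"

lemma emb_carrier: "a \<in> carrier A \<Longrightarrow> emb a \<in> carrier cp"
  by (simp add: cp_carrier sa_embed_def quotientI C_const)

lemma emb_add: "\<lbrakk>a \<in> carrier A; b \<in> carrier A\<rbrakk> \<Longrightarrow> emb (sa_add A a b) = sa_add cp (emb a) (emb b)"
  by (simp add: sa_embed_def cp_add C_const)

lemma emb_mult: "\<lbrakk>a \<in> carrier A; b \<in> carrier A\<rbrakk> \<Longrightarrow> emb (sa_mult A a b) = sa_mult cp (emb a) (emb b)"
  by (simp add: sa_embed_def cp_mult C_const)

lemma emb_scale: "a \<in> carrier A \<Longrightarrow> emb (sa_scale A c a) = sa_scale cp c (emb a)"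
  by (simp add: sa_embed_def cp_scale C_const)

lemma emb_star: "a \<in> carrier A \<Longrightarrow> emb (sa_star A a) = sa_star cp (emb a)"
  by (simp add: sa_embed_def cp_star C_const)

lemma emb_zero: "emb (sa_zero A) = sa_zero cp"
  by (simp add: sa_completion_def)

lemma cstar_subalgebra_carrier: "cstar_subalgebra cp (carrier cp)"
  unfolding cstar_subalgebra_def
proof (intro conjI ballI allI impI subset_refl)
  show "sa_zero cp \<in> carrier cp" using emb_carrier[OF zero_closed] by (simp add: emb_zero)
  fix X assume "X \<in> carrier cp"
  then obtain x where x: "x \<in> C" "X = R `` {x}" by (auto simp: cp_carrier elim: quotientE)
  show "sa_star cp X \<in> carrier cp" using x by (simp add: cp_star cp_carrier quotientI C_star)
  show "sa_scale cp c X \<in> carrier cp" for c using x by (simp add: cp_scale cp_carrier quotientI C_scale)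
  fix Y assume "Y \<in> carrier cp"
  then obtain y where y: "y \<in> C" "Y = R `` {y}" by (auto simp: cp_carrier elim: quotientE)
  show "sa_add cp X Y \<in> carrier cp" using x y by (simp add: cp_add cp_carrier quotientI C_add)
  show "sa_mult cp X Y \<in> carrier cp" using x y by (simp add: cp_mult cp_carrier quotientI C_mult)
qed

lemma emb_closed:
  assumes S: "cstar_subalgebra cp S" and a: "a \<in> carrier A"
    and b: "\<And>e. e > 0 \<Longrightarrow> \<exists>b\<in>carrier A. emb b \<in> S \<and> pd a b \<le> e"
  shows "emb a \<in> S"
proof -
  have "\<exists>Y\<in>S. sa_norm cp (sa_diff cp (emb a) Y) < e" if e: "e > 0" for e
  proof -
    \<comment> \<open>Halving \<open>e\<close> turns the weak estimate into the strict one that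
      closedness of \<open>S\<close> asks for.\<close>
    obtain b where b: "b \<in> carrier A" "emb b \<in> S" "pd a b \<le> e / 2" using b[of "e / 2"] e by auto
    have "sa_norm cp (sa_diff cp (emb a) (emb b)) \<le> e / 2"
      using cp_norm_le[OF C_diff[OF C_const[OF a] C_const[OF b(1)]], of 0 "e / 2"] b(3)
      by (simp add: sa_embed_def cp_diff[OF C_const[OF a] C_const[OF b(1)]])
    then show ?thesis using b(2) e by force
  qed
  then show ?thesis using S emb_carrier[OF a] unfolding cstar_subalgebra_def by blast
qed

text \<open>A Cauchy sequence is approximated by the constant sequence of one of its late
  terms.\<close>

lemma emb_dense:
  assumes S: "cstar_subalgebra cp S" and emb: "\<And>a. a \<in> carrier A \<Longrightarrow> emb a \<in> S"
  shows "carrier cp \<subseteq> S"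
proof
  fix X assume X: "X \<in> carrier cp"
  then obtain x where x: "x \<in> C" "X = R `` {x}" by (auto simp: cp_carrier elim: quotientE)
  have "\<exists>Y\<in>S. sa_norm cp (sa_diff cp X Y) < e" if e: "e > 0" for e
  proof -
    obtain N where N: "\<And>m n. m \<ge> N \<Longrightarrow> n \<ge> N \<Longrightarrow> pd (x m) (x n) < e / 2"
      using C_cauchy[OF x(1), of "e / 2"] e by auto
    have c: "(\<lambda>_. x N) \<in> C" by (intro C_const C_carrier x)
    have "sa_norm cp (sa_diff cp X (emb (x N))) \<le> e / 2"
      unfolding x(2) sa_embed_def cp_diff[OF x(1) c]
      by (rule cp_norm_le[OF C_diff[OF x(1) c], of N]) (use N[of _ N] in force)
    then show ?thesis using emb[OF C_carrier[OF x(1), of N]] e by force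
  qed
  then show "X \<in> S" using S X unfolding cstar_subalgebra_def by blast
qed

text \<open>The whole carrier is one of the subalgebras that are intersected, and every other one
  contains the dense image of the algebra.\<close>

lemma cstar_generated_eq_carrier:
  assumes T: "T \<subseteq> carrier cp"
    and emb: "\<And>S a. \<lbrakk>cstar_subalgebra cp S; T \<subseteq> S; a \<in> carrier A\<rbrakk> \<Longrightarrow> emb a \<in> S"
  shows "carrier cp = cstar_generated cp T"
  unfolding cstar_generated_def
  using cstar_subalgebra_carrier T emb_dense[OF _ emb] by blast

end

section \<open>Elements with a single coefficient\<close>

context partial_dynamical_system
begin

lemma fdelta_closed:
  assumes t: "t \<in> carrier G" and f: "f \<in> C0 X (U t)" shows "fdelta t f \<in> carrier alg"
  by (rule alg_carrierI[of "{t}"]) (use t f in \<open>auto simp: fdelta_def C0_zero\<close>)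

lemma fdelta_mult:
  assumes s: "s \<in> carrier G" and f: "f \<in> C0 X (U s)" and t: "t \<in> carrier G" and g: "g \<in> C0 X (U t)"
  shows "sa_mult alg (fdelta s f) (fdelta t g) = fdelta (s \<otimes> t) (\<lambda>x. f x * g (\<phi> (inv s) x))"
proof (intro ext)
  fix r x
  note c = fdelta_closed[OF s f] fdelta_closed[OF t g]
  show "sa_mult alg (fdelta s f) (fdelta t g) r x = fdelta (s \<otimes> t) (\<lambda>x. f x * g (\<phi> (inv s) x)) r x"
  proof (cases "r \<in> carrier G")
    case r: True
    have "sa_mult alg (fdelta s f) (fdelta t g) r x =
        (\<Sum>q\<in>{s}. fdelta s f q x * fdelta t g (inv q \<otimes> r) (\<phi> (inv q) x))"
      by (rule alg_mult[OF c r]) (use s in \<open>auto simp: fdelta_def\<close>)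
    moreover have "inv s \<otimes> r = t \<longleftrightarrow> r = s \<otimes> t"
      using inv_solve_left'[of t s r] s t r by simp
    ultimately show ?thesis by (simp add: fdelta_def)
  next
    case False
    then show ?thesis using alg_mult_outside[OF c False] s t by (auto simp: fdelta_def)
  qed
qed

lemma fdelta_star:
  assumes t: "t \<in> carrier G"
  shows "sa_star alg (fdelta t f) = fdelta (inv t) (\<lambda>x. if x \<in> U (inv t) then cnj (f (\<phi> t x)) else 0)"
proof (intro ext)
  fix r x
  show "sa_star alg (fdelta t f) r x = fdelta (inv t) (\<lambda>x. if x \<in> U (inv t) then cnj (f (\<phi> t x)) else 0) r x"
  proof (cases "r \<in> carrier G")
    case r: True
    then have "inv r = t \<longleftrightarrow> r = inv t" using t inv_inv by metis
    then show ?thesis using t by (simp add: alg_star(1)[OF r] fdelta_def)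
  next
    case False
    then show ?thesis using t by (auto simp: alg_star(2) fdelta_def)
  qed
qed

lemma fdelta_add: "(\<lambda>s x. fdelta t f s x + fdelta t g s x) = fdelta t (\<lambda>x. f x + g x)"
  and fdelta_scale: "(\<lambda>s x. c * fdelta t f s x) = fdelta t (\<lambda>x. c * f x)"
  and fdelta_diff: "(\<lambda>s x. fdelta t f s x - fdelta t g s x) = fdelta t (\<lambda>x. f x - g x)"
  by (auto simp: fdelta_def fun_eq_iff)

lemma fdelta_one_mult:
  assumes f: "f \<in> C0 X (U \<one>)" and g: "g \<in> C0 X (U \<one>)"
  shows "sa_mult alg (fdelta \<one> f) (fdelta \<one> g) = fdelta \<one> (\<lambda>x. f x * g x)"
proof -
  \<comment> \<open>\<open>\<phi> \<one>\<close> is the identity only on the space itself; at all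
    other points \<open>f\<close> vanishes.\<close>
  have "f x * g (\<phi> \<one> x) = f x * g x" for x
    using map_one[of x] C0_outside[OF f, of x] by (cases "x \<in> U \<one>") (simp_all add: domain_one)
  then have "(\<lambda>x. f x * g (\<phi> \<one> x)) = (\<lambda>x. f x * g x)" by (rule ext)
  then show ?thesis using fdelta_mult[OF one_closed f one_closed g] by simp
qed

lemma fdelta_one_star:
  assumes f: "f \<in> C0 X (U \<one>)"
  shows "sa_star alg (fdelta \<one> f) = fdelta \<one> (\<lambda>x. cnj (f x))"
proof -
  have "(if x \<in> U \<one> then cnj (f (\<phi> \<one> x)) else 0) = cnj (f x)" for x
    using map_one[of x] C0_outside[OF f, of x] by (simp add: domain_one)
  then show ?thesis using fdelta_star[OF one_closed, of f] by simp
qed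

lemma alg_induct [consumes 1, case_names zero delta add]:
  assumes a: "a \<in> carrier alg"
    and zero: "P (\<lambda>_ _. 0)"
    and delta: "\<And>t f. \<lbrakk>t \<in> carrier G; f \<in> C0 X (U t)\<rbrakk> \<Longrightarrow> P (fdelta t f)"
    and add: "\<And>a b. \<lbrakk>a \<in> carrier alg; b \<in> carrier alg; P a; P b\<rbrakk> \<Longrightarrow> P (\<lambda>t x. a t x + b t x)"
  shows "P a"
proof -
  \<comment> \<open>The support need only lie in \<open>T\<close>, so that a point can be removed
    from \<open>T\<close> whether or not it belongs to the support or to the group.\<close>
  have "P a" if "finite T" "a \<in> carrier alg" "{t. a t \<noteq> (\<lambda>_. 0)} \<subseteq> T" for T a
    using that
  proof (induction T arbitrary: a rule: finite_induct)
    case empty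
    then have "a = (\<lambda>_ _. 0)" by auto
    then show ?case using zero by simp
  next
    case (insert t T)
    show ?case
    proof (cases "t \<in> carrier G")
      case True
      define b where "b = a(t := (\<lambda>_. 0))"
      have f: "a t \<in> C0 X (U t)" using alg_C0[OF insert.prems(1) True] .
      have b: "b \<in> carrier alg"
      proof (rule alg_carrierI[OF alg_finite_support[OF insert.prems(1)]])
        show "b s = (\<lambda>_. 0)" if "s \<notin> {t. a t \<noteq> (\<lambda>_. 0)}" for s using that by (simp add: b_def)
        show "b s \<in> C0 X (U s)" if "s \<in> carrier G" for s
          using alg_C0[OF insert.prems(1) that] by (simp add: b_def C0_zero)
        show "b s = (\<lambda>_. 0)" if "s \<notin> carrier G" for s
          using alg_outside[OF insert.prems(1) that] by (simp add: b_def)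
      qed
      have "{s. b s \<noteq> (\<lambda>_. 0)} \<subseteq> T" using insert.prems(2) by (auto simp: b_def)
      then have "P b" by (rule insert.IH[OF b])
      moreover have "a = (\<lambda>s x. fdelta t (a t) s x + b s x)" by (auto simp: fdelta_def b_def fun_eq_iff)
      ultimately show ?thesis using add[OF fdelta_closed[OF True f] b delta[OF True f]] by simp
    next
      case False
      then have "{t. a t \<noteq> (\<lambda>_. 0)} \<subseteq> T" using alg_support[OF insert.prems(1)] insert.prems(2) by auto
      then show ?thesis by (rule insert.IH[OF insert.prems(1)])
    qed
  qed
  then show ?thesis using alg_finite_support[OF a] a by blast
qed

subsection \<open>The universal norm\<close>

context
  fixes p assumes p: "cstar_seminorm alg p"
begin

lemma seminorm_nonneg: "a \<in> carrier alg \<Longrightarrow> 0 \<le> p a"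
  and seminorm_cstar: "a \<in> carrier alg \<Longrightarrow> p (sa_mult alg (sa_star alg a) a) = (p a)\<^sup>2"
  and seminorm_scale: "a \<in> carrier alg \<Longrightarrow> p (\<lambda>t x. c * a t x) = norm c * p a"
  and seminorm_add: "\<lbrakk>a \<in> carrier alg; b \<in> carrier alg\<rbrakk> \<Longrightarrow> p (\<lambda>t x. a t x + b t x) \<le> p a + p b"
  using p unfolding cstar_seminorm_def by simp_all

lemma seminorm_one_square:
  assumes f: "f \<in> C0 X (U \<one>)"
  shows "p (fdelta \<one> (\<lambda>x. cnj (f x) * f x)) = (p (fdelta \<one> f))\<^sup>2"
  using seminorm_cstar[OF fdelta_closed[OF one_closed f]]
    fdelta_one_mult[OF C0_cnj[OF Hausdorff open_domain[OF one_closed] f] f] fdelta_one_star[OF f]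
  by simp

text \<open>A real function bounded by \<open>M\<close> is \<open>M (w + cnj w) / 2\<close> for a unimodular \<open>w\<close>, and multiplication
  by \<open>w\<close> does not change the seminorm. Hence \<open>p (f\<^sup>2) \<le> M p f\<close>, whereas \<open>p (f\<^sup>2) = (p f)\<^sup>2\<close>.\<close>

lemma seminorm_one_le:
  assumes f: "f \<in> C0 X (U \<one>)" and h: "\<And>x. f x = of_real (h x)" and M: "M > 0" "\<And>x. \<bar>h x\<bar> \<le> M"
  shows "p (fdelta \<one> f) \<le> M"
proof -
  note H = Hausdorff open_domain[OF one_closed]
  define F :: "complex \<Rightarrow> complex"
    where "F z = of_real (Re z / M) + \<i> * of_real (sqrt (1 - (Re z / M)\<^sup>2))" for z
  define w where "w x = F (f x)" for x
  have fc: "continuous_map X euclidean f" using f by (simp add: C0_iff'[OF one_closed])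
  \<comment> \<open>The real \<open>sqrt\<close> is continuous on the whole line, so no restriction
    on the argument is necessary here. The bound on \<open>h\<close> enters only when
    \<open>w\<close> is shown to be unimodular.\<close>
  have "continuous_on UNIV F" unfolding F_def by (intro continuous_intros) (use M in auto)
  then have wc: "continuous_map X euclidean w"
    unfolding w_def using continuous_map_compose_continuous_on[OF fc] by blast
  have "continuous_on UNIV (\<lambda>z. cnj (F z))"
    using \<open>continuous_on UNIV F\<close> by (intro continuous_intros)
  then have wc': "continuous_map X euclidean (\<lambda>x. cnj (w x))"
    unfolding w_def using continuous_map_compose_continuous_on[OF fc] by blast
  have sq: "(h x / M)\<^sup>2 \<le> 1" for x
    using M by (simp add: abs_le_square_iff[of "h x / M" 1, simplified, symmetric])
  have wcnj: "cnj (w x) * w x = 1" for x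
    using sq[of x] by (simp add: w_def F_def h complex_eq_iff flip: power2_eq_square)
  have wn: "norm (w x) \<le> 1" "norm (cnj (w x)) \<le> 1" for x
  proof -
    have "norm (w x) * norm (w x) = 1" using arg_cong[OF wcnj[of x], of norm] by (simp add: norm_mult)
    then have "norm (w x) = 1" by (metis norm_ge_zero power2_eq_square power2_eq_imp_eq one_power2 zero_le_one)
    then show "norm (w x) \<le> 1" "norm (cnj (w x)) \<le> 1" by simp_all
  qed
  \<comment> \<open>A unimodular factor leaves \<open>cnj (f x) * f x\<close> unchanged, and by the
    C*-identity this function determines the seminorm.\<close>
  have unit: "(\<lambda>x. f x * u x) \<in> C0 X (U \<one>)" "p (fdelta \<one> (\<lambda>x. f x * u x)) = p (fdelta \<one> f)"
    if u: "continuous_map X euclidean u" "\<And>x. norm (u x) \<le> 1" "\<And>x. cnj (u x) * u x = 1" for u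
  proof -
    show c: "(\<lambda>x. f x * u x) \<in> C0 X (U \<one>)" by (rule C0_mult_bounded[OF H f u(1,2)])
    have "cnj (f x * u x) * (f x * u x) = cnj (f x) * f x" for x
      using u(3)[of x] by (simp add: algebra_simps)
    then have "(\<lambda>x. cnj (f x * u x) * (f x * u x)) = (\<lambda>x. cnj (f x) * f x)" by (rule ext)
    then have "(p (fdelta \<one> (\<lambda>x. f x * u x)))\<^sup>2 = (p (fdelta \<one> f))\<^sup>2"
      using seminorm_one_square[OF c] seminorm_one_square[OF f] by (simp only:)
    then show "p (fdelta \<one> (\<lambda>x. f x * u x)) = p (fdelta \<one> f)"
      using seminorm_nonneg[OF fdelta_closed[OF one_closed c]]
        seminorm_nonneg[OF fdelta_closed[OF one_closed f]] by (metis power2_eq_imp_eq)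
  qed
  have wcnj': "cnj (cnj (w x)) * cnj (w x) = 1" for x using wcnj[of x] by (simp add: mult.commute)
  note u = unit[OF wc wn(1) wcnj] unit[OF wc' wn(2) wcnj']
  \<comment> \<open>The real part of \<open>w x\<close> is \<open>h x / M\<close>, so
    \<open>w x + cnj (w x)\<close> equals \<open>2 * h x / M\<close>, while both sides amount to the
    square of the real number \<open>h x\<close>.\<close>
  have "cnj (f x) * f x = of_real (M / 2) * (f x * w x + f x * cnj (w x))" for x
    using M(1) by (simp add: w_def F_def h complex_eq_iff)
  then have "(\<lambda>x. cnj (f x) * f x) = (\<lambda>x. of_real (M / 2) * (f x * w x + f x * cnj (w x)))" by (rule ext)
  then have e1: "p (fdelta \<one> (\<lambda>x. of_real (M / 2) * (f x * w x + f x * cnj (w x)))) = (p (fdelta \<one> f))\<^sup>2"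
    using seminorm_one_square[OF f] by (simp only:)
  have e2: "p (fdelta \<one> (\<lambda>x. of_real (M / 2) * (f x * w x + f x * cnj (w x)))) =
      M / 2 * p (fdelta \<one> (\<lambda>x. f x * w x + f x * cnj (w x)))"
    using seminorm_scale[OF fdelta_closed[OF one_closed C0_add[OF H u(1) u(3)]], of "of_real (M / 2)"] M(1)
    unfolding fdelta_scale by (simp del: times_divide_eq_left of_real_divide)
  have "p (fdelta \<one> (\<lambda>x. f x * w x + f x * cnj (w x))) \<le> p (fdelta \<one> f) + p (fdelta \<one> f)"
    using seminorm_add[OF fdelta_closed[OF one_closed u(1)] fdelta_closed[OF one_closed u(3)]]
    unfolding fdelta_add u(2) u(4) .
  then have "M / 2 * p (fdelta \<one> (\<lambda>x. f x * w x + f x * cnj (w x))) \<le>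
      M / 2 * (p (fdelta \<one> f) + p (fdelta \<one> f))"
    by (rule mult_left_mono) (use M(1) in simp)
  then have "(p (fdelta \<one> f))\<^sup>2 \<le> M / 2 * (p (fdelta \<one> f) + p (fdelta \<one> f))"
    unfolding e2[symmetric] e1 .
  then have "p (fdelta \<one> f) * p (fdelta \<one> f) \<le> M * p (fdelta \<one> f)" by (simp add: power2_eq_square)
  then show ?thesis
    using M(1) seminorm_nonneg[OF fdelta_closed[OF one_closed f]]
    by (cases "p (fdelta \<one> f) = 0") auto
qed

text \<open>For a = f \<delta>_t the product a* a sits at the identity with the real coefficient
  |f(\<phi>_t x)|^2, which is bounded by \<open>M\<^sup>2\<close>. The C*-identity thus reduces the
  claim to \<open>seminorm_one_le\<close>.\<close>

lemma seminorm_fdelta_le: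
  assumes t: "t \<in> carrier G" and f: "f \<in> C0 X (U t)" and M: "M > 0" "\<And>x. norm (f x) \<le> M"
  shows "p (fdelta t f) \<le> M"
proof -
  note c = fdelta_closed[OF t f]
  have t': "inv t \<in> carrier G" using t by simp
  define g where "g = (\<lambda>x. if x \<in> U (inv t) then cnj (f (\<phi> t x)) else 0)"
  define k where "k = (\<lambda>x. g x * f (\<phi> (inv (inv t)) x))"
  have "(\<lambda>x. cnj (f x)) \<in> C0 X (U (inv (inv t)))"
    using t f C0_cnj[OF Hausdorff open_domain[OF t] f] by simp
  from C0_transport[OF t' this] have g: "g \<in> C0 X (U (inv t))" unfolding g_def inv_inv[OF t] .
  have "k \<in> C0 X (U (inv t \<otimes> t))" unfolding k_def by (rule C0_mult_pullback[OF t' t g f])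
  then have k: "k \<in> C0 X (U \<one>)" using t by simp
  have e: "sa_mult alg (sa_star alg (fdelta t f)) (fdelta t f) = fdelta \<one> k"
    unfolding fdelta_star[OF t] g_def[symmetric] fdelta_mult[OF t' g t f] k_def[symmetric] l_inv[OF t] ..
  define h where "h x = (if x \<in> U (inv t) then (norm (f (\<phi> t x)))\<^sup>2 else 0)" for x
  have "k x = of_real (h x)" for x
    using t by (simp add: k_def g_def h_def mult.commute complex_norm_square del: of_real_power)
  moreover have "\<bar>h x\<bar> \<le> M\<^sup>2" for x using M(2)[of "\<phi> t x"] by (simp add: h_def power_mono)
  ultimately have "p (fdelta \<one> k) \<le> M\<^sup>2"
    using M(1) by (intro seminorm_one_le[OF k, of h]) auto
  also have "p (fdelta \<one> k) = (p (fdelta t f))\<^sup>2"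
    using seminorm_cstar[OF c] unfolding e .
  finally show ?thesis by (rule power2_le_imp_le) (use M(1) in simp)
qed

end

abbreviation unorm where "unorm \<equiv> universal_norm alg"

text \<open>It makes the set of values under the supremum non-empty and, through
  \<open>seminorm_le_unorm\<close>, shows the universal norm to be nonnegative.\<close>

lemma zero_seminorm: "cstar_seminorm alg (\<lambda>_. 0)"
  by (simp add: cstar_seminorm_def)

text \<open>The bound is independent of the seminorm, so the supremum defining the universal norm is
  finite at every element.\<close>

lemma seminorms_bounded: "a \<in> carrier alg \<Longrightarrow> \<exists>B. \<forall>p. cstar_seminorm alg p \<longrightarrow> p a \<le> B"
proof (induction rule: alg_induct)
  case zero
  have "p (\<lambda>_ _. 0) \<le> 0" if "cstar_seminorm alg p" for p
    using seminorm_scale[OF that alg_zero_closed, of 0] by simp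
  then show ?case by blast
next
  case (delta t f)
  obtain M where "M > 0" "\<And>x. norm (f x) \<le> M" using C0_bounded[OF Hausdorff open_domain[OF delta(1)] delta(2)] by metis
  then show ?case using seminorm_fdelta_le[OF _ delta] by blast
next
  case (add a b)
  then obtain B B' where "\<And>p. cstar_seminorm alg p \<Longrightarrow> p a \<le> B" "\<And>p. cstar_seminorm alg p \<Longrightarrow> p b \<le> B'" by blast
  then have "p (\<lambda>t x. a t x + b t x) \<le> B + B'" if "cstar_seminorm alg p" for p
    using seminorm_add[OF that add(1,2)] that by (meson add_mono order_trans)
  then show ?case by blast
qed

lemma seminorm_le_unorm:
  assumes "cstar_seminorm alg p" "a \<in> carrier alg" shows "p a \<le> unorm a"
proof -
  obtain B where "\<And>p. cstar_seminorm alg p \<Longrightarrow> p a \<le> B" using seminorms_bounded[OF assms(2)] by blast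
  then have "bdd_above {p a | p. cstar_seminorm alg p}" unfolding bdd_above_def by blast
  then show ?thesis unfolding universal_norm_def using assms(1) by (intro cSup_upper) blast
qed

lemma unorm_le: "(\<And>p. cstar_seminorm alg p \<Longrightarrow> p a \<le> B) \<Longrightarrow> unorm a \<le> B"
  unfolding universal_norm_def using zero_seminorm by (intro cSup_least) blast+

lemma cstar_seminorm_unorm: "cstar_seminorm alg unorm"
  unfolding cstar_seminorm_def
proof (intro conjI ballI allI)
  fix a assume a: "a \<in> carrier alg"
  show nonneg: "0 \<le> unorm a" using seminorm_le_unorm[OF zero_seminorm a] .
  have star: "p (sa_star alg a) = p a" if "cstar_seminorm alg p" for p
    using that a unfolding cstar_seminorm_def by blast
  show "unorm (sa_star alg a) = unorm a"
  proof (rule antisym; rule unorm_le)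
    fix p assume p: "cstar_seminorm alg p"
    show "p (sa_star alg a) \<le> unorm a"
      unfolding star[OF p] by (rule seminorm_le_unorm[OF p a])
    show "p a \<le> unorm (sa_star alg a)"
      unfolding star[OF p, symmetric] by (rule seminorm_le_unorm[OF p alg_star_closed[OF a]])
  qed
  let ?aa = "sa_mult alg (sa_star alg a) a"
  have aa: "?aa \<in> carrier alg" by (intro alg_mult_closed alg_star_closed a)
  show "unorm ?aa = (unorm a)\<^sup>2"
  proof (rule antisym)
    show "unorm ?aa \<le> (unorm a)\<^sup>2"
    proof (rule unorm_le)
      fix p assume p: "cstar_seminorm alg p"
      show "p ?aa \<le> (unorm a)\<^sup>2"
        unfolding seminorm_cstar[OF p a]
        by (intro power_mono seminorm_le_unorm[OF p a] seminorm_nonneg[OF p a])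
    qed
    \<comment> \<open>Taking the root below the supremum spares an exchange of supremum and
      square.\<close>
    have "unorm a \<le> sqrt (unorm ?aa)"
    proof (rule unorm_le)
      fix p assume p: "cstar_seminorm alg p"
      show "p a \<le> sqrt (unorm ?aa)"
        using seminorm_le_unorm[OF p aa] unfolding seminorm_cstar[OF p a] by (rule real_le_rsqrt)
    qed
    from power_mono[OF this nonneg, of 2] show "(unorm a)\<^sup>2 \<le> unorm ?aa"
      using seminorm_le_unorm[OF zero_seminorm aa] by simp
  qed
  fix c
  have ca: "(\<lambda>t x. c * a t x) \<in> carrier alg" by (rule alg_scale_closed[OF a])
  show "unorm (sa_scale alg c a) = norm c * unorm a"
    unfolding alg_scale
  proof (rule antisym)
    show "unorm (\<lambda>t x. c * a t x) \<le> norm c * unorm a"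
    proof (rule unorm_le)
      fix p assume p: "cstar_seminorm alg p"
      show "p (\<lambda>t x. c * a t x) \<le> norm c * unorm a"
        unfolding seminorm_scale[OF p a] by (intro mult_left_mono seminorm_le_unorm[OF p a]) simp
    qed
    show "norm c * unorm a \<le> unorm (\<lambda>t x. c * a t x)"
    proof (cases "c = 0")
      case False
      have "unorm a \<le> unorm (\<lambda>t x. c * a t x) / norm c"
      proof (rule unorm_le)
        fix p assume p: "cstar_seminorm alg p"
        show "p a \<le> unorm (\<lambda>t x. c * a t x) / norm c"
          using seminorm_le_unorm[OF p ca] False by (simp add: seminorm_scale[OF p a] field_simps)
      qed
      then show ?thesis using False by (simp add: field_simps)
    next
      case True
      then show ?thesis using seminorm_le_unorm[OF zero_seminorm ca] by simp
    qed
  qed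
next
  fix a b assume a: "a \<in> carrier alg" and b: "b \<in> carrier alg"
  show "unorm (sa_add alg a b) \<le> unorm a + unorm b"
    unfolding alg_add
  proof (rule unorm_le)
    fix p assume p: "cstar_seminorm alg p"
    show "p (\<lambda>t x. a t x + b t x) \<le> unorm a + unorm b"
      using seminorm_add[OF p a b] seminorm_le_unorm[OF p a] seminorm_le_unorm[OF p b] by linarith
  qed
  show "unorm (sa_mult alg a b) \<le> unorm a * unorm b"
  proof (rule unorm_le)
    fix p assume p: "cstar_seminorm alg p"
    have "p (sa_mult alg a b) \<le> p a * p b" using p a b unfolding cstar_seminorm_def by blast
    also have "\<dots> \<le> unorm a * unorm b"
      by (intro mult_mono seminorm_le_unorm p a b seminorm_nonneg order_trans[OF seminorm_nonneg[OF p a] seminorm_le_unorm[OF p a]])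
    finally show "p (sa_mult alg a b) \<le> unorm a * unorm b" .
  qed
qed

sublocale cstar_seminormed alg unorm
proof
  show "sa_zero alg \<in> carrier alg" by (simp add: alg_zero_closed)
  fix x y assume x: "x \<in> carrier alg" and y: "y \<in> carrier alg"
  show "sa_add alg x y \<in> carrier alg" using alg_add_closed[OF x y] by simp
  show "sa_scale alg c x \<in> carrier alg" for c using alg_scale_closed[OF x] by simp
  show "sa_mult alg x y \<in> carrier alg" by (rule alg_mult_closed[OF x y])
  show "sa_star alg x \<in> carrier alg" by (rule alg_star_closed[OF x])
  show "sa_diff alg x x = sa_scale alg 0 x" by simp
  show "sa_diff alg y x = sa_scale alg (-1) (sa_diff alg x y)" by simp
  show "x = sa_add alg (sa_diff alg x y) y" by simp
  show "sa_diff alg (sa_scale alg c x) (sa_scale alg c y) = sa_scale alg c (sa_diff alg x y)" for c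
    by (simp add: algebra_simps)
  show "sa_diff alg (sa_star alg x) (sa_star alg y) = sa_star alg (sa_diff alg x y)"
  proof (intro ext)
    fix t z
    show "sa_diff alg (sa_star alg x) (sa_star alg y) t z = sa_star alg (sa_diff alg x y) t z"
      by (cases "t \<in> carrier G") (simp_all add: alg_star)
  qed
  fix z
  show "sa_diff alg x z = sa_add alg (sa_diff alg x y) (sa_diff alg y z)" by simp
  fix x' y' assume x': "x' \<in> carrier alg" and y': "y' \<in> carrier alg"
  show "sa_diff alg (sa_add alg x y) (sa_add alg x' y') = sa_add alg (sa_diff alg x x') (sa_diff alg y y')"
    by (simp add: algebra_simps)
  have d: "(\<lambda>t z. x t z - x' t z) \<in> carrier alg" "(\<lambda>t z. y t z - y' t z) \<in> carrier alg"
    using alg_add_closed[OF x alg_scale_closed[OF x', of "-1"]] alg_add_closed[OF y alg_scale_closed[OF y', of "-1"]]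
    by simp_all
  show "sa_diff alg (sa_mult alg x y) (sa_mult alg x' y') =
      sa_add alg (sa_mult alg (sa_diff alg x x') y) (sa_mult alg x' (sa_diff alg y y'))"
  proof (intro ext)
    fix t z
    \<comment> \<open>Over the union of the two supports all four products are sums with the same
      index set, and the identity holds term by term.\<close>
    let ?R = "{t. x t \<noteq> (\<lambda>_. 0)} \<union> {t. x' t \<noteq> (\<lambda>_. 0)}"
    have R: "finite ?R" "?R \<subseteq> carrier G"
      using alg_finite_support[OF x] alg_finite_support[OF x'] alg_support[OF x] alg_support[OF x'] by auto
    show "sa_diff alg (sa_mult alg x y) (sa_mult alg x' y') t z =
        sa_add alg (sa_mult alg (sa_diff alg x x') y) (sa_mult alg x' (sa_diff alg y y')) t z"
    proof (cases "t \<in> carrier G")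
      case t: True
      have s: "{t. (\<lambda>z. x t z - x' t z) \<noteq> (\<lambda>_. 0)} \<subseteq> ?R" by auto
      show ?thesis
        unfolding alg_diff alg_add alg_mult[OF x y t R(1) Un_upper1 R(2)]
          alg_mult[OF x' y' t R(1) Un_upper2 R(2)] alg_mult[OF d(1) y t R(1) s R(2)]
          alg_mult[OF x' d(2) t R(1) Un_upper2 R(2)]
        unfolding sum_subtractf[symmetric] sum.distrib[symmetric]
        by (rule sum.cong) (simp_all add: algebra_simps)
    next
      case False
      show ?thesis
        unfolding alg_diff alg_add alg_mult_outside[OF x y False] alg_mult_outside[OF x' y' False]
          alg_mult_outside[OF d(1) y False] alg_mult_outside[OF x' d(2) False] by simp
    qed
  qed
qed (rule cstar_seminorm_unorm)

lemma unorm_fdelta_le: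
  assumes "t \<in> carrier G" "f \<in> C0 X (U t)" "M > 0" "\<And>x. norm (f x) \<le> M"
  shows "unorm (fdelta t f) \<le> M"
  using seminorm_fdelta_le[OF seminorm assms] .

end

section \<open>Generation by characteristic functions\<close>

context partial_dynamical_system
begin

lemma crossed_product_eq: "crossed_product G X U \<phi> = cp"
  by (simp add: crossed_product_def)

lemma cp_delta_eq: "cp_delta G X U \<phi> t f = emb (fdelta t f)"
  by (simp add: cp_delta_def)

context
  fixes S assumes S: "cstar_subalgebra cp S"
begin

definition delta_in :: "'g \<Rightarrow> ('x \<Rightarrow> complex) \<Rightarrow> bool" where
  "delta_in t f \<longleftrightarrow> t \<in> carrier G \<and> f \<in> C0 X (U t) \<and> emb (fdelta t f) \<in> S"

lemma delta_inD: "delta_in t f \<Longrightarrow> t \<in> carrier G" "delta_in t f \<Longrightarrow> f \<in> C0 X (U t)"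
    "delta_in t f \<Longrightarrow> emb (fdelta t f) \<in> S" "delta_in t f \<Longrightarrow> fdelta t f \<in> carrier alg"
  by (auto simp: delta_in_def intro: fdelta_closed)

lemma S_add: "Z \<in> S \<Longrightarrow> Y \<in> S \<Longrightarrow> sa_add cp Z Y \<in> S"
  and S_mult: "Z \<in> S \<Longrightarrow> Y \<in> S \<Longrightarrow> sa_mult cp Z Y \<in> S"
  and S_scale: "Z \<in> S \<Longrightarrow> sa_scale cp c Z \<in> S"
  and S_star: "Z \<in> S \<Longrightarrow> sa_star cp Z \<in> S"
  and S_zero: "sa_zero cp \<in> S"
  using S unfolding cstar_subalgebra_def by blast+

lemma delta_in_add:
  assumes f: "delta_in t f" and g: "delta_in t g" shows "delta_in t (\<lambda>x. f x + g x)"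
proof -
  have "emb (sa_add alg (fdelta t f) (fdelta t g)) \<in> S"
    unfolding emb_add[OF delta_inD(4)[OF f] delta_inD(4)[OF g]]
    by (rule S_add[OF delta_inD(3)[OF f] delta_inD(3)[OF g]])
  then show ?thesis
    using delta_inD(1)[OF f] C0_add[OF Hausdorff open_domain[OF delta_inD(1)[OF f]] delta_inD(2)[OF f] delta_inD(2)[OF g]]
    unfolding alg_add fdelta_add delta_in_def by blast
qed

lemma delta_in_scale:
  assumes f: "delta_in t f" shows "delta_in t (\<lambda>x. c * f x)"
proof -
  have "emb (sa_scale alg c (fdelta t f)) \<in> S"
    unfolding emb_scale[OF delta_inD(4)[OF f]] by (rule S_scale[OF delta_inD(3)[OF f]])
  then show ?thesis
    using delta_inD(1)[OF f] C0_scale[OF Hausdorff open_domain[OF delta_inD(1)[OF f]] delta_inD(2)[OF f]]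
    unfolding alg_scale fdelta_scale delta_in_def by blast
qed

lemma delta_in_diff:
  assumes f: "delta_in t f" and g: "delta_in t g" shows "delta_in t (\<lambda>x. f x - g x)"
  using delta_in_add[OF f delta_in_scale[OF g, of "-1"]] by simp

lemma delta_in_mult:
  assumes f: "delta_in s f" and g: "delta_in t g"
  shows "delta_in (s \<otimes> t) (\<lambda>x. f x * g (\<phi> (inv s) x))"
proof -
  have "emb (sa_mult alg (fdelta s f) (fdelta t g)) \<in> S"
    unfolding emb_mult[OF delta_inD(4)[OF f] delta_inD(4)[OF g]]
    by (rule S_mult[OF delta_inD(3)[OF f] delta_inD(3)[OF g]])
  then show ?thesis
    using C0_mult_pullback[OF delta_inD(1)[OF f] delta_inD(1)[OF g] delta_inD(2)[OF f] delta_inD(2)[OF g]]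
      m_closed[OF delta_inD(1)[OF f] delta_inD(1)[OF g]]
    unfolding fdelta_mult[OF delta_inD(1,2)[OF f] delta_inD(1,2)[OF g]] delta_in_def by blast
qed

lemma delta_in_star:
  assumes f: "delta_in t f"
  shows "delta_in (inv t) (\<lambda>x. if x \<in> U (inv t) then cnj (f (\<phi> t x)) else 0)"
proof -
  note t = delta_inD(1)[OF f]
  have t': "inv t \<in> carrier G" using t by simp
  have "emb (sa_star alg (fdelta t f)) \<in> S"
    unfolding emb_star[OF delta_inD(4)[OF f]] by (rule S_star[OF delta_inD(3)[OF f]])
  moreover have "(\<lambda>x. cnj (f x)) \<in> C0 X (U (inv (inv t)))"
    unfolding inv_inv[OF t] by (rule C0_cnj[OF Hausdorff open_domain[OF t] delta_inD(2)[OF f]])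
  from C0_transport[OF t' this]
  have "(\<lambda>x. if x \<in> U (inv t) then cnj (f (\<phi> t x)) else 0) \<in> C0 X (U (inv t))"
    unfolding inv_inv[OF t] .
  ultimately show ?thesis
    using t' unfolding fdelta_star[OF t] delta_in_def by blast
qed

text \<open>Here \<open>unorm_fdelta_le\<close> is put to use: \<open>S\<close> is closed for the
  norm of the completion, but at a fixed group element uniform approximation is enough.\<close>

lemma delta_in_limit:
  assumes t: "t \<in> carrier G" and f: "f \<in> C0 X (U t)"
    and g: "\<And>e. e > 0 \<Longrightarrow> \<exists>g. delta_in t g \<and> (\<forall>x. norm (f x - g x) \<le> e)"
  shows "delta_in t f"
proof -
  have "emb (fdelta t f) \<in> S"
  proof (rule emb_closed[OF S fdelta_closed[OF t f]])
    fix e :: real assume e: "e > 0"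
    obtain g where g: "delta_in t g" "\<And>x. norm (f x - g x) \<le> e" using g[OF e] by blast
    have "(\<lambda>x. f x + -1 * g x) \<in> C0 X (U t)"
      by (rule C0_add[OF Hausdorff open_domain[OF t] f C0_scale[OF Hausdorff open_domain[OF t] delta_inD(2)[OF g(1)]]])
    then have "(\<lambda>x. f x - g x) \<in> C0 X (U t)" by simp
    from unorm_fdelta_le[OF t this e g(2)]
    have "unorm (sa_diff alg (fdelta t f) (fdelta t g)) \<le> e" unfolding alg_diff fdelta_diff .
    then show "\<exists>b\<in>carrier alg. emb b \<in> S \<and> unorm (sa_diff alg (fdelta t f) b) \<le> e"
      using delta_inD(3,4)[OF g(1)] by blast
  qed
  then show ?thesis using t f by (simp add: delta_in_def)
qed

section \<open>Compact open sets whose indicators give elements of the subalgebra\<close>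

definition charset :: "'g \<Rightarrow> 'x set set" where
  "charset t = {K. K \<subseteq> U t \<and> delta_in t (indicator K)}"

lemma charsetD: "K \<in> charset t \<Longrightarrow> t \<in> carrier G" "K \<in> charset t \<Longrightarrow> K \<subseteq> U t"
    "K \<in> charset t \<Longrightarrow> delta_in t (indicator K)"
  by (auto simp: charset_def delta_inD)

lemma charset_compact_open: "K \<in> charset t \<Longrightarrow> openin X K \<and> compactin X K"
  using indicator_in_C0_iff[OF Hausdorff open_domain charsetD(2)] delta_inD(2)[OF charsetD(3)] charsetD(1)
  by blast

text \<open>The product of 1_K \<delta>_s and 1_K' \<delta>_t is again an indicator, namely of the
  part of \<open>K\<close> that lies in the translate of \<open>K'\<close> by
  \<open>s\<close>.\<close>

lemma charset_mult:
  assumes K: "K \<in> charset s" and K': "K' \<in> charset t"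
  shows "{x \<in> K. \<phi> (inv s) x \<in> K'} \<in> charset (s \<otimes> t)"
proof -
  have "(\<lambda>x. indicator K x * indicator K' (\<phi> (inv s) x)) =
      (indicator {x \<in> K. \<phi> (inv s) x \<in> K'} :: 'x \<Rightarrow> complex)"
    by (auto simp: indicator_def fun_eq_iff)
  moreover have "{x \<in> K. \<phi> (inv s) x \<in> K'} \<subseteq> U (s \<otimes> t)"
    using domain_mult[OF charsetD(1)[OF K] charsetD(1)[OF K']] charsetD(2)[OF K] charsetD(2)[OF K'] by blast
  ultimately show ?thesis
    using delta_in_mult[OF charsetD(3)[OF K] charsetD(3)[OF K']] by (simp add: charset_def)
qed

lemma charset_star:
  assumes K: "K \<in> charset t" shows "{x \<in> U (inv t). \<phi> t x \<in> K} \<in> charset (inv t)"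
proof -
  have "(\<lambda>x. if x \<in> U (inv t) then cnj (indicator K (\<phi> t x)) else 0) =
      (indicator {x \<in> U (inv t). \<phi> t x \<in> K} :: 'x \<Rightarrow> complex)"
    by (auto simp: indicator_def fun_eq_iff)
  then show ?thesis using delta_in_star[OF charsetD(3)[OF K]] by (simp add: charset_def)
qed

text \<open>For a = 1_K \<delta>_t the product a a* is 1_K \<delta>_1.\<close>

lemma charset_one:
  assumes K: "K \<in> charset t" shows "K \<in> charset \<one>"
proof -
  note t = charsetD(1)[OF K]
  have "{x \<in> K. \<phi> (inv t) x \<in> {x \<in> U (inv t). \<phi> t x \<in> K}} = K"
    using maps[OF t] inverse[OF t] charsetD(2)[OF K] by auto
  then show ?thesis using charset_mult[OF K charset_star[OF K]] t by simp
qed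

lemma charset_Int:
  assumes K: "K \<in> charset \<one>" and K': "K' \<in> charset t" shows "K \<inter> K' \<in> charset t"
proof -
  have "{x \<in> K. \<phi> (inv \<one>) x \<in> K'} = K \<inter> K'"
    using map_one charsetD(2)[OF K] by (auto simp: domain_one)
  then show ?thesis using charset_mult[OF K K'] charsetD(1)[OF K'] by simp
qed

lemma charset_Diff:
  assumes K: "K \<in> charset \<one>" and K': "K' \<in> charset \<one>" shows "K - K' \<in> charset \<one>"
proof -
  \<comment> \<open>Subtracting only the indicator of the intersection keeps the values in 0 and
    1.\<close>
  have "(\<lambda>x. indicator K x - indicator (K \<inter> K') x) = (indicator (K - K') :: 'x \<Rightarrow> complex)"
    by (auto simp: indicator_def fun_eq_iff)
  then show ?thesis
    using delta_in_diff[OF charsetD(3)[OF K] charsetD(3)[OF charset_Int[OF K K']]] charsetD(2)[OF K]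
    by (auto simp: charset_def)
qed

context
  assumes cover: "\<And>t x. \<lbrakk>t \<in> carrier G; x \<in> U t\<rbrakk> \<Longrightarrow> \<exists>K\<in>charset t. x \<in> K"
    and separate: "\<And>x y. \<lbrakk>x \<in> topspace X; y \<in> topspace X; x \<noteq> y\<rbrakk> \<Longrightarrow> \<exists>K\<in>charset \<one>. x \<in> K \<longleftrightarrow> y \<notin> K"
begin

text \<open>Compactness turns separation of points into a basis of the topology.\<close>

lemma charset_basis:
  assumes W: "openin X W" and x: "x \<in> W"
  obtains K where "K \<in> charset \<one>" "x \<in> K" "K \<subseteq> W"
proof -
  have xX: "x \<in> topspace X" using openin_subset[OF W] x by blast
  then obtain K0 where K0: "K0 \<in> charset \<one>" "x \<in> K0" using cover[of \<one> x] by (auto simp: domain_one)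
  have "\<exists>L\<in>charset \<one>. y \<in> L \<and> x \<notin> L" if y: "y \<in> K0 - W" for y
  proof -
    have "y \<in> topspace X" using y charsetD(2)[OF K0(1)] by (auto simp: domain_one)
    moreover have "x \<noteq> y" using x y by auto
    ultimately obtain K where K: "K \<in> charset \<one>" "x \<in> K \<longleftrightarrow> y \<notin> K"
      using separate[OF xX] by blast
    \<comment> \<open>A separating set that contains \<open>x\<close> instead of \<open>y\<close> is
      replaced by its complement in \<open>K0\<close>.\<close>
    show ?thesis
    proof (cases "x \<in> K")
      case True
      then show ?thesis using charset_Diff[OF K0(1) K(1)] K(2) y by blast
    qed (use K in blast)
  qed
  then obtain L where L: "\<And>y. y \<in> K0 - W \<Longrightarrow> L y \<in> charset \<one> \<and> y \<in> L y \<and> x \<notin> L y" by metis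
  have "compactin X (K0 \<inter> (topspace X - W))"
    using charset_compact_open[OF K0(1)] W by (intro compact_Int_closedin) auto
  moreover have "K0 \<inter> (topspace X - W) = K0 - W"
    using charsetD(2)[OF K0(1)] by (auto simp: domain_one)
  ultimately have "compactin X (K0 - W)" by simp
  moreover have "\<And>V. V \<in> L ` (K0 - W) \<Longrightarrow> openin X V" using L charset_compact_open by blast
  moreover have "K0 - W \<subseteq> \<Union>(L ` (K0 - W))" using L by blast
  ultimately obtain \<F> where F: "finite \<F>" "\<F> \<subseteq> L ` (K0 - W)" "K0 - W \<subseteq> \<Union>\<F>"
    by (meson compactinD)
  have "K0 - \<Union>\<F> \<in> charset \<one>"
    using F(1,2)
  proof (induction \<F> rule: finite_induct)
    case (insert V \<F>)
    then have V: "V \<in> charset \<one>" and IH: "K0 - \<Union>\<F> \<in> charset \<one>" using L by blast+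
    have "K0 - \<Union>(insert V \<F>) = (K0 - \<Union>\<F>) - V" by blast
    then show ?case using charset_Diff[OF IH V] by simp
  qed (use K0 in simp)
  moreover have "x \<in> K0 - \<Union>\<F>" using K0(2) F(2) L by blast
  moreover have "K0 - \<Union>\<F> \<subseteq> W" using F(3) by blast
  ultimately show ?thesis using that by blast
qed

text \<open>The compact set where \<open>f\<close> has norm at least \<open>e\<close> is covered by
  finitely many members of \<open>charset t\<close> on which \<open>f\<close> is constant up to
  \<open>e\<close>. The sets may overlap: a step function is built by overwriting its values on one
  set after the other.\<close>

lemma delta_in_C0:
  assumes t: "t \<in> carrier G" and f: "f \<in> C0 X (U t)" shows "delta_in t f"
proof (rule delta_in_limit[OF t f])
  fix e :: real assume e: "e > 0"
  have fc: "continuous_map X euclidean f" and f0: "\<And>x. x \<notin> U t \<Longrightarrow> f x = 0"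
    and fk: "compactin X {x \<in> U t. e \<le> norm (f x)}"
    using f e by (simp_all add: C0_iff'[OF t])
  have "\<exists>K c. K \<in> charset t \<and> x \<in> K \<and> (\<forall>y\<in>K. norm (f y - c) < e)" if x: "x \<in> U t" for x
  proof -
    obtain K where K: "K \<in> charset t" "x \<in> K" using cover[OF t x] by blast
    have "openin X {y \<in> topspace X. f y \<in> ball (f x) e}"
      by (rule openin_continuous_map_preimage[OF fc]) simp
    moreover have "x \<in> {y \<in> topspace X. f y \<in> ball (f x) e}" using x domain_subset[OF t] e by auto
    ultimately obtain K' where K': "K' \<in> charset \<one>" "x \<in> K'" "K' \<subseteq> {y \<in> topspace X. f y \<in> ball (f x) e}"
      by (rule charset_basis)
    have "\<forall>y\<in>K' \<inter> K. norm (f y - f x) < e" using K'(3) by (auto simp: dist_norm norm_minus_commute)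
    then show ?thesis using charset_Int[OF K'(1) K(1)] K(2) K'(2) by blast
  qed
  then obtain K c where K: "\<And>x. x \<in> U t \<Longrightarrow> K x \<in> charset t \<and> x \<in> K x \<and> (\<forall>y\<in>K x. norm (f y - c x) < e)"
    by metis
  let ?C = "{x \<in> U t. e \<le> norm (f x)}"
  have "\<And>V. V \<in> K ` ?C \<Longrightarrow> openin X V" using K charset_compact_open by blast
  moreover have "?C \<subseteq> \<Union>(K ` ?C)" using K by blast
  ultimately obtain \<F> where F: "finite \<F>" "\<F> \<subseteq> K ` ?C" "?C \<subseteq> \<Union>\<F>"
    using fk by (meson compactinD)
  have "\<exists>g. delta_in t g \<and> (\<forall>y\<in>\<Union>\<F>. norm (f y - g y) < e) \<and> (\<forall>y. y \<notin> \<Union>\<F> \<longrightarrow> g y = 0)"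
    using F(1,2)
  proof (induction \<F> rule: finite_induct)
    case empty
    have "emb (sa_zero alg) \<in> S" unfolding emb_zero by (rule S_zero)
    moreover have "fdelta t (\<lambda>_. 0) = sa_zero alg" by (auto simp: fdelta_def fun_eq_iff)
    ultimately have "delta_in t (\<lambda>_. 0)" using t by (simp add: delta_in_def C0_zero)
    then show ?case by (intro exI[of _ "\<lambda>_. 0"]) simp
  next
    case (insert V \<F>)
    then obtain g where g: "delta_in t g" "\<And>y. y \<in> \<Union>\<F> \<Longrightarrow> norm (f y - g y) < e"
      "\<And>y. y \<notin> \<Union>\<F> \<Longrightarrow> g y = 0" by blast
    obtain x where x: "x \<in> U t" "V = K x" using insert.prems by blast
    have V: "V \<in> charset t" using K x by blast
    \<comment> \<open>\<open>V\<close> is used at the identity, by \<open>charset_one\<close>, so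
      that multiplying with its indicator leaves the group element \<open>t\<close> in
      place.\<close>
    have "delta_in (\<one> \<otimes> t) (\<lambda>y. indicator V y * g (\<phi> (inv \<one>) y))"
      by (rule delta_in_mult[OF charsetD(3)[OF charset_one[OF V]] g(1)])
    moreover have "(\<lambda>y. indicator V y * g (\<phi> (inv \<one>) y)) = (\<lambda>y. indicator V y * g y)"
      using map_one charsetD(2)[OF charset_one[OF V]] by (auto simp: fun_eq_iff indicator_def domain_one)
    ultimately have "delta_in t (\<lambda>y. indicator V y * g y)" using t by simp
    \<comment> \<open>The old function is erased on \<open>V\<close> and replaced there by the
      constant \<open>c x\<close>.\<close>
    from delta_in_add[OF delta_in_diff[OF g(1) this] delta_in_scale[OF charsetD(3)[OF V], of "c x"]]
    have "delta_in t (\<lambda>y. g y - indicator V y * g y + c x * indicator V y)" .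
    moreover have "norm (f y - (g y - indicator V y * g y + c x * indicator V y)) < e"
      if "y \<in> \<Union>(insert V \<F>)" for y
    proof (cases "y \<in> V")
      case True
      then show ?thesis using K[OF x(1)] x(2) by simp
    qed (use g(2)[of y] that in auto)
    moreover have "g y - indicator V y * g y + c x * indicator V y = 0" if "y \<notin> \<Union>(insert V \<F>)" for y
      using that g(3)[of y] by simp
    ultimately show ?case by blast
  qed
  then obtain g where g: "delta_in t g" "\<And>y. y \<in> \<Union>\<F> \<Longrightarrow> norm (f y - g y) < e"
    "\<And>y. y \<notin> \<Union>\<F> \<Longrightarrow> g y = 0" by blast
  have "norm (f y - g y) \<le> e" for y
  proof (cases "y \<in> \<Union>\<F>")
    case False
    \<comment> \<open>Outside the cover the approximating function is 0, and so is \<open>f\<close>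
      up to \<open>e\<close>.\<close>
    then have "y \<notin> ?C" using F(3) by blast
    then have "norm (f y) < e" using f0[of y] e by (cases "y \<in> U t") auto
    then show ?thesis using g(3)[OF False] by simp
  qed (use g(2)[of y] in simp)
  then show "\<exists>g. delta_in t g \<and> (\<forall>x. norm (f x - g x) \<le> e)" using g(1) by blast
qed

lemma emb_in: "a \<in> carrier alg \<Longrightarrow> emb a \<in> S"
proof (induction rule: alg_induct)
  case zero
  then show ?case using S_zero emb_zero unfolding alg_zero by simp
next
  case (delta t f)
  then show ?case by (rule delta_inD(3)[OF delta_in_C0])
next
  case (add a b)
  then show ?case using emb_add[of a b] S_add[of "emb a" "emb b"] by simp
qed

end

end

theorem cstar_generated_eq_carrierI:
  assumes "T \<subseteq> carrier (crossed_product G X U \<phi>)"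
    and "\<And>S t x. \<lbrakk>cstar_subalgebra (crossed_product G X U \<phi>) S; T \<subseteq> S; t \<in> carrier G; x \<in> U t\<rbrakk> \<Longrightarrow>
      \<exists>K\<in>charset S t. x \<in> K"
    and "\<And>S x y. \<lbrakk>cstar_subalgebra (crossed_product G X U \<phi>) S; T \<subseteq> S; x \<in> topspace X; y \<in> topspace X; x \<noteq> y\<rbrakk> \<Longrightarrow>
      \<exists>K\<in>charset S \<one>. x \<in> K \<longleftrightarrow> y \<notin> K"
  shows "carrier (crossed_product G X U \<phi>) = cstar_generated (crossed_product G X U \<phi>) T"
  unfolding crossed_product_eq
proof (rule cstar_generated_eq_carrier)
  show "T \<subseteq> carrier cp" using assms(1) by (simp add: crossed_product_eq)
  fix S a assume S: "cstar_subalgebra cp S" "T \<subseteq> S" and a: "a \<in> carrier alg"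
  show "emb a \<in> S"
  proof (rule emb_in[OF S(1) _ _ a])
    show "\<exists>K\<in>charset S t. x \<in> K" if "t \<in> carrier G" "x \<in> U t" for t x
      using assms(2)[OF _ S(2) that] S(1) by (simp add: crossed_product_eq)
    show "\<exists>K\<in>charset S \<one>. x \<in> K \<longleftrightarrow> y \<notin> K" if "x \<in> topspace X" "y \<in> topspace X" "x \<noteq> y" for x y
      using assms(3)[OF _ S(2) that] S(1) by (simp add: crossed_product_eq)
  qed
qed

end

section \<open>Partial actions of free groups\<close>

text \<open>Partial homeomorphisms of the letters determine a partial action of the free group by
  composition along reduced words.\<close>

locale free_partial_action =
  fixes L :: "'l set" and X :: "'x topology" and U :: "'l signed_letter list \<Rightarrow> 'x set"
    and \<phi> :: "'l signed_letter list \<Rightarrow> 'x \<Rightarrow> 'x"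
  assumes Hausdorff: "Hausdorff_space X"
    and U_Nil: "U [] = topspace X"
    and phi_Nil: "x \<in> topspace X \<Longrightarrow> \<phi> [] x = x"
    and letter_open: "letter_base a \<in> L \<Longrightarrow> openin X (U [a])"
    and letter_continuous: "letter_base a \<in> L \<Longrightarrow> continuous_map (subtopology X (U [a])) X (\<phi> [flip_letter a])"
    and letter_maps: "\<lbrakk>letter_base a \<in> L; x \<in> U [a]\<rbrakk> \<Longrightarrow> \<phi> [flip_letter a] x \<in> U [flip_letter a]"
    and letter_inverse: "\<lbrakk>letter_base a \<in> L; x \<in> U [a]\<rbrakk> \<Longrightarrow> \<phi> [a] (\<phi> [flip_letter a] x) = x"
    and U_Cons: "a # t \<in> carrier (free_group L) \<Longrightarrow> x \<in> U (a # t) \<longleftrightarrow> x \<in> U [a] \<and> \<phi> [flip_letter a] x \<in> U t"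
    and phi_Cons: "\<lbrakk>a # t \<in> carrier (free_group L); x \<in> U (a # t)\<rbrakk> \<Longrightarrow>
      \<phi> (rev (map flip_letter (a # t))) x = \<phi> (rev (map flip_letter t)) (\<phi> [flip_letter a] x)"
begin

abbreviation winv :: "'l signed_letter list \<Rightarrow> 'l signed_letter list" where
  "winv t \<equiv> rev (map flip_letter t)"

abbreviation wmult :: "'l signed_letter list \<Rightarrow> 'l signed_letter list \<Rightarrow> 'l signed_letter list" where
  "wmult s t \<equiv> foldr reduced_Cons s t"

lemma carrier_ConsD:
  assumes "a # t \<in> carrier (free_group L)"
  shows "t \<in> carrier (free_group L)" "letter_base a \<in> L" "fg_reduced (a # t)"
  using assms fg_reduced_ConsD by (auto simp: free_group_def)

lemma winv_carrier: "t \<in> carrier (free_group L) \<Longrightarrow> winv t \<in> carrier (free_group L)"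
  using fg_reduced_inverse[of t] by (auto simp: free_group_def)

lemma wmult_carrier:
  "s \<in> carrier (free_group L) \<Longrightarrow> t \<in> carrier (free_group L) \<Longrightarrow> wmult s t \<in> carrier (free_group L)"
  using set_foldr_reduced_Cons[of s t] by (fastforce simp: free_group_def fg_reduced_foldr)

lemma winv_winv: "winv (winv t) = t"
  by (simp add: rev_map o_def)

lemma letter_topspace: "letter_base a \<in> L \<Longrightarrow> x \<in> U [a] \<Longrightarrow> \<phi> [flip_letter a] x \<in> topspace X"
  using letter_maps[of a x] openin_subset[OF letter_open[of "flip_letter a"]] by auto

lemma U_open: "t \<in> carrier (free_group L) \<Longrightarrow> openin X (U t)"
proof (induction t)
  case (Cons a t)
  note c = carrier_ConsD[OF Cons.prems]
  have "openin (subtopology X (U [a])) {x \<in> topspace (subtopology X (U [a])). \<phi> [flip_letter a] x \<in> U t}"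
    by (rule openin_continuous_map_preimage[OF letter_continuous[OF c(2)] Cons.IH[OF c(1)]])
  moreover have "{x \<in> topspace (subtopology X (U [a])). \<phi> [flip_letter a] x \<in> U t} = U (a # t)"
    using U_Cons[OF Cons.prems] openin_subset[OF letter_open[OF c(2)]] by auto
  ultimately show ?case using letter_open[OF c(2)] by (simp add: openin_open_subtopology)
qed (simp add: U_Nil)

lemma phi_continuous: "t \<in> carrier (free_group L) \<Longrightarrow> continuous_map (subtopology X (U t)) X (\<phi> (winv t))"
proof (induction t)
  case Nil
  have "continuous_map X X (\<phi> [])"
    by (rule continuous_map_eq[OF continuous_map_id]) (simp add: phi_Nil)
  then show ?case by (simp add: U_Nil)
next
  case (Cons a t)
  note c = carrier_ConsD[OF Cons.prems]
  have sub: "U (a # t) \<subseteq> U [a]" using U_Cons[OF Cons.prems] by auto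
  have "continuous_map (subtopology X (U (a # t))) X (\<phi> [flip_letter a])"
    using continuous_map_from_subtopology_mono[OF letter_continuous[OF c(2)] sub] .
  then have "continuous_map (subtopology X (U (a # t))) (subtopology X (U t)) (\<phi> [flip_letter a])"
    using U_Cons[OF Cons.prems] by (auto simp: continuous_map_in_subtopology)
  from continuous_map_compose[OF this Cons.IH[OF c(1)]]
  have "continuous_map (subtopology X (U (a # t))) X (\<phi> (winv t) \<circ> \<phi> [flip_letter a])" .
  then show ?case
    by (rule continuous_map_eq) (simp add: phi_Cons[OF Cons.prems, simplified])
qed

text \<open>By induction on \<open>s\<close>, the letter \<open>a\<close> is put in front of
  \<open>wmult s t\<close>. Without cancellation \<open>U_Cons\<close> and \<open>phi_Cons\<close>
  apply; if \<open>a\<close> cancels the first letter, \<open>letter_inverse\<close> shows that the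
  two letter maps undo each other.\<close>

lemma phi_mult:
  assumes "s \<in> carrier (free_group L)" "t \<in> carrier (free_group L)" "x \<in> U s" "\<phi> (winv s) x \<in> U t"
  shows "x \<in> U (wmult s t) \<and> \<phi> (winv (wmult s t)) x = \<phi> (winv t) (\<phi> (winv s) x)"
  using assms
proof (induction s arbitrary: x)
  case Nil
  then show ?case by (simp add: U_Nil phi_Nil)
next
  case (Cons a s)
  note c = carrier_ConsD[OF Cons.prems(1)]
  define y where "y = \<phi> [flip_letter a] x"
  define w where "w = wmult s t"
  have x: "x \<in> U [a]" and y: "y \<in> U s" using Cons.prems(3) U_Cons[OF Cons.prems(1)] by (auto simp: y_def)
  have e: "\<phi> (winv (a # s)) x = \<phi> (winv s) y" using phi_Cons[OF Cons.prems(1,3)] by (simp add: y_def)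
  have wL: "w \<in> carrier (free_group L)" unfolding w_def by (rule wmult_carrier[OF c(1) Cons.prems(2)])
  have yw: "y \<in> U w" "\<phi> (winv w) y = \<phi> (winv t) (\<phi> (winv s) y)"
    using Cons.IH[OF c(1) Cons.prems(2) y] Cons.prems(4) e by (simp_all add: w_def)
  have "x \<in> U (reduced_Cons a w) \<and> \<phi> (winv (reduced_Cons a w)) x = \<phi> (winv w) y"
  proof (cases w)
    case Nil
    then show ?thesis
      using x letter_topspace[OF c(2) x] by (simp add: y_def phi_Nil)
  next
    case (Cons b v)
    show ?thesis
    proof (cases "b = flip_letter a")
      case True
      have bv: "b # v \<in> carrier (free_group L)" using wL Cons by simp
      have "\<phi> [flip_letter b] y \<in> U v" "\<phi> (winv (b # v)) y = \<phi> (winv v) (\<phi> [flip_letter b] y)"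
        using yw(1) U_Cons[OF bv] phi_Cons[OF bv] Cons by auto
      moreover have "\<phi> [flip_letter b] y = x" using letter_inverse[OF c(2) x] True by (simp add: y_def)
      ultimately show ?thesis using True Cons by simp
    next
      case False
      have "fg_reduced (reduced_Cons a w)" using wL by (intro fg_reduced_reduced_Cons) (simp add: free_group_def)
      then have "a # w \<in> carrier (free_group L)" using wL c(2) False Cons by (simp add: free_group_def)
      then show ?thesis
        using U_Cons[of a w x] phi_Cons[of a w x] x yw(1) False Cons by (simp add: y_def)
    qed
  qed
  then show ?case unfolding e yw(2)[symmetric] by (simp add: w_def)
qed

text \<open>The inverse of \<open>a # t\<close> is the product of \<open>winv t\<close> with the
  single letter \<open>flip_letter a\<close>, reduced already, so \<open>phi_mult\<close> yields the
  step.\<close>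

lemma phi_inverse:
  "t \<in> carrier (free_group L) \<Longrightarrow> x \<in> U t \<Longrightarrow> \<phi> (winv t) x \<in> U (winv t) \<and> \<phi> t (\<phi> (winv t) x) = x"
proof (induction t arbitrary: x)
  case Nil
  then show ?case by (simp add: U_Nil phi_Nil)
next
  case (Cons a t)
  note c = carrier_ConsD[OF Cons.prems(1)]
  define y where "y = \<phi> [flip_letter a] x"
  define z where "z = \<phi> (winv t) y"
  have x: "x \<in> U [a]" and y: "y \<in> U t" using Cons.prems(2) U_Cons[OF Cons.prems(1)] by (auto simp: y_def)
  have z: "z \<in> U (winv t)" "\<phi> t z = y" using Cons.IH[OF c(1) y] by (simp_all add: z_def)
  have fl: "[flip_letter a] \<in> carrier (free_group L)" using c(2) by (simp add: free_group_def fg_reduced_def)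
  have w: "wmult (winv t) [flip_letter a] = winv (a # t)"
  proof -
    have "fg_reduced (winv (a # t))" by (rule fg_reduced_inverse[OF c(3)])
    from foldr_reduced_Cons_Nil[OF this] show ?thesis by simp
  qed
  have y': "y \<in> U [flip_letter a]" unfolding y_def by (rule letter_maps[OF c(2) x])
  have "z \<in> U (wmult (winv t) [flip_letter a]) \<and>
      \<phi> (winv (wmult (winv t) [flip_letter a])) z = \<phi> (winv [flip_letter a]) (\<phi> (winv (winv t)) z)"
    by (rule phi_mult[OF winv_carrier[OF c(1)] fl z(1)]) (simp only: winv_winv z(2) y')
  then have "z \<in> U (winv (a # t)) \<and> \<phi> (a # t) z = \<phi> [a] y"
    unfolding w winv_winv z(2) by simp
  moreover have "\<phi> [a] y = x" unfolding y_def by (rule letter_inverse[OF c(2) x])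
  ultimately show ?case using phi_Cons[OF Cons.prems] by (simp add: y_def z_def)
qed

lemma partial_dynamical_system: "partial_dynamical_system (free_group L) X U \<phi>"
proof -
  interpret G: group "free_group L" by (rule group_free_group)
  show ?thesis
  proof
    show "Hausdorff_space X" by (rule Hausdorff)
    show "U \<one>\<^bsub>free_group L\<^esub> = topspace X" by (simp add: free_group_def U_Nil)
    show "\<phi> \<one>\<^bsub>free_group L\<^esub> x = x" if "x \<in> topspace X" for x
      using phi_Nil[OF that] by (simp add: free_group_def)
    fix t assume t: "t \<in> carrier (free_group L)"
    note i = inv_free_group[OF t]
    show "openin X (U t)" by (rule U_open[OF t])
    show "continuous_map (subtopology X (U t)) X (\<phi> (inv\<^bsub>free_group L\<^esub> t))"
      unfolding i by (rule phi_continuous[OF t])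
    show "\<phi> (inv\<^bsub>free_group L\<^esub> t) x \<in> U (inv\<^bsub>free_group L\<^esub> t)" if "x \<in> U t" for x
      unfolding i using phi_inverse[OF t that] by blast
    show "\<phi> t (\<phi> (inv\<^bsub>free_group L\<^esub> t) x) = x" if "x \<in> U t" for x
      unfolding i using phi_inverse[OF t that] by blast
    fix s x assume s: "s \<in> carrier (free_group L)"
    assume x: "x \<in> U s" "\<phi> (inv\<^bsub>free_group L\<^esub> s) x \<in> U t"
    have "x \<in> U (wmult s t)"
      using phi_mult[OF s t x(1)] x(2) unfolding inv_free_group[OF s] by blast
    then show "x \<in> U (s \<otimes>\<^bsub>free_group L\<^esub> t)" by (simp add: free_group_def)
  qed
qed

end

section \<open>Compactness by finite approximation\<close>

text \<open>A point of \<open>M\<close> is sent to its pattern of memberships in a power of the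
  two-point discrete space. The hypothesis \<open>limit\<close> says that the set of patterns is
  closed, hence compact by Tychonoff. By the hypothesis \<open>sub\<close>, open sets are determined
  near a point of \<open>M\<close> by finitely many memberships, and so compactness returns to
  \<open>M\<close>.\<close>

lemma compactin_finite_approximation:
  fixes \<Phi> :: "'i \<Rightarrow> 'x set"
  assumes M: "M \<subseteq> \<Union>\<S>"
    and sub: "\<And>S. S \<in> \<S> \<Longrightarrow> \<exists>i\<in>I. S \<inter> M = \<Phi> i \<inter> M \<or> S \<inter> M = M - \<Phi> i"
    and limit: "\<And>\<xi>. (\<And>F. finite F \<Longrightarrow> F \<subseteq> I \<Longrightarrow> \<exists>x\<in>M. \<forall>i\<in>F. \<xi> i \<longleftrightarrow> x \<in> \<Phi> i) \<Longrightarrow>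
      \<exists>x\<in>M. \<forall>i\<in>I. \<xi> i \<longleftrightarrow> x \<in> \<Phi> i"
  shows "compactin (topology_generated_by \<S>) M"
proof -
  define P where "P = product_topology (\<lambda>_::'i. discrete_topology (UNIV :: bool set)) I"
  define \<Psi> where "\<Psi> x = restrict (\<lambda>i. x \<in> \<Phi> i) I" for x
  define V where "V F \<xi> = {\<omega> \<in> topspace P. \<forall>i\<in>F. \<omega> i = \<xi> i}" for F :: "'i set" and \<xi>
  have proj: "openin P {\<omega> \<in> topspace P. \<omega> i = c}" if i: "i \<in> I" for i c
  proof -
    have "continuous_map P (discrete_topology UNIV) (\<lambda>\<omega>. \<omega> i)"
      unfolding P_def by (rule continuous_map_product_projection[OF i])
    from openin_continuous_map_preimage[OF this, of "{c}"] show ?thesis by simp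
  qed
  have V: "openin P (V F \<xi>)" if "finite F" "F \<subseteq> I" for F \<xi>
    using that
  proof (induction F rule: finite_induct)
    case (insert i F)
    have "V (insert i F) \<xi> = {\<omega> \<in> topspace P. \<omega> i = \<xi> i} \<inter> V F \<xi>" by (auto simp: V_def)
    then show ?case using insert proj[of i "\<xi> i"] openin_Int by simp
  qed (simp add: V_def)
  have \<Psi>P: "\<Psi> x \<in> topspace P" for x by (simp add: \<Psi>_def P_def)
  have "closedin P (\<Psi> ` M)"
    unfolding closedin_def
  proof (intro conjI)
    show "\<Psi> ` M \<subseteq> topspace P" by (rule image_subsetI) (rule \<Psi>P)
    show "openin P (topspace P - \<Psi> ` M)"
    proof (rule iffD2[OF openin_subopen], rule ballI)
      fix \<xi> assume \<xi>: "\<xi> \<in> topspace P - \<Psi> ` M"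
      \<comment> \<open>If every finite part of \<xi> were matched by a point of \<open>M\<close>,
        then \<open>limit\<close> would exhibit \<xi> as the pattern of a point.\<close>
      have "\<exists>F. finite F \<and> F \<subseteq> I \<and> (\<forall>x\<in>M. \<exists>i\<in>F. \<xi> i \<noteq> (x \<in> \<Phi> i))"
      proof (rule ccontr)
        assume "\<not> ?thesis"
        then have n: "\<exists>x\<in>M. \<forall>i\<in>F. \<xi> i \<longleftrightarrow> x \<in> \<Phi> i" if "finite F" "F \<subseteq> I" for F
          using that by meson
        obtain x where x: "x \<in> M" "\<forall>i\<in>I. \<xi> i \<longleftrightarrow> x \<in> \<Phi> i" using limit[OF n] by blast
        have "\<xi> \<in> extensional I" using \<xi> by (simp add: P_def PiE_def)
        then have "\<xi> = \<Psi> x" using x(2) by (auto simp: \<Psi>_def extensional_def fun_eq_iff restrict_def)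
        then show False using \<xi> x(1) by blast
      qed
      then obtain F where F: "finite F" "F \<subseteq> I" "\<forall>x\<in>M. \<exists>i\<in>F. \<xi> i \<noteq> (x \<in> \<Phi> i)"
        by (elim exE conjE)
      have "\<Psi> x \<notin> V F \<xi>" if x: "x \<in> M" for x
      proof -
        obtain i where "i \<in> F" "\<xi> i \<noteq> (x \<in> \<Phi> i)" using bspec[OF F(3) x] by (elim bexE)
        then show ?thesis using F(2) by (auto simp: V_def \<Psi>_def)
      qed
      then have "V F \<xi> \<subseteq> topspace P - \<Psi> ` M" by (auto simp: V_def)
      moreover have "\<xi> \<in> V F \<xi>" using \<xi> by (simp add: V_def)
      ultimately show "\<exists>T. openin P T \<and> \<xi> \<in> T \<and> T \<subseteq> topspace P - \<Psi> ` M"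
        using V[OF F(1,2)] by blast
    qed
  qed
  moreover have "compact_space P"
    unfolding P_def by (simp add: compact_space_product_topology compact_space_discrete_topology)
  ultimately have K: "compactin P (\<Psi> ` M)" by (metis closedin_compact_space)
  \<comment> \<open>This holds for the generating sets with a single index and survives finite
    intersections and arbitrary unions.\<close>
  have basic: "\<exists>F. finite F \<and> F \<subseteq> I \<and> (\<forall>y\<in>M. (\<forall>i\<in>F. y \<in> \<Phi> i \<longleftrightarrow> x \<in> \<Phi> i) \<longrightarrow> y \<in> W)"
    if "generate_topology_on \<S> W" "x \<in> W \<inter> M" for W x
    using that
  proof (induction W rule: generate_topology_on.induct)
    case (Int W W')
    then obtain F F' where "finite F" "F \<subseteq> I" "\<forall>y\<in>M. (\<forall>i\<in>F. y \<in> \<Phi> i \<longleftrightarrow> x \<in> \<Phi> i) \<longrightarrow> y \<in> W"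
      "finite F'" "F' \<subseteq> I" "\<forall>y\<in>M. (\<forall>i\<in>F'. y \<in> \<Phi> i \<longleftrightarrow> x \<in> \<Phi> i) \<longrightarrow> y \<in> W'"
      using Int.IH Int.prems by (metis IntE IntI)
    then show ?case by (intro exI[of _ "F \<union> F'"]) (simp add: ball_Un)
  next
    case (UN K)
    then obtain k where k: "k \<in> K" "x \<in> k \<inter> M" by auto
    obtain F where F: "finite F" "F \<subseteq> I" "\<forall>y\<in>M. (\<forall>i\<in>F. y \<in> \<Phi> i \<longleftrightarrow> x \<in> \<Phi> i) \<longrightarrow> y \<in> k"
      using UN.IH[OF k] by metis
    then show ?case using k(1) by (intro exI[of _ F]) (simp add: Bex_def, metis)
  next
    case (Basis S)
    obtain i where i: "i \<in> I" "S \<inter> M = \<Phi> i \<inter> M \<or> S \<inter> M = M - \<Phi> i" using sub[OF Basis(1)] by metis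
    have "y \<in> S" if "y \<in> M" "y \<in> \<Phi> i \<longleftrightarrow> x \<in> \<Phi> i" for y
      using i(2) Basis(2) that by blast
    then show ?case using i(1) by (intro exI[of _ "{i}"]) simp
  qed auto
  show ?thesis
    unfolding compactin_def
  proof (intro conjI allI impI)
    show "M \<subseteq> topspace (topology_generated_by \<S>)" using M by simp
    fix \<U> assume U: "(\<forall>W\<in>\<U>. openin (topology_generated_by \<S>) W) \<and> M \<subseteq> \<Union>\<U>"
    have "\<exists>W F. W \<in> \<U> \<and> finite F \<and> F \<subseteq> I \<and> (\<forall>y\<in>M. (\<forall>i\<in>F. y \<in> \<Phi> i \<longleftrightarrow> x \<in> \<Phi> i) \<longrightarrow> y \<in> W)"
      if x: "x \<in> M" for x
    proof -
      obtain W where W: "W \<in> \<U>" "x \<in> W" using U x by blast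
      then have "generate_topology_on \<S> W" using U openin_topology_generated_by by blast
      from basic[OF this, of x] show ?thesis using W x by blast
    qed
    then obtain W F where WF: "\<And>x. x \<in> M \<Longrightarrow> W x \<in> \<U> \<and> finite (F x) \<and> F x \<subseteq> I \<and>
        (\<forall>y\<in>M. (\<forall>i\<in>F x. y \<in> \<Phi> i \<longleftrightarrow> x \<in> \<Phi> i) \<longrightarrow> y \<in> W x)" by metis
    have cov: "\<Psi> ` M \<subseteq> \<Union>((\<lambda>x. V (F x) (\<Psi> x)) ` M)" by (auto simp: V_def \<Psi>P)
    have op: "openin P T" if T: "T \<in> (\<lambda>x. V (F x) (\<Psi> x)) ` M" for T
    proof -
      obtain x where x: "x \<in> M" "T = V (F x) (\<Psi> x)" using T by auto
      show ?thesis unfolding x(2) by (rule V) (use WF[OF x(1)] in auto)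
    qed
    have "\<exists>\<F>. finite \<F> \<and> \<F> \<subseteq> (\<lambda>x. V (F x) (\<Psi> x)) ` M \<and> \<Psi> ` M \<subseteq> \<Union>\<F>"
      by (rule compactinD[OF K _ cov]) (rule op)
    then obtain \<F> where F: "finite \<F>" "\<F> \<subseteq> (\<lambda>x. V (F x) (\<Psi> x)) ` M" "\<Psi> ` M \<subseteq> \<Union>\<F>"
      by (elim exE conjE)
    obtain N where N: "N \<subseteq> M" "finite N" "\<F> = (\<lambda>x. V (F x) (\<Psi> x)) ` N"
      using finite_subset_image[OF F(1,2)] by auto
    have "M \<subseteq> \<Union>(W ` N)"
    proof
      fix y assume y: "y \<in> M"
      then obtain x where x: "x \<in> N" "\<Psi> y \<in> V (F x) (\<Psi> x)" using F(3) unfolding N(3) by auto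
      have wf: "F x \<subseteq> I" "\<forall>y\<in>M. (\<forall>i\<in>F x. y \<in> \<Phi> i \<longleftrightarrow> x \<in> \<Phi> i) \<longrightarrow> y \<in> W x"
        using WF[of x] x(1) N(1) by auto
      have "y \<in> \<Phi> i \<longleftrightarrow> x \<in> \<Phi> i" if i: "i \<in> F x" for i
      proof -
        have "\<Psi> y i = \<Psi> x i" using x(2) i by (simp add: V_def)
        then show ?thesis using subsetD[OF wf(1) i] by (simp add: \<Psi>_def)
      qed
      then have "y \<in> W x" using wf(2) y by simp
      then show "y \<in> \<Union>(W ` N)" using x(1) by auto
    qed
    then show "\<exists>\<F>. finite \<F> \<and> \<F> \<subseteq> \<U> \<and> M \<subseteq> \<Union>\<F>"
      using N WF by (intro exI[of _ "W ` N"]) auto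
  qed
qed

section \<open>Ultrafilters in generalized Boolean algebras\<close>

context
  fixes A B C :: "'b::generalized_boolean_algebra"
begin

lemma gba_inf_bot: "inf bot A = bot" "inf A bot = bot"
  by (simp_all add: inf_absorb1 inf_absorb2)

lemma gba_diff_le: "A - B \<le> A"
  by (metis sup_inf_diff sup_ge2)

lemma gba_inf_diff: "inf B (A - B) = bot"
proof -
  have "inf B (A - B) = inf B (inf A (A - B))" using gba_diff_le by (simp add: inf_absorb2)
  also have "\<dots> = inf (inf A B) (A - B)" by (simp add: inf.assoc inf.left_commute)
  finally show ?thesis by (simp add: inf_inf_diff)
qed

lemma gba_le_diff:
  assumes "inf C B = bot" "C \<le> A" shows "C \<le> A - B"
proof -
  have "C = inf C (sup (inf A B) (A - B))" using assms(2) by (simp add: sup_inf_diff inf_absorb1)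
  also have "\<dots> = sup (inf C (inf A B)) (inf C (A - B))" by (rule inf_sup_distrib1)
  also have "inf C (inf A B) = bot"
    using assms(1) by (metis gba_inf_bot(2) inf.left_commute)
  finally show ?thesis by (metis inf_le2 bot_least sup_absorb2)
qed

end

lemma ideal_downward: "ba_ideal J \<Longrightarrow> A \<in> J \<Longrightarrow> B \<le> A \<Longrightarrow> B \<in> J"
  unfolding ba_ideal_def by (metis inf_absorb2)

lemma ideal_inf: "ba_ideal J \<Longrightarrow> A \<in> J \<Longrightarrow> inf A B \<in> J" "ba_ideal J \<Longrightarrow> A \<in> J \<Longrightarrow> inf B A \<in> J"
  by (meson ideal_downward inf_le1 inf_le2)+

lemma ideal_UNIV: "ba_ideal UNIV"
  by (simp add: ba_ideal_def)

text \<open>There is no unit, so maximality is expressed by relative complements in members of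
  \<open>F\<close>. If \<open>B\<close> is not in \<open>F\<close>, some \<open>C\<close> in
  \<open>F\<close> is disjoint from \<open>B\<close>, since otherwise \<open>F\<close> and
  \<open>B\<close> would generate a larger filter; then \<open>inf C A\<close> lies below
  \<open>A - B\<close>.\<close>

lemma ultrafilters_iff:
  assumes J: "ba_ideal J"
  shows "F \<in> ba_ultrafilters J \<longleftrightarrow> F \<subseteq> J \<and> F \<noteq> {} \<and> bot \<notin> F \<and> (\<forall>A\<in>F. \<forall>B\<in>J. A \<le> B \<longrightarrow> B \<in> F) \<and>
     (\<forall>A\<in>F. \<forall>B\<in>F. inf A B \<in> F) \<and> (\<forall>A\<in>F. \<forall>B\<in>J. B \<in> F \<or> A - B \<in> F)" (is "_ \<longleftrightarrow> ?R")
proof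
  assume F: "F \<in> ba_ultrafilters J"
  then have f: "F \<subseteq> J" "F \<noteq> {}" "bot \<notin> F" "\<And>A B. A \<in> F \<Longrightarrow> B \<in> J \<Longrightarrow> A \<le> B \<Longrightarrow> B \<in> F"
    "\<And>A B. A \<in> F \<Longrightarrow> B \<in> F \<Longrightarrow> inf A B \<in> F"
    and max: "\<And>G. ba_filter J G \<Longrightarrow> F \<subseteq> G \<Longrightarrow> G = F"
    by (auto simp: ba_ultrafilters_def ba_filter_def)
  have "A - B \<in> F" if A: "A \<in> F" and B: "B \<in> J" "B \<notin> F" for A B
  proof -
    have "\<exists>C\<in>F. inf C B = bot"
    proof (rule ccontr)
      assume n: "\<not> ?thesis"
      \<comment> \<open>The filter in \<open>J\<close> generated by \<open>F\<close> and
        \<open>B\<close>.\<close>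
      define G where "G = {D \<in> J. \<exists>C\<in>F. inf C B \<le> D}"
      have "ba_filter J G"
        unfolding ba_filter_def
      proof (intro conjI ballI impI)
        show "G \<subseteq> J" by (auto simp: G_def)
        have "B \<in> G" using A B(1) by (auto simp: G_def intro: bexI[of _ A])
        then show "G \<noteq> {}" by auto
        show "bot \<notin> G" using n by (auto simp: G_def bot.extremum_unique)
        show "E \<in> G" if "D \<in> G" "E \<in> J" "D \<le> E" for D E using that by (auto simp: G_def intro: order_trans)
        show "inf D E \<in> G" if DE: "D \<in> G" "E \<in> G" for D E
        proof -
          obtain C C' where C: "C \<in> F" "C' \<in> F" "inf C B \<le> D" "inf C' B \<le> E" "D \<in> J"
            using DE by (auto simp: G_def)
          then have "inf (inf C C') B \<le> inf D E"
            using inf_mono[OF inf_le1[of C C'] order_refl[of B]] inf_mono[OF inf_le2[of C C'] order_refl[of B]]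
            by (meson inf.boundedI order_trans)
          then show ?thesis using C f(5) ideal_inf[OF J] by (auto simp: G_def)
        qed
      qed
      moreover have "F \<subseteq> G" using f(1) by (auto simp: G_def intro: inf_le1)
      ultimately have "G = F" by (rule max)
      moreover have "B \<in> G" using A B by (auto simp: G_def)
      ultimately show False using B by simp
    qed
    then obtain C where C: "C \<in> F" "inf C B = bot" by blast
    have "inf (inf C A) B = bot"
      using C(2) by (metis gba_inf_bot(1) inf.assoc inf.commute)
    then have "inf C A \<le> A - B" by (rule gba_le_diff) simp
    then show ?thesis
      using f(4)[OF f(5)[OF C(1) A]] ideal_downward[OF J _ gba_diff_le] A f(1) by blast
  qed
  then show ?R using f(1-3) f(4,5) by auto
next
  assume R: ?R
  have "G = F" if G: "ba_filter J G" "F \<subseteq> G" for G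
  proof
    show "G \<subseteq> F"
    proof
      fix D assume D: "D \<in> G"
      obtain A where A: "A \<in> F" using R by auto
      have "A - D \<notin> F"
      proof
        assume "A - D \<in> F"
        then have "inf D (A - D) \<in> G" using G D by (auto simp: ba_filter_def)
        then show False using G(1) by (simp add: gba_inf_diff ba_filter_def)
      qed
      moreover have "D \<in> J" using D G(1) by (auto simp: ba_filter_def)
      ultimately show "D \<in> F" using R A by auto
    qed
  qed (rule G(2))
  then show "F \<in> ba_ultrafilters J" using R by (simp add: ba_ultrafilters_def ba_filter_def)
qed

context
  fixes J F assumes J: "ba_ideal J" and F: "F \<in> ba_ultrafilters J"
begin

lemma uf_subset: "F \<subseteq> J" and uf_nonempty: "F \<noteq> {}" and uf_bot: "bot \<notin> F"
  and uf_up: "A \<in> F \<Longrightarrow> B \<in> J \<Longrightarrow> A \<le> B \<Longrightarrow> B \<in> F"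
  and uf_inf: "A \<in> F \<Longrightarrow> B \<in> F \<Longrightarrow> inf A B \<in> F"
  and uf_prime: "A \<in> F \<Longrightarrow> B \<in> J \<Longrightarrow> B \<in> F \<or> A - B \<in> F"
  using F by (simp_all add: ultrafilters_iff[OF J])

end

lemma action_mono: "ba_action h \<Longrightarrow> A \<le> B \<Longrightarrow> h A \<le> h B"
  unfolding ba_action_def by (metis inf.absorb_iff2 inf.commute)

text \<open>Only non-emptiness can fail for the preimage, which is why the range of an edge may be
  \<open>{}\<close>. With the identity as \<open>h\<close> the lemma restricts an ultrafilter to an
  ideal.\<close>

lemma uf_pullback:
  assumes h: "ba_action h" and J: "ba_ideal J" and K: "ba_ideal K" and v: "v \<in> ba_ultrafilters K"
    and hJ: "h ` J \<subseteq> K" and ne: "{B \<in> J. h B \<in> v} \<noteq> {}"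
  shows "{B \<in> J. h B \<in> v} \<in> ba_ultrafilters J"
  unfolding ultrafilters_iff[OF J]
proof (intro conjI ballI impI)
  have h': "h bot = bot" "h (inf A B) = inf (h A) (h B)" "h (A - B) = h A - h B" for A B
    using h by (simp_all add: ba_action_def)
  show "bot \<notin> {B \<in> J. h B \<in> v}" using uf_bot[OF K v] h' by simp
  show "B \<in> {B \<in> J. h B \<in> v}" if "A \<in> {B \<in> J. h B \<in> v}" "B \<in> J" "A \<le> B" for A B
    using that uf_up[OF K v _ _ action_mono[OF h]] hJ by blast
  show "inf A B \<in> {B \<in> J. h B \<in> v}" if "A \<in> {B \<in> J. h B \<in> v}" "B \<in> {B \<in> J. h B \<in> v}" for A B
    using that uf_inf[OF K v] ideal_inf[OF J] by (simp add: h')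
  show "B \<in> {B \<in> J. h B \<in> v} \<or> A - B \<in> {B \<in> J. h B \<in> v}" if "A \<in> {B \<in> J. h B \<in> v}" "B \<in> J" for A B
    using that uf_prime[OF K v, of "h A" "h B"] hJ ideal_downward[OF J _ gba_diff_le] by (auto simp: h')
qed (use ne in auto)

lemma uf_extend:
  assumes J: "ba_ideal J" and F: "F \<in> ba_ultrafilters J"
  shows "{B. \<exists>A\<in>F. A \<le> B} \<in> ba_ultrafilters UNIV"
  unfolding ultrafilters_iff[OF ideal_UNIV]
proof (intro conjI ballI impI)
  show "{B. \<exists>A\<in>F. A \<le> B} \<noteq> {}" using uf_nonempty[OF J F] by blast
  show "bot \<notin> {B. \<exists>A\<in>F. A \<le> B}" using uf_bot[OF J F] by (auto simp: bot.extremum_unique)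
  show "C \<in> {B. \<exists>A\<in>F. A \<le> B}" if "B \<in> {B. \<exists>A\<in>F. A \<le> B}" "B \<le> C" for B C
    using that order_trans by blast
  show "inf B C \<in> {B. \<exists>A\<in>F. A \<le> B}" if "B \<in> {B. \<exists>A\<in>F. A \<le> B}" "C \<in> {B. \<exists>A\<in>F. A \<le> B}" for B C
    using that uf_inf[OF J F] inf_mono by blast
  show "C \<in> {B. \<exists>A\<in>F. A \<le> B} \<or> B - C \<in> {B. \<exists>A\<in>F. A \<le> B}" if B: "B \<in> {B. \<exists>A\<in>F. A \<le> B}" for B C
  proof -
    obtain A where A: "A \<in> F" "A \<le> B" using B by blast
    \<comment> \<open>\<open>C\<close> need not lie in \<open>J\<close>, so the prime property of
      \<open>F\<close> is applied to \<open>inf A C\<close>.\<close>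
    then have "inf A C \<in> J" using uf_subset[OF J F] ideal_inf[OF J] by blast
    from uf_prime[OF J F A(1) this] show ?thesis
    proof
      assume "inf A C \<in> F"
      then show ?thesis using inf_le2 by blast
    next
      assume D: "A - inf A C \<in> F"
      have "inf (A - inf A C) C = inf (inf A C) (A - inf A C)"
        using gba_diff_le[of A "inf A C"] by (metis inf.assoc inf.commute inf_absorb1)
      then have "inf (A - inf A C) C = bot" by (simp add: gba_inf_diff)
      then have "A - inf A C \<le> B - C"
        by (rule gba_le_diff) (use A(2) gba_diff_le order_trans in blast)
      then show ?thesis using D by blast
    qed
  qed
qed simp

lemma uf_extend_iff:
  assumes J: "ba_ideal J" and F: "F \<in> ba_ultrafilters J" and B: "B \<in> J"
  shows "(\<exists>A\<in>F. A \<le> B) \<longleftrightarrow> B \<in> F"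
  using uf_up[OF J F _ B] by blast

lemma openin_ultrafilter_topology: "A \<in> J \<Longrightarrow> openin (ultrafilter_topology J) {F \<in> ba_ultrafilters J. A \<in> F}"
  unfolding ultrafilter_topology_def by (rule topology_generated_by_Basis) blast

lemma topspace_ultrafilter_topology:
  assumes J: "ba_ideal J" shows "topspace (ultrafilter_topology J) = ba_ultrafilters J"
proof (intro equalityI subsetI)
  fix F assume F: "F \<in> ba_ultrafilters J"
  obtain A where "A \<in> F" using uf_nonempty[OF J F] by auto
  then show "F \<in> topspace (ultrafilter_topology J)"
    using F uf_subset[OF J F] by (auto simp: ultrafilter_topology_def)
qed (auto simp: ultrafilter_topology_def)

text \<open>The generating sets form a basis, as those of \<open>A\<close> and \<open>A'\<close>
  meet in the one of \<open>inf A A'\<close>.\<close>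

lemma ultrafilter_topology_basis:
  assumes J: "ba_ideal J" and W: "openin (ultrafilter_topology J) W" and F: "F \<in> W"
  obtains A where "A \<in> F" "{G \<in> ba_ultrafilters J. A \<in> G} \<subseteq> W"
proof -
  have "generate_topology_on {{F \<in> ba_ultrafilters J. A \<in> F} | A. A \<in> J} W"
    using W unfolding ultrafilter_topology_def by (rule openin_topology_generated_by)
  then have "\<exists>A\<in>F. {G \<in> ba_ultrafilters J. A \<in> G} \<subseteq> W"
    using F
  proof (induction rule: generate_topology_on.induct)
    case (Int W W')
    then obtain A A' where A: "A \<in> F" "{G \<in> ba_ultrafilters J. A \<in> G} \<subseteq> W"
      "A' \<in> F" "{G \<in> ba_ultrafilters J. A' \<in> G} \<subseteq> W'" by blast
    then have uf: "F \<in> ba_ultrafilters J"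
      using Int openin_subset[of "ultrafilter_topology J" W]
      unfolding topspace_ultrafilter_topology[OF J]
      by (auto simp: ultrafilter_topology_def openin_topology_generated_by_iff)
    have AJ: "A \<in> J" "A' \<in> J" using A uf_subset[OF J uf] by auto
    have "A \<in> G \<and> A' \<in> G" if "G \<in> ba_ultrafilters J" "inf A A' \<in> G" for G
      using uf_up[OF J that] AJ by simp
    then show ?case using A uf_inf[OF J uf A(1,3)] by blast
  next
    case (UN K)
    then show ?case by blast
  qed auto
  then show ?thesis using that by blast
qed

lemma Hausdorff_ultrafilter_topology:
  assumes J: "ba_ideal J" shows "Hausdorff_space (ultrafilter_topology J)"
proof -
  have 1: "\<exists>A B. A \<in> F \<and> B \<in> G \<and> inf A B = bot \<and> A \<in> J \<and> B \<in> J"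
    if F: "F \<in> ba_ultrafilters J" and G: "G \<in> ba_ultrafilters J" and A: "A \<in> F" "A \<notin> G" for F G A
  proof -
    \<comment> \<open>\<open>B\<close> takes the place of a unit: \<open>B - A\<close> is disjoint
      from \<open>A\<close> and lies in \<open>G\<close>.\<close>
    obtain B where B: "B \<in> G" using uf_nonempty[OF J G] by blast
    have "A \<in> J" using A uf_subset[OF J F] by blast
    then have "B - A \<in> G" using uf_prime[OF J G B] A(2) by blast
    then show ?thesis using A(1) \<open>A \<in> J\<close> gba_inf_diff uf_subset[OF J G] by blast
  qed
  have sep: "\<exists>A B. A \<in> F \<and> B \<in> G \<and> inf A B = bot \<and> A \<in> J \<and> B \<in> J"
    if F: "F \<in> ba_ultrafilters J" and G: "G \<in> ba_ultrafilters J" and FG: "F \<noteq> G" for F G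
  proof (cases "F \<subseteq> G")
    case False
    then show ?thesis using 1[OF F G] by blast
  next
    case True
    then obtain A where "A \<in> G" "A \<notin> F" using FG by blast
    from 1[OF G F this] show ?thesis by (metis inf.commute)
  qed
  have disj: "disjnt {H \<in> ba_ultrafilters J. A \<in> H} {H \<in> ba_ultrafilters J. B \<in> H}" if AB: "inf A B = bot" for A B
  proof -
    have "\<not> (A \<in> H \<and> B \<in> H)" if H: "H \<in> ba_ultrafilters J" for H
      using uf_inf[OF J H, of A B] uf_bot[OF J H] AB by auto
    then show ?thesis by (auto simp: disjnt_def)
  qed
  show ?thesis
    unfolding Hausdorff_space_def topspace_ultrafilter_topology[OF J]
  proof (intro allI impI; elim conjE)
    fix F G assume FG: "F \<in> ba_ultrafilters J" "G \<in> ba_ultrafilters J" "F \<noteq> G"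
    obtain A B where AB: "A \<in> F" "B \<in> G" "inf A B = bot" "A \<in> J" "B \<in> J" using sep[OF FG] by blast
    show "\<exists>U V. openin (ultrafilter_topology J) U \<and> openin (ultrafilter_topology J) V \<and> F \<in> U \<and> G \<in> V \<and> disjnt U V"
      using openin_ultrafilter_topology[OF AB(4)] openin_ultrafilter_topology[OF AB(5)] disj[OF AB(3)] FG AB(1,2)
      by blast
  qed
qed

text \<open>Each condition in \<open>ultrafilters_iff\<close> on members of the filter concerns at
  most three elements of \<open>J\<close>, so it passes to patterns that agree with an ultrafilter
  on every finite set. Keeping \<open>A\<close> in the ultrafilters prevents the limit from being
  empty.\<close>

lemma compactin_ultrafilter_topology:
  assumes J: "ba_ideal J" and A: "A \<in> J"
  shows "compactin (ultrafilter_topology J) {F \<in> ba_ultrafilters J. A \<in> F}"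
  unfolding ultrafilter_topology_def
proof (rule compactin_finite_approximation[where I = J and \<Phi> = "\<lambda>B. {F \<in> ba_ultrafilters J. B \<in> F}"])
  let ?M = "{F \<in> ba_ultrafilters J. A \<in> F}"
  show "?M \<subseteq> \<Union>{{F \<in> ba_ultrafilters J. A \<in> F} | A. A \<in> J}" using A by blast
  show "\<exists>i\<in>J. S \<inter> ?M = {F \<in> ba_ultrafilters J. i \<in> F} \<inter> ?M \<or> S \<inter> ?M = ?M - {F \<in> ba_ultrafilters J. i \<in> F}"
    if "S \<in> {{F \<in> ba_ultrafilters J. A \<in> F} | A. A \<in> J}" for S using that by blast
  fix \<xi> assume "\<And>F. finite F \<Longrightarrow> F \<subseteq> J \<Longrightarrow> \<exists>x\<in>?M. \<forall>i\<in>F. \<xi> i = (x \<in> {F \<in> ba_ultrafilters J. i \<in> F})"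
  then have \<xi>: "\<exists>x\<in>ba_ultrafilters J. A \<in> x \<and> (\<forall>i\<in>F. \<xi> i \<longleftrightarrow> i \<in> x)" if "finite F" "F \<subseteq> J" for F
    using that by fastforce
  have "{B \<in> J. \<xi> B} \<in> ba_ultrafilters J"
    unfolding ultrafilters_iff[OF J]
  proof (intro conjI ballI impI)
    show "{B \<in> J. \<xi> B} \<noteq> {}" using \<xi>[of "{A}"] A by auto
    show "bot \<notin> {B \<in> J. \<xi> B}"
    proof
      assume "bot \<in> {B \<in> J. \<xi> B}"
      then obtain x where "x \<in> ba_ultrafilters J" "bot \<in> x" using \<xi>[of "{bot}"] by auto
      then show False using uf_bot[OF J] by simp
    qed
    fix B assume B: "B \<in> {B \<in> J. \<xi> B}"
    show "C \<in> {B \<in> J. \<xi> B}" if C: "C \<in> J" "B \<le> C" for C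
    proof -
      obtain x where x: "x \<in> ba_ultrafilters J" "B \<in> x" "\<xi> C \<longleftrightarrow> C \<in> x" using \<xi>[of "{B, C}"] B C by auto
      then show ?thesis using uf_up[OF J x(1) x(2) C] C by simp
    qed
    show "inf B C \<in> {B \<in> J. \<xi> B}" if C: "C \<in> {B \<in> J. \<xi> B}" for C
    proof -
      have "inf B C \<in> J" using B ideal_inf(1)[OF J] by simp
      then obtain x where x: "x \<in> ba_ultrafilters J" "B \<in> x" "C \<in> x" "\<xi> (inf B C) \<longleftrightarrow> inf B C \<in> x"
        using \<xi>[of "{B, C, inf B C}"] B C by auto
      then show ?thesis using uf_inf[OF J x(1-3)] \<open>inf B C \<in> J\<close> by simp
    qed
    show "C \<in> {B \<in> J. \<xi> B} \<or> B - C \<in> {B \<in> J. \<xi> B}" if C: "C \<in> J" for C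
    proof -
      have "B - C \<in> J" using B ideal_downward[OF J _ gba_diff_le] by simp
      then obtain x where x: "x \<in> ba_ultrafilters J" "B \<in> x" "\<xi> C \<longleftrightarrow> C \<in> x" "\<xi> (B - C) \<longleftrightarrow> B - C \<in> x"
        using \<xi>[of "{B, C, B - C}"] B C by auto
      then show ?thesis using uf_prime[OF J x(1,2) C] \<open>B - C \<in> J\<close> C by auto
    qed
  qed auto
  moreover have "\<xi> A" using \<xi>[of "{A}"] A by auto
  ultimately show "\<exists>x\<in>?M. \<forall>i\<in>J. \<xi> i = (x \<in> {F \<in> ba_ultrafilters J. i \<in> F})"
    using A by (intro bexI[of _ "{B \<in> J. \<xi> B}"]) auto
qed

section \<open>Boundary paths\<close>

abbreviation path_Cons :: "('l, 'b) edge \<Rightarrow> ('l, 'b) path \<Rightarrow> ('l, 'b) path" where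
  "path_Cons e \<mu> \<equiv> path_prepend [e] \<mu>"

lemma path_take_Cons: "path_take (Suc n) (path_Cons e \<mu>) = e # path_take n \<mu>"
  by (cases \<mu>) (simp_all add: map_upt_Suc del: upt_Suc)

lemma path_take_0 [simp]: "path_take 0 \<mu> = []"
  by (cases \<mu>) simp_all

lemma path_length_Cons: "path_length (path_Cons e \<mu>) = eSuc (path_length \<mu>)"
  by (cases \<mu>) (simp_all add: eSuc_enat zero_enat_def)

lemma path_starts_Nil [simp]: "path_starts \<mu> []"
  by (simp add: path_starts_def)

lemma path_starts_Vertex [simp]: "\<not> path_starts (Vertex v) (a # \<alpha>)"
  by (simp add: path_starts_def)

lemma path_starts_Cons: "path_starts (path_Cons e \<mu>) (a # \<alpha>) \<longleftrightarrow> fst e = a \<and> path_starts \<mu> \<alpha>"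
  by (simp add: path_starts_def path_take_Cons)

context gen_boolean_dyn_system
begin

lemma theta_in_ideal: "a \<in> L \<Longrightarrow> \<theta> a B \<in> \<I> a"
  using range_subset[of a] by blast

lemma word_action_Nil [simp]: "word_action [] B = B"
  and word_action_Cons [simp]: "word_action (a # \<alpha>) B = word_action \<alpha> (\<theta> a B)"
  by (simp_all add: word_action_def)

lemma word_action_action: "\<alpha> \<in> lists L \<Longrightarrow> ba_action (word_action \<alpha>)"
proof (induction \<alpha>)
  case Nil
  then show ?case by (simp add: ba_action_def)
next
  case (Cons a \<alpha>)
  then show ?case using action[of a] by (simp add: ba_action_def)
qed

lemma word_ideal_ideal: "\<alpha> \<in> lists L \<Longrightarrow> ba_ideal (word_ideal \<alpha>)"
proof (cases \<alpha>)
  case Nil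
  then show ?thesis by (simp add: ideal_UNIV)
next
  case (Cons a \<beta>)
  assume "\<alpha> \<in> lists L"
  then have a: "a \<in> L" and h: "ba_action (word_action \<beta>)" using Cons word_action_action by auto
  show ?thesis
    unfolding ba_ideal_def
  proof (intro conjI ballI allI)
    obtain B where "B \<in> \<I> a" using ideal[OF a] by (auto simp: ba_ideal_def)
    then show "word_ideal \<alpha> \<noteq> {}" using Cons by auto
    fix A assume "A \<in> word_ideal \<alpha>"
    then obtain B where B: "B \<in> \<I> a" "A \<le> word_action \<beta> B" using Cons by auto
    show "inf A C \<in> word_ideal \<alpha>" for C using B Cons le_infI1 by auto
    fix A' assume "A' \<in> word_ideal \<alpha>"
    then obtain B' where B': "B' \<in> \<I> a" "A' \<le> word_action \<beta> B'" using Cons by auto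
    have "sup A A' \<le> word_action \<beta> (sup B B')"
      using sup_mono[OF B(2) B'(2)] h by (simp add: ba_action_def)
    moreover have "sup B B' \<in> \<I> a" using ideal[OF a] B(1) B'(1) by (simp add: ba_ideal_def)
    ultimately show "sup A A' \<in> word_ideal \<alpha>" using Cons by auto
  qed
qed

lemma word_ideal_single: "a \<in> L \<Longrightarrow> word_ideal [a] = \<I> a"
  using ideal_downward[OF ideal[of a]] by auto

text \<open>An image under \<open>\<theta> b\<close> lies in \<open>\<I> b\<close> by
  \<open>range_subset\<close>, so a letter in front can only shrink the ideal of a word.\<close>

lemma word_ideal_Cons_subset:
  assumes "a # \<alpha> \<in> lists L" "A \<in> word_ideal (a # \<alpha>)" shows "A \<in> word_ideal \<alpha>"
proof (cases \<alpha>)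
  case (Cons b \<beta>)
  obtain B where B: "B \<in> \<I> a" "A \<le> word_action \<alpha> B" using assms(2) by auto
  have "b \<in> L" using assms(1) Cons by simp
  then have "\<theta> b B \<in> \<I> b" by (rule theta_in_ideal)
  then show ?thesis using B Cons by auto
qed simp

lemma word_ideal_Cons_inf: "B \<in> \<I> a \<Longrightarrow> inf A (word_action \<alpha> B) \<in> word_ideal (a # \<alpha>)"
  by (auto intro: bexI[of _ B])

section \<open>Vertices, edges and extensions by one edge\<close>

lemma E0_nonempty: "v \<in> E0 \<Longrightarrow> v \<noteq> {}"
  unfolding E0_def by (rule uf_nonempty[OF ideal_UNIV])

text \<open>Having a member distinguishes ultrafilters from the point \<open>{}\<close>. The filter
  laws below therefore hold on all of \<open>F0\<close>, and ranges of paths need no case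
  distinction.\<close>

lemma F0_in_E0: "v \<in> F0 \<Longrightarrow> A \<in> v \<Longrightarrow> v \<in> E0"
  by (auto simp: F0_def)

lemma F0_up: "v \<in> F0 \<Longrightarrow> A \<in> v \<Longrightarrow> A \<le> B \<Longrightarrow> B \<in> v"
  using F0_in_E0[of v A] unfolding E0_def by (rule uf_up[OF ideal_UNIV]) simp_all

lemma F0_inf:
  assumes v: "v \<in> F0" shows "inf A B \<in> v \<longleftrightarrow> A \<in> v \<and> B \<in> v"
proof
  assume "inf A B \<in> v"
  then show "A \<in> v \<and> B \<in> v" using F0_up[OF v] inf_le1 inf_le2 by metis
next
  assume "A \<in> v \<and> B \<in> v"
  then have AB: "A \<in> v" "B \<in> v" by simp_all
  from F0_in_E0[OF v AB(1)] show "inf A B \<in> v" unfolding E0_def by (rule uf_inf[OF ideal_UNIV _ AB])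
qed

lemma F0_bot:
  assumes v: "v \<in> F0" shows "bot \<notin> v"
proof
  assume b: "bot \<in> v"
  from F0_in_E0[OF v b] show False unfolding E0_def using uf_bot[OF ideal_UNIV] b by metis
qed

lemma E0_F0: "v \<in> E0 \<Longrightarrow> v \<in> F0"
  by (simp add: F0_def)

lemma E1_iff: "e \<in> E1 \<longleftrightarrow> fst e \<in> L \<and> snd e \<in> ba_ultrafilters (\<I> (fst e))"
  by (cases e) (simp add: E1_def)

lemma edge_d_E0: "e \<in> E1 \<Longrightarrow> edge_d e \<in> E0"
  unfolding edge_d_def E0_def using uf_extend[OF ideal, of "fst e" "snd e"] by (simp add: E1_iff)

lemma edge_d_iff: "e \<in> E1 \<Longrightarrow> B \<in> \<I> (fst e) \<Longrightarrow> B \<in> edge_d e \<longleftrightarrow> B \<in> snd e"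
  unfolding edge_d_def using uf_extend_iff[OF ideal, of "fst e" "snd e" B] by (simp add: E1_iff)

text \<open>An edge is recovered from its label and \<open>edge_d\<close>, so the ultrafilter of an
  ideal can be traded for an ultrafilter of the whole algebra throughout.\<close>

lemma edge_snd: "e \<in> E1 \<Longrightarrow> snd e = edge_d e \<inter> \<I> (fst e)"
  using edge_d_iff[of e] uf_subset[OF ideal, of "fst e" "snd e"] by (auto simp: E1_iff)

lemma edge_r_iff: "e \<in> E1 \<Longrightarrow> B \<in> edge_r e \<longleftrightarrow> \<theta> (fst e) B \<in> edge_d e"
  using edge_d_iff[of e "\<theta> (fst e) B"] theta_in_ideal[of "fst e" B]
  by (simp add: edge_r_def letter_map_def E1_iff)

lemma edge_nonempty: "e \<in> E1 \<Longrightarrow> \<exists>B. B \<in> \<I> (fst e) \<and> B \<in> edge_d e"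
  using uf_nonempty[OF ideal, of "fst e" "snd e"] edge_snd[of e] by (auto simp: E1_iff)

lemma edge_eqI: "e \<in> E1 \<Longrightarrow> f \<in> E1 \<Longrightarrow> fst e = fst f \<Longrightarrow> edge_d e = edge_d f \<Longrightarrow> e = f"
  using edge_snd[of e] edge_snd[of f] by (simp add: prod_eq_iff)

lemma edge_r_F0: "e \<in> E1 \<Longrightarrow> edge_r e \<in> F0"
proof -
  assume e: "e \<in> E1"
  then have a: "fst e \<in> L" and v: "edge_d e \<in> ba_ultrafilters UNIV"
    using edge_d_E0[OF e] by (simp_all add: E1_iff E0_def)
  have eq: "edge_r e = {B \<in> UNIV. \<theta> (fst e) B \<in> edge_d e}" using edge_r_iff[OF e] by auto
  show ?thesis
    using uf_pullback[OF action[OF a] ideal_UNIV ideal_UNIV v]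
    unfolding eq F0_def E0_def by auto
qed

text \<open>Restricting \<open>v\<close> to the ideal is a pullback along the inclusion. Extending
  again gives back \<open>v\<close>, because \<open>inf\<close> with a member of \<open>v\<close> in
  the ideal moves every member of \<open>v\<close> into the ideal.\<close>

lemma lift_edge:
  assumes a: "a \<in> L" and v: "v \<in> F0" and ne: "v \<inter> \<I> a \<noteq> {}"
  shows "(a, v \<inter> \<I> a) \<in> E1" "edge_d (a, v \<inter> \<I> a) = v"
proof -
  have v': "v \<in> ba_ultrafilters UNIV" using ne F0_in_E0[OF v] by (auto simp: E0_def)
  have "{B \<in> \<I> a. (\<lambda>x. x) B \<in> v} \<in> ba_ultrafilters (\<I> a)"
    by (rule uf_pullback[OF _ ideal[OF a] ideal_UNIV v']) (use ne in \<open>auto simp: ba_action_def\<close>)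
  moreover have "{B \<in> \<I> a. (\<lambda>x. x) B \<in> v} = v \<inter> \<I> a" by auto
  ultimately show "(a, v \<inter> \<I> a) \<in> E1" using a by (simp add: E1_iff)
  obtain C where C: "C \<in> v" "C \<in> \<I> a" using ne by auto
  have "B \<in> edge_d (a, v \<inter> \<I> a)" if "B \<in> v" for B
  proof -
    have "inf B C \<in> v \<inter> \<I> a" using that C F0_inf[OF v] ideal_inf(2)[OF ideal[OF a]] by simp
    then show ?thesis unfolding edge_d_def by (auto intro!: bexI[of _ "inf B C"])
  qed
  moreover have "B \<in> v" if "B \<in> edge_d (a, v \<inter> \<I> a)" for B
    using that F0_up[OF v] by (auto simp: edge_d_def)
  ultimately show "edge_d (a, v \<inter> \<I> a) = v" by auto
qed

lemma En_Cons: "e # es \<in> En (Suc n) \<longleftrightarrow> e \<in> E1 \<and> es \<in> En n \<and> (es \<noteq> [] \<longrightarrow> edge_d e = edge_r (hd es))"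
proof -
  have "(\<forall>i. Suc i < Suc n \<longrightarrow> edge_d ((e # es) ! i) = edge_r ((e # es) ! Suc i)) \<longleftrightarrow>
      (\<forall>i. Suc i < n \<longrightarrow> edge_d (es ! i) = edge_r (es ! Suc i)) \<and> (es \<noteq> [] \<longrightarrow> edge_d e = edge_r (hd es))"
    (is "?l \<longleftrightarrow> ?r") if "length es = n"
  proof
    assume l: ?l
    have "edge_d (es ! i) = edge_r (es ! Suc i)" if "Suc i < n" for i
      using spec[OF l, of "Suc i"] that by simp
    moreover have "edge_d e = edge_r (hd es)" if "es \<noteq> []"
      using spec[OF l, of 0] that \<open>length es = n\<close> by (cases es) auto
    ultimately show ?r by blast
  next
    assume r: ?r
    show ?l
    proof (intro allI impI)
      fix i assume "Suc i < Suc n"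
      then show "edge_d ((e # es) ! i) = edge_r ((e # es) ! Suc i)"
        using r \<open>length es = n\<close> by (cases i; cases es) auto
    qed
  qed
  then show ?thesis unfolding En_def by auto
qed

lemma En_0: "es \<in> En 0 \<longleftrightarrow> es = []"
  by (auto simp: En_def)

lemma Vertex_boundary: "Vertex v \<in> boundary \<longleftrightarrow> v \<in> E0_sg"
  by (auto simp: boundary_def infinite_paths_def finite_paths_def E0_sg_def)

lemma FinPath_boundary:
  "FinPath es \<in> boundary \<longleftrightarrow> es \<noteq> [] \<and> es \<in> En (length es) \<and> edge_d (last es) \<in> E0_sg"
proof -
  have "FinPath es \<in> finite_paths \<longleftrightarrow> es \<noteq> [] \<and> es \<in> En (length es)"
    unfolding finite_paths_def by (auto simp: En_def Suc_le_eq)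
  then show ?thesis by (auto simp: boundary_def infinite_paths_def)
qed

lemma InfPath_boundary: "InfPath f \<in> boundary \<longleftrightarrow> (\<forall>i. f i \<in> E1 \<and> edge_d (f i) = edge_r (f (Suc i)))"
  by (auto simp: boundary_def infinite_paths_def finite_paths_def)

lemma path_r_Cons [simp]: "path_r (path_Cons e \<mu>) = edge_r e"
  by (cases \<mu>) simp_all

lemma Cons_boundary:
  assumes e: "e \<in> E1" and \<mu>: "\<mu> \<in> boundary" and r: "path_r \<mu> = edge_d e"
  shows "path_Cons e \<mu> \<in> boundary"
proof (cases \<mu>)
  case (Vertex v)
  then show ?thesis
    using e \<mu> r En_Cons[of e "[]" 0] by (simp add: FinPath_boundary Vertex_boundary En_0)
next
  case (FinPath es)
  then show ?thesis
    using e \<mu> r En_Cons[of e es "length es"] by (simp add: FinPath_boundary)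
next
  case (InfPath f)
  have "edge_d ((\<lambda>i. if i < 1 then [e] ! i else f (i - 1)) i) = edge_r ((\<lambda>i. if i < 1 then [e] ! i else f (i - 1)) (Suc i))" for i
    using \<mu> r InfPath by (cases i) (simp_all add: InfPath_boundary)
  then show ?thesis using e \<mu> r InfPath by (simp add: InfPath_boundary)
qed

text \<open>The condition on a finite boundary path concerns only its last vertex, which survives
  removal of the first edge; a single edge leaves the vertex \<open>edge_d e\<close>. This is the
  case distinction behind the inductions over words.\<close>

lemma boundary_cases [consumes 1, case_names Vertex Cons]:
  assumes "\<mu> \<in> boundary"
  obtains v where "\<mu> = Vertex v" "v \<in> E0_sg"
  | e \<nu> where "\<mu> = path_Cons e \<nu>" "e \<in> E1" "\<nu> \<in> boundary" "path_r \<nu> = edge_d e"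
proof (cases \<mu>)
  case (Vertex v)
  then show ?thesis using that(1) assms by (simp add: Vertex_boundary)
next
  case (FinPath es)
  have es: "es \<noteq> []" "es \<in> En (length es)" "edge_d (last es) \<in> E0_sg"
    using assms FinPath by (simp_all add: FinPath_boundary)
  then obtain e fs where efs: "es = e # fs" by (cases es) auto
  then have e: "e \<in> E1" "fs \<in> En (length fs)" "fs \<noteq> [] \<longrightarrow> edge_d e = edge_r (hd fs)"
    using es(2) En_Cons[of e fs "length fs"] by simp_all
  show ?thesis
  proof (cases "fs = []")
    case True
    then show ?thesis
      using that(2)[of e "Vertex (edge_d e)"] FinPath efs e es by (simp add: Vertex_boundary)
  next
    case False
    then show ?thesis
      using that(2)[of e "FinPath fs"] FinPath efs e es by (simp add: FinPath_boundary)
  qed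
next
  case (InfPath f)
  have "(\<lambda>i. if i < length [f 0] then [f 0] ! i else f (Suc (i - length [f 0]))) = f"
  proof
    fix i show "(if i < length [f 0] then [f 0] ! i else f (Suc (i - length [f 0]))) = f i" by (cases i) simp_all
  qed
  then have "\<mu> = path_Cons (f 0) (InfPath (\<lambda>i. f (Suc i)))" by (simp only: InfPath path_prepend.simps)
  then show ?thesis
    by (rule that(2)) (use assms InfPath in \<open>simp_all add: InfPath_boundary\<close>)
qed

lemma path_drop_0: "\<mu> \<in> boundary \<Longrightarrow> path_drop 0 \<mu> = \<mu>"
  by (cases \<mu>) (simp_all add: FinPath_boundary)

lemma path_drop_Suc:
  assumes \<mu>: "\<mu> \<in> boundary" and r: "path_r \<mu> = edge_d e"
  shows "path_drop (Suc n) (path_Cons e \<mu>) = path_drop n \<mu>"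
  using assms by (cases \<mu>) (simp_all add: FinPath_boundary)

lemma path_drop_Cons:
  assumes \<mu>: "\<mu> \<in> boundary" and r: "path_r \<mu> = edge_d e"
  shows "path_drop (Suc 0) (path_Cons e \<mu>) = \<mu>"
  using path_drop_Suc[OF assms, of 0] path_drop_0[OF \<mu>] by simp

lemma path_drop_boundary:
  assumes "\<mu> \<in> boundary" "path_starts \<mu> \<alpha>"
  shows "path_drop (length \<alpha>) \<mu> \<in> boundary"
  using assms
proof (induction \<alpha> arbitrary: \<mu>)
  case Nil
  then show ?case by (simp add: path_drop_0)
next
  case (Cons a \<alpha>)
  from Cons.prems(1) show ?case
  proof (cases rule: boundary_cases)
    case (Vertex v)
    then show ?thesis using Cons.prems(2) by simp
  next
    case C: (Cons e \<nu>)
    then show ?thesis using Cons.IH[of \<nu>] Cons.prems(2) path_drop_Suc[of \<nu> e]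
      by (simp add: path_starts_Cons del: path_prepend.simps)
  qed
qed

lemma path_r_F0:
  assumes "\<mu> \<in> boundary" shows "path_r \<mu> \<in> F0"
  using assms
proof (cases rule: boundary_cases)
  case (Vertex v)
  then show ?thesis by (simp add: E0_sg_def F0_def)
next
  case (Cons e \<nu>)
  then show ?thesis using edge_r_F0[of e] by (simp only: path_r_Cons)
qed

subsection \<open>The ultrafilters along a path\<close>

text \<open>For a non-empty word this is \<open>edge_d\<close> of the edge that completes it
  (\<open>tail_filter_last\<close>). The value \<open>{}\<close>, an element of \<open>F0\<close>,
  stands for paths that do not start with the word.\<close>

definition tail_filter :: "('l, 'b) path \<Rightarrow> 'l list \<Rightarrow> 'b set" where
  "tail_filter \<mu> \<alpha> = (if path_starts \<mu> \<alpha> then path_r (path_drop (length \<alpha>) \<mu>) else {})"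

lemma tail_filter_Nil: "\<mu> \<in> boundary \<Longrightarrow> tail_filter \<mu> [] = path_r \<mu>"
  by (simp add: tail_filter_def path_drop_0)

lemma tail_filter_Vertex: "tail_filter (Vertex v) (a # \<alpha>) = {}"
  by (simp add: tail_filter_def)

lemma tail_filter_Cons:
  assumes "\<mu> \<in> boundary" "path_r \<mu> = edge_d e"
  shows "tail_filter (path_Cons e \<mu>) (a # \<alpha>) = (if fst e = a then tail_filter \<mu> \<alpha> else {})"
  using path_drop_Suc[OF assms] by (simp add: tail_filter_def path_starts_Cons del: path_prepend.simps)

lemma tail_filter_F0: "\<mu> \<in> boundary \<Longrightarrow> tail_filter \<mu> \<alpha> \<in> F0"
  unfolding tail_filter_def using path_r_F0[OF path_drop_boundary] by (auto simp: F0_def)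

lemma tail_filter_starts: "A \<in> tail_filter \<mu> \<alpha> \<Longrightarrow> path_starts \<mu> \<alpha>"
  by (auto simp: tail_filter_def split: if_splits)

lemma path_starts_lists: "\<mu> \<in> boundary \<Longrightarrow> path_starts \<mu> \<alpha> \<Longrightarrow> \<alpha> \<in> lists L"
proof (induction \<alpha> arbitrary: \<mu>)
  case (Cons a \<alpha>)
  from Cons.prems(1) show ?case
  proof (cases rule: boundary_cases)
    case (Vertex v)
    then show ?thesis using Cons.prems(2) by simp
  next
    case C: (Cons e \<nu>)
    then show ?thesis using Cons.IH[of \<nu>] Cons.prems(2)
      by (auto simp: path_starts_Cons E1_iff simp del: path_prepend.simps)
  qed
qed simp

text \<open>By \<open>edge_r_iff\<close>, passing an edge replaces a set by its image under the
  action of the label; this is iterated along the word.\<close>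

lemma word_action_tail_filter:
  "\<mu> \<in> boundary \<Longrightarrow> path_starts \<mu> \<alpha> \<Longrightarrow> word_action \<alpha> B \<in> tail_filter \<mu> \<alpha> \<longleftrightarrow> B \<in> path_r \<mu>"
proof (induction \<alpha> arbitrary: \<mu> B)
  case Nil
  then show ?case by (simp add: tail_filter_Nil)
next
  case (Cons a \<alpha>)
  from Cons.prems(1) show ?case
  proof (cases rule: boundary_cases)
    case (Vertex v)
    then show ?thesis using Cons.prems(2) by simp
  next
    case C: (Cons e \<nu>)
    then have s: "fst e = a" "path_starts \<nu> \<alpha>"
      using Cons.prems(2) by (simp_all add: path_starts_Cons del: path_prepend.simps)
    have "tail_filter \<mu> (a # \<alpha>) = tail_filter \<nu> \<alpha>"
      unfolding C(1) tail_filter_Cons[OF C(3,4)] using s by simp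
    moreover have "B \<in> path_r \<mu> \<longleftrightarrow> \<theta> a B \<in> path_r \<nu>"
      unfolding C(1,4) path_r_Cons using edge_r_iff[OF C(2)] s by simp
    ultimately show ?thesis using Cons.IH[OF C(3) s(2)] by simp
  qed
qed

text \<open>A member of the ultrafilter of the first edge is pushed forward along the remaining
  letters. The excluded case is the empty word on a path with empty range.\<close>

lemma tail_filter_meets_ideal:
  assumes \<mu>: "\<mu> \<in> boundary" and ne: "path_starts \<mu> \<alpha>" "\<alpha> \<noteq> [] \<or> path_r \<mu> \<noteq> {}"
  shows "\<exists>A \<in> word_ideal \<alpha>. A \<in> tail_filter \<mu> \<alpha>"
proof (cases \<alpha>)
  case Nil
  then show ?thesis using \<mu> ne(2) by (auto simp: tail_filter_Nil)
next
  case A: (Cons a \<beta>)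
  from \<mu> show ?thesis
  proof (cases rule: boundary_cases)
    case (Vertex v)
    then show ?thesis using ne(1) A by simp
  next
    case C: (Cons e \<nu>)
    then have s: "fst e = a" "path_starts \<nu> \<beta>"
      using ne(1) A by (simp_all add: path_starts_Cons del: path_prepend.simps)
    obtain B where B: "B \<in> \<I> a" "B \<in> path_r \<nu>" using edge_nonempty[OF C(2)] C(4) s(1) by auto
    have "tail_filter \<mu> \<alpha> = tail_filter \<nu> \<beta>"
      unfolding C(1) A tail_filter_Cons[OF C(3,4)] using s by simp
    then have "word_action \<beta> B \<in> tail_filter \<mu> \<alpha>"
      using word_action_tail_filter[OF C(3) s(2)] B(2) by simp
    moreover have "word_action \<beta> B \<in> word_ideal \<alpha>" using A B(1) by auto
    ultimately show ?thesis by blast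
  qed
qed

text \<open>Intersecting with \<open>word_action \<alpha> B\<close> brings an arbitrary
  \<open>A\<close> into the ideal of the longer word. Membership does not change, as this set
  belongs to the tail filter already once \<open>B\<close> lies in the range.\<close>

lemma tail_filter_shift:
  assumes "\<mu> \<in> boundary" "path_r \<mu> = edge_d e" and B: "B \<in> path_r \<mu>"
  shows "inf A (word_action \<alpha> B) \<in> tail_filter (path_Cons e \<mu>) (fst e # \<alpha>) \<longleftrightarrow> A \<in> tail_filter \<mu> \<alpha>"
  unfolding tail_filter_Cons[OF assms(1,2)] F0_inf[OF tail_filter_F0[OF assms(1)]]
  using word_action_tail_filter[OF assms(1), of \<alpha> B] tail_filter_starts[of A \<mu> \<alpha>] B
  by (auto simp: F0_inf[OF tail_filter_F0[OF assms(1)]])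

text \<open>The range has to be compared too, since \<open>path_take\<close> is empty on every
  vertex.\<close>

lemma path_eqI:
  assumes "\<And>n. path_take n \<mu> = path_take n \<nu>" "path_r \<mu> = path_r \<nu>" "\<mu> \<in> boundary" "\<nu> \<in> boundary"
  shows "\<mu> = \<nu>"
proof (cases \<mu>; cases \<nu>)
  fix v w assume "\<mu> = Vertex v" "\<nu> = Vertex w"
  then show ?thesis using assms(2) by simp
next
  fix v es assume "\<mu> = Vertex v" "\<nu> = FinPath es"
  then show ?thesis using assms(1)[of 1] assms(4) by (cases es) (simp_all add: FinPath_boundary)
next
  fix v f assume "\<mu> = Vertex v" "\<nu> = InfPath f"
  then show ?thesis using assms(1)[of 1] by simp
next
  fix es v assume "\<mu> = FinPath es" "\<nu> = Vertex v"
  then show ?thesis using assms(1)[of 1] assms(3) by (cases es) (simp_all add: FinPath_boundary)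
next
  fix es fs assume "\<mu> = FinPath es" "\<nu> = FinPath fs"
  then show ?thesis using assms(1)[of "max (length es) (length fs)"] by simp
next
  fix es f assume "\<mu> = FinPath es" "\<nu> = InfPath f"
  then show ?thesis using arg_cong[OF assms(1)[of "Suc (length es)"], of length] by simp
next
  fix f v assume "\<mu> = InfPath f" "\<nu> = Vertex v"
  then show ?thesis using assms(1)[of 1] by simp
next
  fix f es assume "\<mu> = InfPath f" "\<nu> = FinPath es"
  then show ?thesis using arg_cong[OF assms(1)[of "Suc (length es)"], of length] by simp
next
  fix f g assume fg: "\<mu> = InfPath f" "\<nu> = InfPath g"
  have "f i = g i" for i using assms(1)[of "Suc i"] fg by simp
  then show ?thesis using fg by auto
qed

text \<open>The filters at one-letter words reveal the label and the \<open>edge_d\<close> of the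
  first edge, and these determine the edge; then the words shift by one letter.\<close>

lemma tail_filter_inject:
  assumes "\<mu> \<in> boundary" "\<nu> \<in> boundary" "\<And>\<alpha>. \<alpha> \<in> lists L \<Longrightarrow> tail_filter \<mu> \<alpha> = tail_filter \<nu> \<alpha>"
  shows "\<mu> = \<nu>"
proof -
  have vertex: False if "\<mu> = Vertex v" "\<nu> = path_Cons e \<nu>'" "e \<in> E1" "\<nu>' \<in> boundary" "path_r \<nu>' = edge_d e"
    "\<And>\<alpha>. \<alpha> \<in> lists L \<Longrightarrow> tail_filter \<mu> \<alpha> = tail_filter \<nu> \<alpha>" for \<mu> \<nu> v e \<nu>'
  proof -
    have "tail_filter \<nu> [fst e] = edge_d e"
      unfolding that(2) tail_filter_Cons[OF that(4,5)] by (simp add: tail_filter_Nil that(4,5))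
    moreover have "tail_filter \<nu> [fst e] = {}"
      using that(6)[of "[fst e]"] that(1,3) by (simp add: tail_filter_Vertex E1_iff)
    ultimately show False using E0_nonempty[OF edge_d_E0[OF that(3)]] by simp
  qed
  have "path_take n \<mu> = path_take n \<nu>" for n
    using assms
  proof (induction n arbitrary: \<mu> \<nu>)
    case (Suc n)
    note eq = Suc.prems(3)
    from Suc.prems(1) show ?case
    proof (cases rule: boundary_cases)
      case V: (Vertex v)
      from Suc.prems(2) show ?thesis
      proof (cases rule: boundary_cases)
        case (Vertex w)
        then show ?thesis using V by simp
      next
        case (Cons e \<nu>')
        then show ?thesis using vertex[OF V(1) Cons eq] by blast
      qed
    next
      case C: (Cons e \<mu>')
      from Suc.prems(2) show ?thesis
      proof (cases rule: boundary_cases)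
        case (Vertex w)
        then show ?thesis using vertex[OF Vertex(1) C eq[symmetric]] by blast
      next
        case D: (Cons f \<nu>')
        have L: "fst e \<in> L" using C(2) by (simp add: E1_iff)
        have "tail_filter \<mu> [fst e] = edge_d e"
          unfolding C(1) tail_filter_Cons[OF C(3,4)] by (simp add: tail_filter_Nil C(3,4))
        moreover have "tail_filter \<nu> [fst e] = (if fst f = fst e then edge_d f else {})"
          unfolding D(1) tail_filter_Cons[OF D(3,4)] by (simp add: tail_filter_Nil D(3,4))
        ultimately have "edge_d e = (if fst f = fst e then edge_d f else {})" using eq[of "[fst e]"] L by simp
        then have fe: "fst f = fst e" "edge_d f = edge_d e"
          using E0_nonempty[OF edge_d_E0[OF C(2)]] by (auto split: if_splits)
        have ef: "e = f" by (rule edge_eqI[OF C(2) D(2)]) (simp_all add: fe)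
        have "tail_filter \<mu>' \<alpha> = tail_filter \<nu>' \<alpha>" if "\<alpha> \<in> lists L" for \<alpha>
          using eq[of "fst e # \<alpha>"] L that fe(1)
          unfolding C(1) D(1) tail_filter_Cons[OF C(3,4)] tail_filter_Cons[OF D(3,4)] by simp
        then have "path_take n \<mu>' = path_take n \<nu>'" by (rule Suc.IH[OF C(3) D(3)])
        then show ?thesis unfolding C(1) D(1) path_take_Cons ef by simp
      qed
    qed
  qed simp
  moreover have "path_r \<mu> = path_r \<nu>" using assms(3)[of "[]"] by (simp add: tail_filter_Nil assms(1,2))
  ultimately show ?thesis using path_eqI assms(1,2) by blast
qed

end

section \<open>The cylinder topology\<close>

context gen_boolean_dyn_system
begin

definition cyl :: "'l list \<Rightarrow> 'b \<Rightarrow> ('l, 'b) path set" where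
  "cyl \<alpha> A = {\<mu> \<in> boundary. A \<in> tail_filter \<mu> \<alpha>}"

text \<open>For these indices the cylinders turn out to be compact (\<open>compactin_cyl\<close>).
  Other cylinders are unions of such ones by \<open>cyl_eq_Union\<close>, hence open.\<close>

definition cyl_index :: "('l list \<times> 'b) set" where
  "cyl_index = {(\<alpha>, A). \<alpha> \<in> lists L \<and> A \<in> word_ideal \<alpha>}"

text \<open>Declaring the complements open as well makes this the topology of pointwise convergence
  of membership patterns, to which \<open>compactin_finite_approximation\<close> applies.\<close>

definition cyl_topology :: "('l, 'b) path topology" where
  "cyl_topology = topology_generated_by
     ((\<lambda>(\<alpha>, A). cyl \<alpha> A) ` cyl_index \<union> (\<lambda>(\<alpha>, A). boundary - cyl \<alpha> A) ` cyl_index)"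

lemma cyl_index_Nil: "([], A) \<in> cyl_index"
  by (simp add: cyl_index_def)

lemma cyl_index_single: "a \<in> L \<Longrightarrow> B \<in> \<I> a \<Longrightarrow> ([a], B) \<in> cyl_index"
  using word_ideal_single[of a] by (simp add: cyl_index_def del: word_ideal.simps)

lemma cyl_index_inf: "a \<in> L \<Longrightarrow> \<alpha> \<in> lists L \<Longrightarrow> B \<in> \<I> a \<Longrightarrow> (a # \<alpha>, inf A (word_action \<alpha> B)) \<in> cyl_index"
  using word_ideal_Cons_inf[of B a A \<alpha>] by (simp add: cyl_index_def del: word_ideal.simps)

lemma cyl_index_tl: "(a # \<alpha>, A) \<in> cyl_index \<Longrightarrow> (\<alpha>, A) \<in> cyl_index"
  using word_ideal_Cons_subset[of a \<alpha> A] by (simp add: cyl_index_def del: word_ideal.simps)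

lemma topspace_cyl_topology: "topspace cyl_topology = boundary"
proof -
  \<comment> \<open>The complement of the empty cylinder makes \<open>boundary\<close> itself a
    generating set, so that paths with empty range are covered as well.\<close>
  have "cyl [] bot = {}" unfolding cyl_def using F0_bot[OF tail_filter_F0] by blast
  then have "boundary \<in> (\<lambda>(\<alpha>, A). boundary - cyl \<alpha> A) ` cyl_index"
    using image_eqI[of boundary "\<lambda>(\<alpha>, A). boundary - cyl \<alpha> A" "([], bot)" cyl_index] cyl_index_Nil by simp
  from Union_upper[OF UnI2[OF this]] show ?thesis
    unfolding cyl_topology_def topology_generated_by_topspace
  proof (rule equalityI[rotated])
    show "\<Union>((\<lambda>(\<alpha>, A). cyl \<alpha> A) ` cyl_index \<union> (\<lambda>(\<alpha>, A). boundary - cyl \<alpha> A) ` cyl_index) \<subseteq> boundary"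
      by (rule Union_least) (auto simp: cyl_def split: prod.splits)
  qed
qed

lemma cyl_open_index: "(\<alpha>, A) \<in> cyl_index \<Longrightarrow> openin cyl_topology (cyl \<alpha> A)"
  unfolding cyl_topology_def
  by (rule topology_generated_by_Basis, rule UnI1, rule image_eqI[of _ _ "(\<alpha>, A)"]) simp_all

lemma cyl_closed_index: "(\<alpha>, A) \<in> cyl_index \<Longrightarrow> closedin cyl_topology (cyl \<alpha> A)"
  unfolding closedin_def topspace_cyl_topology
proof
  assume "(\<alpha>, A) \<in> cyl_index"
  then show "openin cyl_topology (boundary - cyl \<alpha> A)"
    unfolding cyl_topology_def
    by (intro topology_generated_by_Basis, intro UnI2, intro image_eqI[of _ _ "(\<alpha>, A)"]) simp_all
qed (auto simp: cyl_def)

text \<open>The tail filter meets the ideal of the word, so \<open>A\<close> may be cut down to a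
  member of the ideal.\<close>

lemma cyl_eq_Union:
  assumes \<alpha>: "\<alpha> \<in> lists L" shows "cyl \<alpha> A = (\<Union>C\<in>word_ideal \<alpha>. cyl \<alpha> (inf A C))"
proof (intro equalityI subsetI)
  fix \<mu> assume "\<mu> \<in> cyl \<alpha> A"
  then have \<mu>: "\<mu> \<in> boundary" "A \<in> tail_filter \<mu> \<alpha>" by (simp_all add: cyl_def)
  have "\<alpha> \<noteq> [] \<or> path_r \<mu> \<noteq> {}" using \<mu> by (auto simp: tail_filter_Nil)
  then obtain C where C: "C \<in> word_ideal \<alpha>" "C \<in> tail_filter \<mu> \<alpha>"
    using tail_filter_meets_ideal[OF \<mu>(1) tail_filter_starts[OF \<mu>(2)]] by metis
  have "inf A C \<in> tail_filter \<mu> \<alpha>" using \<mu>(2) C(2) F0_inf[OF tail_filter_F0[OF \<mu>(1)]] by simp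
  then show "\<mu> \<in> (\<Union>C\<in>word_ideal \<alpha>. cyl \<alpha> (inf A C))"
    using \<mu>(1) by (intro UN_I[OF C(1)]) (simp add: cyl_def)
next
  fix \<mu> assume "\<mu> \<in> (\<Union>C\<in>word_ideal \<alpha>. cyl \<alpha> (inf A C))"
  then obtain C where C: "\<mu> \<in> boundary" "inf A C \<in> tail_filter \<mu> \<alpha>" unfolding cyl_def by blast
  then show "\<mu> \<in> cyl \<alpha> A" using F0_inf[OF tail_filter_F0[OF C(1)]] by (simp add: cyl_def)
qed

lemma cyl_open:
  assumes \<alpha>: "\<alpha> \<in> lists L" shows "openin cyl_topology (cyl \<alpha> A)"
proof (subst cyl_eq_Union[OF assms], rule openin_Union)
  fix S assume "S \<in> (\<lambda>C. cyl \<alpha> (inf A C)) ` word_ideal \<alpha>"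
  then obtain C where C: "C \<in> word_ideal \<alpha>" "S = cyl \<alpha> (inf A C)" by auto
  have "inf A C \<in> word_ideal \<alpha>" by (rule ideal_inf(2)[OF word_ideal_ideal[OF \<alpha>] C(1)])
  then show "openin cyl_topology S" unfolding C(2) using \<alpha> by (intro cyl_open_index) (simp add: cyl_index_def)
qed

lemma starts_eq_Union:
  assumes "\<alpha> \<noteq> []" shows "{\<mu> \<in> boundary. path_starts \<mu> \<alpha>} = (\<Union>C\<in>word_ideal \<alpha>. cyl \<alpha> C)"
proof (intro equalityI subsetI)
  fix \<mu> assume "\<mu> \<in> {\<mu> \<in> boundary. path_starts \<mu> \<alpha>}"
  then have \<mu>: "\<mu> \<in> boundary" "path_starts \<mu> \<alpha>" by simp_all
  then obtain C where C: "C \<in> word_ideal \<alpha>" "C \<in> tail_filter \<mu> \<alpha>"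
    using tail_filter_meets_ideal[OF \<mu>] assms by metis
  then show "\<mu> \<in> (\<Union>C\<in>word_ideal \<alpha>. cyl \<alpha> C)"
    using \<mu>(1) by (intro UN_I[OF C(1)]) (simp add: cyl_def)
qed (auto simp: cyl_def dest: tail_filter_starts)

lemma starts_open:
  assumes "\<alpha> \<in> lists L" "\<alpha> \<noteq> []" shows "openin cyl_topology {\<mu> \<in> boundary. path_starts \<mu> \<alpha>}"
  unfolding starts_eq_Union[OF assms(2)] using cyl_open[OF assms(1)] by (intro openin_Union) auto

lemma cyl_separate:
  assumes \<mu>: "\<mu> \<in> boundary" and \<nu>: "\<nu> \<in> boundary" and ne: "\<mu> \<noteq> \<nu>"
  obtains \<beta> B where "(\<beta>, B) \<in> cyl_index" "\<mu> \<in> cyl \<beta> B \<longleftrightarrow> \<nu> \<notin> cyl \<beta> B"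
proof -
  have sep: "\<exists>i\<in>cyl_index. \<mu> \<in> case_prod cyl i \<and> \<nu> \<notin> case_prod cyl i"
    if m: "\<mu> \<in> boundary" "\<alpha> \<in> lists L" "A \<in> tail_filter \<mu> \<alpha>" "A \<notin> tail_filter \<nu> \<alpha>" for \<mu> \<nu> \<alpha> A
  proof -
    have "\<mu> \<in> cyl \<alpha> A" "\<nu> \<notin> cyl \<alpha> A" using m by (simp_all add: cyl_def)
    then obtain C where "C \<in> word_ideal \<alpha>" "\<mu> \<in> cyl \<alpha> (inf A C)" "\<nu> \<notin> cyl \<alpha> (inf A C)"
      unfolding cyl_eq_Union[OF m(2), of A] by auto
    then show ?thesis using ideal_inf(2)[OF word_ideal_ideal[OF m(2)], of C A] m(2)
      by (intro bexI[of _ "(\<alpha>, inf A C)"]) (simp_all add: cyl_index_def)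
  qed
  obtain \<alpha> where \<alpha>: "\<alpha> \<in> lists L" "tail_filter \<mu> \<alpha> \<noteq> tail_filter \<nu> \<alpha>"
    using tail_filter_inject[OF \<mu> \<nu>] ne by metis
  have "\<exists>i\<in>cyl_index. \<mu> \<in> case_prod cyl i \<longleftrightarrow> \<nu> \<notin> case_prod cyl i"
  proof (cases "tail_filter \<mu> \<alpha> \<subseteq> tail_filter \<nu> \<alpha>")
    case False
    then obtain A where "A \<in> tail_filter \<mu> \<alpha>" "A \<notin> tail_filter \<nu> \<alpha>" by auto
    from sep[OF \<mu> \<alpha>(1) this] show ?thesis by metis
  next
    case True
    then obtain A where "A \<in> tail_filter \<nu> \<alpha>" "A \<notin> tail_filter \<mu> \<alpha>" using \<alpha>(2) by auto
    from sep[OF \<nu> \<alpha>(1) this] show ?thesis by metis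
  qed
  then show ?thesis using that by auto
qed

lemma Hausdorff_cyl_topology: "Hausdorff_space cyl_topology"
  unfolding Hausdorff_space_def topspace_cyl_topology
proof (intro allI impI; elim conjE)
  fix \<mu> \<nu> assume \<mu>: "\<mu> \<in> boundary" and \<nu>: "\<nu> \<in> boundary" and ne: "\<mu> \<noteq> \<nu>"
  from cyl_separate[OF this] obtain \<beta> B where B: "(\<beta>, B) \<in> cyl_index" "\<mu> \<in> cyl \<beta> B \<longleftrightarrow> \<nu> \<notin> cyl \<beta> B" by metis
  have o: "openin cyl_topology (cyl \<beta> B)" "openin cyl_topology (boundary - cyl \<beta> B)"
    using cyl_open_index[OF B(1)] cyl_closed_index[OF B(1)]
    by (simp_all add: closedin_def topspace_cyl_topology)
  show "\<exists>U V. openin cyl_topology U \<and> openin cyl_topology V \<and> \<mu> \<in> U \<and> \<nu> \<in> V \<and> disjnt U V"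
  proof (cases "\<mu> \<in> cyl \<beta> B")
    case True
    then show ?thesis using o B(2) \<nu>
      by (intro exI[of _ "cyl \<beta> B"] exI[of _ "boundary - cyl \<beta> B"]) (simp add: disjnt_def)
  next
    case False
    then show ?thesis using o B(2) \<mu>
      by (intro exI[of _ "boundary - cyl \<beta> B"] exI[of _ "cyl \<beta> B"]) (auto simp: disjnt_def)
  qed
qed

subsection \<open>Regular vertices\<close>

text \<open>It serves to shrink a neighborhood of a regular vertex in \<open>F0\<close> to a basic
  set of ultrafilters; the point \<open>{}\<close> drops out in both cases of the
  definition.\<close>

lemma F0_open_E0:
  assumes "openin F0_topology W" shows "openin E0_topology {v \<in> E0. v \<in> W}"
proof (cases "ba_unital TYPE('b)")
  case True
  then have "generate_topology_on (insert {{}} {V. openin E0_topology V}) W"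
    using assms unfolding F0_topology_def by (simp add: openin_topology_generated_by)
  then show ?thesis
  proof (induction W rule: generate_topology_on.induct)
    case (Int V W)
    have "{v \<in> E0. v \<in> V \<inter> W} = {v \<in> E0. v \<in> V} \<inter> {v \<in> E0. v \<in> W}" by auto
    then show ?case using Int.IH openin_Int by simp
  next
    case (UN K)
    have "{v \<in> E0. v \<in> \<Union>K} = \<Union>((\<lambda>k. {v \<in> E0. v \<in> k}) ` K)" by auto
    then show ?case using UN.IH openin_Union[of "(\<lambda>k. {v \<in> E0. v \<in> k}) ` K"] by auto
  next
    case (Basis s)
    show ?case
    proof (cases "s = {{}}")
      case True
      then have "{v \<in> E0. v \<in> s} = {}" using E0_nonempty by auto
      then show ?thesis by (simp only: openin_empty)
    next
      case False
      then have s: "openin E0_topology s" using Basis by simp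
      have "topspace E0_topology = E0"
        unfolding E0_topology_def E0_def by (rule topspace_ultrafilter_topology[OF ideal_UNIV])
      then have "{v \<in> E0. v \<in> s} = s" using openin_subset[OF s] by auto
      then show ?thesis using s by simp
    qed
  qed simp
next
  case False
  then obtain O' where O: "openin (Alexandroff_compactification E0_topology) O'"
    "W = (\<lambda>v. if v = {} then None else Some v) -` O' \<inter> F0"
    using assms unfolding F0_topology_def by (auto simp: openin_pullback_topology)
  have t: "topspace E0_topology = E0"
    unfolding E0_topology_def E0_def by (rule topspace_ultrafilter_topology[OF ideal_UNIV])
  have "openin E0_topology {v \<in> topspace E0_topology. Some v \<in> O'}"
    by (rule openin_continuous_map_preimage[OF continuous_map_Some O(1)])
  moreover have "{v \<in> topspace E0_topology. Some v \<in> O'} = {v \<in> E0. v \<in> W}"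
    unfolding t O(2) using E0_nonempty E0_F0 by auto
  ultimately show ?thesis by simp
qed

text \<open>Near a regular vertex the edges with nearby range form a compact set, so finitely many
  pairs of a label and a set in its ideal cover them. A boundary path with nearby range cannot be a
  vertex, since that vertex would be regular; its first edge therefore belongs to one of these
  pairs. This is what keeps limit paths from stopping at a regular vertex.\<close>

lemma regular_vertex_cover:
  assumes v: "v \<in> E0" "v \<in> F0_rg"
  obtains B S where "B \<in> v" "finite S" "S \<subseteq> {(a, C). a \<in> L \<and> C \<in> \<I> a}"
    "\<forall>\<mu>\<in>boundary. B \<in> path_r \<mu> \<longrightarrow> (\<exists>(a, C)\<in>S. C \<in> tail_filter \<mu> [a])"
proof -
  have "v \<in> F0_fin" and ncl: "v \<notin> (F0_topology closure_of F0_sce)" using v(2) by (simp_all add: F0_rg_def)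
  then obtain V W where VW: "openin F0_topology W" "v \<in> W" "W \<subseteq> V" "V \<subseteq> F0"
    "compactin E1_topology {e \<in> E1. edge_r e \<in> V}"
    by (auto simp: F0_fin_def)
  have "v \<in> topspace F0_topology" using openin_subset[OF VW(1)] VW(2) by auto
  then obtain T where T: "openin F0_topology T" "v \<in> T" "\<forall>u\<in>F0_sce. u \<notin> T"
    using ncl unfolding in_closure_of by auto
  have "openin F0_topology (W \<inter> T)" using VW(1) T(1) by (rule openin_Int)
  from F0_open_E0[OF this] have "openin (ultrafilter_topology UNIV) {v \<in> E0. v \<in> W \<inter> T}"
    by (simp only: E0_topology_def)
  moreover have "v \<in> {v \<in> E0. v \<in> W \<inter> T}" using v(1) VW(2) T(2) by simp
  ultimately obtain B where B: "B \<in> v" "{G \<in> ba_ultrafilters UNIV. B \<in> G} \<subseteq> {v \<in> E0. v \<in> W \<inter> T}"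
    by (rule ultrafilter_topology_basis[OF ideal_UNIV])
  let ?O = "\<lambda>(a, C). {a} \<times> {\<eta> \<in> ba_ultrafilters (\<I> a). C \<in> \<eta>}"
  let ?J = "{(a, C). a \<in> L \<and> C \<in> \<I> a}"
  have "openin E1_topology (?O p)" if p: "p \<in> ?J" for p
  proof -
    obtain a C where aC: "p = (a, C)" "a \<in> L" "C \<in> \<I> a" using p by auto
    have "{x. (i, x) \<in> ?O p} = (if i = a then {\<eta> \<in> ba_ultrafilters (\<I> a). C \<in> \<eta>} else {})" for i
      using aC by auto
    then show ?thesis
      unfolding E1_topology_def openin_sum_topology
      using aC openin_ultrafilter_topology[OF aC(3)] topspace_ultrafilter_topology[OF ideal[OF aC(2)]] by auto
  qed
  moreover have "{e \<in> E1. edge_r e \<in> V} \<subseteq> \<Union>(?O ` ?J)"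
  proof
    fix e assume "e \<in> {e \<in> E1. edge_r e \<in> V}"
    then have e: "e \<in> E1" by simp
    obtain C where "C \<in> \<I> (fst e)" "C \<in> edge_d e" using edge_nonempty[OF e] by auto
    then have m: "e \<in> ?O (fst e, C)" "(fst e, C) \<in> ?J"
      using e edge_d_iff[OF e] by (simp_all add: E1_iff mem_Times_iff)
    show "e \<in> \<Union>(?O ` ?J)" by (rule UN_I, rule m(2), rule m(1))
  qed
  ultimately have "\<exists>\<F>. finite \<F> \<and> \<F> \<subseteq> ?O ` ?J \<and> {e \<in> E1. edge_r e \<in> V} \<subseteq> \<Union>\<F>"
    by (intro compactinD[OF VW(5)]) auto
  then obtain \<F> where F: "finite \<F>" "\<F> \<subseteq> ?O ` ?J" "{e \<in> E1. edge_r e \<in> V} \<subseteq> \<Union>\<F>" by (elim exE conjE)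
  obtain S where S: "S \<subseteq> ?J" "finite S" "\<F> = ?O ` S" using finite_subset_image[OF F(1,2)] by auto
  have "\<exists>(a, C)\<in>S. C \<in> tail_filter \<mu> [a]" if \<mu>: "\<mu> \<in> boundary" and BB: "B \<in> path_r \<mu>" for \<mu>
  proof -
    have r: "path_r \<mu> \<in> W" "path_r \<mu> \<in> T"
      using B(2) BB F0_in_E0[OF path_r_F0[OF \<mu>] BB] by (auto simp: E0_def)
    \<comment> \<open>Regularity is an open condition: \<open>W\<close> and \<open>T\<close> witness
      it for every range they contain.\<close>
    have "path_r \<mu> \<in> F0_rg"
    proof -
      have "path_r \<mu> \<in> F0_fin" using VW r(1) path_r_F0[OF \<mu>] unfolding F0_fin_def by blast
      moreover have "path_r \<mu> \<notin> (F0_topology closure_of F0_sce)"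
        using T r(2) unfolding in_closure_of by blast
      ultimately show ?thesis by (simp add: F0_rg_def)
    qed
    from \<mu> show ?thesis
    proof (cases rule: boundary_cases)
      case (Vertex w)
      then show ?thesis using \<open>path_r \<mu> \<in> F0_rg\<close> by (simp add: E0_sg_def)
    next
      case (Cons e \<nu>)
      have "path_r \<mu> = edge_r e" unfolding Cons(1) by (rule path_r_Cons)
      then have "e \<in> {e \<in> E1. edge_r e \<in> V}" using Cons(2) r(1) VW(3) by auto
      then obtain a C where aC: "(a, C) \<in> S" "e \<in> ?O (a, C)" using F(3) unfolding S(3) by auto
      then have "fst e = a" "C \<in> edge_d e"
        using edge_d_iff[OF Cons(2), of C] S(1) by (auto simp: mem_Times_iff)
      then have "C \<in> tail_filter \<mu> [a]"
        unfolding Cons(1) tail_filter_Cons[OF Cons(3,4)] by (simp add: tail_filter_Nil[OF Cons(3)] Cons(4))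
      then show ?thesis using aC(1) by auto
    qed
  qed
  then show ?thesis by (intro that[OF B(1) S(2,1)] ballI impI)
qed

end

section \<open>Compactness of the cylinders\<close>

context gen_boolean_dyn_system
begin

text \<open>A pointwise limit \<open>\<xi>\<close> of boundary paths prescribes which cylinders contain the limit path;
  the path is read off edge by edge.\<close>

definition approximable :: "('l list \<Rightarrow> 'b \<Rightarrow> bool) \<Rightarrow> bool" where
  "approximable \<xi> \<longleftrightarrow> (\<forall>F. finite F \<longrightarrow> F \<subseteq> cyl_index \<longrightarrow>
     (\<exists>\<mu>\<in>boundary. \<forall>(\<alpha>, A)\<in>F. \<xi> \<alpha> A \<longleftrightarrow> A \<in> tail_filter \<mu> \<alpha>))"

text \<open>The pattern left after removal of a first edge with label \<open>a\<close> whose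
  ultrafilter contains \<open>B\<close>. As in \<open>tail_filter_shift\<close>, the intersection
  keeps the index in \<open>cyl_index\<close>.\<close>

definition shift :: "('l list \<Rightarrow> 'b \<Rightarrow> bool) \<Rightarrow> 'l \<Rightarrow> 'b \<Rightarrow> 'l list \<Rightarrow> 'b \<Rightarrow> bool" where
  "shift \<xi> a B = (\<lambda>\<alpha> A. \<xi> (a # \<alpha>) (inf A (word_action \<alpha> B)))"

lemma approximableD:
  assumes "approximable \<xi>" "finite F" "F \<subseteq> cyl_index"
  obtains \<mu> where "\<mu> \<in> boundary" "\<forall>\<alpha> A. (\<alpha>, A) \<in> F \<longrightarrow> (\<xi> \<alpha> A \<longleftrightarrow> A \<in> tail_filter \<mu> \<alpha>)"
proof -
  have "\<exists>\<mu>\<in>boundary. \<forall>(\<alpha>, A)\<in>F. \<xi> \<alpha> A \<longleftrightarrow> A \<in> tail_filter \<mu> \<alpha>"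
    using assms by (simp add: approximable_def)
  then obtain \<mu> where \<mu>: "\<mu> \<in> boundary" "\<forall>(\<alpha>, A)\<in>F. \<xi> \<alpha> A \<longleftrightarrow> A \<in> tail_filter \<mu> \<alpha>" by (elim bexE)
  show ?thesis by (rule that[OF \<mu>(1)]) (use \<mu>(2) in auto)
qed

lemma tail_filter_singleE:
  assumes "\<mu> \<in> boundary" "B \<in> tail_filter \<mu> [a]"
  obtains e \<nu> where "\<mu> = path_Cons e \<nu>" "e \<in> E1" "\<nu> \<in> boundary" "path_r \<nu> = edge_d e" "fst e = a" "B \<in> path_r \<nu>"
  using assms(1)
proof (cases rule: boundary_cases)
  case (Vertex v)
  then show ?thesis using assms(2) by (simp add: tail_filter_Vertex)
next
  case (Cons e \<nu>)
  have "B \<in> (if fst e = a then path_r \<nu> else {})"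
    using assms(2) unfolding Cons(1) tail_filter_Cons[OF Cons(3,4)] tail_filter_Nil[OF Cons(3)] .
  then show ?thesis using that[OF Cons] by (simp split: if_splits)
qed

context
  fixes \<xi> a B
  assumes \<xi>: "approximable \<xi>" and a: "a \<in> L" and B: "B \<in> \<I> a" and \<xi>B: "\<xi> [a] B"
begin

text \<open>Adding the index \<open>([a], B)\<close> to \<open>F\<close> forces the approximating
  path to begin with an edge labelled \<open>a\<close> that sees \<open>B\<close>.\<close>

lemma approximable_first_edge:
  assumes F: "finite F" "F \<subseteq> cyl_index"
  obtains e \<nu> where "e \<in> E1" "\<nu> \<in> boundary" "path_r \<nu> = edge_d e" "fst e = a" "B \<in> path_r \<nu>"
    "\<forall>\<alpha> A. (\<alpha>, A) \<in> F \<longrightarrow> (\<xi> \<alpha> A \<longleftrightarrow> A \<in> tail_filter (path_Cons e \<nu>) \<alpha>)"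
proof -
  have "finite (insert ([a], B) F)" "insert ([a], B) F \<subseteq> cyl_index"
    using F cyl_index_single[OF a B] by simp_all
  from approximableD[OF \<xi> this] obtain \<mu> where \<mu>: "\<mu> \<in> boundary"
    "\<forall>\<alpha> A. (\<alpha>, A) \<in> insert ([a], B) F \<longrightarrow> (\<xi> \<alpha> A \<longleftrightarrow> A \<in> tail_filter \<mu> \<alpha>)" by metis
  have "B \<in> tail_filter \<mu> [a]" using \<mu>(2) \<xi>B by simp
  from tail_filter_singleE[OF \<mu>(1) this] obtain e \<nu> where
    "\<mu> = path_Cons e \<nu>" "e \<in> E1" "\<nu> \<in> boundary" "path_r \<nu> = edge_d e" "fst e = a" "B \<in> path_r \<nu>" by metis
  then show ?thesis using that[of e \<nu>] \<mu>(2) by simp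
qed

text \<open>Paths that approximate \<xi> approximate the shifted pattern once their first edge is
  removed.\<close>

lemma approximable_shift: "approximable (shift \<xi> a B)"
  unfolding approximable_def
proof (intro allI impI)
  fix F assume F: "finite F" "F \<subseteq> cyl_index"
  let ?F = "(\<lambda>(\<alpha>, A). (a # \<alpha>, inf A (word_action \<alpha> B))) ` F"
  have sub: "?F \<subseteq> cyl_index"
  proof (rule image_subsetI)
    fix x assume "x \<in> F"
    then obtain \<alpha> A where x: "x = (\<alpha>, A)" "\<alpha> \<in> lists L" using F(2) by (cases x) (auto simp: cyl_index_def)
    show "(case x of (\<alpha>, A) \<Rightarrow> (a # \<alpha>, inf A (word_action \<alpha> B))) \<in> cyl_index"
      using cyl_index_inf[OF a x(2) B, of A] x(1) by simp
  qed
  have fin: "finite ?F" using F(1) by simp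
  obtain e \<nu> where e: "e \<in> E1" "\<nu> \<in> boundary" "path_r \<nu> = edge_d e" "fst e = a" "B \<in> path_r \<nu>"
    "\<forall>\<alpha> A. (\<alpha>, A) \<in> ?F \<longrightarrow> (\<xi> \<alpha> A \<longleftrightarrow> A \<in> tail_filter (path_Cons e \<nu>) \<alpha>)"
    by (rule approximable_first_edge[OF fin sub])
  note e6 = e(6)[rule_format]
  have "shift \<xi> a B \<alpha> A \<longleftrightarrow> A \<in> tail_filter \<nu> \<alpha>" if "(\<alpha>, A) \<in> F" for \<alpha> A
  proof -
    have "(a # \<alpha>, inf A (word_action \<alpha> B)) \<in> ?F"
      using image_eqI[OF _ that, of _ "\<lambda>(\<alpha>, A). (a # \<alpha>, inf A (word_action \<alpha> B))"] by simp
    from e6[OF this] show ?thesis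
      using tail_filter_shift[OF e(2,3,5), of A \<alpha>] e(4) by (simp add: shift_def del: path_prepend.simps)
  qed
  then show "\<exists>\<mu>\<in>boundary. \<forall>(\<alpha>, A)\<in>F. shift \<xi> a B \<alpha> A \<longleftrightarrow> A \<in> tail_filter \<mu> \<alpha>"
    using e(2) by (intro bexI[of _ \<nu>]) auto
qed

lemma shift_Nil: "shift \<xi> a B [] B"
  using \<xi>B by (simp add: shift_def)

text \<open>Together with \<open>approximable_Cons\<close> this recovers \<xi> from \<open>a\<close>
  and the shifted pattern. Each relation involves only two indices, so it can be checked on one
  approximating path.\<close>

lemma approximable_Nil: "\<xi> [] C \<longleftrightarrow> shift \<xi> a B [] (\<theta> a C)"
proof -
  let ?F = "{([], C), ([a], inf (\<theta> a C) B)}"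
  have "inf (\<theta> a C) B \<in> \<I> a" by (rule ideal_inf(2)[OF ideal[OF a] B])
  then have sub: "?F \<subseteq> cyl_index" using cyl_index_Nil cyl_index_single[OF a] by simp
  have fin: "finite ?F" by simp
  obtain e \<nu> where e: "e \<in> E1" "\<nu> \<in> boundary" "path_r \<nu> = edge_d e" "fst e = a" "B \<in> path_r \<nu>"
    "\<forall>\<alpha> A. (\<alpha>, A) \<in> ?F \<longrightarrow> (\<xi> \<alpha> A \<longleftrightarrow> A \<in> tail_filter (path_Cons e \<nu>) \<alpha>)"
    by (rule approximable_first_edge[OF fin sub])
  note e6 = e(6)[rule_format]
  have "\<xi> [] C \<longleftrightarrow> C \<in> edge_r e"
    using e6[of "[]" C] tail_filter_Nil[OF Cons_boundary[OF e(1-3)]] by (simp only: path_r_Cons) simp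
  also have "\<dots> \<longleftrightarrow> \<theta> a C \<in> path_r \<nu>" using edge_r_iff[OF e(1), of C] e(3,4) by simp
  also have "\<dots> \<longleftrightarrow> inf (\<theta> a C) B \<in> tail_filter (path_Cons e \<nu>) [a]"
    using tail_filter_shift[OF e(2,3,5), of "\<theta> a C" "[]"] e(4) tail_filter_Nil[OF e(2)]
    by (simp del: path_prepend.simps)
  also have "\<dots> \<longleftrightarrow> \<xi> [a] (inf (\<theta> a C) B)" using e6[of "[a]" "inf (\<theta> a C) B"] by simp
  finally show ?thesis by (simp add: shift_def)
qed

lemma approximable_Cons:
  assumes A: "(b # \<alpha>, A) \<in> cyl_index"
  shows "\<xi> (b # \<alpha>) A \<longleftrightarrow> b = a \<and> shift \<xi> a B \<alpha> A"
proof -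
  let ?F = "{(b # \<alpha>, A), (a # \<alpha>, inf A (word_action \<alpha> B))}"
  have "\<alpha> \<in> lists L" using A by (simp add: cyl_index_def)
  then have sub: "?F \<subseteq> cyl_index" using A cyl_index_inf[OF a _ B] by simp
  have fin: "finite ?F" by simp
  obtain e \<nu> where e: "e \<in> E1" "\<nu> \<in> boundary" "path_r \<nu> = edge_d e" "fst e = a" "B \<in> path_r \<nu>"
    "\<forall>\<alpha> A. (\<alpha>, A) \<in> ?F \<longrightarrow> (\<xi> \<alpha> A \<longleftrightarrow> A \<in> tail_filter (path_Cons e \<nu>) \<alpha>)"
    by (rule approximable_first_edge[OF fin sub])
  note e6 = e(6)[rule_format]
  have "\<xi> (b # \<alpha>) A \<longleftrightarrow> A \<in> tail_filter (path_Cons e \<nu>) (b # \<alpha>)" using e6[of "b # \<alpha>" A] by simp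
  also have "\<dots> \<longleftrightarrow> b = a \<and> A \<in> tail_filter \<nu> \<alpha>"
    unfolding tail_filter_Cons[OF e(2,3)] using e(4) by auto
  also have "A \<in> tail_filter \<nu> \<alpha> \<longleftrightarrow> \<xi> (a # \<alpha>) (inf A (word_action \<alpha> B))"
    using tail_filter_shift[OF e(2,3,5), of A \<alpha>] e(4) e6[of "a # \<alpha>" "inf A (word_action \<alpha> B)"]
    by (simp del: path_prepend.simps)
  finally show ?thesis by (simp add: shift_def)
qed

end

text \<open>The filter conditions again involve at most three sets at once and so pass to the limit.
  A limit of non-empty ranges may be empty, whence \<open>F0\<close> in place of
  \<open>E0\<close>.\<close>

lemma approximable_F0:
  assumes \<xi>: "approximable \<xi>" shows "{B. \<xi> [] B} \<in> F0"
proof (cases "{B. \<xi> [] B} = {}")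
  case False
  have ap: "\<exists>v\<in>F0. \<forall>B\<in>T. \<xi> [] B \<longleftrightarrow> B \<in> v" if T: "finite T" for T
  proof -
    have "finite (Pair [] ` T)" "Pair [] ` T \<subseteq> cyl_index" using T cyl_index_Nil by auto
    from approximableD[OF \<xi> this] obtain \<mu> where \<mu>: "\<mu> \<in> boundary"
      "\<forall>\<alpha> A. (\<alpha>, A) \<in> Pair [] ` T \<longrightarrow> (\<xi> \<alpha> A \<longleftrightarrow> A \<in> tail_filter \<mu> \<alpha>)" by metis
    then show ?thesis using path_r_F0[OF \<mu>(1)] tail_filter_Nil[OF \<mu>(1)]
      by (intro bexI[of _ "path_r \<mu>"]) auto
  qed
  have "{B. \<xi> [] B} \<in> ba_ultrafilters UNIV"
    unfolding ultrafilters_iff[OF ideal_UNIV]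
  proof (intro conjI ballI impI)
    show "bot \<notin> {B. \<xi> [] B}"
    proof -
      obtain v where v: "v \<in> F0" "\<xi> [] bot \<longleftrightarrow> bot \<in> v" using ap[of "{bot}"] by auto
      then show ?thesis using F0_bot[OF v(1)] by simp
    qed
    fix A assume A: "A \<in> {B. \<xi> [] B}"
    show "B \<in> {B. \<xi> [] B}" if B: "A \<le> B" for B
    proof -
      obtain v where v: "v \<in> F0" "A \<in> v" "\<xi> [] B \<longleftrightarrow> B \<in> v" using ap[of "{A, B}"] A by auto
      then show ?thesis using F0_up[OF v(1,2) B] by simp
    qed
    show "inf A B \<in> {B. \<xi> [] B}" if B: "B \<in> {B. \<xi> [] B}" for B
    proof -
      obtain v where v: "v \<in> F0" "A \<in> v" "B \<in> v" "\<xi> [] (inf A B) \<longleftrightarrow> inf A B \<in> v"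
        using ap[of "{A, B, inf A B}"] A B by auto
      then show ?thesis using F0_inf[OF v(1)] by simp
    qed
    show "B \<in> {B. \<xi> [] B} \<or> A - B \<in> {B. \<xi> [] B}" for B
    proof -
      obtain v where v: "v \<in> F0" "A \<in> v" "\<xi> [] B \<longleftrightarrow> B \<in> v" "\<xi> [] (A - B) \<longleftrightarrow> A - B \<in> v"
        using ap[of "{A, B, A - B}"] A by auto
      have "v \<in> ba_ultrafilters UNIV" using F0_in_E0[OF v(1,2)] by (simp add: E0_def)
      from uf_prime[OF ideal_UNIV this v(2), of B] show ?thesis using v by simp
    qed
  qed (use False in simp_all)
  then show ?thesis by (simp add: F0_def E0_def)
qed (simp add: F0_def)

definition stops :: "('l list \<Rightarrow> 'b \<Rightarrow> bool) \<Rightarrow> bool" where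
  "stops \<xi> \<longleftrightarrow> (\<forall>a\<in>L. \<forall>B\<in>\<I> a. \<not> \<xi> [a] B)"

text \<open>Membership of \<open>A\<close> in the ideal of the word gives some \<open>C\<close> in
  the ideal of the first letter such that every path in the cylinder of \<open>A\<close> also lies
  in the one-letter cylinder of \<open>C\<close>. A path approximating both indices carries this
  over to \<xi>.\<close>

lemma stops_Cons:
  assumes \<xi>: "approximable \<xi>" "stops \<xi>" and A: "(b # \<alpha>, A) \<in> cyl_index"
  shows "\<not> \<xi> (b # \<alpha>) A"
proof
  assume x: "\<xi> (b # \<alpha>) A"
  obtain C where C: "C \<in> \<I> b" "A \<le> word_action \<alpha> C" and b: "b \<in> L" using A by (auto simp: cyl_index_def)
  let ?F = "{(b # \<alpha>, A), ([b], C)}"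
  have F: "finite ?F" "?F \<subseteq> cyl_index" using A cyl_index_single[OF b C(1)] by simp_all
  obtain \<mu> where \<mu>: "\<mu> \<in> boundary" "\<forall>\<alpha> A. (\<alpha>, A) \<in> ?F \<longrightarrow> (\<xi> \<alpha> A \<longleftrightarrow> A \<in> tail_filter \<mu> \<alpha>)"
    by (rule approximableD[OF \<xi>(1) F])
  note \<mu>2 = \<mu>(2)[rule_format]
  have A\<mu>: "A \<in> tail_filter \<mu> (b # \<alpha>)" using \<mu>2[of "b # \<alpha>" A] x by simp
  have "C \<in> tail_filter \<mu> [b]"
    using \<mu>(1)
  proof (cases rule: boundary_cases)
    case (Vertex v)
    then show ?thesis using A\<mu> by (simp add: tail_filter_Vertex)
  next
    case (Cons e \<nu>)
    have e: "fst e = b" "A \<in> tail_filter \<nu> \<alpha>"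
      using A\<mu> unfolding Cons(1) tail_filter_Cons[OF Cons(3,4)] by (simp_all split: if_splits)
    have "C \<in> path_r \<nu>"
      using F0_up[OF tail_filter_F0[OF Cons(3)] e(2) C(2)]
        word_action_tail_filter[OF Cons(3) tail_filter_starts[OF e(2)]] by simp
    then show ?thesis
      unfolding Cons(1) tail_filter_Cons[OF Cons(3,4)] tail_filter_Nil[OF Cons(3)] using e(1) by simp
  qed
  then have "\<xi> [b] C" using \<mu>2[of "[b]" C] by simp
  then show False using \<xi>(2) b C(1) by (simp add: stops_def)
qed

text \<open>At a regular vertex, the finitely many pairs from \<open>regular_vertex_cover\<close>
  can be added to the approximated indices. The approximating path then begins with an edge in one
  of them, and \<xi> would not stop.\<close>

lemma stops_singular:
  assumes \<xi>: "approximable \<xi>" "stops \<xi>" and A: "\<xi> [] A"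
  shows "{B. \<xi> [] B} \<in> E0_sg"
proof (rule ccontr)
  let ?v = "{B. \<xi> [] B}"
  assume n: "?v \<notin> E0_sg"
  have v: "?v \<in> E0" by (rule F0_in_E0[OF approximable_F0[OF \<xi>(1)], of A]) (use A in simp)
  then have "?v \<in> F0_rg" using n by (simp add: E0_sg_def)
  with v obtain B S where S: "B \<in> ?v" "finite S" "S \<subseteq> {(a, C). a \<in> L \<and> C \<in> \<I> a}"
    "\<forall>\<mu>\<in>boundary. B \<in> path_r \<mu> \<longrightarrow> (\<exists>(a, C)\<in>S. C \<in> tail_filter \<mu> [a])"
    by (rule regular_vertex_cover)
  let ?F = "insert ([], B) ((\<lambda>(a, C). ([a], C)) ` S)"
  have sub: "?F \<subseteq> cyl_index" using S(3) cyl_index_Nil cyl_index_single by auto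
  have fin: "finite ?F" using S(2) by simp
  obtain \<mu> where \<mu>: "\<mu> \<in> boundary" "\<forall>\<alpha> A. (\<alpha>, A) \<in> ?F \<longrightarrow> (\<xi> \<alpha> A \<longleftrightarrow> A \<in> tail_filter \<mu> \<alpha>)"
    by (rule approximableD[OF \<xi>(1) fin sub])
  note \<mu>2 = \<mu>(2)[rule_format]
  have "B \<in> path_r \<mu>" using \<mu>2[of "[]" B] S(1) tail_filter_Nil[OF \<mu>(1)] by simp
  then obtain a C where aC: "(a, C) \<in> S" "C \<in> tail_filter \<mu> [a]" using S(4) \<mu>(1) by auto
  have "([a], C) \<in> ?F" using image_eqI[OF _ aC(1), of _ "\<lambda>(a, C). ([a], C)"] by simp
  then have "\<xi> [a] C" using \<mu>2[of "[a]" C] aC(2) by simp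
  moreover have "a \<in> L" "C \<in> \<I> a" using aC(1) S(3) by auto
  ultimately show False using \<xi>(2) by (simp add: stops_def)
qed

section \<open>Reading off the limit path\<close>

definition represents :: "('l list \<Rightarrow> 'b \<Rightarrow> bool) \<Rightarrow> ('l, 'b) path \<Rightarrow> bool" where
  "represents \<xi> \<mu> \<longleftrightarrow> (\<forall>(\<alpha>, A)\<in>cyl_index. \<xi> \<alpha> A \<longleftrightarrow> A \<in> tail_filter \<mu> \<alpha>)"

text \<open>For an approximable pattern that does not stop the label is unique by
  \<open>approximable_Cons\<close>, whereas \<open>first_set\<close> is merely some witness.\<close>

definition first_label :: "('l list \<Rightarrow> 'b \<Rightarrow> bool) \<Rightarrow> 'l" where
  "first_label \<xi> = (SOME a. a \<in> L \<and> (\<exists>B\<in>\<I> a. \<xi> [a] B))"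

definition first_set :: "('l list \<Rightarrow> 'b \<Rightarrow> bool) \<Rightarrow> 'b" where
  "first_set \<xi> = (SOME B. B \<in> \<I> (first_label \<xi>) \<and> \<xi> [first_label \<xi>] B)"

definition next_approx :: "('l list \<Rightarrow> 'b \<Rightarrow> bool) \<Rightarrow> 'l list \<Rightarrow> 'b \<Rightarrow> bool" where
  "next_approx \<xi> = shift \<xi> (first_label \<xi>) (first_set \<xi>)"

lemma first_label_set:
  assumes "\<not> stops \<xi>"
  shows "first_label \<xi> \<in> L" "first_set \<xi> \<in> \<I> (first_label \<xi>)" "\<xi> [first_label \<xi>] (first_set \<xi>)"
proof -
  have "\<exists>a. a \<in> L \<and> (\<exists>B\<in>\<I> a. \<xi> [a] B)" using assms by (auto simp: stops_def)
  from someI_ex[OF this] have 1: "first_label \<xi> \<in> L" "\<exists>B. B \<in> \<I> (first_label \<xi>) \<and> \<xi> [first_label \<xi>] B"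
    by (auto simp: first_label_def)
  show "first_label \<xi> \<in> L" by (rule 1)
  show "first_set \<xi> \<in> \<I> (first_label \<xi>)" "\<xi> [first_label \<xi>] (first_set \<xi>)"
    using someI_ex[OF 1(2)] by (simp_all add: first_set_def)
qed

lemma lift_edge_r:
  assumes "a \<in> L" "v \<in> F0" "v \<inter> \<I> a \<noteq> {}"
  shows "C \<in> edge_r (a, v \<inter> \<I> a) \<longleftrightarrow> \<theta> a C \<in> v"
  using edge_r_iff[OF lift_edge(1)[OF assms], of C] lift_edge(2)[OF assms] by simp

lemma represents_Cons:
  assumes \<xi>: "approximable \<xi>" "\<not> stops \<xi>" and \<mu>: "\<mu> \<in> boundary" and rep: "represents (next_approx \<xi>) \<mu>"
  shows "\<exists>\<mu>\<in>boundary. represents \<xi> \<mu>"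
proof -
  note f = first_label_set[OF \<xi>(2)]
  let ?a = "first_label \<xi>"
  \<comment> \<open>The ultrafilter of the new edge is dictated by the range of
    \<open>\<mu>\<close>; \<open>first_set\<close> witnesses that it is non-empty.\<close>
  define e where "e = (?a, path_r \<mu> \<inter> \<I> ?a)"
  have r: "next_approx \<xi> [] C \<longleftrightarrow> C \<in> path_r \<mu>" for C
    using rep cyl_index_Nil[of C] tail_filter_Nil[OF \<mu>] by (auto simp: represents_def)
  have "first_set \<xi> \<in> path_r \<mu>"
    using r[of "first_set \<xi>"] shift_Nil[OF \<xi>(1) f] by (simp add: next_approx_def)
  then have ne: "path_r \<mu> \<inter> \<I> ?a \<noteq> {}" using f(2) by auto
  note e1 = lift_edge[OF f(1) path_r_F0[OF \<mu>] ne, folded e_def]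
  have e: "path_Cons e \<mu> \<in> boundary" by (rule Cons_boundary[OF e1(1) \<mu> e1(2)[symmetric]])
  have "\<xi> \<alpha> A \<longleftrightarrow> A \<in> tail_filter (path_Cons e \<mu>) \<alpha>" if A: "(\<alpha>, A) \<in> cyl_index" for \<alpha> A
  proof (cases \<alpha>)
    case Nil
    have "\<xi> [] A \<longleftrightarrow> \<theta> ?a A \<in> path_r \<mu>"
      using approximable_Nil[OF \<xi>(1) f, of A] r[of "\<theta> ?a A"] by (simp add: next_approx_def)
    also have "\<dots> \<longleftrightarrow> A \<in> edge_r e" using lift_edge_r[OF f(1) path_r_F0[OF \<mu>] ne] by (simp add: e_def)
    finally show ?thesis unfolding Nil tail_filter_Nil[OF e] path_r_Cons .
  next
    case (Cons b \<beta>)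
    have "(\<beta>, A) \<in> cyl_index" using cyl_index_tl A Cons by simp
    then have "next_approx \<xi> \<beta> A \<longleftrightarrow> A \<in> tail_filter \<mu> \<beta>" using rep by (auto simp: represents_def)
    moreover have "\<xi> (b # \<beta>) A \<longleftrightarrow> b = ?a \<and> next_approx \<xi> \<beta> A"
      unfolding next_approx_def using approximable_Cons[OF \<xi>(1) f] A Cons by simp
    ultimately show ?thesis
      unfolding Cons tail_filter_Cons[OF \<mu> e1(2)[symmetric]] by (simp add: e_def)
  qed
  then show ?thesis using e by (auto simp: represents_def simp del: path_prepend.simps)
qed

text \<open>The set \<open>A\<close> guarantees that the range of the limit is not
  \<open>{}\<close>, which is no vertex.\<close>

lemma represents_stopped:
  assumes \<xi>: "approximable \<xi>" "\<xi> [] A" "stops \<xi>" shows "\<exists>\<mu>\<in>boundary. represents \<xi> \<mu>"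
proof -
  define v where "v = {B. \<xi> [] B}"
  have v: "Vertex v \<in> boundary" unfolding Vertex_boundary v_def by (rule stops_singular[OF \<xi>(1,3,2)])
  have "\<xi> \<alpha> A \<longleftrightarrow> A \<in> tail_filter (Vertex v) \<alpha>" if A: "(\<alpha>, A) \<in> cyl_index" for \<alpha> A
  proof (cases \<alpha>)
    case Nil
    then show ?thesis using tail_filter_Nil[OF v] by (simp add: v_def)
  next
    case (Cons b \<beta>)
    then show ?thesis using stops_Cons[OF \<xi>(1,3)] A by (simp add: tail_filter_Vertex)
  qed
  then show ?thesis using v by (auto simp: represents_def)
qed

text \<open>\<open>A\<close> varies in the induction: for the shifted pattern
  \<open>first_set \<xi>\<close> takes its role, by \<open>shift_Nil\<close>.\<close>

lemma represents_stopping: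
  "approximable \<xi> \<Longrightarrow> \<xi> [] A \<Longrightarrow> stops ((next_approx ^^ n) \<xi>) \<Longrightarrow> \<exists>\<mu>\<in>boundary. represents \<xi> \<mu>"
proof (induction n arbitrary: \<xi> A)
  case 0
  then show ?case using represents_stopped[of \<xi> A] by simp
next
  case (Suc n)
  show ?case
  proof (cases "stops \<xi>")
    case True
    then show ?thesis by (rule represents_stopped[OF Suc.prems(1,2)])
  next
    case False
    note f = first_label_set[OF False]
    have "approximable (next_approx \<xi>)"
      unfolding next_approx_def by (rule approximable_shift[OF Suc.prems(1) f])
    moreover have "next_approx \<xi> [] (first_set \<xi>)"
      unfolding next_approx_def by (rule shift_Nil[OF Suc.prems(1) f])
    moreover have "stops ((next_approx ^^ n) (next_approx \<xi>))"
      using Suc.prems(3) by (simp only: funpow_Suc_right o_def)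
    ultimately obtain \<mu> where "\<mu> \<in> boundary" "represents (next_approx \<xi>) \<mu>" using Suc.IH by metis
    then show ?thesis by (rule represents_Cons[OF Suc.prems(1) False])
  qed
qed

text \<open>No finite recursion ends here, so all edges are defined at once from the iterated
  shifts. Each tail \<open>P n\<close> represents the pattern \<open>X n\<close>, by induction on
  the word for all \<open>n\<close> simultaneously.\<close>

lemma represents_infinite:
  assumes \<xi>: "approximable \<xi>" and ns: "\<And>n. \<not> stops ((next_approx ^^ n) \<xi>)"
  shows "\<exists>\<mu>\<in>boundary. represents \<xi> \<mu>"
proof -
  define X where "X n = (next_approx ^^ n) \<xi>" for n
  have XS: "X (Suc n) = next_approx (X n)" for n by (simp add: X_def)
  note f = first_label_set[OF ns, folded X_def]
  have X: "approximable (X n)" for n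
  proof (induction n)
    case (Suc n)
    from approximable_shift[OF Suc f(1)[of n] f(2)[of n] f(3)[of n]] show ?case
      by (simp add: XS next_approx_def)
  qed (simp add: X_def \<xi>)
  define v where "v n = {B. X n [] B}" for n
  define a where "a n = first_label (X n)" for n
  \<comment> \<open>The index \<open>Suc n\<close> occurs because \<open>edge_d\<close> of edge
    \<open>n\<close> is the range of the tail that follows it.\<close>
  define e where "e n = (a n, v (Suc n) \<inter> \<I> (a n))" for n
  have v: "v n \<in> F0" for n unfolding v_def by (rule approximable_F0[OF X])
  have aL: "a n \<in> L" for n unfolding a_def by (rule f)
  have "first_set (X n) \<in> v (Suc n)" for n
    unfolding v_def XS next_approx_def using shift_Nil[OF X f] by simp
  then have ne: "v (Suc n) \<inter> \<I> (a n) \<noteq> {}" for n using f(2)[of n] by (auto simp: a_def)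
  have e1: "e n \<in> E1" "edge_d (e n) = v (Suc n)" for n
    unfolding e_def using lift_edge[OF aL v ne] by simp_all
  have er: "edge_r (e n) = v n" for n
  proof -
    have "C \<in> edge_r (e n) \<longleftrightarrow> C \<in> v n" for C
    proof -
      have "C \<in> edge_r (e n) \<longleftrightarrow> \<theta> (a n) C \<in> v (Suc n)" unfolding e_def by (rule lift_edge_r[OF aL v ne])
      also have "\<dots> \<longleftrightarrow> C \<in> v n"
        using approximable_Nil[OF X f, of n C] by (simp add: v_def XS next_approx_def a_def)
      finally show ?thesis .
    qed
    then show ?thesis by auto
  qed
  define P where "P n = InfPath (\<lambda>i. e (n + i))" for n
  have Pb: "P n \<in> boundary" for n
    unfolding P_def InfPath_boundary using e1 er by simp
  have Pr: "path_r (P n) = v n" for n by (simp add: P_def er)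
  have PS: "P n = path_Cons (e n) (P (Suc n))" for n
  proof -
    have "(\<lambda>i. if i < length [e n] then [e n] ! i else e (Suc n + (i - length [e n]))) = (\<lambda>i. e (n + i))"
    proof
      fix i show "(if i < length [e n] then [e n] ! i else e (Suc n + (i - length [e n]))) = e (n + i)"
        by (cases i) simp_all
    qed
    then show ?thesis by (simp only: P_def path_prepend.simps)
  qed
  have "X n \<alpha> A \<longleftrightarrow> A \<in> tail_filter (P n) \<alpha>" if "(\<alpha>, A) \<in> cyl_index" for n \<alpha> A
    using that
  proof (induction \<alpha> arbitrary: n)
    case Nil
    show ?case unfolding tail_filter_Nil[OF Pb] Pr by (simp add: v_def)
  next
    case (Cons b \<beta>)
    have "X n (b # \<beta>) A \<longleftrightarrow> b = a n \<and> X (Suc n) \<beta> A"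
      unfolding XS next_approx_def a_def by (rule approximable_Cons[OF X f Cons.prems])
    also have "X (Suc n) \<beta> A \<longleftrightarrow> A \<in> tail_filter (P (Suc n)) \<beta>"
      by (rule Cons.IH[OF cyl_index_tl[OF Cons.prems]])
    finally have "X n (b # \<beta>) A \<longleftrightarrow> b = a n \<and> A \<in> tail_filter (P (Suc n)) \<beta>" .
    moreover have "path_r (P (Suc n)) = edge_d (e n)" by (simp add: Pr e1)
    ultimately show ?case
      unfolding PS[of n] using tail_filter_Cons[OF Pb, of "Suc n" "e n" b \<beta>] by (simp add: e_def del: path_prepend.simps)
  qed
  from this[of _ _ 0] have "represents \<xi> (P 0)" by (auto simp: represents_def X_def)
  then show ?thesis using Pb by blast
qed

text \<open>All approximating paths have \<open>A\<close> in their range, hence so has the limit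
  pattern. This is the starting point that \<open>represents_stopping\<close> asks for.\<close>

lemma compactin_cyl_Nil: "compactin cyl_topology (cyl [] A)"
  unfolding cyl_topology_def
proof (rule compactin_finite_approximation[where I = cyl_index and \<Phi> = "\<lambda>(\<alpha>, A). cyl \<alpha> A"])
  let ?S = "(\<lambda>(\<alpha>, A). cyl \<alpha> A) ` cyl_index \<union> (\<lambda>(\<alpha>, A). boundary - cyl \<alpha> A) ` cyl_index"
  have "cyl [] A \<subseteq> boundary" by (auto simp: cyl_def)
  also have "boundary = \<Union>?S"
    using topspace_cyl_topology unfolding cyl_topology_def topology_generated_by_topspace by (rule sym)
  finally show "cyl [] A \<subseteq> \<Union>?S" .
  show "\<exists>i\<in>cyl_index. S \<inter> cyl [] A = (case i of (\<alpha>, A) \<Rightarrow> cyl \<alpha> A) \<inter> cyl [] A \<or>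
      S \<inter> cyl [] A = cyl [] A - (case i of (\<alpha>, A) \<Rightarrow> cyl \<alpha> A)" if S: "S \<in> ?S" for S
  proof -
    obtain \<alpha> B where B: "(\<alpha>, B) \<in> cyl_index" "S = cyl \<alpha> B \<or> S = boundary - cyl \<alpha> B" using S by auto
    have "cyl [] A \<subseteq> boundary" by (auto simp: cyl_def)
    then show ?thesis using B by (intro bexI[OF _ B(1)]) auto
  qed
  fix c :: "'l list \<times> 'b \<Rightarrow> bool"
  assume ap: "\<And>F. finite F \<Longrightarrow> F \<subseteq> cyl_index \<Longrightarrow>
      \<exists>x\<in>cyl [] A. \<forall>i\<in>F. c i = (x \<in> (case i of (\<alpha>, A) \<Rightarrow> cyl \<alpha> A))"
  define \<xi> where "\<xi> = curry c"
  have ap': "\<exists>\<mu>\<in>boundary. A \<in> path_r \<mu> \<and> (\<forall>(\<alpha>, B)\<in>F. \<xi> \<alpha> B \<longleftrightarrow> B \<in> tail_filter \<mu> \<alpha>)"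
    if F: "finite F" "F \<subseteq> cyl_index" for F
  proof -
    obtain \<mu> where \<mu>: "\<mu> \<in> cyl [] A" "\<forall>i\<in>F. c i = (\<mu> \<in> (case i of (\<alpha>, A) \<Rightarrow> cyl \<alpha> A))"
      using ap[OF F] by metis
    have b: "\<mu> \<in> boundary" "A \<in> path_r \<mu>" using \<mu>(1) tail_filter_Nil by (auto simp: cyl_def)
    have "\<xi> \<alpha> B \<longleftrightarrow> B \<in> tail_filter \<mu> \<alpha>" if "(\<alpha>, B) \<in> F" for \<alpha> B
      using bspec[OF \<mu>(2) that] b(1) by (simp add: \<xi>_def cyl_def)
    then show ?thesis using b by (intro bexI[of _ \<mu>]) auto
  qed
  have \<xi>: "approximable \<xi>"
    unfolding approximable_def
  proof (intro allI impI)
    fix F assume "finite F" "F \<subseteq> cyl_index"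
    from ap'[OF this] obtain \<mu> where \<mu>: "\<mu> \<in> boundary" "\<forall>(\<alpha>, B)\<in>F. \<xi> \<alpha> B \<longleftrightarrow> B \<in> tail_filter \<mu> \<alpha>"
      by (elim bexE conjE)
    show "\<exists>\<mu>\<in>boundary. \<forall>(\<alpha>, A)\<in>F. \<xi> \<alpha> A \<longleftrightarrow> A \<in> tail_filter \<mu> \<alpha>" by (rule bexI, rule \<mu>(2), rule \<mu>(1))
  qed
  have "{([], A)} \<subseteq> cyl_index" using cyl_index_Nil by simp
  from ap'[OF _ this] obtain \<mu> where "\<mu> \<in> boundary" "A \<in> path_r \<mu>" "\<xi> [] A \<longleftrightarrow> A \<in> tail_filter \<mu> []" by auto
  then have \<xi>A: "\<xi> [] A" by (simp add: tail_filter_Nil)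
  have "\<exists>\<mu>\<in>boundary. represents \<xi> \<mu>"
  proof (cases "\<exists>n. stops ((next_approx ^^ n) \<xi>)")
    case True
    then show ?thesis using represents_stopping[OF \<xi> \<xi>A] by metis
  next
    case False
    then show ?thesis by (intro represents_infinite[OF \<xi>]) simp
  qed
  then obtain \<nu> where \<nu>: "\<nu> \<in> boundary" "represents \<xi> \<nu>" by metis
  have rep: "\<xi> \<alpha> B \<longleftrightarrow> \<nu> \<in> cyl \<alpha> B" if "(\<alpha>, B) \<in> cyl_index" for \<alpha> B
    using \<nu> that by (auto simp: represents_def cyl_def)
  have "\<nu> \<in> cyl [] A" using rep[OF cyl_index_Nil] \<xi>A by simp
  moreover have "\<forall>i\<in>cyl_index. c i = (\<nu> \<in> (case i of (\<alpha>, A) \<Rightarrow> cyl \<alpha> A))"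
    using rep by (auto simp: \<xi>_def)
  ultimately show "\<exists>x\<in>cyl [] A. \<forall>i\<in>cyl_index. c i = (x \<in> (case i of (\<alpha>, A) \<Rightarrow> cyl \<alpha> A))" by metis
qed

end

section \<open>Adding and removing the first edge\<close>

lemma path_take_take: "m \<le> n \<Longrightarrow> path_take m \<mu> = take m (path_take n \<mu>)"
  by (cases \<mu>) (simp_all add: take_map min_absorb1)

lemma path_starts_single: "path_starts \<mu> (a # \<alpha>) \<Longrightarrow> path_starts \<mu> [a]"
  using path_take_take[of 1 "Suc (length \<alpha>)" \<mu>] by (simp add: path_starts_def flip: take_map)

context gen_boolean_dyn_system
begin

definition add_edge :: "'l \<Rightarrow> ('l, 'b) path \<Rightarrow> ('l, 'b) path" where
  "add_edge a \<mu> = path_Cons (a, path_r \<mu> \<inter> \<I> a) \<mu>"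

abbreviation remove_edge :: "('l, 'b) path \<Rightarrow> ('l, 'b) path" where
  "remove_edge \<equiv> path_drop (Suc 0)"

definition starting :: "'l \<Rightarrow> ('l, 'b) path set" where
  "starting a = {\<mu> \<in> boundary. path_starts \<mu> [a]}"

definition extendable :: "'l \<Rightarrow> ('l, 'b) path set" where
  "extendable a = {\<mu> \<in> boundary. path_r \<mu> \<inter> \<I> a \<noteq> {}}"

lemma startingE:
  assumes "\<mu> \<in> starting a"
  obtains e \<nu> where "\<mu> = path_Cons e \<nu>" "e \<in> E1" "\<nu> \<in> boundary" "path_r \<nu> = edge_d e" "fst e = a"
    "remove_edge \<mu> = \<nu>"
proof -
  have "\<mu> \<in> boundary" "path_starts \<mu> [a]" using assms by (simp_all add: starting_def)
  from this(1) show ?thesis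
  proof (cases rule: boundary_cases)
    case (Vertex v)
    then show ?thesis using \<open>path_starts \<mu> [a]\<close> by simp
  next
    case (Cons e \<nu>)
    have "fst e = a" using \<open>path_starts \<mu> [a]\<close> unfolding Cons(1) path_starts_Cons by simp
    moreover have "remove_edge \<mu> = \<nu>" unfolding Cons(1) by (rule path_drop_Cons[OF Cons(3,4)])
    ultimately show ?thesis using that Cons by metis
  qed
qed

lemma
  assumes "\<mu> \<in> starting a"
  shows remove_edge_extendable: "remove_edge \<mu> \<in> extendable a"
    and add_remove: "add_edge a (remove_edge \<mu>) = \<mu>"
    and tail_filter_remove: "tail_filter (remove_edge \<mu>) \<alpha> = tail_filter \<mu> (a # \<alpha>)"
proof -
  obtain e \<nu> where e: "\<mu> = path_Cons e \<nu>" "e \<in> E1" "\<nu> \<in> boundary" "path_r \<nu> = edge_d e" "fst e = a"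
    "remove_edge \<mu> = \<nu>" using startingE[OF assms] by metis
  obtain B where "B \<in> \<I> a" "B \<in> path_r \<nu>" using edge_nonempty[OF e(2)] e(4,5) by auto
  then show "remove_edge \<mu> \<in> extendable a" using e(3) unfolding e(6) extendable_def by auto
  have "(a, path_r \<nu> \<inter> \<I> a) = e" using edge_snd[OF e(2)] e(4,5) by (simp add: prod_eq_iff)
  then show "add_edge a (remove_edge \<mu>) = \<mu>" unfolding e(6) add_edge_def by (simp only: e(1))
  show "tail_filter (remove_edge \<mu>) \<alpha> = tail_filter \<mu> (a # \<alpha>)"
    unfolding e(6) unfolding e(1) tail_filter_Cons[OF e(3,4)] using e(5) by simp
qed

lemma
  assumes a: "a \<in> L" and "\<mu> \<in> extendable a"
  shows add_edge_starting: "add_edge a \<mu> \<in> starting a"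
    and remove_add: "remove_edge (add_edge a \<mu>) = \<mu>"
    and tail_filter_add: "tail_filter (add_edge a \<mu>) (b # \<alpha>) = (if b = a then tail_filter \<mu> \<alpha> else {})"
    and tail_filter_add_Nil: "C \<in> tail_filter (add_edge a \<mu>) [] \<longleftrightarrow> \<theta> a C \<in> path_r \<mu>"
proof -
  have \<mu>: "\<mu> \<in> boundary" and ne: "path_r \<mu> \<inter> \<I> a \<noteq> {}" using assms(2) by (simp_all add: extendable_def)
  note e = lift_edge[OF a path_r_F0[OF \<mu>] ne]
  have b: "add_edge a \<mu> \<in> boundary" unfolding add_edge_def by (rule Cons_boundary[OF e(1) \<mu> e(2)[symmetric]])
  then show "add_edge a \<mu> \<in> starting a"
    unfolding starting_def add_edge_def by (simp add: path_starts_Cons del: path_prepend.simps)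
  show "remove_edge (add_edge a \<mu>) = \<mu>"
    unfolding add_edge_def by (rule path_drop_Cons[OF \<mu> e(2)[symmetric]])
  show "tail_filter (add_edge a \<mu>) (b # \<alpha>) = (if b = a then tail_filter \<mu> \<alpha> else {})"
    unfolding add_edge_def tail_filter_Cons[OF \<mu> e(2)[symmetric]] by auto
  show "C \<in> tail_filter (add_edge a \<mu>) [] \<longleftrightarrow> \<theta> a C \<in> path_r \<mu>"
    unfolding tail_filter_Nil[OF b] unfolding add_edge_def path_r_Cons
    by (rule lift_edge_r[OF a path_r_F0[OF \<mu>] ne])
qed

lemma starting_eq_Union: "a \<in> L \<Longrightarrow> starting a = (\<Union>B\<in>\<I> a. cyl [a] B)"
  unfolding starting_def using starts_eq_Union[of "[a]"] word_ideal_single[of a] by simp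

lemma extendable_eq_Union: "extendable a = (\<Union>B\<in>\<I> a. cyl [] B)"
  unfolding extendable_def cyl_def using tail_filter_Nil by auto

lemma starting_open: "a \<in> L \<Longrightarrow> openin cyl_topology (starting a)"
  unfolding starting_def by (rule starts_open) simp_all

lemma extendable_open: "openin cyl_topology (extendable a)"
  unfolding extendable_eq_Union using cyl_open[of "[]"] by (intro openin_Union) auto

lemma cyl_subset_boundary: "cyl \<alpha> A \<subseteq> boundary"
  by (auto simp: cyl_def)

lemma continuous_map_into_cyl_topology:
  assumes D: "openin cyl_topology D" and f: "f ` D \<subseteq> boundary"
    and o: "\<And>\<alpha> A. (\<alpha>, A) \<in> cyl_index \<Longrightarrow> openin cyl_topology {\<mu> \<in> D. f \<mu> \<in> cyl \<alpha> A}"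
      "\<And>\<alpha> A. (\<alpha>, A) \<in> cyl_index \<Longrightarrow> openin cyl_topology {\<mu> \<in> D. f \<mu> \<notin> cyl \<alpha> A}"
  shows "continuous_map (subtopology cyl_topology D) cyl_topology f"
proof -
  let ?S = "(\<lambda>(\<alpha>, A). cyl \<alpha> A) ` cyl_index \<union> (\<lambda>(\<alpha>, A). boundary - cyl \<alpha> A) ` cyl_index"
  have D': "D \<subseteq> topspace cyl_topology" using D by (rule openin_subset)
  then have tD: "topspace (subtopology cyl_topology D) = D" by auto
  have U: "\<Union>?S = boundary"
    using topspace_cyl_topology unfolding cyl_topology_def topology_generated_by_topspace .
  have "continuous_map (subtopology cyl_topology D) (topology_generated_by ?S) f"
  proof (rule continuous_on_generated_topo)
    show "f ` topspace (subtopology cyl_topology D) \<subseteq> \<Union>?S"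
      unfolding tD U by (rule f)
    fix S assume "S \<in> ?S"
    then obtain \<alpha> A where A: "(\<alpha>, A) \<in> cyl_index" "S = cyl \<alpha> A \<or> S = boundary - cyl \<alpha> A" by auto
    have "f -` cyl \<alpha> A \<inter> D = {\<mu> \<in> D. f \<mu> \<in> cyl \<alpha> A}" "f -` (boundary - cyl \<alpha> A) \<inter> D = {\<mu> \<in> D. f \<mu> \<notin> cyl \<alpha> A}"
      using f by auto
    then have "openin cyl_topology (f -` S \<inter> D)" using A(2) o[OF A(1)] by metis
    then show "openin (subtopology cyl_topology D) (f -` S \<inter> topspace (subtopology cyl_topology D))"
      unfolding tD openin_open_subtopology[OF D] by simp
  qed
  then show ?thesis by (simp only: cyl_topology_def)
qed

lemma continuous_remove_edge:
  assumes a: "a \<in> L"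
  shows "continuous_map (subtopology cyl_topology (starting a)) cyl_topology remove_edge"
proof (rule continuous_map_into_cyl_topology[OF starting_open[OF a]])
  show "remove_edge ` starting a \<subseteq> boundary" using remove_edge_extendable by (auto simp: extendable_def)
  fix \<alpha> A assume A: "(\<alpha>, A) \<in> cyl_index"
  then have \<alpha>: "\<alpha> \<in> lists L" by (simp add: cyl_index_def)
  have iff: "remove_edge \<mu> \<in> cyl \<alpha> A \<longleftrightarrow> \<mu> \<in> cyl (a # \<alpha>) A" if "\<mu> \<in> starting a" for \<mu>
    using tail_filter_remove[OF that, of \<alpha>] remove_edge_extendable[OF that] that
    by (simp add: cyl_def starting_def extendable_def)
  have "cyl (a # \<alpha>) A \<subseteq> starting a"
    using path_starts_single[OF tail_filter_starts] by (auto simp: cyl_def starting_def)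
  then have "{\<mu> \<in> starting a. remove_edge \<mu> \<in> cyl \<alpha> A} = cyl (a # \<alpha>) A" using iff by auto
  then show "openin cyl_topology {\<mu> \<in> starting a. remove_edge \<mu> \<in> cyl \<alpha> A}"
    using cyl_open[of "a # \<alpha>"] a \<alpha> by simp
  \<comment> \<open>The ideal of \<open>a # \<alpha>\<close> may fail to contain \<open>A\<close>,
    and then the complement of the cylinder is not given as a generating set. On each
    \<open>cyl [a] B\<close> the set \<open>A\<close> can be replaced by its intersection with
    \<open>word_action \<alpha> B\<close>, which does belong to that ideal.\<close>
  have eq: "{\<mu> \<in> starting a. remove_edge \<mu> \<notin> cyl \<alpha> A} =
      (\<Union>B\<in>\<I> a. cyl [a] B - cyl (a # \<alpha>) (inf A (word_action \<alpha> B)))" (is "?l = ?r")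
  proof (rule Set.set_eqI)
    fix \<mu>
    have 1: "\<mu> \<in> cyl (a # \<alpha>) (inf A (word_action \<alpha> B)) \<longleftrightarrow> \<mu> \<in> cyl (a # \<alpha>) A" if B: "\<mu> \<in> cyl [a] B" for B
    proof -
      have \<mu>: "\<mu> \<in> boundary" "B \<in> tail_filter \<mu> [a]" using B by (simp_all add: cyl_def)
      obtain e \<nu> where e: "\<mu> = path_Cons e \<nu>" "e \<in> E1" "\<nu> \<in> boundary" "path_r \<nu> = edge_d e" "fst e = a" "B \<in> path_r \<nu>"
        using tail_filter_singleE[OF \<mu>] by metis
      have "inf A (word_action \<alpha> B) \<in> tail_filter \<mu> (a # \<alpha>) \<longleftrightarrow> A \<in> tail_filter \<nu> \<alpha>"
        using tail_filter_shift[OF e(3,4,6), of A \<alpha>] unfolding e(1,5) .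
      also have "\<dots> \<longleftrightarrow> A \<in> tail_filter \<mu> (a # \<alpha>)"
        unfolding e(1) tail_filter_Cons[OF e(3,4)] using e(5) by simp
      finally show ?thesis using \<mu>(1) by (simp add: cyl_def)
    qed
    have "\<mu> \<in> ?l \<longleftrightarrow> \<mu> \<in> starting a \<and> \<mu> \<notin> cyl (a # \<alpha>) A" using iff by auto
    also have "\<dots> \<longleftrightarrow> \<mu> \<in> ?r" unfolding starting_eq_Union[OF a] using 1 by auto
    finally show "\<mu> \<in> ?l \<longleftrightarrow> \<mu> \<in> ?r" .
  qed
  show "openin cyl_topology {\<mu> \<in> starting a. remove_edge \<mu> \<notin> cyl \<alpha> A}"
    unfolding eq
  proof (rule openin_Union)
    fix S assume "S \<in> (\<lambda>B. cyl [a] B - cyl (a # \<alpha>) (inf A (word_action \<alpha> B))) ` \<I> a"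
    then obtain B where B: "B \<in> \<I> a" "S = cyl [a] B - cyl (a # \<alpha>) (inf A (word_action \<alpha> B))" by auto
    show "openin cyl_topology S"
      unfolding B(2)
      by (rule openin_diff[OF cyl_open_index[OF cyl_index_single[OF a B(1)]] cyl_closed_index[OF cyl_index_inf[OF a \<alpha> B(1)]]])
  qed
qed

lemma continuous_add_edge:
  assumes a: "a \<in> L"
  shows "continuous_map (subtopology cyl_topology (extendable a)) cyl_topology (add_edge a)"
proof (rule continuous_map_into_cyl_topology[OF extendable_open])
  have b: "add_edge a \<mu> \<in> boundary" if "\<mu> \<in> extendable a" for \<mu>
    using add_edge_starting[OF a that] by (simp add: starting_def)
  then show "add_edge a ` extendable a \<subseteq> boundary" by auto
  fix \<alpha> A assume A: "(\<alpha>, A) \<in> cyl_index"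
  \<comment> \<open>The preimage of a cylinder is the trace of a clopen set, which settles cylinders
    and complements together.\<close>
  obtain S where S: "openin cyl_topology S" "closedin cyl_topology S"
    "\<And>\<mu>. \<mu> \<in> extendable a \<Longrightarrow> add_edge a \<mu> \<in> cyl \<alpha> A \<longleftrightarrow> \<mu> \<in> S"
  proof (cases \<alpha>)
    case Nil
    have "add_edge a \<mu> \<in> cyl \<alpha> A \<longleftrightarrow> \<mu> \<in> cyl [] (\<theta> a A)" if "\<mu> \<in> extendable a" for \<mu>
      using tail_filter_add_Nil[OF a that, of A] b[OF that] that
      by (simp add: cyl_def Nil extendable_def tail_filter_Nil)
    then show ?thesis
      using that[of "cyl [] (\<theta> a A)"] cyl_open_index[OF cyl_index_Nil] cyl_closed_index[OF cyl_index_Nil] by simp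
  next
    case (Cons c \<beta>)
    then have A': "(\<beta>, A) \<in> cyl_index" using cyl_index_tl A by simp
    have iff: "add_edge a \<mu> \<in> cyl \<alpha> A \<longleftrightarrow> c = a \<and> \<mu> \<in> cyl \<beta> A" if "\<mu> \<in> extendable a" for \<mu>
      using tail_filter_add[OF a that, of c \<beta>] b[OF that] that
      by (simp add: cyl_def Cons extendable_def)
    show ?thesis
    proof (cases "c = a")
      case True
      then show ?thesis using that[of "cyl \<beta> A"] cyl_open_index[OF A'] cyl_closed_index[OF A'] iff by simp
    next
      case False
      then show ?thesis using that[of "{}"] iff by simp
    qed
  qed
  have "{\<mu> \<in> extendable a. add_edge a \<mu> \<in> cyl \<alpha> A} = extendable a \<inter> S" using S(3) by auto
  then show "openin cyl_topology {\<mu> \<in> extendable a. add_edge a \<mu> \<in> cyl \<alpha> A}"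
    using openin_Int[OF extendable_open S(1)] by simp
  have "{\<mu> \<in> extendable a. add_edge a \<mu> \<notin> cyl \<alpha> A} = extendable a - S" using S(3) by auto
  then show "openin cyl_topology {\<mu> \<in> extendable a. add_edge a \<mu> \<notin> cyl \<alpha> A}"
    using openin_diff[OF extendable_open S(2)] by simp
qed

text \<open>Since \<open>A\<close> lies in the ideal of the longer word, every path in
  \<open>cyl \<alpha> A\<close> has a range meeting \<open>\<I> a\<close>, so an edge can be added.
  Compactness of cylinders thus passes from a word to the word with a letter in front.\<close>

lemma cyl_Cons_eq_image:
  assumes A: "(a # \<alpha>, A) \<in> cyl_index"
  shows "cyl \<alpha> A \<subseteq> extendable a" "cyl (a # \<alpha>) A = add_edge a ` cyl \<alpha> A"
proof -
  have a: "a \<in> L" using A by (simp add: cyl_index_def)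
  obtain B where B: "B \<in> \<I> a" "A \<le> word_action \<alpha> B" using A by (auto simp: cyl_index_def)
  show sub: "cyl \<alpha> A \<subseteq> extendable a"
  proof
    fix \<mu> assume "\<mu> \<in> cyl \<alpha> A"
    then have \<mu>: "\<mu> \<in> boundary" "A \<in> tail_filter \<mu> \<alpha>" by (simp_all add: cyl_def)
    have "B \<in> path_r \<mu>"
      using F0_up[OF tail_filter_F0[OF \<mu>(1)] \<mu>(2) B(2)]
        word_action_tail_filter[OF \<mu>(1) tail_filter_starts[OF \<mu>(2)]] by simp
    then show "\<mu> \<in> extendable a" using B(1) \<mu>(1) by (auto simp: extendable_def)
  qed
  show "cyl (a # \<alpha>) A = add_edge a ` cyl \<alpha> A"
  proof (intro equalityI subsetI)
    fix \<mu> assume "\<mu> \<in> cyl (a # \<alpha>) A"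
    then have \<mu>: "\<mu> \<in> boundary" "A \<in> tail_filter \<mu> (a # \<alpha>)" by (simp_all add: cyl_def)
    have s: "\<mu> \<in> starting a"
      using \<mu>(1) path_starts_single[OF tail_filter_starts[OF \<mu>(2)]] by (simp add: starting_def)
    have "remove_edge \<mu> \<in> cyl \<alpha> A"
      using \<mu>(2) tail_filter_remove[OF s, of \<alpha>] remove_edge_extendable[OF s] by (simp add: cyl_def extendable_def)
    then show "\<mu> \<in> add_edge a ` cyl \<alpha> A" using add_remove[OF s] by (metis image_eqI)
  next
    fix \<mu> assume "\<mu> \<in> add_edge a ` cyl \<alpha> A"
    then obtain \<nu> where \<nu>: "\<nu> \<in> cyl \<alpha> A" "\<mu> = add_edge a \<nu>" by auto
    then have e: "\<nu> \<in> extendable a" using sub by auto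
    show "\<mu> \<in> cyl (a # \<alpha>) A"
      using \<nu> tail_filter_add[OF a e, of a \<alpha>] add_edge_starting[OF a e] by (simp add: cyl_def starting_def)
  qed
qed

lemma compactin_cyl: "(\<alpha>, A) \<in> cyl_index \<Longrightarrow> compactin cyl_topology (cyl \<alpha> A)"
proof (induction \<alpha>)
  case Nil
  show ?case by (rule compactin_cyl_Nil)
next
  case (Cons a \<alpha>)
  have a: "a \<in> L" using Cons.prems by (simp add: cyl_index_def)
  note c = cyl_Cons_eq_image[OF Cons.prems]
  have "compactin (subtopology cyl_topology (extendable a)) (cyl \<alpha> A)"
    using Cons.IH[OF cyl_index_tl[OF Cons.prems]] c(1) by (simp add: compactin_subtopology)
  from image_compactin[OF this continuous_add_edge[OF a]] show ?case unfolding c(2) .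
qed

end

section \<open>The topology of the boundary path space\<close>

text \<open>Continuity on \<open>D\<close> makes the preimage closed only relative to
  \<open>D\<close>, which need not be closed in \<open>X\<close>. Finitely many of the sets
  \<open>W\<close> cover \<open>K\<close>, and their preimages confine the preimage of
  \<open>K\<close> to a closed subset of \<open>X\<close> inside \<open>D\<close>.\<close>

lemma closedin_preimage_of_compact:
  assumes f: "continuous_map (subtopology X D) Y f" and Y: "Hausdorff_space Y" and K: "compactin Y K"
    and cov: "K \<subseteq> \<Union>\<O>" and op: "\<And>W. W \<in> \<O> \<Longrightarrow> openin Y W"
    and cl: "\<And>W. W \<in> \<O> \<Longrightarrow> closedin X {x \<in> D. f x \<in> W}"
  shows "closedin X {x \<in> D. f x \<in> K}"
proof -
  have "\<exists>\<F>. finite \<F> \<and> \<F> \<subseteq> \<O> \<and> K \<subseteq> \<Union>\<F>"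
    by (rule compactinD[OF K _ cov]) (rule op)
  then obtain \<F> where F: "finite \<F>" "\<F> \<subseteq> \<O>" "K \<subseteq> \<Union>\<F>" by (elim exE conjE)
  define C where "C = (\<Union>W\<in>\<F>. {x \<in> D. f x \<in> W})"
  have C: "closedin X C"
    unfolding C_def
  proof (rule closedin_Union)
    show "closedin X S" if S: "S \<in> (\<lambda>W. {x \<in> D. f x \<in> W}) ` \<F>" for S
    proof -
      obtain W where "W \<in> \<F>" "S = {x \<in> D. f x \<in> W}" using S by auto
      then show ?thesis using cl F(2) by auto
    qed
  qed (use F(1) in simp)
  have "closedin (subtopology X D) {x \<in> topspace (subtopology X D). f x \<in> K}"
    by (rule closedin_continuous_map_preimage[OF f compactin_imp_closedin[OF Y K]])
  then obtain Q where Q: "closedin X Q" "{x \<in> topspace (subtopology X D). f x \<in> K} = Q \<inter> D"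
    unfolding closedin_subtopology by auto
  have "C \<subseteq> topspace X" by (rule closedin_subset[OF C])
  have "{x \<in> D. f x \<in> K} = Q \<inter> C"
  proof (intro equalityI subsetI)
    fix x assume x: "x \<in> {x \<in> D. f x \<in> K}"
    then have "x \<in> C" using F(3) by (auto simp: C_def)
    then have "x \<in> {x \<in> topspace (subtopology X D). f x \<in> K}" using x \<open>C \<subseteq> topspace X\<close> by auto
    then show "x \<in> Q \<inter> C" unfolding Q(2) using \<open>x \<in> C\<close> by auto
  next
    fix x assume x: "x \<in> Q \<inter> C"
    then have "x \<in> Q \<inter> D" by (auto simp: C_def)
    then show "x \<in> {x \<in> D. f x \<in> K}" unfolding Q(2)[symmetric] by auto
  qed
  then show ?thesis using closedin_Int[OF Q(1) C] by simp
qed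

lemma continuous_map_nbhdI:
  assumes f: "\<And>x. x \<in> topspace X \<Longrightarrow> f x \<in> topspace Y"
    and n: "\<And>x W. x \<in> topspace X \<Longrightarrow> openin Y W \<Longrightarrow> f x \<in> W \<Longrightarrow>
      \<exists>N. openin X N \<and> x \<in> N \<and> (\<forall>y\<in>N. f y \<in> W)"
  shows "continuous_map X Y f"
  unfolding continuous_map_def
proof (intro conjI allI impI)
  show "f \<in> topspace X \<rightarrow> topspace Y" using f by simp
  fix W assume W: "openin Y W"
  show "openin X {x \<in> topspace X. f x \<in> W}"
  proof (rule iffD2[OF openin_subopen], rule ballI)
    fix x assume x: "x \<in> {x \<in> topspace X. f x \<in> W}"
    then obtain N where N: "openin X N" "x \<in> N" "\<forall>y\<in>N. f y \<in> W" using n[OF _ W] by auto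
    have "N \<subseteq> topspace X" by (rule openin_subset[OF N(1)])
    then have "N \<subseteq> {x \<in> topspace X. f x \<in> W}" using N(3) by auto
    then show "\<exists>T. openin X T \<and> x \<in> T \<and> T \<subseteq> {x \<in> topspace X. f x \<in> W}" using N(1,2) by auto
  qed
qed

lemma length_path_take: "enat n \<le> path_length \<mu> \<Longrightarrow> length (path_take n \<mu>) = n"
  by (cases \<mu>) (simp_all add: zero_enat_def)

lemma path_starts_length: "path_starts \<mu> \<alpha> \<Longrightarrow> enat (length \<alpha>) \<le> path_length \<mu>"
proof (cases \<mu>)
  case (FinPath es)
  assume "path_starts \<mu> \<alpha>"
  then have "length (map fst (path_take (length \<alpha>) \<mu>)) = length \<alpha>" by (simp only: path_starts_def)
  then show ?thesis using FinPath by simp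
next
  case (Vertex v)
  assume "path_starts \<mu> \<alpha>"
  then show ?thesis using Vertex by (simp add: path_starts_def zero_enat_def)
qed simp

context gen_boolean_dyn_system
begin

lemma word_ideal_last: "\<alpha> \<in> lists L \<Longrightarrow> \<alpha> \<noteq> [] \<Longrightarrow> A \<in> word_ideal \<alpha> \<Longrightarrow> A \<in> \<I> (last \<alpha>)"
proof (induction \<alpha>)
  case (Cons a \<alpha>)
  show ?case
  proof (cases "\<alpha> = []")
    case True
    then show ?thesis using Cons.prems word_ideal_single[of a] by (simp del: word_ideal.simps)
  next
    case False
    then show ?thesis using Cons.IH word_ideal_Cons_subset[OF Cons.prems(1,3)] Cons.prems(1) by simp
  qed
qed simp

lemma tail_filter_last:
  assumes "\<mu> \<in> boundary" "path_starts \<mu> \<alpha>" "\<alpha> \<noteq> []"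
  shows "last (path_take (length \<alpha>) \<mu>) \<in> E1 \<and> fst (last (path_take (length \<alpha>) \<mu>)) = last \<alpha> \<and>
    edge_d (last (path_take (length \<alpha>) \<mu>)) = tail_filter \<mu> \<alpha>"
  using assms
proof (induction \<alpha> arbitrary: \<mu>)
  case (Cons a \<alpha>)
  from Cons.prems(1) show ?case
  proof (cases rule: boundary_cases)
    case (Vertex v)
    then show ?thesis using Cons.prems(2) by simp
  next
    case C: (Cons e \<nu>)
    have s: "fst e = a" "path_starts \<nu> \<alpha>" using Cons.prems(2) unfolding C(1) path_starts_Cons by simp_all
    have t: "tail_filter \<mu> (a # \<alpha>) = tail_filter \<nu> \<alpha>" unfolding C(1) tail_filter_Cons[OF C(3,4)] using s by simp
    have p: "path_take (length (a # \<alpha>)) \<mu> = e # path_take (length \<alpha>) \<nu>"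
      unfolding C(1) by (simp add: path_take_Cons del: path_prepend.simps)
    show ?thesis
    proof (cases "\<alpha> = []")
      case True
      then show ?thesis unfolding p t using C s by (simp add: tail_filter_Nil)
    next
      case False
      have "path_take (length \<alpha>) \<nu> \<noteq> []"
        using length_path_take[OF path_starts_length[OF s(2)]] False by auto
      then show ?thesis unfolding p t using Cons.IH[OF C(3) s(2) False] False by simp
    qed
  qed
qed simp

lemma in_tail_filter_iff:
  assumes \<mu>: "\<mu> \<in> boundary" and \<alpha>: "\<alpha> \<noteq> []" and A: "A \<in> \<I> (last \<alpha>)"
  shows "A \<in> tail_filter \<mu> \<alpha> \<longleftrightarrow> path_starts \<mu> \<alpha> \<and> A \<in> snd (last (path_take (length \<alpha>) \<mu>))"
proof (cases "path_starts \<mu> \<alpha>")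
  case True
  note t = tail_filter_last[OF \<mu> True \<alpha>]
  have "A \<in> edge_d (last (path_take (length \<alpha>) \<mu>)) \<longleftrightarrow> A \<in> snd (last (path_take (length \<alpha>) \<mu>))"
    by (rule edge_d_iff) (use t A in auto)
  then show ?thesis using t True by simp
next
  case False
  then show ?thesis using tail_filter_starts[of A \<mu> \<alpha>] by auto
qed

lemma path_take_En: "\<mu> \<in> boundary \<Longrightarrow> enat n \<le> path_length \<mu> \<Longrightarrow> path_take n \<mu> \<in> En n"
proof (induction n arbitrary: \<mu>)
  case 0
  then show ?case by (simp add: En_0)
next
  case (Suc n)
  from Suc.prems(1) show ?case
  proof (cases rule: boundary_cases)
    case (Vertex v)
    then show ?thesis using Suc.prems(2) by (simp add: zero_enat_def)
  next
    case (Cons e \<nu>)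
    have "enat n \<le> path_length \<nu>"
      using Suc.prems(2) unfolding Cons(1) path_length_Cons by (simp flip: eSuc_enat)
    then have n: "path_take n \<nu> \<in> En n" by (rule Suc.IH[OF Cons(3)])
    have "edge_d e = edge_r (hd (path_take n \<nu>))" if ne: "path_take n \<nu> \<noteq> []"
    proof -
      obtain m where m: "n = Suc m" using ne by (cases n) auto
      from Cons(3) show ?thesis
      proof (cases rule: boundary_cases)
        case (Vertex v)
        then show ?thesis using ne by simp
      next
        case D: (Cons f \<rho>)
        have "hd (path_take n \<nu>) = f" unfolding m D(1) path_take_Cons by simp
        moreover have "path_r \<nu> = edge_r f" unfolding D(1) by (rule path_r_Cons)
        ultimately show ?thesis using Cons(4) by simp
      qed
    qed
    then show ?thesis unfolding Cons(1) path_take_Cons En_Cons using Cons(2) n by simp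
  qed
qed

subsection \<open>Finite paths\<close>

lemma topspace_E0_topology: "topspace E0_topology = E0"
  unfolding E0_topology_def E0_def by (rule topspace_ultrafilter_topology[OF ideal_UNIV])

lemma topspace_E1_topology: "topspace E1_topology = E1"
  unfolding E1_topology_def E1_def using topspace_ultrafilter_topology[OF ideal] by auto

lemma openin_E1_topology: "openin E1_topology V \<longleftrightarrow> V \<subseteq> E1 \<and> (\<forall>a\<in>L. openin (ultrafilter_topology (\<I> a)) {\<eta>. (a, \<eta>) \<in> V})"
proof -
  have "Sigma L (topspace \<circ> (\<lambda>\<alpha>. ultrafilter_topology (\<I> \<alpha>))) = E1"
    unfolding E1_def using topspace_ultrafilter_topology[OF ideal] by auto
  then show ?thesis unfolding E1_topology_def openin_sum_topology by simp
qed

lemma Hausdorff_E0_topology: "Hausdorff_space E0_topology"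
  unfolding E0_topology_def by (rule Hausdorff_ultrafilter_topology[OF ideal_UNIV])

lemma openin_E1_image:
  assumes a: "a \<in> L" and V: "openin (ultrafilter_topology (\<I> a)) V" shows "openin E1_topology (Pair a ` V)"
proof -
  have "{\<eta>. (b, \<eta>) \<in> Pair a ` V} = (if b = a then V else {})" for b by auto
  moreover have "Pair a ` V \<subseteq> E1"
    using openin_subset[OF V] topspace_ultrafilter_topology[OF ideal[OF a]] a by (auto simp: E1_def)
  ultimately show ?thesis unfolding openin_E1_topology using V by simp
qed

lemma Hausdorff_E1_topology: "Hausdorff_space E1_topology"
  unfolding Hausdorff_space_def topspace_E1_topology
proof (intro allI impI; elim conjE)
  fix e f assume e: "e \<in> E1" and f: "f \<in> E1" and ne: "e \<noteq> f"
  obtain a \<eta> where a: "e = (a, \<eta>)" "a \<in> L" "\<eta> \<in> ba_ultrafilters (\<I> a)" using e by (auto simp: E1_def)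
  obtain b \<zeta> where b: "f = (b, \<zeta>)" "b \<in> L" "\<zeta> \<in> ba_ultrafilters (\<I> b)" using f by (auto simp: E1_def)
  show "\<exists>U V. openin E1_topology U \<and> openin E1_topology V \<and> e \<in> U \<and> f \<in> V \<and> disjnt U V"
  proof (cases "a = b")
    case True
    then have "\<eta> \<noteq> \<zeta>" using a b ne by simp
    then obtain U V where UV: "openin (ultrafilter_topology (\<I> a)) U" "openin (ultrafilter_topology (\<I> a)) V"
      "\<eta> \<in> U" "\<zeta> \<in> V" "disjnt U V"
      using Hausdorff_ultrafilter_topology[OF ideal[OF a(2)]] a(3) b(3) True
      unfolding Hausdorff_space_def topspace_ultrafilter_topology[OF ideal[OF a(2)]] by metis
    have "disjnt (Pair a ` U) (Pair a ` V)" using UV(5) by (auto simp: disjnt_def)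
    moreover have "e \<in> Pair a ` U" "f \<in> Pair a ` V" using UV(3,4) a b True by auto
    ultimately show ?thesis
      using openin_E1_image[OF a(2) UV(1)] openin_E1_image[OF a(2) UV(2)] by metis
  next
    case False
    let ?U = "Pair a ` topspace (ultrafilter_topology (\<I> a))" and ?V = "Pair b ` topspace (ultrafilter_topology (\<I> b))"
    have "disjnt ?U ?V" using False by (auto simp: disjnt_def)
    moreover have "e \<in> ?U" "f \<in> ?V"
      using a b topspace_ultrafilter_topology[OF ideal[OF a(2)]] topspace_ultrafilter_topology[OF ideal[OF b(2)]] by auto
    ultimately show ?thesis
      using openin_E1_image[OF a(2) openin_topspace] openin_E1_image[OF b(2) openin_topspace] by metis
  qed
qed

lemma topspace_En_topology: "topspace (En_topology n) = En n"
proof -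
  have "es \<in> (\<lambda>es. restrict (nth es) {..<n}) -` topspace (product_topology (\<lambda>_. E1_topology) {..<n})"
    if "es \<in> En n" for es
    using that by (auto simp: En_def topspace_E1_topology)
  then show ?thesis unfolding En_topology_def topspace_pullback_topology by auto
qed

lemma continuous_into_En_topology:
  assumes f: "\<And>x. x \<in> topspace X \<Longrightarrow> f x \<in> En n"
    and c: "\<And>i. i < n \<Longrightarrow> continuous_map X E1_topology (\<lambda>x. f x ! i)"
  shows "continuous_map X (En_topology n) f"
  unfolding En_topology_def
proof (rule continuous_map_pullback')
  show "continuous_map X (product_topology (\<lambda>_. E1_topology) {..<n}) ((\<lambda>es. restrict (nth es) {..<n}) \<circ> f)"
    unfolding continuous_map_componentwise
  proof (intro conjI ballI)
    fix i assume i: "i \<in> {..<n}"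
    then show "continuous_map X E1_topology (\<lambda>x. ((\<lambda>es. restrict (nth es) {..<n}) \<circ> f) x i)"
      using c[of i] by simp
  qed auto
  show "topspace X \<subseteq> f -` En n" using f by auto
qed

lemma Hausdorff_En_topology: "Hausdorff_space (En_topology n)"
proof (rule Hausdorff_space_injective_preimage)
  show "Hausdorff_space (product_topology (\<lambda>_. E1_topology) {..<n})"
    unfolding Hausdorff_space_product_topology using Hausdorff_E1_topology by simp
  have "continuous_map (En_topology n) (product_topology (\<lambda>_. E1_topology) {..<n}) (id \<circ> (\<lambda>es. restrict (nth es) {..<n}))"
    unfolding En_topology_def by (rule continuous_map_pullback[OF continuous_map_id])
  then show "continuous_map (En_topology n) (product_topology (\<lambda>_. E1_topology) {..<n}) (\<lambda>es. restrict (nth es) {..<n})"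
    by simp
  show "inj_on (\<lambda>es. restrict (nth es) {..<n}) (topspace (En_topology n))"
    unfolding topspace_En_topology
  proof (rule inj_onI)
    fix es fs assume e: "es \<in> En n" "fs \<in> En n" and eq: "restrict (nth es) {..<n} = restrict (nth fs) {..<n}"
    have "es ! i = fs ! i" if "i < n" for i using fun_cong[OF eq, of i] that by simp
    then show "es = fs" using e by (intro nth_equalityI) (simp_all add: En_def)
  qed
qed

lemma openin_Vertex_image: "openin E0_topology V \<Longrightarrow> openin finite_paths_topology (Vertex ` V)"
  unfolding openin_finite_paths_topology
proof (intro conjI allI impI)
  assume V: "openin E0_topology V"
  show "Vertex ` V \<subseteq> finite_paths" using openin_subset[OF V] topspace_E0_topology by (auto simp: finite_paths_def)
  have eq: "{v. Vertex v \<in> Vertex ` V} = V" by auto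
  show "openin E0_topology {v. Vertex v \<in> Vertex ` V}" unfolding eq by (rule V)
  show "openin (En_topology n) {es. length es = n \<and> FinPath es \<in> Vertex ` V}" for n
  proof -
    have eq: "{es. length es = n \<and> FinPath es \<in> Vertex ` V} = {}" by auto
    show ?thesis unfolding eq by (rule openin_empty)
  qed
qed

lemma openin_FinPath_image:
  assumes n: "1 \<le> n" and V: "openin (En_topology n) V"
  shows "openin finite_paths_topology (FinPath ` V)"
  unfolding openin_finite_paths_topology
proof (intro conjI allI impI)
  have VE: "V \<subseteq> En n" using openin_subset[OF V] topspace_En_topology by simp
  then show "FinPath ` V \<subseteq> finite_paths" using n by (auto simp: finite_paths_def)
  have eq: "{v. Vertex v \<in> FinPath ` V} = {}" by auto
  show "openin E0_topology {v. Vertex v \<in> FinPath ` V}" unfolding eq by (rule openin_empty)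
  fix m :: nat
  have "{es. length es = m \<and> FinPath es \<in> FinPath ` V} = (if m = n then V else {})"
    using VE by (auto simp: En_def)
  then show "openin (En_topology m) {es. length es = m \<and> FinPath es \<in> FinPath ` V}" using V by simp
qed

lemma topspace_finite_paths_topology: "topspace finite_paths_topology = finite_paths"
proof -
  have "openin finite_paths_topology finite_paths"
    unfolding openin_finite_paths_topology
  proof (intro conjI allI impI)
    have "{v. Vertex v \<in> finite_paths} = topspace E0_topology"
      unfolding topspace_E0_topology by (auto simp: finite_paths_def)
    then show "openin E0_topology {v. Vertex v \<in> finite_paths}" by simp
    fix n :: nat assume n: "1 \<le> n"
    have "{es. length es = n \<and> FinPath es \<in> finite_paths} = topspace (En_topology n)"
      unfolding topspace_En_topology using n by (auto simp: finite_paths_def En_def)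
    then show "openin (En_topology n) {es. length es = n \<and> FinPath es \<in> finite_paths}" by simp
  qed simp
  moreover have "topspace finite_paths_topology \<subseteq> finite_paths"
    using openin_topspace[of finite_paths_topology] unfolding openin_finite_paths_topology by simp
  ultimately show ?thesis using openin_subset by auto
qed

text \<open>The finite-path counterpart of a cylinder (\<open>cyl_eq_edge_box\<close>).
  \<open>A\<close> is tested at the last edge only; by \<open>En_word_action\<close> that edge
  controls all earlier ones.\<close>

definition edge_box :: "'l list \<Rightarrow> 'b \<Rightarrow> ('l, 'b) edge list set" where
  "edge_box \<alpha> A = {es \<in> En (length \<alpha>). map fst es = \<alpha> \<and> A \<in> snd (last es)}"

lemma continuous_nth_En:
  assumes i: "i < n" shows "continuous_map (En_topology n) E1_topology (\<lambda>es. es ! i)"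
proof -
  have "continuous_map (En_topology n) E1_topology ((\<lambda>g. g i) \<circ> (\<lambda>es. restrict (nth es) {..<n}))"
    unfolding En_topology_def
    by (rule continuous_map_pullback[OF continuous_map_product_projection]) (use i in simp)
  then show ?thesis by (rule continuous_map_eq) (use i in simp)
qed

lemma edge_box_open:
  assumes \<alpha>: "\<alpha> \<in> lists L" "\<alpha> \<noteq> []" and A: "A \<in> \<I> (last \<alpha>)"
  shows "openin (En_topology (length \<alpha>)) (edge_box \<alpha> A)"
proof -
  let ?n = "length \<alpha>"
  \<comment> \<open>Every coordinate fixes its label, and the last one also asks for
    \<open>A\<close>.\<close>
  define W where "W i = Pair (\<alpha> ! i) ` (if i = ?n - 1 then {\<eta> \<in> ba_ultrafilters (\<I> (\<alpha> ! i)). A \<in> \<eta>}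
      else topspace (ultrafilter_topology (\<I> (\<alpha> ! i))))" for i
  have last\<alpha>: "last \<alpha> = \<alpha> ! (?n - 1)" by (rule last_conv_nth[OF \<alpha>(2)])
  have W: "openin E1_topology (W i)" if "i < ?n" for i
  proof -
    have "\<alpha> ! i \<in> L" using \<alpha>(1) that by (auto simp: in_lists_conv_set)
    moreover have "openin (ultrafilter_topology (\<I> (\<alpha> ! i))) (if i = ?n - 1 then {\<eta> \<in> ba_ultrafilters (\<I> (\<alpha> ! i)). A \<in> \<eta>}
      else topspace (ultrafilter_topology (\<I> (\<alpha> ! i))))"
      using openin_ultrafilter_topology[OF A] by (simp add: last\<alpha>)
    ultimately show ?thesis unfolding W_def by (rule openin_E1_image)
  qed
  have "edge_box \<alpha> A = (\<Inter>i\<in>{..<?n}. {es \<in> topspace (En_topology ?n). es ! i \<in> W i})"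
  proof (rule Set.set_eqI)
    fix es
    show "es \<in> edge_box \<alpha> A \<longleftrightarrow> es \<in> (\<Inter>i\<in>{..<?n}. {es \<in> topspace (En_topology ?n). es ! i \<in> W i})"
    proof (cases "es \<in> En ?n")
      case True
      then have len: "length es = ?n" "\<And>i. i < ?n \<Longrightarrow> es ! i \<in> E1" by (auto simp: En_def)
      have "es \<noteq> []" using len(1) \<alpha>(2) by auto
      then have last: "last es = es ! (?n - 1)" using len(1) last_conv_nth by metis
      have Wi: "es ! i \<in> W i \<longleftrightarrow> fst (es ! i) = \<alpha> ! i \<and> (i = ?n - 1 \<longrightarrow> A \<in> snd (es ! i))" if i: "i < ?n" for i
      proof -
        obtain a \<eta> where e: "es ! i = (a, \<eta>)" "a \<in> L" "\<eta> \<in> ba_ultrafilters (\<I> a)" using len(2)[OF i] by (auto simp: E1_def)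
        have "\<alpha> ! i \<in> L" using \<alpha>(1) i by (auto simp: in_lists_conv_set)
        then show ?thesis
          unfolding e(1) W_def using e(2,3) topspace_ultrafilter_topology[OF ideal, of "\<alpha> ! i"] by auto
      qed
      have "es \<in> (\<Inter>i\<in>{..<?n}. {es \<in> topspace (En_topology ?n). es ! i \<in> W i}) \<longleftrightarrow> (\<forall>i<?n. es ! i \<in> W i)"
        using True topspace_En_topology \<alpha>(2) by auto
      also have "\<dots> \<longleftrightarrow> (\<forall>i<?n. fst (es ! i) = \<alpha> ! i) \<and> A \<in> snd (es ! (?n - 1))" (is "?l \<longleftrightarrow> ?r")
      proof
        assume l: ?l
        have "?n - 1 < ?n" using \<alpha>(2) by simp
        with l show ?r using Wi by simp
      next
        assume r: ?r
        have "es ! i \<in> W i" if "i < ?n" for i using Wi[OF that] r that by simp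
        then show ?l by simp
      qed
      also have "(\<forall>i<?n. fst (es ! i) = \<alpha> ! i) \<longleftrightarrow> map fst es = \<alpha>"
        using len(1) by (auto simp: list_eq_iff_nth_eq)
      finally show ?thesis using True last by (simp add: edge_box_def)
    next
      case False
      then show ?thesis using \<alpha>(2) by (auto simp: edge_box_def topspace_En_topology)
    qed
  qed
  moreover have "openin (En_topology ?n) (\<Inter>i\<in>{..<?n}. {es \<in> topspace (En_topology ?n). es ! i \<in> W i})"
  proof (rule openin_Inter)
    show "(\<lambda>i. {es \<in> topspace (En_topology ?n). es ! i \<in> W i}) ` {..<?n} \<noteq> {}" using \<alpha>(2) by auto
    fix S assume "S \<in> (\<lambda>i. {es \<in> topspace (En_topology ?n). es ! i \<in> W i}) ` {..<?n}"
    then obtain i where i: "i < ?n" "S = {es \<in> topspace (En_topology ?n). es ! i \<in> W i}" by auto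
    show "openin (En_topology ?n) S"
      unfolding i(2) by (rule openin_continuous_map_preimage[OF continuous_nth_En[OF i(1)] W[OF i(1)]])
  qed simp
  ultimately show ?thesis by simp
qed

text \<open>Backward induction from the last edge: matching of consecutive edges and
  \<open>edge_r_iff\<close> move one letter of the action at a time.\<close>

lemma En_word_action:
  assumes es: "es \<in> En n" and i: "i < n"
  shows "word_action (drop (Suc i) (map fst es)) B \<in> edge_d (last es) \<longleftrightarrow> B \<in> edge_d (es ! i)"
proof -
  have len: "length es = n" and E: "\<And>i. i < n \<Longrightarrow> es ! i \<in> E1"
    and m: "\<And>i. Suc i < n \<Longrightarrow> edge_d (es ! i) = edge_r (es ! Suc i)"
    using es by (auto simp: En_def)
  have "es \<noteq> []" using i len by auto
  from last_conv_nth[OF this] have last: "last es = es ! (n - 1)" using len by simp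
  have "i \<le> n - 1" using i by simp
  then show ?thesis
  proof (induction i arbitrary: B rule: inc_induct)
    case base
    then show ?case using len i last by simp
  next
    case (step k)
    then have k: "Suc k < n" by simp
    have "drop (Suc k) (map fst es) = fst (es ! Suc k) # drop (Suc (Suc k)) (map fst es)"
      using Cons_nth_drop_Suc[of "Suc k" "map fst es"] k len by simp
    then have "word_action (drop (Suc k) (map fst es)) B \<in> edge_d (last es) \<longleftrightarrow> \<theta> (fst (es ! Suc k)) B \<in> edge_d (es ! Suc k)"
      using step.IH[of "\<theta> (fst (es ! Suc k)) B"] by simp
    also have "\<dots> \<longleftrightarrow> B \<in> edge_d (es ! k)" unfolding m[OF k] using edge_r_iff[OF E[OF k]] by simp
    finally show ?case .
  qed
qed

lemma edge_box_cover:
  assumes es: "es \<in> En n" and n: "1 \<le> n"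
  obtains A where "map fst es \<in> lists L" "A \<in> word_ideal (map fst es)" "es \<in> edge_box (map fst es) A"
proof -
  have len: "length es = n" and E: "set es \<subseteq> E1" using es by (auto simp: En_def)
  then obtain e fs where efs: "es = e # fs" using n by (cases es) auto
  have "fst f \<in> L" if "f \<in> set es" for f using E that E1_iff[of f] by auto
  then have L: "map fst es \<in> lists L" by (auto simp: in_lists_conv_set)
  have e: "e \<in> E1" using E efs by simp
  obtain B where B: "B \<in> \<I> (fst e)" "B \<in> edge_d e" using edge_nonempty[OF e] by auto
  \<comment> \<open>A member of the first ultrafilter, pushed forward along the remaining labels,
    lies in the ideal of the word and in the filter of the last edge.\<close>
  let ?A = "word_action (map fst fs) B"
  have A: "?A \<in> word_ideal (map fst es)" using B(1) efs by auto
  have "?A \<in> edge_d (last es)" using En_word_action[OF es, of 0 B] B(2) n efs by simp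
  moreover have "last es \<in> E1" using E efs by auto
  moreover have "?A \<in> \<I> (fst (last es))" using word_ideal_last[OF L _ A] last_map[of es fst] efs by (simp del: list.map last.simps)
  ultimately have "?A \<in> snd (last es)" using edge_d_iff by simp
  then show ?thesis using that[OF L A] es len by (simp add: edge_box_def)
qed

end

section \<open>Compactness of the boxes of finite paths\<close>

context gen_boolean_dyn_system
begin

text \<open>The edges with labels \<alpha> of a path that ends at \<open>v\<close>. The formula
  gives each coordinate directly, so that continuity in \<open>v\<close> can be checked coordinate
  by coordinate.\<close>

definition word_lift :: "'l list \<Rightarrow> 'b set \<Rightarrow> ('l, 'b) edge list" where
  "word_lift \<alpha> v = map (\<lambda>i. (\<alpha> ! i, {B \<in> \<I> (\<alpha> ! i). word_action (drop (Suc i) \<alpha>) B \<in> v})) [0..<length \<alpha>]"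

lemma word_ideal_drop: "\<alpha> \<in> lists L \<Longrightarrow> A \<in> word_ideal \<alpha> \<Longrightarrow> A \<in> word_ideal (drop i \<alpha>)"
proof (induction i arbitrary: \<alpha>)
  case (Suc i)
  show ?case
  proof (cases \<alpha>)
    case (Cons a \<beta>)
    then show ?thesis using Suc.IH[of \<beta>] Suc.prems word_ideal_Cons_subset[of a \<beta> A] by simp
  qed (use Suc.prems in simp)
qed simp

context
  fixes \<alpha> A assumes \<alpha>: "\<alpha> \<in> lists L" "\<alpha> \<noteq> []" and A: "A \<in> word_ideal \<alpha>"
begin

text \<open>\<open>A\<close> lies in the ideal of the rest of the word, hence below the image of
  some \<open>C\<close> in \<open>\<I> (\<alpha> ! i)\<close>. That image lies in \<open>v\<close>,
  which makes the pulled back filter non-empty.\<close>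

lemma word_lift_edge:
  assumes v: "v \<in> E0" "A \<in> v" and i: "i < length \<alpha>"
  shows "{B \<in> \<I> (\<alpha> ! i). word_action (drop (Suc i) \<alpha>) B \<in> v} \<in> ba_ultrafilters (\<I> (\<alpha> ! i))"
    and "edge_d (word_lift \<alpha> v ! i) = {B. word_action (drop (Suc i) \<alpha>) B \<in> v}"
proof -
  let ?a = "\<alpha> ! i" and ?\<beta> = "drop (Suc i) \<alpha>"
  have a: "?a \<in> L" using \<alpha>(1) i by (auto simp: in_lists_conv_set)
  have \<beta>: "?\<beta> \<in> lists L" using \<alpha>(1) in_set_dropD[of _ "Suc i" \<alpha>] by (auto simp: in_lists_conv_set)
  have "A \<in> word_ideal (?a # ?\<beta>)"
    using word_ideal_drop[OF \<alpha>(1) A, of i] Cons_nth_drop_Suc[OF i] by simp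
  then obtain C where C: "C \<in> \<I> ?a" "A \<le> word_action ?\<beta> C" by auto
  note vF = E0_F0[OF v(1)]
  have Cv: "word_action ?\<beta> C \<in> v" by (rule F0_up[OF vF v(2) C(2)])
  show "{B \<in> \<I> ?a. word_action ?\<beta> B \<in> v} \<in> ba_ultrafilters (\<I> ?a)"
    by (rule uf_pullback[OF word_action_action[OF \<beta>] ideal[OF a] ideal_UNIV])
      (use v(1) C(1) Cv in \<open>auto simp: E0_def\<close>)
  have "(\<exists>D\<in>{B \<in> \<I> ?a. word_action ?\<beta> B \<in> v}. D \<le> B) \<longleftrightarrow> word_action ?\<beta> B \<in> v" for B
  proof
    assume "\<exists>D\<in>{B \<in> \<I> ?a. word_action ?\<beta> B \<in> v}. D \<le> B"
    then obtain D where D: "word_action ?\<beta> D \<in> v" "D \<le> B" by auto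
    show "word_action ?\<beta> B \<in> v"
      by (rule F0_up[OF vF D(1) action_mono[OF word_action_action[OF \<beta>] D(2)]])
  next
    assume B: "word_action ?\<beta> B \<in> v"
    have "word_action ?\<beta> (inf B C) = inf (word_action ?\<beta> B) (word_action ?\<beta> C)"
      using word_action_action[OF \<beta>] by (simp add: ba_action_def)
    then have "word_action ?\<beta> (inf B C) \<in> v" using F0_inf[OF vF] B Cv by simp
    moreover have "inf B C \<in> \<I> ?a" by (rule ideal_inf(2)[OF ideal[OF a] C(1)])
    ultimately show "\<exists>D\<in>{B \<in> \<I> ?a. word_action ?\<beta> B \<in> v}. D \<le> B"
      by (intro bexI[of _ "inf B C"]) simp_all
  qed
  then show "edge_d (word_lift \<alpha> v ! i) = {B. word_action ?\<beta> B \<in> v}"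
    using i by (simp add: word_lift_def edge_d_def)
qed

lemma word_lift_nth_E1:
  assumes v: "v \<in> E0" "A \<in> v" and i: "i < length \<alpha>" shows "word_lift \<alpha> v ! i \<in> E1"
proof -
  have "\<alpha> ! i \<in> L" using \<alpha>(1) i by (auto simp: in_lists_conv_set)
  then show ?thesis using word_lift_edge(1)[OF assms] i by (simp add: word_lift_def E1_iff)
qed

lemma word_lift_edge_box:
  assumes v: "v \<in> E0" "A \<in> v" shows "word_lift \<alpha> v \<in> edge_box \<alpha> A"
proof -
  have len: "length (word_lift \<alpha> v) = length \<alpha>" by (simp add: word_lift_def)
  have "edge_d (word_lift \<alpha> v ! i) = edge_r (word_lift \<alpha> v ! Suc i)" if i: "Suc i < length \<alpha>" for i
  proof -
    have "edge_r (word_lift \<alpha> v ! Suc i) = {B. \<theta> (\<alpha> ! Suc i) B \<in> edge_d (word_lift \<alpha> v ! Suc i)}"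
      using edge_r_iff[OF word_lift_nth_E1[OF v i]] i by (auto simp: word_lift_def)
    also have "\<dots> = {B. word_action (\<alpha> ! Suc i # drop (Suc (Suc i)) \<alpha>) B \<in> v}"
      unfolding word_lift_edge(2)[OF v i] by simp
    also have "\<alpha> ! Suc i # drop (Suc (Suc i)) \<alpha> = drop (Suc i) \<alpha>" by (rule Cons_nth_drop_Suc[OF i])
    finally show ?thesis using word_lift_edge(2)[OF v, of i] i by simp
  qed
  moreover have "set (word_lift \<alpha> v) \<subseteq> E1"
    using word_lift_nth_E1[OF v] len by (auto simp: set_conv_nth)
  ultimately have En: "word_lift \<alpha> v \<in> En (length \<alpha>)" using len by (simp add: En_def)
  have "map fst (word_lift \<alpha> v) = \<alpha>" by (simp add: word_lift_def o_def map_nth)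
  moreover have "A \<in> snd (last (word_lift \<alpha> v))"
  proof -
    have ne: "word_lift \<alpha> v \<noteq> []" using len \<alpha>(2) by auto
    have n: "length \<alpha> - 1 < length \<alpha>" using \<alpha>(2) by simp
    have "A \<in> \<I> (\<alpha> ! (length \<alpha> - 1))" using word_ideal_last[OF \<alpha> A] last_conv_nth[OF \<alpha>(2)] by simp
    then show ?thesis using last_conv_nth[OF ne] len n v(2) by (simp add: word_lift_def)
  qed
  ultimately show ?thesis using En by (simp add: edge_box_def)
qed

lemma edge_box_eq_image: "edge_box \<alpha> A = word_lift \<alpha> ` {v \<in> E0. A \<in> v}"
proof (intro equalityI subsetI)
  fix es assume es: "es \<in> edge_box \<alpha> A"
  then have En: "es \<in> En (length \<alpha>)" "map fst es = \<alpha>" "A \<in> snd (last es)" by (simp_all add: edge_box_def)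
  from En(1) have len: "length es = length \<alpha>" and E: "\<And>i. i < length \<alpha> \<Longrightarrow> es ! i \<in> E1"
    by (auto simp: En_def)
  have "es \<noteq> []" using len \<alpha>(2) by auto
  then have l: "last es \<in> E1" using E[of "length \<alpha> - 1"] last_conv_nth[of es] len \<alpha>(2) by simp
  let ?v = "edge_d (last es)"
  have v: "?v \<in> E0" by (rule edge_d_E0[OF l])
  have "A \<in> ?v" using edge_snd[OF l] En(3) by simp
  have "es = word_lift \<alpha> ?v"
  proof (rule nth_equalityI)
    fix i assume "i < length es"
    then have i: "i < length \<alpha>" using len by simp
    have f: "fst (es ! i) = \<alpha> ! i" using arg_cong[OF En(2), of "\<lambda>l. l ! i"] i len by simp
    moreover have "snd (es ! i) = {B \<in> \<I> (\<alpha> ! i). word_action (drop (Suc i) \<alpha>) B \<in> ?v}"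
      unfolding edge_snd[OF E[OF i]] f En_word_action[OF En(1) i, unfolded En(2)] by auto
    ultimately show "es ! i = word_lift \<alpha> ?v ! i" using i by (simp add: word_lift_def prod_eq_iff)
  qed (simp add: word_lift_def len)
  then show "es \<in> word_lift \<alpha> ` {v \<in> E0. A \<in> v}" using v \<open>A \<in> ?v\<close> by auto
qed (use word_lift_edge_box in auto)

text \<open>The box is the image under \<open>word_lift\<close> of the compact set of ultrafilters
  containing \<open>A\<close>. Coordinate \<open>i\<close> is continuous, as it pulls the basic set
  of \<open>B\<close> back to that of the image of \<open>B\<close> under the remaining
  word.\<close>

lemma compactin_edge_box: "compactin (En_topology (length \<alpha>)) (edge_box \<alpha> A)"
proof -
  let ?Z = "{v \<in> E0. A \<in> v}"
  have "compactin E0_topology ?Z"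
    unfolding E0_topology_def E0_def by (rule compactin_ultrafilter_topology[OF ideal_UNIV]) simp
  then have K: "compactin (subtopology E0_topology ?Z) ?Z" by (simp add: compactin_subtopology)
  have tZ: "topspace (subtopology E0_topology ?Z) = ?Z" using topspace_E0_topology by auto
  have "openin E0_topology ?Z"
    unfolding E0_topology_def E0_def by (rule openin_ultrafilter_topology) simp
  have "continuous_map (subtopology E0_topology ?Z) (En_topology (length \<alpha>)) (word_lift \<alpha>)"
  proof (rule continuous_into_En_topology)
    show "word_lift \<alpha> v \<in> En (length \<alpha>)" if "v \<in> topspace (subtopology E0_topology ?Z)" for v
      using word_lift_edge_box[of v] that unfolding tZ by (simp add: edge_box_def)
    fix i assume i: "i < length \<alpha>"
    let ?a = "\<alpha> ! i" and ?h = "\<lambda>v. {B \<in> \<I> (\<alpha> ! i). word_action (drop (Suc i) \<alpha>) B \<in> v}"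
    have a: "?a \<in> L" using \<alpha>(1) i by (auto simp: in_lists_conv_set)
    have "continuous_map (subtopology E0_topology ?Z) (ultrafilter_topology (\<I> ?a)) ?h"
      unfolding ultrafilter_topology_def[of "\<I> ?a"]
    proof (rule continuous_on_generated_topo)
      show "?h ` topspace (subtopology E0_topology ?Z) \<subseteq> \<Union>{{F \<in> ba_ultrafilters (\<I> ?a). A \<in> F} | A. A \<in> \<I> ?a}"
      proof (rule image_subsetI)
        fix v assume "v \<in> topspace (subtopology E0_topology ?Z)"
        then have "?h v \<in> topspace (ultrafilter_topology (\<I> ?a))"
          unfolding tZ topspace_ultrafilter_topology[OF ideal[OF a]] using word_lift_edge(1)[OF _ _ i, of v] by simp
        then show "?h v \<in> \<Union>{{F \<in> ba_ultrafilters (\<I> ?a). A \<in> F} | A. A \<in> \<I> ?a}"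
          unfolding ultrafilter_topology_def topology_generated_by_topspace .
      qed
      fix S assume "S \<in> {{F \<in> ba_ultrafilters (\<I> ?a). A \<in> F} | A. A \<in> \<I> ?a}"
      then obtain B where B: "B \<in> \<I> ?a" "S = {F \<in> ba_ultrafilters (\<I> ?a). B \<in> F}" by auto
      have "?h -` S \<inter> topspace (subtopology E0_topology ?Z) = {v \<in> E0. word_action (drop (Suc i) \<alpha>) B \<in> v} \<inter> ?Z"
        unfolding tZ B(2) using B(1) word_lift_edge(1)[OF _ _ i] by auto
      moreover have "openin E0_topology {v \<in> E0. word_action (drop (Suc i) \<alpha>) B \<in> v}"
        unfolding E0_topology_def E0_def by (rule openin_ultrafilter_topology) simp
      ultimately show "openin (subtopology E0_topology ?Z) (?h -` S \<inter> topspace (subtopology E0_topology ?Z))"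
        by (simp only: openin_subtopology_Int)
    qed
    from continuous_map_compose[OF this continuous_map_component_injection[OF a, of "\<lambda>\<alpha>. ultrafilter_topology (\<I> \<alpha>)"]]
    have "continuous_map (subtopology E0_topology ?Z) E1_topology (Pair ?a \<circ> ?h)" by (simp only: E1_topology_def)
    then show "continuous_map (subtopology E0_topology ?Z) E1_topology (\<lambda>v. word_lift \<alpha> v ! i)"
      by (rule continuous_map_eq) (use i in \<open>simp add: word_lift_def\<close>)
  qed
  from image_compactin[OF K this] show ?thesis unfolding edge_box_eq_image .
qed

end

subsection \<open>The initial segments of a boundary path\<close>

definition long_paths :: "nat \<Rightarrow> ('l, 'b) path set" where
  "long_paths n = {\<mu> \<in> boundary. enat n \<le> path_length \<mu>}"

lemma long_paths_open:
  assumes "1 \<le> n" shows "openin cyl_topology (long_paths n)"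
proof -
  have "long_paths n = (\<Union>\<alpha>\<in>{\<alpha> \<in> lists L. length \<alpha> = n}. {\<mu> \<in> boundary. path_starts \<mu> \<alpha>})" (is "_ = ?r")
  proof (intro equalityI subsetI)
    fix \<mu> assume "\<mu> \<in> long_paths n"
    then have \<mu>: "\<mu> \<in> boundary" "enat n \<le> path_length \<mu>" by (simp_all add: long_paths_def)
    have s: "path_starts \<mu> (map fst (path_take n \<mu>))"
      unfolding path_starts_def using length_path_take[OF \<mu>(2)] by simp
    then have "map fst (path_take n \<mu>) \<in> {\<alpha> \<in> lists L. length \<alpha> = n}"
      using path_starts_lists[OF \<mu>(1) s] length_path_take[OF \<mu>(2)] by simp
    then show "\<mu> \<in> ?r" using \<mu>(1) s by blast
  qed (use path_starts_length in \<open>auto simp: long_paths_def\<close>)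
  moreover have "openin cyl_topology ?r"
  proof (rule openin_Union)
    fix S assume "S \<in> (\<lambda>\<alpha>. {\<mu> \<in> boundary. path_starts \<mu> \<alpha>}) ` {\<alpha> \<in> lists L. length \<alpha> = n}"
    then obtain \<alpha> where \<alpha>: "\<alpha> \<in> lists L" "length \<alpha> = n" "S = {\<mu> \<in> boundary. path_starts \<mu> \<alpha>}" by auto
    have "\<alpha> \<noteq> []" using \<alpha>(2) assms by auto
    then show "openin cyl_topology S" unfolding \<alpha>(3) by (rule starts_open[OF \<alpha>(1)])
  qed
  ultimately show ?thesis by simp
qed

lemma path_take_nth: "j < n \<Longrightarrow> enat n \<le> path_length \<mu> \<Longrightarrow> path_take n \<mu> ! j = last (path_take (Suc j) \<mu>)"
proof -
  assume j: "j < n" and n: "enat n \<le> path_length \<mu>"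
  have l: "length (path_take n \<mu>) = n" by (rule length_path_take[OF n])
  have "path_take (Suc j) \<mu> = take (Suc j) (path_take n \<mu>)" by (rule path_take_take) (use j in simp)
  then show ?thesis using j l by (simp add: take_Suc_conv_app_nth)
qed

text \<open>Coordinate \<open>j\<close> is the last edge of the initial segment of length
  \<open>Suc j\<close>, so a cylinder over the labels of that segment controls it.\<close>

lemma continuous_path_take:
  assumes n: "1 \<le> n"
  shows "continuous_map (subtopology cyl_topology (long_paths n)) (En_topology n) (path_take n)"
proof (rule continuous_into_En_topology)
  have D: "openin cyl_topology (long_paths n)" by (rule long_paths_open[OF n])
  have sub: "long_paths n \<subseteq> boundary" by (auto simp: long_paths_def)
  then have t: "topspace (subtopology cyl_topology (long_paths n)) = long_paths n"
    using topspace_cyl_topology by auto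
  show En: "path_take n \<mu> \<in> En n" if "\<mu> \<in> topspace (subtopology cyl_topology (long_paths n))" for \<mu>
    using path_take_En[of \<mu> n] that unfolding t by (simp add: long_paths_def)
  fix j assume j: "j < n"
  show "continuous_map (subtopology cyl_topology (long_paths n)) E1_topology (\<lambda>\<mu>. path_take n \<mu> ! j)"
  proof (rule continuous_map_nbhdI)
    show "path_take n \<mu> ! j \<in> topspace E1_topology" if "\<mu> \<in> topspace (subtopology cyl_topology (long_paths n))" for \<mu>
      using En[OF that] j unfolding topspace_E1_topology by (auto simp: En_def)
    fix \<mu> W assume "\<mu> \<in> topspace (subtopology cyl_topology (long_paths n))" and W: "openin E1_topology W" "path_take n \<mu> ! j \<in> W"
    then have \<mu>: "\<mu> \<in> boundary" "enat n \<le> path_length \<mu>" unfolding t by (simp_all add: long_paths_def)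
    have nth: "path_take n \<nu> ! j = last (path_take (Suc j) \<nu>)" if "\<nu> \<in> long_paths n" for \<nu>
      by (rule path_take_nth[OF j]) (use that in \<open>simp add: long_paths_def\<close>)
    define \<alpha> where "\<alpha> = map fst (path_take (Suc j) \<mu>)"
    have "enat (Suc j) \<le> path_length \<mu>" by (rule order_trans[OF _ \<mu>(2)]) (use j in simp)
    then have len: "length \<alpha> = Suc j" unfolding \<alpha>_def using length_path_take by simp
    then have s: "path_starts \<mu> \<alpha>" unfolding path_starts_def by (simp add: \<alpha>_def)
    have \<alpha>: "\<alpha> \<in> lists L" "\<alpha> \<noteq> []" using path_starts_lists[OF \<mu>(1) s] len by auto
    define e where "e = last (path_take (Suc j) \<mu>)"
    have e: "e \<in> E1" "fst e = last \<alpha>" using tail_filter_last[OF \<mu>(1) s \<alpha>(2)] unfolding len e_def by simp_all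
    have a: "last \<alpha> \<in> L" using e by (simp add: E1_iff)
    have eW: "e \<in> W" using W(2) nth[of \<mu>] \<mu> by (simp add: long_paths_def e_def)
    have "openin (ultrafilter_topology (\<I> (last \<alpha>))) {\<eta>. (last \<alpha>, \<eta>) \<in> W}"
      using W(1) a unfolding openin_E1_topology by simp
    moreover have "snd e \<in> {\<eta>. (last \<alpha>, \<eta>) \<in> W}" using eW e(2) by (cases e) simp
    ultimately obtain C where C: "C \<in> snd e" "{G \<in> ba_ultrafilters (\<I> (last \<alpha>)). C \<in> G} \<subseteq> {\<eta>. (last \<alpha>, \<eta>) \<in> W}"
      by (rule ultrafilter_topology_basis[OF ideal[OF a]])
    have CI: "C \<in> \<I> (last \<alpha>)" using edge_snd[OF e(1)] C(1) e(2) by simp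
    show "\<exists>N. openin (subtopology cyl_topology (long_paths n)) N \<and> \<mu> \<in> N \<and> (\<forall>y\<in>N. path_take n y ! j \<in> W)"
    proof (intro exI conjI ballI)
      show "openin (subtopology cyl_topology (long_paths n)) (cyl \<alpha> C \<inter> long_paths n)"
        by (rule openin_subtopology_Int[OF cyl_open[OF \<alpha>(1)]])
      show "\<mu> \<in> cyl \<alpha> C \<inter> long_paths n"
        using in_tail_filter_iff[OF \<mu>(1) \<alpha>(2) CI] s C(1) \<mu> len by (simp add: cyl_def long_paths_def e_def)
      fix \<nu> assume "\<nu> \<in> cyl \<alpha> C \<inter> long_paths n"
      then have \<nu>: "\<nu> \<in> boundary" "C \<in> tail_filter \<nu> \<alpha>" "\<nu> \<in> long_paths n" by (simp_all add: cyl_def)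
      then have s': "path_starts \<nu> \<alpha>" "C \<in> snd (last (path_take (Suc j) \<nu>))"
        using in_tail_filter_iff[OF \<nu>(1) \<alpha>(2) CI] len by simp_all
      define f where "f = last (path_take (Suc j) \<nu>)"
      have f: "f \<in> E1" "fst f = last \<alpha>" using tail_filter_last[OF \<nu>(1) s'(1) \<alpha>(2)] unfolding len f_def by simp_all
      then have "snd f \<in> {G \<in> ba_ultrafilters (\<I> (last \<alpha>)). C \<in> G}" using s'(2) by (simp add: E1_iff f_def)
      then have "(last \<alpha>, snd f) \<in> W" using C(2) by auto
      then have "f \<in> W" using f(2) by (cases f) simp
      then show "path_take n \<nu> ! j \<in> W" using nth[OF \<nu>(3)] by (simp add: f_def)
    qed
  qed
qed

lemma cyl_eq_edge_box:
  assumes \<alpha>: "\<alpha> \<in> lists L" "\<alpha> \<noteq> []" and A: "A \<in> word_ideal \<alpha>"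
  shows "{\<mu> \<in> long_paths (length \<alpha>). path_take (length \<alpha>) \<mu> \<in> edge_box \<alpha> A} = cyl \<alpha> A"
proof (rule Set.set_eqI)
  fix \<mu>
  note I = word_ideal_last[OF \<alpha> A]
  show "\<mu> \<in> {\<mu> \<in> long_paths (length \<alpha>). path_take (length \<alpha>) \<mu> \<in> edge_box \<alpha> A} \<longleftrightarrow> \<mu> \<in> cyl \<alpha> A"
  proof (cases "\<mu> \<in> boundary")
    case True
    show ?thesis
      using in_tail_filter_iff[OF True \<alpha>(2) I] path_take_En[OF True, of "length \<alpha>"] path_starts_length[of \<mu> \<alpha>]
      by (auto simp: cyl_def edge_box_def long_paths_def path_starts_def)
  qed (simp add: cyl_def long_paths_def)
qed

text \<open>The domain on which \<open>path_r\<close> takes values in \<open>E0\<close>, leaving out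
  the paths with range \<open>{}\<close>.\<close>

definition range_paths :: "('l, 'b) path set" where
  "range_paths = {\<mu> \<in> boundary. path_r \<mu> \<in> E0}"

lemma continuous_path_r: "continuous_map (subtopology cyl_topology range_paths) E0_topology path_r"
proof (rule continuous_map_nbhdI)
  have t: "topspace (subtopology cyl_topology range_paths) = range_paths"
    using topspace_cyl_topology by (auto simp: range_paths_def)
  show "path_r \<mu> \<in> topspace E0_topology" if "\<mu> \<in> topspace (subtopology cyl_topology range_paths)" for \<mu>
    using that unfolding t topspace_E0_topology by (simp add: range_paths_def)
  fix \<mu> W assume "\<mu> \<in> topspace (subtopology cyl_topology range_paths)" and W: "openin E0_topology W" "path_r \<mu> \<in> W"
  then have \<mu>: "\<mu> \<in> boundary" "path_r \<mu> \<in> E0" unfolding t by (simp_all add: range_paths_def)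
  have "openin (ultrafilter_topology UNIV) W" using W(1) by (simp only: E0_topology_def)
  from ultrafilter_topology_basis[OF ideal_UNIV this W(2)]
  obtain B where B: "B \<in> path_r \<mu>" "{G \<in> ba_ultrafilters UNIV. B \<in> G} \<subseteq> W" by metis
  show "\<exists>N. openin (subtopology cyl_topology range_paths) N \<and> \<mu> \<in> N \<and> (\<forall>y\<in>N. path_r y \<in> W)"
  proof (intro exI conjI ballI)
    show "openin (subtopology cyl_topology range_paths) (cyl [] B \<inter> range_paths)"
      by (rule openin_subtopology_Int[OF cyl_open_index[OF cyl_index_Nil]])
    show "\<mu> \<in> cyl [] B \<inter> range_paths" using \<mu> B(1) by (simp add: cyl_def tail_filter_Nil range_paths_def)
    fix \<nu> assume "\<nu> \<in> cyl [] B \<inter> range_paths"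
    then have \<nu>: "\<nu> \<in> boundary" "B \<in> tail_filter \<nu> []" "path_r \<nu> \<in> E0"
      by (simp_all add: cyl_def range_paths_def)
    then have "path_r \<nu> \<in> {G \<in> ba_ultrafilters UNIV. B \<in> G}"
      using tail_filter_Nil[OF \<nu>(1)] by (simp add: E0_def)
    then show "path_r \<nu> \<in> W" using B(2) by auto
  qed
qed

lemma cyl_Nil_eq: "{\<mu> \<in> range_paths. path_r \<mu> \<in> {v \<in> E0. A \<in> v}} = cyl [] A"
proof -
  have "path_r \<mu> \<in> E0" if "\<mu> \<in> boundary" "A \<in> path_r \<mu>" for \<mu>
    by (rule F0_in_E0[OF path_r_F0[OF that(1)] that(2)])
  then show ?thesis by (auto simp: range_paths_def cyl_def tail_filter_Nil)
qed

lemma range_paths_open: "openin cyl_topology range_paths"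
proof -
  have eq: "range_paths = (\<Union>B. cyl [] B)"
  proof (intro equalityI subsetI)
    fix \<mu> assume "\<mu> \<in> range_paths"
    then have \<mu>: "\<mu> \<in> boundary" "path_r \<mu> \<in> E0" by (simp_all add: range_paths_def)
    obtain B where "B \<in> path_r \<mu>" using E0_nonempty[OF \<mu>(2)] by auto
    then show "\<mu> \<in> (\<Union>B. cyl [] B)" using \<mu>(1) by (auto simp: cyl_def tail_filter_Nil)
  next
    fix \<mu> assume "\<mu> \<in> (\<Union>B. cyl [] B)"
    then obtain B where B: "\<mu> \<in> boundary" "B \<in> tail_filter \<mu> []" by (auto simp: cyl_def)
    then have "B \<in> path_r \<mu>" using tail_filter_Nil[OF B(1)] by simp
    then show "\<mu> \<in> range_paths" using F0_in_E0[OF path_r_F0[OF B(1)]] B(1) by (simp add: range_paths_def)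
  qed
  show ?thesis unfolding eq by (rule openin_Union) (use cyl_open_index[OF cyl_index_Nil] in auto)
qed

section \<open>The sets \<open>Z S\<close> in the cylinder topology\<close>

lemma Z_eq: "Z S = {\<mu> \<in> boundary. Vertex (path_r \<mu>) \<in> S} \<union> (\<Union>n\<in>{1..}. {\<mu> \<in> long_paths n. FinPath (path_take n \<mu>) \<in> S})"
  by (auto simp: Z_def long_paths_def)

lemma finite_pathsD:
  assumes "S \<subseteq> finite_paths"
  shows "Vertex v \<in> S \<Longrightarrow> v \<in> E0" "FinPath es \<in> S \<Longrightarrow> es \<in> En (length es) \<and> 1 \<le> length es"
  using assms by (auto simp: finite_paths_def En_def)

text \<open>The preimages under \<open>path_r\<close> and \<open>path_take n\<close> are taken on
  open domains, so being open in the domain is enough.\<close>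

lemma Z_open:
  assumes V: "openin finite_paths_topology V" shows "openin cyl_topology (Z V)"
proof -
  have V': "V \<subseteq> finite_paths" "openin E0_topology {v. Vertex v \<in> V}"
    "\<And>n. 1 \<le> n \<Longrightarrow> openin (En_topology n) {es. length es = n \<and> FinPath es \<in> V}"
    using V unfolding openin_finite_paths_topology by simp_all
  have "openin cyl_topology {\<mu> \<in> boundary. Vertex (path_r \<mu>) \<in> V}"
  proof -
    have "openin (subtopology cyl_topology range_paths)
        {\<mu> \<in> topspace (subtopology cyl_topology range_paths). path_r \<mu> \<in> {v. Vertex v \<in> V}}"
      by (rule openin_continuous_map_preimage[OF continuous_path_r V'(2)])
    moreover have "{\<mu> \<in> topspace (subtopology cyl_topology range_paths). path_r \<mu> \<in> {v. Vertex v \<in> V}} =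
        {\<mu> \<in> boundary. Vertex (path_r \<mu>) \<in> V}"
      using finite_pathsD(1)[OF V'(1)] topspace_cyl_topology by (auto simp: range_paths_def)
    ultimately show ?thesis using openin_trans_full[OF _ range_paths_open] by simp
  qed
  moreover have "openin cyl_topology {\<mu> \<in> long_paths n. FinPath (path_take n \<mu>) \<in> V}" if n: "1 \<le> n" for n
  proof -
    have "openin (subtopology cyl_topology (long_paths n))
        {\<mu> \<in> topspace (subtopology cyl_topology (long_paths n)). path_take n \<mu> \<in> {es. length es = n \<and> FinPath es \<in> V}}"
      by (rule openin_continuous_map_preimage[OF continuous_path_take[OF n] V'(3)[OF n]])
    moreover have "{\<mu> \<in> topspace (subtopology cyl_topology (long_paths n)). path_take n \<mu> \<in> {es. length es = n \<and> FinPath es \<in> V}} =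
        {\<mu> \<in> long_paths n. FinPath (path_take n \<mu>) \<in> V}"
      using length_path_take topspace_cyl_topology by (auto simp: long_paths_def)
    ultimately show ?thesis using openin_trans_full[OF _ long_paths_open[OF n]] by simp
  qed
  ultimately show ?thesis unfolding Z_eq by (intro openin_Un openin_Union) auto
qed

lemma openin_piece: "1 \<le> n \<Longrightarrow> openin finite_paths_topology (FinPath ` En n)"
  using openin_FinPath_image[of n "En n"] openin_topspace[of "En_topology n"] by (simp add: topspace_En_topology)

lemma openin_Vertex_piece: "openin finite_paths_topology (Vertex ` E0)"
  using openin_Vertex_image[of E0] openin_topspace[of E0_topology] by (simp add: topspace_E0_topology)

lemma closedin_piece:
  assumes n: "1 \<le> n" shows "closedin finite_paths_topology (FinPath ` En n)"
proof -
  have "finite_paths - FinPath ` En n = Vertex ` E0 \<union> (\<Union>m\<in>{1..} - {n}. FinPath ` En m)"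
    unfolding finite_paths_def by (auto simp: En_def)
  moreover have "openin finite_paths_topology (Vertex ` E0 \<union> (\<Union>m\<in>{1..} - {n}. FinPath ` En m))"
    using openin_piece openin_Vertex_piece by (intro openin_Un openin_Union) auto
  moreover have "FinPath ` En n \<subseteq> finite_paths" using n unfolding finite_paths_def by auto
  ultimately show ?thesis unfolding closedin_def topspace_finite_paths_topology by simp
qed

lemma closedin_Vertex_piece: "closedin finite_paths_topology (Vertex ` E0)"
proof -
  have "finite_paths - Vertex ` E0 = (\<Union>m\<in>{1..}. FinPath ` En m)"
    unfolding finite_paths_def by auto
  moreover have "openin finite_paths_topology (\<Union>m\<in>{1..}. FinPath ` En m)"
    using openin_piece by (intro openin_Union) auto
  moreover have "Vertex ` E0 \<subseteq> finite_paths" unfolding finite_paths_def by auto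
  ultimately show ?thesis unfolding closedin_def topspace_finite_paths_topology by simp
qed

text \<open>The vertices and the paths of each length form clopen pieces that cover the space. A
  compact set meets each piece in a compact set and only finitely many of them at all.\<close>

lemma compactin_pieces:
  assumes K: "compactin finite_paths_topology K"
  shows "compactin E0_topology {v. Vertex v \<in> K}"
    and "1 \<le> n \<Longrightarrow> compactin (En_topology n) {es. length es = n \<and> FinPath es \<in> K}"
    and "\<exists>N. \<forall>n\<ge>N. \<forall>es. FinPath es \<in> K \<longrightarrow> length es \<noteq> n"
proof -
  have sub: "K \<subseteq> finite_paths" using compactin_subset_topspace[OF K] topspace_finite_paths_topology by simp
  define ep where "ep p = (case p of FinPath es \<Rightarrow> es | _ \<Rightarrow> [])" for p :: "('l, 'b) path"
  define vp where "vp p = (case p of Vertex v \<Rightarrow> v | _ \<Rightarrow> {})" for p :: "('l, 'b) path"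
  have KV: "compactin (subtopology finite_paths_topology (Vertex ` E0)) (K \<inter> Vertex ` E0)"
    using compact_Int_closedin[OF K closedin_Vertex_piece] by (simp add: compactin_subtopology)
  have "continuous_map (subtopology finite_paths_topology (Vertex ` E0)) E0_topology vp"
    unfolding continuous_map_def
  proof (intro conjI allI impI)
    have t: "topspace (subtopology finite_paths_topology (Vertex ` E0)) = Vertex ` E0"
      using openin_subset[OF openin_Vertex_piece] by auto
    show "vp \<in> topspace (subtopology finite_paths_topology (Vertex ` E0)) \<rightarrow> topspace E0_topology"
      unfolding t topspace_E0_topology by (auto simp: vp_def)
    fix W assume W: "openin E0_topology W"
    have "{p \<in> topspace (subtopology finite_paths_topology (Vertex ` E0)). vp p \<in> W} = Vertex ` W \<inter> Vertex ` E0"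
      unfolding t by (auto simp: vp_def)
    then show "openin (subtopology finite_paths_topology (Vertex ` E0))
        {p \<in> topspace (subtopology finite_paths_topology (Vertex ` E0)). vp p \<in> W}"
      using openin_subtopology_Int[OF openin_Vertex_image[OF W]] by simp
  qed
  from image_compactin[OF KV this] have "compactin E0_topology (vp ` (K \<inter> Vertex ` E0))" .
  moreover have "vp ` (K \<inter> Vertex ` E0) = {v. Vertex v \<in> K}"
    using finite_pathsD(1)[OF sub] by (force simp: vp_def)
  ultimately show "compactin E0_topology {v. Vertex v \<in> K}" by simp
  show "compactin (En_topology n) {es. length es = n \<and> FinPath es \<in> K}" if n: "1 \<le> n"
  proof -
    have KV: "compactin (subtopology finite_paths_topology (FinPath ` En n)) (K \<inter> FinPath ` En n)"
      using compact_Int_closedin[OF K closedin_piece[OF n]] by (simp add: compactin_subtopology)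
    have "continuous_map (subtopology finite_paths_topology (FinPath ` En n)) (En_topology n) ep"
      unfolding continuous_map_def
    proof (intro conjI allI impI)
      have t: "topspace (subtopology finite_paths_topology (FinPath ` En n)) = FinPath ` En n"
        using openin_subset[OF openin_piece[OF n]] by auto
      show "ep \<in> topspace (subtopology finite_paths_topology (FinPath ` En n)) \<rightarrow> topspace (En_topology n)"
        unfolding t topspace_En_topology by (auto simp: ep_def)
      fix W assume W: "openin (En_topology n) W"
      have "{p \<in> topspace (subtopology finite_paths_topology (FinPath ` En n)). ep p \<in> W} = FinPath ` W \<inter> FinPath ` En n"
        unfolding t by (auto simp: ep_def)
      then show "openin (subtopology finite_paths_topology (FinPath ` En n))
          {p \<in> topspace (subtopology finite_paths_topology (FinPath ` En n)). ep p \<in> W}"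
        using openin_subtopology_Int[OF openin_FinPath_image[OF n W]] by simp
    qed
    from image_compactin[OF KV this] have "compactin (En_topology n) (ep ` (K \<inter> FinPath ` En n))" .
    moreover have "ep ` (K \<inter> FinPath ` En n) = {es. length es = n \<and> FinPath es \<in> K}"
    proof (intro equalityI subsetI)
      fix es assume "es \<in> {es. length es = n \<and> FinPath es \<in> K}"
      then have "FinPath es \<in> K \<inter> FinPath ` En n" using finite_pathsD(2)[OF sub, of es] by auto
      then show "es \<in> ep ` (K \<inter> FinPath ` En n)" by (intro image_eqI[of _ _ "FinPath es"]) (simp_all add: ep_def)
    qed (auto simp: ep_def En_def)
    ultimately show ?thesis by simp
  qed
  let ?U = "insert (Vertex ` E0) ((\<lambda>n. FinPath ` En n) ` {1..})"
  have "K \<subseteq> \<Union>?U" using sub unfolding finite_paths_def by auto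
  moreover have "openin finite_paths_topology W" if "W \<in> ?U" for W
    using that openin_piece openin_Vertex_piece by auto
  ultimately have "\<exists>\<F>. finite \<F> \<and> \<F> \<subseteq> ?U \<and> K \<subseteq> \<Union>\<F>" by (intro compactinD[OF K])
  then obtain \<F> where F: "finite \<F>" "\<F> \<subseteq> ?U" "K \<subseteq> \<Union>\<F>" by (elim exE conjE)
  have "\<exists>N. \<forall>n\<ge>N. \<forall>es\<in>En n. FinPath es \<notin> \<Union>\<F>"
    using F(1,2)
  proof (induction \<F> rule: finite_induct)
    case (insert W \<F>)
    then obtain N where N: "\<forall>n\<ge>N. \<forall>es\<in>En n. FinPath es \<notin> \<Union>\<F>" by auto
    have "\<exists>M. \<forall>n\<ge>M. \<forall>es\<in>En n. FinPath es \<notin> W"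
    proof (cases "W = Vertex ` E0")
      case False
      then obtain m where "W = FinPath ` En m" using insert.prems by auto
      then have "\<forall>n\<ge>Suc m. \<forall>es\<in>En n. FinPath es \<notin> W" by (auto simp: En_def)
      then show ?thesis by (rule exI)
    qed auto
    then obtain M where M: "\<forall>n\<ge>M. \<forall>es\<in>En n. FinPath es \<notin> W" by auto
    have "\<forall>n\<ge>max M N. \<forall>es\<in>En n. FinPath es \<notin> \<Union>(insert W \<F>)" using M N by auto
    then show ?case by (rule exI)
  qed simp
  then obtain N where N: "\<forall>n\<ge>N. \<forall>es\<in>En n. FinPath es \<notin> \<Union>\<F>" by auto
  have "length es \<noteq> n" if "n \<ge> N" "FinPath es \<in> K" for n es
    using N that finite_pathsD(2)[OF sub that(2)] F(3) by auto
  then show "\<exists>N. \<forall>n\<ge>N. \<forall>es. FinPath es \<in> K \<longrightarrow> length es \<noteq> n" by auto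
qed

text \<open>Only finitely many lengths occur in \<open>K\<close>, so \<open>Z K\<close> is a finite
  union of preimages of compact sets. Each is closed by \<open>closedin_preimage_of_compact\<close>,
  covering \<open>K\<close> with boxes, whose preimages are cylinders.\<close>

lemma Z_closed:
  assumes K: "compactin finite_paths_topology K" shows "closedin cyl_topology (Z K)"
proof -
  note c = compactin_pieces[OF K]
  have sub: "K \<subseteq> finite_paths" using compactin_subset_topspace[OF K] topspace_finite_paths_topology by simp
  obtain N where N: "\<forall>n\<ge>N. \<forall>es. FinPath es \<in> K \<longrightarrow> length es \<noteq> n" using c(3) by auto
  have 0: "closedin cyl_topology {\<mu> \<in> range_paths. path_r \<mu> \<in> {v. Vertex v \<in> K}}"
  proof (rule closedin_preimage_of_compact[OF continuous_path_r Hausdorff_E0_topology c(1),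
        where \<O> = "range (\<lambda>A. {v \<in> E0. A \<in> v})"])
    show "{v. Vertex v \<in> K} \<subseteq> \<Union>(range (\<lambda>A. {v \<in> E0. A \<in> v}))"
      using finite_pathsD(1)[OF sub] E0_nonempty by fastforce
    fix W assume "W \<in> range (\<lambda>A. {v \<in> E0. A \<in> v})"
    then obtain A where A: "W = {v \<in> E0. A \<in> v}" by auto
    show "openin E0_topology W" unfolding A E0_topology_def E0_def by (rule openin_ultrafilter_topology) simp
    show "closedin cyl_topology {\<mu> \<in> range_paths. path_r \<mu> \<in> W}"
      unfolding A cyl_Nil_eq by (rule cyl_closed_index[OF cyl_index_Nil])
  qed
  have n: "closedin cyl_topology {\<mu> \<in> long_paths n. path_take n \<mu> \<in> {es. length es = n \<and> FinPath es \<in> K}}" if n: "1 \<le> n" for n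
  proof (rule closedin_preimage_of_compact[OF continuous_path_take[OF n] Hausdorff_En_topology c(2)[OF n],
        where \<O> = "(\<lambda>(\<alpha>, A). edge_box \<alpha> A) ` {(\<alpha>, A). \<alpha> \<in> lists L \<and> A \<in> word_ideal \<alpha> \<and> length \<alpha> = n}"])
    let ?O = "(\<lambda>(\<alpha>, A). edge_box \<alpha> A) ` {(\<alpha>, A). \<alpha> \<in> lists L \<and> A \<in> word_ideal \<alpha> \<and> length \<alpha> = n}"
    show "{es. length es = n \<and> FinPath es \<in> K} \<subseteq> \<Union>?O"
    proof
      fix es assume "es \<in> {es. length es = n \<and> FinPath es \<in> K}"
      then have es: "es \<in> En n" "length es = n" using finite_pathsD(2)[OF sub, of es] by auto
      obtain A where A: "map fst es \<in> lists L" "A \<in> word_ideal (map fst es)" "es \<in> edge_box (map fst es) A"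
        by (rule edge_box_cover[OF es(1) n])
      have "edge_box (map fst es) A \<in> ?O"
        using A(1,2) es(2) by (intro image_eqI[of _ _ "(map fst es, A)"]) simp_all
      then show "es \<in> \<Union>?O" using A(3) by (rule UnionI)
    qed
    fix W assume "W \<in> ?O"
    then obtain \<alpha> A where A: "W = edge_box \<alpha> A" "\<alpha> \<in> lists L" "A \<in> word_ideal \<alpha>" "length \<alpha> = n" by auto
    then have ne: "\<alpha> \<noteq> []" using n by auto
    show "openin (En_topology n) W"
      unfolding A(1) A(4)[symmetric] by (rule edge_box_open[OF A(2) ne word_ideal_last[OF A(2) ne A(3)]])
    show "closedin cyl_topology {\<mu> \<in> long_paths n. path_take n \<mu> \<in> W}"
      unfolding A(1) A(4)[symmetric] cyl_eq_edge_box[OF A(2) ne A(3)]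
      by (rule cyl_closed_index) (use A in \<open>simp add: cyl_index_def\<close>)
  qed
  have "Z K = {\<mu> \<in> range_paths. path_r \<mu> \<in> {v. Vertex v \<in> K}} \<union>
      (\<Union>n\<in>{1..<N}. {\<mu> \<in> long_paths n. path_take n \<mu> \<in> {es. length es = n \<and> FinPath es \<in> K}})" (is "_ = ?r")
  proof (intro equalityI subsetI)
    fix \<mu> assume "\<mu> \<in> Z K"
    then consider "\<mu> \<in> boundary" "Vertex (path_r \<mu>) \<in> K"
      | n where "1 \<le> n" "\<mu> \<in> long_paths n" "FinPath (path_take n \<mu>) \<in> K"
      unfolding Z_eq by auto
    then show "\<mu> \<in> ?r"
    proof cases
      case 1
      then show ?thesis using finite_pathsD(1)[OF sub] by (simp add: range_paths_def)
    next
      case (2 n)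
      have l: "length (path_take n \<mu>) = n" using 2(2) length_path_take[of n \<mu>] by (simp add: long_paths_def)
      then have "n < N" using N 2(3) not_less by metis
      then show ?thesis using 2 l by auto
    qed
  next
    fix \<mu> assume "\<mu> \<in> ?r"
    then show "\<mu> \<in> Z K" unfolding Z_eq by (auto simp: range_paths_def)
  qed
  moreover have "closedin cyl_topology ?r"
    using 0 n by (intro closedin_Un closedin_Union) auto
  ultimately show ?thesis by simp
qed

lemma cyl_eq_Z:
  "cyl [] A = Z (Vertex ` {v \<in> E0. A \<in> v})"
  "\<lbrakk>\<alpha> \<in> lists L; \<alpha> \<noteq> []; A \<in> word_ideal \<alpha>\<rbrakk> \<Longrightarrow> cyl \<alpha> A = Z (FinPath ` edge_box \<alpha> A)"
proof -
  have e: "{\<mu> \<in> boundary. Vertex (path_r \<mu>) \<in> Vertex ` {v \<in> E0. A \<in> v}} = cyl [] A"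
    unfolding cyl_Nil_eq[symmetric] by (auto simp: range_paths_def)
  have e': "{\<mu> \<in> long_paths n. FinPath (path_take n \<mu>) \<in> Vertex ` {v \<in> E0. A \<in> v}} = {}" for n by auto
  show "cyl [] A = Z (Vertex ` {v \<in> E0. A \<in> v})" unfolding Z_eq e e' by simp
  assume \<alpha>: "\<alpha> \<in> lists L" "\<alpha> \<noteq> []" and A: "A \<in> word_ideal \<alpha>"
  have n: "length \<alpha> \<in> {1..}" using \<alpha>(2) by (cases \<alpha>) auto
  have 1: "{\<mu> \<in> long_paths n. FinPath (path_take n \<mu>) \<in> FinPath ` edge_box \<alpha> A} = (if n = length \<alpha> then cyl \<alpha> A else {})" for n
  proof (cases "n = length \<alpha>")
    case True
    have "{\<mu> \<in> long_paths (length \<alpha>). FinPath (path_take (length \<alpha>) \<mu>) \<in> FinPath ` edge_box \<alpha> A} =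
        {\<mu> \<in> long_paths (length \<alpha>). path_take (length \<alpha>) \<mu> \<in> edge_box \<alpha> A}" by auto
    then show ?thesis using True cyl_eq_edge_box[OF \<alpha> A] by simp
  next
    case False
    have "path_take n \<mu> \<notin> edge_box \<alpha> A" if "\<mu> \<in> long_paths n" for \<mu>
      using length_path_take[of n \<mu>] that False by (auto simp: long_paths_def edge_box_def En_def)
    then show ?thesis using False by auto
  qed
  have 0: "{\<mu> \<in> boundary. Vertex (path_r \<mu>) \<in> FinPath ` edge_box \<alpha> A} = {}" by auto
  show "cyl \<alpha> A = Z (FinPath ` edge_box \<alpha> A)" unfolding Z_eq 0 1 using n by auto
qed

text \<open>A vertex is caught by its range and every other path by its first edge, which also works
  when its range is \<open>{}\<close>.\<close>

lemma Z_finite_paths: "Z finite_paths = boundary"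
proof (intro equalityI subsetI)
  fix \<mu> assume \<mu>: "\<mu> \<in> boundary"
  then show "\<mu> \<in> Z finite_paths"
  proof (cases rule: boundary_cases)
    case (Vertex v)
    then show ?thesis using \<mu> by (auto simp: Z_def finite_paths_def E0_sg_def)
  next
    case (Cons e \<nu>)
    have "enat 1 = eSuc 0" by (simp add: eSuc_enat zero_enat_def)
    then have l: "enat 1 \<le> path_length \<mu>" unfolding Cons(1) path_length_Cons by simp
    have "FinPath (path_take 1 \<mu>) \<in> finite_paths"
      using path_take_En[OF \<mu> l] unfolding finite_paths_def by auto
    then show ?thesis using \<mu> l by (auto simp: Z_def intro!: exI[of _ 1])
  qed
qed (simp add: Z_def)

text \<open>One inclusion is \<open>Z_open\<close> with \<open>Z_closed\<close>. For the other, an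
  indexed cylinder is \<open>Z Q\<close> with \<open>Q\<close> both open and compact, so it and its
  complement have the form \<open>Z V - Z K\<close>, with \<open>K\<close> empty or with
  \<open>V\<close> the whole space.\<close>

theorem boundary_topology_eq: "boundary_topology = cyl_topology"
proof (rule topology_eq[THEN iffD2], intro allI iffI)
  fix S assume "openin boundary_topology S"
  then have "generate_topology_on {Z V - Z K | V K. openin finite_paths_topology V \<and> compactin finite_paths_topology K} S"
    unfolding boundary_topology_def by (rule openin_topology_generated_by)
  then show "openin cyl_topology S"
  proof (induction S rule: generate_topology_on.induct)
    case (Basis S)
    then obtain V K where VK: "S = Z V - Z K" "openin finite_paths_topology V" "compactin finite_paths_topology K" by auto
    show ?case unfolding VK(1) by (rule openin_diff[OF Z_open[OF VK(2)] Z_closed[OF VK(3)]])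
  qed auto
next
  fix S assume "openin cyl_topology S"
  then have "generate_topology_on ((\<lambda>(\<alpha>, A). cyl \<alpha> A) ` cyl_index \<union> (\<lambda>(\<alpha>, A). boundary - cyl \<alpha> A) ` cyl_index) S"
    unfolding cyl_topology_def by (rule openin_topology_generated_by)
  then show "openin boundary_topology S"
  proof (induction S rule: generate_topology_on.induct)
    case (Basis S)
    then obtain \<alpha> A where A: "(\<alpha>, A) \<in> cyl_index" "S = cyl \<alpha> A \<or> S = boundary - cyl \<alpha> A" by auto
    have bd: "openin boundary_topology (Z V - Z K)" if "openin finite_paths_topology V" "compactin finite_paths_topology K" for V K
      unfolding boundary_topology_def by (rule topology_generated_by_Basis) (use that in auto)
    have "\<exists>Q. openin finite_paths_topology Q \<and> compactin finite_paths_topology Q \<and> cyl \<alpha> A = Z Q"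
    proof (cases "\<alpha> = []")
      case True
      let ?Q = "Vertex ` {v \<in> E0. A \<in> v}"
      have o: "openin E0_topology {v \<in> E0. A \<in> v}"
        unfolding E0_topology_def E0_def by (rule openin_ultrafilter_topology) simp
      have "compactin E0_topology {v \<in> E0. A \<in> v}"
        unfolding E0_topology_def E0_def by (rule compactin_ultrafilter_topology[OF ideal_UNIV]) simp
      moreover have "continuous_map E0_topology finite_paths_topology Vertex"
        unfolding continuous_map_def topspace_finite_paths_topology topspace_E0_topology
      proof (intro conjI allI impI)
        show "Vertex \<in> E0 \<rightarrow> finite_paths" by (simp add: finite_paths_def)
        fix V assume "openin finite_paths_topology V"
        then have "V \<subseteq> finite_paths" "openin E0_topology {v. Vertex v \<in> V}"
          unfolding openin_finite_paths_topology by simp_all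
        moreover have "{v \<in> E0. Vertex v \<in> V} = {v. Vertex v \<in> V}"
          using finite_pathsD(1)[OF \<open>V \<subseteq> finite_paths\<close>] by auto
        ultimately show "openin E0_topology {v \<in> E0. Vertex v \<in> V}" by simp
      qed
      ultimately have "compactin finite_paths_topology ?Q" by (rule image_compactin)
      then show ?thesis using openin_Vertex_image[OF o] cyl_eq_Z(1) True by metis
    next
      case False
      have \<alpha>: "\<alpha> \<in> lists L" and AI: "A \<in> word_ideal \<alpha>" using A(1) by (simp_all add: cyl_index_def)
      let ?n = "length \<alpha>" and ?Q = "FinPath ` edge_box \<alpha> A"
      have n: "1 \<le> ?n" using False by (cases \<alpha>) auto
      note o = edge_box_open[OF \<alpha> False word_ideal_last[OF \<alpha> False AI]]
      have "continuous_map (En_topology ?n) finite_paths_topology FinPath"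
        unfolding continuous_map_def topspace_finite_paths_topology topspace_En_topology
      proof (intro conjI allI impI)
        show "FinPath \<in> En ?n \<rightarrow> finite_paths" using n by (auto simp: finite_paths_def)
        fix V assume "openin finite_paths_topology V"
        then have V: "V \<subseteq> finite_paths" "openin (En_topology ?n) {es. length es = ?n \<and> FinPath es \<in> V}"
          using n unfolding openin_finite_paths_topology by simp_all
        moreover have "{es \<in> En ?n. FinPath es \<in> V} = {es. length es = ?n \<and> FinPath es \<in> V}"
          using finite_pathsD(2)[OF V(1)] by (auto simp: En_def)
        ultimately show "openin (En_topology ?n) {es \<in> En ?n. FinPath es \<in> V}" by simp
      qed
      with compactin_edge_box[OF \<alpha> False AI] have "compactin finite_paths_topology ?Q" by (rule image_compactin)
      then show ?thesis using openin_FinPath_image[OF n o] cyl_eq_Z(2)[OF \<alpha> False AI] by metis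
    qed
    then obtain Q where Q: "openin finite_paths_topology Q" "compactin finite_paths_topology Q" "cyl \<alpha> A = Z Q" by auto
    have "Z {} = {}" by (simp add: Z_def)
    then have "openin boundary_topology (cyl \<alpha> A)" using bd[OF Q(1) compactin_empty] Q(3) by simp
    moreover have "openin boundary_topology (boundary - cyl \<alpha> A)"
      using bd[OF openin_topspace Q(2)] Q(3) Z_finite_paths topspace_finite_paths_topology by simp
    ultimately show ?case using A(2) by metis
  qed auto
qed

end

section \<open>The partial action\<close>

lemma gens_word: "[a. Gen a \<leftarrow> word_elt \<alpha> @ word_elt_inv \<beta>] = \<alpha>"
proof -
  have "[a. Gen a \<leftarrow> map GenInv l] = []" for l :: "'l list" by (induction l) auto
  moreover have "[a. Gen a \<leftarrow> map Gen \<alpha>] = \<alpha>" by (induction \<alpha>) auto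
  ultimately show ?thesis by (simp add: word_elt_def word_elt_inv_def)
qed

lemma inv_gens_word: "rev [b. GenInv b \<leftarrow> word_elt \<alpha> @ word_elt_inv \<beta>] = \<beta>"
proof -
  have 1: "[b. GenInv b \<leftarrow> map Gen \<alpha>] = []" by (induction \<alpha>) auto
  have 2: "[b. GenInv b \<leftarrow> map GenInv l] = l" for l by (induction l) auto
  show ?thesis
    unfolding word_elt_def word_elt_inv_def by (simp only: map_append concat_append 1 2 append_Nil rev_rev_ident)
qed

lemma word_decomposition_unique:
  assumes "word_elt \<alpha> @ word_elt_inv \<beta> = word_elt \<alpha>' @ word_elt_inv \<beta>'"
  shows "\<alpha> = \<alpha>' \<and> \<beta> = \<beta>'"
  using gens_word[of \<alpha> \<beta>] gens_word[of \<alpha>' \<beta>'] inv_gens_word[of \<alpha> \<beta>] inv_gens_word[of \<alpha>' \<beta>']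
  unfolding assms by simp

lemma word_elt_Nil [simp]: "word_elt [] = []" "word_elt_inv [] = []"
  by (simp_all add: word_elt_def word_elt_inv_def)

lemma winv_word: "rev (map flip_letter (word_elt \<alpha> @ word_elt_inv \<beta>)) = word_elt \<beta> @ word_elt_inv \<alpha>"
  by (simp add: word_elt_def word_elt_inv_def rev_map o_def)

lemma Cons_Gen_word_iff:
  "(\<exists>\<alpha> \<beta>. Gen a # t = word_elt \<alpha> @ word_elt_inv \<beta>) \<longleftrightarrow> (\<exists>\<alpha> \<beta>. t = word_elt \<alpha> @ word_elt_inv \<beta>)"
proof
  assume "\<exists>\<alpha> \<beta>. Gen a # t = word_elt \<alpha> @ word_elt_inv \<beta>"
  then obtain \<alpha> \<beta> where *: "Gen a # t = word_elt \<alpha> @ word_elt_inv \<beta>" by auto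
  show "\<exists>\<alpha> \<beta>. t = word_elt \<alpha> @ word_elt_inv \<beta>"
  proof (cases \<alpha>)
    case Nil
    then have "Gen a \<in> set (word_elt_inv \<beta>)" using * by (metis append_Nil list.set_intros(1) word_elt_Nil(1))
    then show ?thesis by (auto simp: word_elt_inv_def)
  next
    case (Cons b \<gamma>)
    then have "t = word_elt \<gamma> @ word_elt_inv \<beta>" using * by (simp add: word_elt_def)
    then show ?thesis by auto
  qed
next
  assume "\<exists>\<alpha> \<beta>. t = word_elt \<alpha> @ word_elt_inv \<beta>"
  then obtain \<alpha> \<beta> where "t = word_elt \<alpha> @ word_elt_inv \<beta>" by auto
  then have "Gen a # t = word_elt (a # \<alpha>) @ word_elt_inv \<beta>" by (simp add: word_elt_def)
  then show "\<exists>\<alpha> \<beta>. Gen a # t = word_elt \<alpha> @ word_elt_inv \<beta>" by auto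
qed

lemma Cons_GenInv_word_iff:
  "(\<exists>\<alpha> \<beta>. GenInv b # t = word_elt \<alpha> @ word_elt_inv \<beta>) \<longleftrightarrow> (\<exists>\<beta>. t = word_elt_inv \<beta>)"
proof
  assume "\<exists>\<alpha> \<beta>. GenInv b # t = word_elt \<alpha> @ word_elt_inv \<beta>"
  then obtain \<alpha> \<beta> where *: "GenInv b # t = word_elt \<alpha> @ word_elt_inv \<beta>" by auto
  have "\<alpha> = []" using * by (cases \<alpha>) (simp_all add: word_elt_def)
  then have t: "GenInv b # t = map GenInv (rev \<beta>)" using * by (simp add: word_elt_inv_def)
  then obtain \<gamma> where "rev \<beta> = b # \<gamma>" "t = map GenInv \<gamma>" by (cases "rev \<beta>") auto
  then have "t = word_elt_inv (rev \<gamma>)" by (simp add: word_elt_inv_def)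
  then show "\<exists>\<beta>. t = word_elt_inv \<beta>" by auto
next
  assume "\<exists>\<beta>. t = word_elt_inv \<beta>"
  then obtain \<beta> where "t = word_elt_inv \<beta>" by auto
  then have "GenInv b # t = word_elt [] @ word_elt_inv (\<beta> @ [b])" by (simp add: word_elt_inv_def)
  then show "\<exists>\<alpha> \<beta>. GenInv b # t = word_elt \<alpha> @ word_elt_inv \<beta>" by metis
qed

context gen_boolean_dyn_system
begin

text \<open>One formula for the four clauses of \<open>pa_domain\<close>. The case of empty \<beta>
  is separate because a path with empty range meets no ideal but still belongs to the domain of the
  identity.\<close>

definition word_domain :: "'l list \<Rightarrow> 'l list \<Rightarrow> ('l, 'b) path set" where
  "word_domain \<alpha> \<beta> = {\<mu> \<in> boundary. path_starts \<mu> \<alpha> \<and> (\<beta> = [] \<or> tail_filter \<mu> \<alpha> \<inter> word_ideal \<beta> \<noteq> {})}"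

lemma word_elt_lists:
  "word_elt \<alpha> @ word_elt_inv \<beta> \<in> carrier (free_group L) \<Longrightarrow> \<alpha> \<in> lists L \<and> \<beta> \<in> lists L"
proof -
  assume t: "word_elt \<alpha> @ word_elt_inv \<beta> \<in> carrier (free_group L)"
  have "letter_base x \<in> L" if "x \<in> set (word_elt \<alpha> @ word_elt_inv \<beta>)" for x
    using t that by (auto simp: free_group_def)
  from this[of "Gen _"] this[of "GenInv _"] show ?thesis
    by (auto simp: word_elt_def word_elt_inv_def in_lists_conv_set)
qed

lemma words1I:
  assumes "\<alpha> \<in> lists L" "\<alpha> \<noteq> []" "A \<in> word_ideal \<alpha>" "A \<in> v" "v \<in> F0" shows "\<alpha> \<in> words1"
proof -
  have "A \<noteq> bot" using F0_bot[OF assms(5)] assms(4) by auto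
  then show ?thesis using assms(1-3) by (auto simp: words1_def words_def)
qed

text \<open>The ultrafilter of the last edge is the tail filter cut down to the ideal of its label,
  and \<open>inf\<close> with a member \<open>C\<close> of it brings any set of the tail filter
  there without leaving the ideal of \<beta>.\<close>

lemma snd_last_meets_ideal:
  assumes \<mu>: "\<mu> \<in> boundary" "path_starts \<mu> \<alpha>" "\<alpha> \<noteq> []" and \<beta>: "\<beta> \<in> lists L"
  shows "snd (last (path_take (length \<alpha>) \<mu>)) \<inter> word_ideal \<beta> \<noteq> {} \<longleftrightarrow> tail_filter \<mu> \<alpha> \<inter> word_ideal \<beta> \<noteq> {}"
proof -
  define e where "e = last (path_take (length \<alpha>) \<mu>)"
  have e: "e \<in> E1" "edge_d e = tail_filter \<mu> \<alpha>" using tail_filter_last[OF \<mu>] by (simp_all add: e_def)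
  have s: "snd e = tail_filter \<mu> \<alpha> \<inter> \<I> (fst e)" using edge_snd[OF e(1)] e(2) by simp
  obtain C where C: "C \<in> \<I> (fst e)" "C \<in> tail_filter \<mu> \<alpha>" using edge_nonempty[OF e(1)] e(2) by auto
  have "inf A C \<in> snd e \<inter> word_ideal \<beta>" if A: "A \<in> tail_filter \<mu> \<alpha>" "A \<in> word_ideal \<beta>" for A
  proof -
    have "inf A C \<in> tail_filter \<mu> \<alpha>" using F0_inf[OF tail_filter_F0[OF \<mu>(1)]] A(1) C(2) by simp
    moreover have "fst e \<in> L" using e(1) by (simp add: E1_iff)
    then have "inf A C \<in> \<I> (fst e)" by (rule ideal_inf(2)[OF ideal C(1)])
    moreover have "inf A C \<in> word_ideal \<beta>" by (rule ideal_inf(1)[OF word_ideal_ideal[OF \<beta>] A(2)])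
    ultimately show ?thesis unfolding s by simp
  qed
  then show ?thesis unfolding e_def[symmetric] using s by auto
qed

lemma pa_domain_word:
  assumes t: "word_elt \<alpha> @ word_elt_inv \<beta> \<in> carrier (free_group L)"
  shows "pa_domain (word_elt \<alpha> @ word_elt_inv \<beta>) = word_domain \<alpha> \<beta>"
proof (rule Set.set_eqI)
  fix \<mu>
  have L: "\<alpha> \<in> lists L" "\<beta> \<in> lists L" using word_elt_lists[OF t] by auto
  have red: "fg_reduced (word_elt \<alpha> @ word_elt_inv \<beta>)" using t by (simp add: free_group_def)
  have eq: "word_elt \<alpha> @ word_elt_inv \<beta> = word_elt \<alpha>' @ word_elt_inv \<beta>' \<longleftrightarrow> \<alpha>' = \<alpha> \<and> \<beta>' = \<beta>" for \<alpha>' \<beta>'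
    using word_decomposition_unique[of \<alpha> \<beta> \<alpha>' \<beta>'] by auto
  have eq1: "word_elt \<alpha> @ word_elt_inv \<beta> = word_elt \<alpha>' \<longleftrightarrow> \<alpha>' = \<alpha> \<and> \<beta> = []" for \<alpha>'
    using eq[of \<alpha>' "[]"] by auto
  have eq2: "word_elt \<alpha> @ word_elt_inv \<beta> = word_elt_inv \<beta>' \<longleftrightarrow> \<alpha> = [] \<and> \<beta>' = \<beta>" for \<beta>'
    using eq[of "[]" \<beta>'] by auto
  have eq0: "word_elt \<alpha> @ word_elt_inv \<beta> = [] \<longleftrightarrow> \<alpha> = [] \<and> \<beta> = []"
    by (simp add: word_elt_def word_elt_inv_def)
  show "\<mu> \<in> pa_domain (word_elt \<alpha> @ word_elt_inv \<beta>) \<longleftrightarrow> \<mu> \<in> word_domain \<alpha> \<beta>"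
  proof (cases "\<mu> \<in> boundary")
    case \<mu>: True
    \<comment> \<open>Membership in \<open>words1\<close> is automatic here: a filter meeting the
      ideal of the word provides a nonzero member of that ideal.\<close>
    have 1: "\<alpha> \<in> words1" if s: "path_starts \<mu> \<alpha>" "\<alpha> \<noteq> []"
    proof -
      obtain A where "A \<in> word_ideal \<alpha>" "A \<in> tail_filter \<mu> \<alpha>"
        using tail_filter_meets_ideal[OF \<mu> s(1)] s(2) by metis
      then show ?thesis by (rule words1I[OF L(1) \<open>\<alpha> \<noteq> []\<close> _ _ tail_filter_F0[OF \<mu>]])
    qed
    have 2: "\<beta> \<in> words1" if "\<beta> \<noteq> []" "tail_filter \<mu> \<alpha> \<inter> word_ideal \<beta> \<noteq> {}"
    proof -
      obtain A where "A \<in> word_ideal \<beta>" "A \<in> tail_filter \<mu> \<alpha>" using \<open>tail_filter \<mu> \<alpha> \<inter> word_ideal \<beta> \<noteq> {}\<close> by auto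
      then show ?thesis by (rule words1I[OF L(2) \<open>\<beta> \<noteq> []\<close> _ _ tail_filter_F0[OF \<mu>]])
    qed
    have "\<mu> \<in> pa_domain (word_elt \<alpha> @ word_elt_inv \<beta>) \<longleftrightarrow>
        (\<alpha> = [] \<and> \<beta> = []) \<or>
        (\<alpha> \<in> words1 \<and> \<beta> \<in> words1 \<and> path_starts \<mu> \<alpha> \<and> snd (last (path_take (length \<alpha>) \<mu>)) \<inter> word_ideal \<beta> \<noteq> {}) \<or>
        (\<alpha> \<in> words1 \<and> \<beta> = [] \<and> path_starts \<mu> \<alpha>) \<or>
        (\<beta> \<in> words1 \<and> \<alpha> = [] \<and> path_r \<mu> \<inter> word_ideal \<beta> \<noteq> {})"
      unfolding pa_domain_def mem_Collect_eq eq eq0 eq1 eq2 using \<mu> red by blast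
    also have "\<dots> \<longleftrightarrow> \<mu> \<in> word_domain \<alpha> \<beta>"
    proof (cases "\<alpha> = []")
      case True
      then have "\<alpha> \<notin> words1" by (simp add: words1_def)
      then show ?thesis using True \<mu> 2 tail_filter_Nil[OF \<mu>] by (auto simp: word_domain_def)
    next
      case ne: False
      show ?thesis
      proof (cases "\<beta> = []")
        case True
        then have "\<beta> \<notin> words1" by (simp add: words1_def)
        then show ?thesis using ne True \<mu> 1 by (auto simp: word_domain_def)
      next
        case False
        have "path_starts \<mu> \<alpha> \<Longrightarrow> snd (last (path_take (length \<alpha>) \<mu>)) \<inter> word_ideal \<beta> \<noteq> {} \<longleftrightarrow> tail_filter \<mu> \<alpha> \<inter> word_ideal \<beta> \<noteq> {}"
          by (rule snd_last_meets_ideal[OF \<mu> _ ne L(2)])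
        then show ?thesis using ne False \<mu> 1 2 unfolding word_domain_def by blast
      qed
    qed
    finally show ?thesis .
  qed (simp add: pa_domain_def word_domain_def)
qed

lemma pa_domain_other:
  assumes "\<not> (\<exists>\<alpha> \<beta>. t = word_elt \<alpha> @ word_elt_inv \<beta>)" shows "pa_domain t = {}"
proof -
  have "t \<noteq> []" "\<And>\<alpha> \<beta>. t \<noteq> word_elt \<alpha> @ word_elt_inv \<beta>" "\<And>\<alpha>. t \<noteq> word_elt \<alpha>" "\<And>\<beta>. t \<noteq> word_elt_inv \<beta>"
    using assms by (metis append_Nil append_Nil2 word_elt_Nil)+
  then show ?thesis by (simp add: pa_domain_def)
qed

lemma letter_carrier: "letter_base x \<in> L \<Longrightarrow> [x] \<in> carrier (free_group L)"
  by (simp add: free_group_def fg_reduced_def)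

lemma pa_domain_Nil: "pa_domain [] = boundary"
  by (simp add: pa_domain_def)

lemma pa_domain_Gen: "a \<in> L \<Longrightarrow> pa_domain [Gen a] = starting a"
  using pa_domain_word[of "[a]" "[]"] letter_carrier[of "Gen a"]
  by (simp add: word_domain_def starting_def word_elt_def)

lemma pa_domain_GenInv: "a \<in> L \<Longrightarrow> pa_domain [GenInv a] = extendable a"
  using pa_domain_word[of "[]" "[a]"] letter_carrier[of "GenInv a"] word_ideal_single[of a]
  by (auto simp: word_domain_def extendable_def word_elt_inv_def tail_filter_Nil simp del: word_ideal.simps)

lemma pa_map_Nil: "pa_map [] \<mu> = \<mu>"
  by (simp add: pa_map_def)

lemma pa_map_GenInv: "pa_map [GenInv a] = remove_edge"
  by (simp add: pa_map_def fun_eq_iff)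

lemma pa_map_Gen: "pa_map [Gen a] = add_edge a"
  by (simp add: pa_map_def add_edge_def fun_eq_iff)

lemma lift_edges_Cons_hd: "lift_edges (a # \<alpha>) \<zeta> \<noteq> [] \<and> fst (hd (lift_edges (a # \<alpha>) \<zeta>)) = a"
  by (cases \<alpha>) (simp_all add: Let_def)

lemma path_prepend_Cons: "es \<noteq> [] \<Longrightarrow> path_prepend (e # es) \<nu> = path_Cons e (path_prepend es \<nu>)"
proof (cases \<nu>)
  case (InfPath f)
  have "(\<lambda>i. if i < length (e # es) then (e # es) ! i else f (i - length (e # es))) =
      (\<lambda>i. if i < length [e] then [e] ! i else if i - length [e] < length es then es ! (i - length [e])
        else f (i - length [e] - length es))"
  proof
    fix i show "(if i < length (e # es) then (e # es) ! i else f (i - length (e # es))) =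
      (if i < length [e] then [e] ! i else if i - length [e] < length es then es ! (i - length [e])
        else f (i - length [e] - length es))" by (cases i) simp_all
  qed
  then show ?thesis unfolding InfPath path_prepend.simps by simp
qed simp_all

lemma path_r_prepend: "es \<noteq> [] \<Longrightarrow> path_r (path_prepend es \<nu>) = edge_r (hd es)"
  by (cases \<nu>) (simp_all add: hd_conv_nth nth_append)

text \<open>\<open>lift_edges\<close> computes from the last edge backwards, and the set it passes
  on is the range of the path prepended so far. This is exactly what iterating
  \<open>add_edge\<close> does.\<close>

lemma path_prepend_lift_edges:
  "\<beta> \<noteq> [] \<Longrightarrow> path_prepend (lift_edges \<beta> (path_r \<nu>)) \<nu> = foldr add_edge \<beta> \<nu>"
proof (induction \<beta> rule: induct_list012)
  case (2 b)
  then show ?case by (simp add: add_edge_def del: path_prepend.simps)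
next
  case (3 b c \<beta>)
  let ?es = "lift_edges (c # \<beta>) (path_r \<nu>)"
  have es: "?es \<noteq> []" "fst (hd ?es) = c" using lift_edges_Cons_hd[of c \<beta> "path_r \<nu>"] by auto
  have "path_r (path_prepend ?es \<nu>) = letter_map c (snd (hd ?es))"
    using path_r_prepend[OF es(1)] es(2) by (simp add: edge_r_def)
  then have "path_prepend (lift_edges (b # c # \<beta>) (path_r \<nu>)) \<nu> = add_edge b (path_prepend ?es \<nu>)"
    using path_prepend_Cons[OF es(1)] by (simp add: Let_def add_edge_def del: path_prepend.simps)
  then show ?case using 3 by simp
qed simp

lemma pa_map_word:
  assumes \<mu>: "\<mu> \<in> boundary" "path_starts \<mu> \<alpha>"
  shows "pa_map (word_elt \<beta> @ word_elt_inv \<alpha>) \<mu> = foldr add_edge \<beta> (path_drop (length \<alpha>) \<mu>)"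
proof -
  let ?\<zeta> = "if \<alpha> = [] then path_r \<mu> else edge_d (last (path_take (length \<alpha>) \<mu>))"
  let ?\<nu> = "if \<alpha> = [] then \<mu> else path_drop (length \<alpha>) \<mu>"
  have \<nu>: "?\<nu> = path_drop (length \<alpha>) \<mu>" using path_drop_0[OF \<mu>(1)] by simp
  have "?\<zeta> = path_r ?\<nu>"
    using tail_filter_last[OF \<mu>] \<mu>(2) by (simp add: tail_filter_def)
  then have "pa_map (word_elt \<beta> @ word_elt_inv \<alpha>) \<mu> = (if \<beta> = [] then ?\<nu> else path_prepend (lift_edges \<beta> (path_r ?\<nu>)) ?\<nu>)"
    unfolding pa_map_def gens_word inv_gens_word Let_def by (simp only:)
  also have "\<dots> = foldr add_edge \<beta> ?\<nu>" using path_prepend_lift_edges[of \<beta> ?\<nu>] by simp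
  finally show ?thesis unfolding \<nu> .
qed

section \<open>Splitting off the first letter of a reduced word\<close>

lemma starting_Cons_iff:
  assumes "\<mu> \<in> boundary"
  shows "path_starts \<mu> (a # \<alpha>) \<longleftrightarrow> \<mu> \<in> starting a \<and> path_starts (remove_edge \<mu>) \<alpha>"
proof
  assume s: "path_starts \<mu> (a # \<alpha>)"
  then have m: "\<mu> \<in> starting a" using path_starts_single[OF s] assms by (simp add: starting_def)
  obtain e \<nu> where e: "\<mu> = path_Cons e \<nu>" "fst e = a" "remove_edge \<mu> = \<nu>" using startingE[OF m] by metis
  have "path_starts \<nu> \<alpha>" using s unfolding e(1) path_starts_Cons by simp
  then show "\<mu> \<in> starting a \<and> path_starts (remove_edge \<mu>) \<alpha>" using m e(3) by simp
next
  assume m: "\<mu> \<in> starting a \<and> path_starts (remove_edge \<mu>) \<alpha>"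
  then obtain e \<nu> where e: "\<mu> = path_Cons e \<nu>" "fst e = a" "remove_edge \<mu> = \<nu>" using startingE by metis
  show "path_starts \<mu> (a # \<alpha>)" using m e(2) unfolding e(3) unfolding e(1) path_starts_Cons by simp
qed

lemma word_ideal_append_single:
  assumes "\<beta> \<noteq> []" "b \<in> L"
  shows "A \<in> word_ideal (\<beta> @ [b]) \<longleftrightarrow> (\<exists>D\<in>word_ideal \<beta>. A \<le> \<theta> b D)"
proof -
  obtain c \<gamma> where \<beta>: "\<beta> = c # \<gamma>" using assms(1) by (cases \<beta>) auto
  have w: "word_action (\<gamma> @ [b]) C = \<theta> b (word_action \<gamma> C)" for C by (simp add: word_action_def)
  show ?thesis
  proof
    assume "A \<in> word_ideal (\<beta> @ [b])"
    then obtain C where "C \<in> \<I> c" "A \<le> \<theta> b (word_action \<gamma> C)" using \<beta> w by auto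
    then show "\<exists>D\<in>word_ideal \<beta>. A \<le> \<theta> b D" using \<beta> by (intro bexI[of _ "word_action \<gamma> C"]) auto
  next
    assume "\<exists>D\<in>word_ideal \<beta>. A \<le> \<theta> b D"
    then obtain D C where D: "A \<le> \<theta> b D" "C \<in> \<I> c" "D \<le> word_action \<gamma> C" using \<beta> by auto
    have "A \<le> word_action (\<gamma> @ [b]) C"
      unfolding w using order_trans[OF D(1) action_mono[OF action[OF assms(2)] D(3)]] .
    then show "A \<in> word_ideal (\<beta> @ [b])" using D(2) \<beta> by auto
  qed
qed

text \<open>Members of the ideal of \<open>\<beta> @ [b]\<close> lie below some
  \<open>\<theta> b D\<close> with \<open>D\<close> in the ideal of \<beta>, and
  \<open>\<theta> b D\<close> lies in the range of \<open>\<mu>\<close> exactly when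
  \<open>D\<close> lies in the range of \<open>add_edge b \<mu>\<close>. The condition at
  \<open>\<mu>\<close> thus becomes one at the longer path.\<close>

lemma add_edge_domain:
  assumes b: "b \<in> L" and \<mu>: "\<mu> \<in> boundary" and \<beta>: "\<beta> \<in> lists L"
  shows "\<mu> \<in> word_domain [] (\<beta> @ [b]) \<longleftrightarrow> \<mu> \<in> extendable b \<and> add_edge b \<mu> \<in> word_domain [] \<beta>"
proof (cases "\<mu> \<in> extendable b")
  case True
  have ab: "add_edge b \<mu> \<in> boundary" using add_edge_starting[OF b True] by (simp add: starting_def)
  show ?thesis
  proof (cases "\<beta> = []")
    case Nil: True
    have "\<mu> \<in> word_domain [] [b]"
      using True word_ideal_single[OF b] tail_filter_Nil[OF \<mu>]
      by (simp add: word_domain_def extendable_def del: word_ideal.simps)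
    then show ?thesis using Nil True ab by (simp add: word_domain_def)
  next
    case False
    have "path_r \<mu> \<inter> word_ideal (\<beta> @ [b]) \<noteq> {} \<longleftrightarrow> (\<exists>D\<in>word_ideal \<beta>. \<theta> b D \<in> path_r \<mu>)"
    proof
      assume "path_r \<mu> \<inter> word_ideal (\<beta> @ [b]) \<noteq> {}"
      then obtain A where A: "A \<in> path_r \<mu>" "A \<in> word_ideal (\<beta> @ [b])" by auto
      then obtain D where "D \<in> word_ideal \<beta>" "A \<le> \<theta> b D" using word_ideal_append_single[OF False b] by auto
      then show "\<exists>D\<in>word_ideal \<beta>. \<theta> b D \<in> path_r \<mu>" using F0_up[OF path_r_F0[OF \<mu>] A(1)] by auto
    next
      assume "\<exists>D\<in>word_ideal \<beta>. \<theta> b D \<in> path_r \<mu>"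
      then obtain D where D: "D \<in> word_ideal \<beta>" "\<theta> b D \<in> path_r \<mu>" by auto
      then have "\<theta> b D \<in> word_ideal (\<beta> @ [b])" using word_ideal_append_single[OF False b] by auto
      then show "path_r \<mu> \<inter> word_ideal (\<beta> @ [b]) \<noteq> {}" using D(2) by auto
    qed
    also have "\<dots> \<longleftrightarrow> tail_filter (add_edge b \<mu>) [] \<inter> word_ideal \<beta> \<noteq> {}"
      using tail_filter_add_Nil[OF b True] by auto
    finally show ?thesis using True \<mu> ab False tail_filter_Nil[OF \<mu>] by (simp add: word_domain_def)
  qed
next
  case False
  have "path_r \<mu> \<inter> word_ideal (\<beta> @ [b]) = {}"
  proof (rule ccontr)
    assume "path_r \<mu> \<inter> word_ideal (\<beta> @ [b]) \<noteq> {}"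
    then obtain A where A: "A \<in> path_r \<mu>" "A \<in> word_ideal (\<beta> @ [b])" by auto
    have "A \<in> \<I> b" using word_ideal_last[of "\<beta> @ [b]" A] \<beta> b A(2) by simp
    then show False using False A(1) \<mu> by (auto simp: extendable_def)
  qed
  then show ?thesis using False tail_filter_Nil[OF \<mu>] by (simp add: word_domain_def)
qed

lemma pa_domain_subset: "pa_domain t \<subseteq> boundary"
  by (auto simp: pa_domain_def)

lemma pa_domain_Cons:
  assumes t: "x # t \<in> carrier (free_group L)"
  shows "\<mu> \<in> pa_domain (x # t) \<longleftrightarrow> \<mu> \<in> pa_domain [x] \<and> pa_map [flip_letter x] \<mu> \<in> pa_domain t"
proof -
  have tL: "t \<in> carrier (free_group L)" and xL: "letter_base x \<in> L" and red: "fg_reduced (x # t)"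
    using t fg_reduced_ConsD by (auto simp: free_group_def)
  show ?thesis
  proof (cases x)
    case (Gen a)
    have a: "a \<in> L" using xL Gen by simp
    show ?thesis
    proof (cases "\<exists>\<alpha> \<beta>. t = word_elt \<alpha> @ word_elt_inv \<beta>")
      case True
      then obtain \<alpha> \<beta> where ab: "t = word_elt \<alpha> @ word_elt_inv \<beta>" by auto
      have xt: "x # t = word_elt (a # \<alpha>) @ word_elt_inv \<beta>" using Gen ab by (simp add: word_elt_def)
      have "\<mu> \<in> word_domain (a # \<alpha>) \<beta> \<longleftrightarrow> \<mu> \<in> starting a \<and> remove_edge \<mu> \<in> word_domain \<alpha> \<beta>"
      proof (cases "\<mu> \<in> starting a")
        case m: True
        then have "\<mu> \<in> boundary" by (simp add: starting_def)
        moreover have "remove_edge \<mu> \<in> boundary" using remove_edge_extendable[OF m] by (simp add: extendable_def)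
        ultimately show ?thesis
          using m starting_Cons_iff[of \<mu> a \<alpha>] tail_filter_remove[OF m, of \<alpha>] by (simp add: word_domain_def)
      next
        case False
        then show ?thesis using starting_Cons_iff[of \<mu> a \<alpha>] by (auto simp: word_domain_def)
      qed
      moreover have "pa_domain (x # t) = word_domain (a # \<alpha>) \<beta>"
        using pa_domain_word[of "a # \<alpha>" \<beta>] t unfolding xt by simp
      moreover have "pa_domain t = word_domain \<alpha> \<beta>"
        using pa_domain_word[of \<alpha> \<beta>] tL unfolding ab by simp
      ultimately show ?thesis using pa_domain_Gen[OF a] pa_map_GenInv[of a] Gen by simp
    next
      case False
      then have "pa_domain t = {}" "pa_domain (x # t) = {}"
        using pa_domain_other Cons_Gen_word_iff[of a t] Gen by auto
      then show ?thesis by simp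
    qed
  next
    case (GenInv b)
    have b: "b \<in> L" using xL GenInv by simp
    show ?thesis
    proof (cases "\<exists>\<beta>. t = word_elt_inv \<beta>")
      case True
      then obtain \<beta> where \<beta>: "t = word_elt [] @ word_elt_inv \<beta>" by auto
      have xt: "x # t = word_elt [] @ word_elt_inv (\<beta> @ [b])" using GenInv \<beta> by (simp add: word_elt_inv_def)
      have \<beta>L: "\<beta> \<in> lists L" using word_elt_lists[of "[]" \<beta>] tL \<beta> by simp
      have "\<mu> \<in> word_domain [] (\<beta> @ [b]) \<longleftrightarrow> \<mu> \<in> extendable b \<and> add_edge b \<mu> \<in> word_domain [] \<beta>"
      proof (cases "\<mu> \<in> boundary")
        case True
        then show ?thesis by (rule add_edge_domain[OF b _ \<beta>L])
      next
        case False
        then show ?thesis by (simp add: word_domain_def extendable_def)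
      qed
      moreover have "pa_domain (x # t) = word_domain [] (\<beta> @ [b])"
        using pa_domain_word[of "[]" "\<beta> @ [b]"] t unfolding xt by simp
      moreover have "pa_domain t = word_domain [] \<beta>"
        using pa_domain_word[of "[]" \<beta>] tL unfolding \<beta> by simp
      ultimately show ?thesis
        using pa_domain_GenInv[OF b] pa_map_Gen[of b] GenInv by simp
    next
      case False
      have e: "pa_domain (x # t) = {}"
        using pa_domain_other[of "x # t"] Cons_GenInv_word_iff[of b t] False GenInv by auto
      \<comment> \<open>Here \<open>x # t\<close> is not of the form \<alpha>\<beta>^{-1} and has
        empty domain, although \<open>t\<close> may have a non-empty one. Reducedness decides: a
        path with an added edge labelled \<open>b\<close> cannot start with the first positive
        letter of \<open>t\<close>, as that letter differs from \<open>b\<close>.\<close>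
      have "add_edge b \<mu> \<notin> pa_domain t" if m: "\<mu> \<in> extendable b"
      proof
        assume d: "add_edge b \<mu> \<in> pa_domain t"
        then have "\<exists>\<alpha> \<beta>. t = word_elt \<alpha> @ word_elt_inv \<beta>" using pa_domain_other[of t] by blast
        then obtain \<alpha> \<beta> where ab: "t = word_elt \<alpha> @ word_elt_inv \<beta>" by auto
        then obtain c \<gamma> where c: "\<alpha> = c # \<gamma>" using False by (cases \<alpha>) auto
        have "c \<noteq> b" using red ab c GenInv by (auto simp: fg_reduced_def word_elt_def)
        moreover have "path_starts (add_edge b \<mu>) \<alpha>"
          using d pa_domain_word[of \<alpha> \<beta>] tL ab by (simp add: word_domain_def)
        then have "add_edge b \<mu> \<in> starting c"
          using starting_Cons_iff[of "add_edge b \<mu>" c \<gamma>] c pa_domain_subset[of t] d by auto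
        then have "path_starts (add_edge b \<mu>) [c]" by (simp add: starting_def)
        then have "c = b" unfolding add_edge_def path_starts_Cons by simp
        ultimately show False by simp
      qed
      then show ?thesis using e pa_domain_GenInv[OF b] pa_map_Gen[of b] GenInv by auto
    qed
  qed
qed

text \<open>By \<open>pa_map_word\<close> both sides drop edges and then add edges one by one. A
  positive first letter accounts for the first edge dropped, a negative one, when no positive
  letters occur, for the first edge added.\<close>

lemma pa_map_Cons:
  assumes t: "x # t \<in> carrier (free_group L)" and \<mu>: "\<mu> \<in> pa_domain (x # t)"
  shows "pa_map (rev (map flip_letter (x # t))) \<mu> = pa_map (rev (map flip_letter t)) (pa_map [flip_letter x] \<mu>)"
proof -
  obtain \<alpha> \<beta> where ab: "x # t = word_elt \<alpha> @ word_elt_inv \<beta>" using \<mu> pa_domain_other[of "x # t"] by auto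
  have m: "\<mu> \<in> boundary" "path_starts \<mu> \<alpha>"
    using \<mu> pa_domain_word[of \<alpha> \<beta>] t unfolding ab by (simp_all add: word_domain_def)
  have lhs: "pa_map (rev (map flip_letter (x # t))) \<mu> = foldr add_edge \<beta> (path_drop (length \<alpha>) \<mu>)"
    unfolding ab winv_word by (rule pa_map_word[OF m])
  have xL: "letter_base x \<in> L" using t by (simp add: free_group_def)
  show ?thesis
  proof (cases \<alpha>)
    case (Cons a \<gamma>)
    have x: "x = Gen a" and tt: "t = word_elt \<gamma> @ word_elt_inv \<beta>" using ab Cons by (simp_all add: word_elt_def)
    have s: "\<mu> \<in> starting a" "path_starts (remove_edge \<mu>) \<gamma>"
      using starting_Cons_iff[OF m(1), of a \<gamma>] m(2) Cons by simp_all
    have r: "remove_edge \<mu> \<in> boundary" using remove_edge_extendable[OF s(1)] by (simp add: extendable_def)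
    obtain e \<nu> where e: "\<mu> = path_Cons e \<nu>" "\<nu> \<in> boundary" "path_r \<nu> = edge_d e" "remove_edge \<mu> = \<nu>"
      using startingE[OF s(1)] by metis
    have "path_drop (length \<alpha>) \<mu> = path_drop (length \<gamma>) (remove_edge \<mu>)"
      unfolding e(4) unfolding Cons e(1) by (simp only: list.size add_0_right add_Suc_right path_drop_Suc[OF e(2,3)])
    then have "foldr add_edge \<beta> (path_drop (length \<alpha>) \<mu>) = pa_map (word_elt \<beta> @ word_elt_inv \<gamma>) (remove_edge \<mu>)"
      using pa_map_word[OF r s(2), of \<beta>] by simp
    then show ?thesis unfolding lhs by (simp only: tt winv_word x flip_letter.simps pa_map_GenInv)
  next
    case Nil
    then have "x # t = map GenInv (rev \<beta>)" using ab by (simp add: word_elt_inv_def)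
    then obtain b \<gamma> where g: "rev \<beta> = b # \<gamma>" "x = GenInv b" "t = map GenInv \<gamma>" by (cases "rev \<beta>") auto
    then have \<beta>: "\<beta> = rev \<gamma> @ [b]" by (metis rev.simps(2) rev_rev_ident)
    have tt: "t = word_elt [] @ word_elt_inv (rev \<gamma>)" using g by (simp add: word_elt_inv_def)
    have b: "b \<in> L" using xL g by simp
    have "\<mu> \<in> extendable b" using \<mu> pa_domain_Cons[OF t, of \<mu>] pa_domain_GenInv[OF b] g(2) by simp
    then have ab': "add_edge b \<mu> \<in> boundary" using add_edge_starting[OF b] by (simp add: starting_def)
    have "foldr add_edge \<beta> (path_drop (length \<alpha>) \<mu>) = foldr add_edge (rev \<gamma>) (add_edge b \<mu>)"
      using Nil \<beta> path_drop_0[OF m(1)] by simp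
    also have "\<dots> = pa_map (word_elt (rev \<gamma>) @ word_elt_inv []) (add_edge b \<mu>)"
      using pa_map_word[OF ab', of "[]" "rev \<gamma>"] path_drop_0[OF ab'] by simp
    finally show ?thesis unfolding lhs by (simp only: tt winv_word g(2) flip_letter.simps pa_map_Gen)
  qed
qed

lemma free_partial_action: "free_partial_action L boundary_topology pa_domain pa_map"
  unfolding boundary_topology_eq
proof
  show "Hausdorff_space cyl_topology" by (rule Hausdorff_cyl_topology)
  show "pa_domain [] = topspace cyl_topology" by (simp add: pa_domain_Nil topspace_cyl_topology)
  show "pa_map [] \<mu> = \<mu>" for \<mu> by (rule pa_map_Nil)
  fix x assume x: "letter_base x \<in> L"
  show "openin cyl_topology (pa_domain [x])"
    using x starting_open extendable_open by (cases x) (simp_all add: pa_domain_Gen pa_domain_GenInv)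
  show "continuous_map (subtopology cyl_topology (pa_domain [x])) cyl_topology (pa_map [flip_letter x])"
    using x continuous_remove_edge continuous_add_edge
    by (cases x) (simp_all add: pa_domain_Gen pa_domain_GenInv pa_map_Gen pa_map_GenInv)
  show "pa_map [flip_letter x] \<mu> \<in> pa_domain [flip_letter x]" if "\<mu> \<in> pa_domain [x]" for \<mu>
    using x that remove_edge_extendable add_edge_starting
    by (cases x) (simp_all add: pa_domain_Gen pa_domain_GenInv pa_map_Gen pa_map_GenInv)
  show "pa_map [x] (pa_map [flip_letter x] \<mu>) = \<mu>" if "\<mu> \<in> pa_domain [x]" for \<mu>
    using x that add_remove remove_add
    by (cases x) (simp_all add: pa_domain_Gen pa_domain_GenInv pa_map_Gen pa_map_GenInv)
next
  fix x t \<mu> assume t: "x # t \<in> carrier (free_group L)"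
  show "\<mu> \<in> pa_domain (x # t) \<longleftrightarrow> \<mu> \<in> pa_domain [x] \<and> pa_map [flip_letter x] \<mu> \<in> pa_domain t"
    by (rule pa_domain_Cons[OF t])
  show "pa_map (rev (map flip_letter (x # t))) \<mu> = pa_map (rev (map flip_letter t)) (pa_map [flip_letter x] \<mu>)"
    if "\<mu> \<in> pa_domain (x # t)" by (rule pa_map_Cons[OF t that])
qed

sublocale action: partial_dynamical_system "free_group L" boundary_topology pa_domain pa_map
  by (rule free_partial_action.partial_dynamical_system[OF free_partial_action])

end

section \<open>The generators\<close>

context gen_boolean_dyn_system
begin

lemma free_group_letter:
  assumes "a \<in> L"
  shows "[Gen a] \<in> carrier (free_group L)" "inv\<^bsub>free_group L\<^esub> [Gen a] = [GenInv a]"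
    "[GenInv a] \<in> carrier (free_group L)" "inv\<^bsub>free_group L\<^esub> [GenInv a] = [Gen a]"
  using letter_carrier[of "Gen a"] letter_carrier[of "GenInv a"] assms inv_free_group[of _ L] by simp_all

lemma free_group_one: "\<one>\<^bsub>free_group L\<^esub> = []"
  by (simp add: free_group_def)

lemma cylinder_Nil: "cylinder [] A = cyl [] A"
  by (auto simp: cylinder_def cyl_def tail_filter_Nil)

lemma cylinder_single:
  assumes "a \<in> L" "B \<in> \<I> a" shows "cylinder [a] B = cyl [a] B"
proof -
  have "path_starts \<mu> [a] \<and> B \<in> snd (last (path_take (length [a]) \<mu>)) \<longleftrightarrow> B \<in> tail_filter \<mu> [a]"
    if "\<mu> \<in> boundary" for \<mu>
    using in_tail_filter_iff[OF that, of "[a]" B] assms(2) by simp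
  then show ?thesis unfolding cylinder_def cyl_def by auto
qed

lemma indicator_cyl_C0:
  assumes "(\<alpha>, A) \<in> cyl_index" "t \<in> carrier (free_group L)" "cyl \<alpha> A \<subseteq> pa_domain t"
  shows "(indicator (cyl \<alpha> A) :: _ \<Rightarrow> complex) \<in> C0 boundary_topology (pa_domain t)"
  using indicator_in_C0_iff[OF action.Hausdorff action.open_domain[OF assms(2)] assms(3)]
    cyl_open_index[OF assms(1)] compactin_cyl[OF assms(1)] by (simp add: boundary_topology_eq)

lemma cyl_single_subset:
  assumes "a \<in> L" shows "cyl [a] B \<subseteq> pa_domain [Gen a]"
  unfolding pa_domain_Gen[OF assms] starting_def cyl_def using tail_filter_starts by auto

lemma cyl_Nil_subset: "cyl [] A \<subseteq> pa_domain []"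
  unfolding pa_domain_Nil by (rule cyl_subset_boundary)

lemma cyl_delta_Nil: "cyl_delta [] A = action.emb (fdelta [] (indicator (cyl [] A)))"
  by (simp add: cyl_delta_def action.cp_delta_eq cylinder_Nil)

lemma cyl_delta_single:
  "a \<in> L \<Longrightarrow> B \<in> \<I> a \<Longrightarrow> cyl_delta [a] B = action.emb (fdelta [Gen a] (indicator (cyl [a] B)))"
  by (simp add: cyl_delta_def action.cp_delta_eq cylinder_single word_elt_def)

definition generators :: "(nat \<Rightarrow> 'l signed_letter list \<Rightarrow> ('l, 'b) path \<Rightarrow> complex) set set" where
  "generators = {cyl_delta [] A | A. A \<in> UNIV} \<union> {cyl_delta [\<alpha>] B | \<alpha> B. \<alpha> \<in> L \<and> B \<in> \<I> \<alpha>}"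

lemma Nil_carrier: "[] \<in> carrier (free_group L)"
  by (simp add: free_group_def)

lemma generators_carrier: "generators \<subseteq> carrier action.cp"
proof
  fix X assume "X \<in> generators"
  then consider A where "X = cyl_delta [] A" | a B where "a \<in> L" "B \<in> \<I> a" "X = cyl_delta [a] B"
    unfolding generators_def by blast
  then show "X \<in> carrier action.cp"
  proof cases
    case 1
    show ?thesis unfolding 1 cyl_delta_Nil
      by (rule action.emb_carrier[OF action.fdelta_closed[OF Nil_carrier indicator_cyl_C0[OF cyl_index_Nil Nil_carrier cyl_Nil_subset]]])
  next
    case (2 a B)
    note g = free_group_letter(1)[OF 2(1)]
    show ?thesis unfolding 2(3) cyl_delta_single[OF 2(1,2)]
      by (rule action.emb_carrier[OF action.fdelta_closed[OF g indicator_cyl_C0[OF cyl_index_single[OF 2(1,2)] g cyl_single_subset[OF 2(1)]]]])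
  qed
qed

context
  fixes S assumes S: "cstar_subalgebra action.cp S" and gen: "generators \<subseteq> S"
begin

lemma cyl_Nil_charset: "cyl [] A \<in> action.charset S []"
proof -
  have "cyl_delta [] A \<in> S" using gen unfolding generators_def by blast
  then show ?thesis
    using indicator_cyl_C0[OF cyl_index_Nil Nil_carrier cyl_Nil_subset] Nil_carrier cyl_Nil_subset
    unfolding action.charset_def[OF S] action.delta_in_def[OF S] cyl_delta_Nil by simp
qed

lemma cyl_single_charset:
  assumes a: "a \<in> L" and B: "B \<in> \<I> a" shows "cyl [a] B \<in> action.charset S [Gen a]"
proof -
  have "cyl_delta [a] B \<in> S" using gen a B unfolding generators_def by blast
  then show ?thesis
    using indicator_cyl_C0[OF cyl_index_single[OF a B] free_group_letter(1)[OF a] cyl_single_subset[OF a]]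
      free_group_letter(1)[OF a] cyl_single_subset[OF a]
    unfolding action.charset_def[OF S] action.delta_in_def[OF S] cyl_delta_single[OF a B] by simp
qed

text \<open>If \<open>A\<close> lies below the image of \<open>B\<close>, the product of the
  generator at \<open>a\<close> for \<open>B\<close> with the element for
  \<open>cyl \<alpha> A\<close> at the identity has the indicator of
  \<open>cyl (a # \<alpha>) A\<close> as coefficient at \<open>a\<close>; \<open>charset_one\<close>
  moves it to the identity.\<close>

lemma cyl_charset: "(\<alpha>, A) \<in> cyl_index \<Longrightarrow> cyl \<alpha> A \<in> action.charset S []"
proof (induction \<alpha>)
  case Nil
  show ?case by (rule cyl_Nil_charset)
next
  case (Cons a \<alpha>)
  have a: "a \<in> L" using Cons.prems by (simp add: cyl_index_def)
  obtain B where B: "B \<in> \<I> a" "A \<le> word_action \<alpha> B" using Cons.prems by (auto simp: cyl_index_def)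
  note IH = Cons.IH[OF cyl_index_tl[OF Cons.prems]]
  have "{\<mu> \<in> cyl [a] B. pa_map (inv\<^bsub>free_group L\<^esub> [Gen a]) \<mu> \<in> cyl \<alpha> A} = cyl (a # \<alpha>) A"
  proof (intro equalityI subsetI)
    fix \<mu> assume "\<mu> \<in> {\<mu> \<in> cyl [a] B. pa_map (inv\<^bsub>free_group L\<^esub> [Gen a]) \<mu> \<in> cyl \<alpha> A}"
    then have \<mu>: "\<mu> \<in> starting a" "remove_edge \<mu> \<in> cyl \<alpha> A"
      using cyl_single_subset[OF a, of B] unfolding pa_domain_Gen[OF a] free_group_letter(2)[OF a] pa_map_GenInv by auto
    then show "\<mu> \<in> cyl (a # \<alpha>) A"
      using tail_filter_remove[OF \<mu>(1), of \<alpha>] by (simp add: cyl_def starting_def)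
  next
    fix \<mu> assume "\<mu> \<in> cyl (a # \<alpha>) A"
    then have \<mu>: "\<mu> \<in> boundary" "A \<in> tail_filter \<mu> (a # \<alpha>)" by (simp_all add: cyl_def)
    have s: "\<mu> \<in> starting a"
      using \<mu>(1) path_starts_single[OF tail_filter_starts[OF \<mu>(2)]] by (simp add: starting_def)
    have r: "remove_edge \<mu> \<in> boundary" using remove_edge_extendable[OF s] by (simp add: extendable_def)
    have rA: "A \<in> tail_filter (remove_edge \<mu>) \<alpha>" using \<mu>(2) tail_filter_remove[OF s, of \<alpha>] by simp
    have "B \<in> path_r (remove_edge \<mu>)"
      using F0_up[OF tail_filter_F0[OF r] rA B(2)] word_action_tail_filter[OF r tail_filter_starts[OF rA]] by simp
    then have "B \<in> tail_filter \<mu> [a]" using tail_filter_remove[OF s, of "[]"] tail_filter_Nil[OF r] by simp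
    then show "\<mu> \<in> {\<mu> \<in> cyl [a] B. pa_map (inv\<^bsub>free_group L\<^esub> [Gen a]) \<mu> \<in> cyl \<alpha> A}"
      using \<mu>(1) r rA unfolding free_group_letter(2)[OF a] pa_map_GenInv by (simp add: cyl_def)
  qed
  then have "cyl (a # \<alpha>) A \<in> action.charset S ([Gen a] \<otimes>\<^bsub>free_group L\<^esub> [])"
    using action.charset_mult[OF S cyl_single_charset[OF a B(1)] IH] by simp
  from action.charset_one[OF S this] show ?case unfolding free_group_one .
qed

text \<open>Positive letters are covered by the generators themselves, negative ones by their
  adjoints.\<close>

lemma letter_cover:
  assumes x: "letter_base x \<in> L" and \<mu>: "\<mu> \<in> pa_domain [x]"
  shows "\<exists>K\<in>action.charset S [x]. \<mu> \<in> K"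
proof (cases x)
  case (Gen a)
  then have a: "a \<in> L" using x by simp
  obtain B where B: "B \<in> \<I> a" "\<mu> \<in> cyl [a] B"
    using \<mu> unfolding Gen pa_domain_Gen[OF a] starting_eq_Union[OF a] by auto
  then show ?thesis unfolding Gen using cyl_single_charset[OF a B(1)] by auto
next
  case (GenInv a)
  then have a: "a \<in> L" using x by simp
  have e: "\<mu> \<in> extendable a" using \<mu> unfolding GenInv pa_domain_GenInv[OF a] .
  obtain B where B: "B \<in> \<I> a" "B \<in> path_r \<mu>" and b: "\<mu> \<in> boundary" using e by (auto simp: extendable_def)
  have m: "{\<nu> \<in> pa_domain (inv\<^bsub>free_group L\<^esub> [Gen a]). pa_map [Gen a] \<nu> \<in> cyl [a] B} \<in>
      action.charset S (inv\<^bsub>free_group L\<^esub> [Gen a])"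
    by (rule action.charset_star[OF S cyl_single_charset[OF a B(1)]])
  have c: "add_edge a \<mu> \<in> cyl [a] B"
    using tail_filter_add[OF a e, of a "[]"] tail_filter_Nil[OF b] B(2) add_edge_starting[OF a e]
    by (simp add: cyl_def starting_def)
  show ?thesis
    unfolding GenInv
    by (rule bexI[OF _ m[unfolded free_group_letter(2)[OF a] pa_map_Gen]])
      (use \<mu> GenInv c in simp)
qed

lemma charset_cover:
  "t \<in> carrier (free_group L) \<Longrightarrow> \<mu> \<in> pa_domain t \<Longrightarrow> \<exists>K\<in>action.charset S t. \<mu> \<in> K"
proof (induction t arbitrary: \<mu>)
  case Nil
  then have \<mu>: "\<mu> \<in> boundary" by (simp add: pa_domain_Nil)
  show ?case
  proof (cases "path_r \<mu> = {}")
    case False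
    then obtain B where "B \<in> path_r \<mu>" by auto
    then have "\<mu> \<in> cyl [] B" using \<mu> by (simp add: cyl_def tail_filter_Nil)
    then show ?thesis using cyl_Nil_charset by auto
  next
    \<comment> \<open>No cylinder over the empty word contains such a path. It is not a vertex, so a
      generator at its first label covers it, and \<open>charset_one\<close> brings that set to the
      identity.\<close>
    case True
    from \<mu> show ?thesis
    proof (cases rule: boundary_cases)
      case (Vertex v)
      then show ?thesis using True E0_nonempty by (auto simp: E0_sg_def)
    next
      case (Cons e \<nu>)
      have a: "fst e \<in> L" using Cons(2) by (simp add: E1_iff)
      have "path_starts \<mu> [fst e]" unfolding Cons(1) path_starts_Cons by simp
      then have "\<mu> \<in> starting (fst e)" using \<mu> by (simp add: starting_def)
      then obtain K where "K \<in> action.charset S [Gen (fst e)]" "\<mu> \<in> K"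
        using letter_cover[of "Gen (fst e)" \<mu>] a pa_domain_Gen[OF a] by auto
      then show ?thesis using action.charset_one[OF S] unfolding free_group_one by auto
    qed
  qed
next
  case (Cons x t)
  have tL: "t \<in> carrier (free_group L)" and x: "letter_base x \<in> L" and red: "fg_reduced (x # t)"
    using Cons.prems(1) fg_reduced_ConsD by (auto simp: free_group_def)
  have d: "\<mu> \<in> pa_domain [x]" "pa_map [flip_letter x] \<mu> \<in> pa_domain t"
    using Cons.prems(2) pa_domain_Cons[OF Cons.prems(1)] by simp_all
  obtain K1 where K1: "K1 \<in> action.charset S [x]" "\<mu> \<in> K1" using letter_cover[OF x d(1)] by auto
  obtain K2 where K2: "K2 \<in> action.charset S t" "pa_map [flip_letter x] \<mu> \<in> K2" using Cons.IH[OF tL d(2)] by auto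
  have inv: "inv\<^bsub>free_group L\<^esub> [x] = [flip_letter x]" using inv_free_group[OF letter_carrier[OF x]] by simp
  have "[x] \<otimes>\<^bsub>free_group L\<^esub> t = x # t" using reduced_Cons_of_reduced[OF red] by (simp add: free_group_def)
  then have "{\<nu> \<in> K1. pa_map [flip_letter x] \<nu> \<in> K2} \<in> action.charset S (x # t)"
    using action.charset_mult[OF S K1(1) K2(1)] by (simp add: inv)
  then show ?case by (rule bexI[rotated]) (use K1(2) K2(2) in simp)
qed

end

lemma carrier_eq_generated: "carrier bdry_crossed_product = cstar_generated bdry_crossed_product generators"
  unfolding bdry_crossed_product_def
proof (rule action.cstar_generated_eq_carrierI)
  show "generators \<subseteq> carrier (crossed_product (free_group L) boundary_topology pa_domain pa_map)"
    using generators_carrier by (simp add: action.crossed_product_eq)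
  fix S assume "cstar_subalgebra (crossed_product (free_group L) boundary_topology pa_domain pa_map) S" and gen: "generators \<subseteq> S"
  then have S: "cstar_subalgebra action.cp S" by (simp add: action.crossed_product_eq)
  show "\<exists>K\<in>action.charset S t. \<mu> \<in> K" if "t \<in> carrier (free_group L)" "\<mu> \<in> pa_domain t" for t \<mu>
    by (rule charset_cover[OF S gen that])
  show "\<exists>K\<in>action.charset S \<one>\<^bsub>free_group L\<^esub>. \<mu> \<in> K \<longleftrightarrow> \<nu> \<notin> K"
    if \<mu>\<nu>: "\<mu> \<in> topspace boundary_topology" "\<nu> \<in> topspace boundary_topology" "\<mu> \<noteq> \<nu>" for \<mu> \<nu>
  proof -
    obtain \<beta> B where B: "(\<beta>, B) \<in> cyl_index" "\<mu> \<in> cyl \<beta> B \<longleftrightarrow> \<nu> \<notin> cyl \<beta> B"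
      using cyl_separate[of \<mu> \<nu>] \<mu>\<nu> unfolding boundary_topology_eq topspace_cyl_topology by metis
    then show ?thesis unfolding free_group_one using cyl_charset[OF S gen B(1)] by auto
  qed
qed

end

theorem proposition3p20:
  fixes L :: "'l set"
    and \<theta> :: "'l \<Rightarrow> 'b::generalized_boolean_algebra \<Rightarrow> 'b"
    and \<I> :: "'l \<Rightarrow> 'b set"
  assumes "gen_boolean_dyn_system L \<theta> \<I>"
  shows "carrier (gen_boolean_dyn_system.bdry_crossed_product L \<theta> \<I>) =
    cstar_generated (gen_boolean_dyn_system.bdry_crossed_product L \<theta> \<I>)
      ({gen_boolean_dyn_system.cyl_delta L \<theta> \<I> [] A | A. A \<in> UNIV} \<union>
       {gen_boolean_dyn_system.cyl_delta L \<theta> \<I> [\<alpha>] B | \<alpha> B. \<alpha> \<in> L \<and> B \<in> \<I> \<alpha>})"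
  using gen_boolean_dyn_system.carrier_eq_generated[OF assms]
  unfolding gen_boolean_dyn_system.generators_def[OF assms] .

end
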